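(* If $(V,\times,I)$ is an infinitary lextensive category such that each arrow of $V$ can be factorized as a regular epimorphism followed by a monomorphism and the functor $$J:\mathsf{Set}\to V,\qquad A\mapsto\sum_{a\in A}I_a$$ is fully faithful, then the canonical functor $\Phi:V\text{-}\mathsf{Cat}\to\mathsf{Cat}(V)$ reflects effective descent morphisms; that is, if $p$ is a morphism of $V\text{-}\mathsf{Cat}$ such that $\Phi(p)$ is of effective descent in $\mathsf{Cat}(V)$, then $p$ is of effective descent in $V\text{-}\mathsf{Cat}$.
   Context: $\times$ is the cartesian product of $V$, $I$ its terminal object, and $I_a=I$ for each $a\in A$. An infinitary lextensive category is a category with finite limits and small coproducts which are disjoint and stable under pullback. $\mathsf{Cat}(V)$ is the category of internal categories in $V$ and $V\text{-}\mathsf{Cat}$ is the category of small categories enriched over the cartesian monoidal category $V$. Under these hypotheses $V\text{-}\mathsf{Cat}$ is the pseudopullback of the object-of-objects functor $U_0:\mathsf{Cat}(V)\to V$ along $J$, and $\Phi$ is the corresponding projection: it sends a $V$-category with set of objects $A$ and hom-objects $M(x,y)$ to the internal category with object of objects $\sum_{a\in A}I_a$ and object of morphisms $\sum_{(x,y)\in A\times A}M(x,y)$. Effective descent: let $\dot\Delta$ be the category of finite ordinals and order preserving maps and $\Delta$ its full subcategory of nonempty ordinals. For a category $\mathbb{X}$ with pullbacks and a morphism $p:E\to B$, compose the augmented simplicial diagram $\mathcal{D}_p:\dot\Delta^{\mathrm{op}}\to\mathbb{X}$, $\mathsf{0}\mapsto B$, $\mathsf{1}\mapsto E$, $\mathsf{2}\mapsto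 E\times_BE$, $\mathsf{3}\mapsto E\times_BE\times_BE,\dots$ (iterated pullbacks of $p$, projections, diagonals) with the basic fibration $(\ )^*:\mathbb{X}^{\mathrm{op}}\to\mathsf{CAT}$, $B\mapsto\mathbb{X}/B$, $p\mapsto p^*$ (pullback along $p$), to obtain $\mathcal{A}_p:\dot\Delta\to\mathsf{CAT}$. The descent category of $p$ is the category of pseudonatural transformations from the constant pseudofunctor at the terminal category to $\mathcal{A}_p|_\Delta$, and $p$ is of effective descent if the canonical comparison functor from $\mathbb{X}/B$ to the descent category is an equivalence. *)

theory Defs
  imports Main "HOL-Library.FuncSet"
begin

section \<open>Categories, functors, equivalences\<close>

record ('o, 'm) cat =
  Obj :: "'o set"
  Arr :: "'m set"
  Dom :: "'m \<Rightarrow> 'o"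
  Cod :: "'m \<Rightarrow> 'o"
  Ident :: "'o \<Rightarrow> 'm"
  Comp :: "'m \<Rightarrow> 'm \<Rightarrow> 'm"

abbreviation comp_in :: "'m \<Rightarrow> ('o, 'm) cat \<Rightarrow> 'm \<Rightarrow> 'm"
    ("(_ \<cdot>\<^bsub>_\<^esub> _)" [71, 0, 70] 70) where
  "g \<cdot>\<^bsub>C\<^esub> f \<equiv> Comp C g f"

definition hom :: "('o, 'm) cat \<Rightarrow> 'o \<Rightarrow> 'o \<Rightarrow> 'm set" where
  "hom C a b = {f \<in> Arr C. Dom C f = a \<and> Cod C f = b}"

definition category :: "('o, 'm) cat \<Rightarrow> bool" where
  "category C \<longleftrightarrow>
     (\<forall>f\<in>Arr C. Dom C f \<in> Obj C \<and> Cod C f \<in> Obj C) \<and>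
     (\<forall>a\<in>Obj C. Ident C a \<in> hom C a a) \<and>
     (\<forall>f\<in>Arr C. \<forall>g\<in>Arr C. Cod C f = Dom C g \<longrightarrow> g \<cdot>\<^bsub>C\<^esub> f \<in> hom C (Dom C f) (Cod C g)) \<and>
     (\<forall>f\<in>Arr C. f \<cdot>\<^bsub>C\<^esub> Ident C (Dom C f) = f \<and> Ident C (Cod C f) \<cdot>\<^bsub>C\<^esub> f = f) \<and>
     (\<forall>f\<in>Arr C. \<forall>g\<in>Arr C. \<forall>h\<in>Arr C. Cod C f = Dom C g \<and> Cod C g = Dom C h \<longrightarrow>
        (h \<cdot>\<^bsub>C\<^esub> g) \<cdot>\<^bsub>C\<^esub> f = h \<cdot>\<^bsub>C\<^esub> (g \<cdot>\<^bsub>C\<^esub> f))"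

definition op_cat :: "('o, 'm) cat \<Rightarrow> ('o, 'm) cat" where
  "op_cat C = \<lparr>Obj = Obj C, Arr = Arr C, Dom = Cod C, Cod = Dom C,
               Ident = Ident C, Comp = (\<lambda>g f. f \<cdot>\<^bsub>C\<^esub> g)\<rparr>"

definition one_cat :: "(unit, unit) cat" where
  "one_cat = \<lparr>Obj = UNIV, Arr = UNIV, Dom = (\<lambda>_. ()), Cod = (\<lambda>_. ()),
              Ident = (\<lambda>_. ()), Comp = (\<lambda>_ _. ())\<rparr>"

record ('o1, 'm1, 'o2, 'm2) funct =
  FObj :: "'o1 \<Rightarrow> 'o2"
  FArr :: "'m1 \<Rightarrow> 'm2"

definition is_functor ::
    "('o1, 'm1) cat \<Rightarrow> ('o2, 'm2) cat \<Rightarrow> ('o1, 'm1, 'o2, 'm2) funct \<Rightarrow> bool" where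
  "is_functor C D F \<longleftrightarrow>
     (\<forall>a\<in>Obj C. FObj F a \<in> Obj D) \<and>
     (\<forall>f\<in>Arr C. FArr F f \<in> hom D (FObj F (Dom C f)) (FObj F (Cod C f))) \<and>
     (\<forall>a\<in>Obj C. FArr F (Ident C a) = Ident D (FObj F a)) \<and>
     (\<forall>f\<in>Arr C. \<forall>g\<in>Arr C. Cod C f = Dom C g \<longrightarrow>
        FArr F (g \<cdot>\<^bsub>C\<^esub> f) = FArr F g \<cdot>\<^bsub>D\<^esub> FArr F f)"

definition id_funct :: "('o, 'm, 'o, 'm) funct" where
  "id_funct = \<lparr>FObj = (\<lambda>a. a), FArr = (\<lambda>f. f)\<rparr>"

definition comp_funct ::
    "('o2, 'm2, 'o3, 'm3) funct \<Rightarrow> ('o1, 'm1, 'o2, 'm2) funct \<Rightarrow> ('o1, 'm1, 'o3, 'm3) funct" where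
  "comp_funct G F = \<lparr>FObj = (\<lambda>a. FObj G (FObj F a)), FArr = (\<lambda>f. FArr G (FArr F f))\<rparr>"

definition iso :: "('o, 'm) cat \<Rightarrow> 'm \<Rightarrow> bool" where
  "iso C f \<longleftrightarrow> f \<in> Arr C \<and>
     (\<exists>g\<in>hom C (Cod C f) (Dom C f).
        g \<cdot>\<^bsub>C\<^esub> f = Ident C (Dom C f) \<and> f \<cdot>\<^bsub>C\<^esub> g = Ident C (Cod C f))"

definition nat_trans ::
    "('o1, 'm1) cat \<Rightarrow> ('o2, 'm2) cat \<Rightarrow> ('o1, 'm1, 'o2, 'm2) funct \<Rightarrow>
     ('o1, 'm1, 'o2, 'm2) funct \<Rightarrow> ('o1 \<Rightarrow> 'm2) \<Rightarrow> bool" where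
  "nat_trans C D F G \<tau> \<longleftrightarrow>
     (\<forall>a\<in>Obj C. \<tau> a \<in> hom D (FObj F a) (FObj G a)) \<and>
     (\<forall>f\<in>Arr C. \<tau> (Cod C f) \<cdot>\<^bsub>D\<^esub> FArr F f = FArr G f \<cdot>\<^bsub>D\<^esub> \<tau> (Dom C f))"

definition nat_iso ::
    "('o1, 'm1) cat \<Rightarrow> ('o2, 'm2) cat \<Rightarrow> ('o1, 'm1, 'o2, 'm2) funct \<Rightarrow>
     ('o1, 'm1, 'o2, 'm2) funct \<Rightarrow> ('o1 \<Rightarrow> 'm2) \<Rightarrow> bool" where
  "nat_iso C D F G \<tau> \<longleftrightarrow> nat_trans C D F G \<tau> \<and> (\<forall>a\<in>Obj C. iso D (\<tau> a))"

definition equivalence ::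
    "('o1, 'm1) cat \<Rightarrow> ('o2, 'm2) cat \<Rightarrow> ('o1, 'm1, 'o2, 'm2) funct \<Rightarrow> bool" where
  "equivalence C D F \<longleftrightarrow> is_functor C D F \<and>
     (\<exists>G \<eta> \<epsilon>. is_functor D C G \<and>
        nat_iso C C id_funct (comp_funct G F) \<eta> \<and>
        nat_iso D D (comp_funct F G) id_funct \<epsilon>)"

definition fully_faithful ::
    "('o1, 'm1) cat \<Rightarrow> ('o2, 'm2) cat \<Rightarrow> ('o1, 'm1, 'o2, 'm2) funct \<Rightarrow> bool" where
  "fully_faithful C D F \<longleftrightarrow>
     (\<forall>a\<in>Obj C. \<forall>b\<in>Obj C. bij_betw (FArr F) (hom C a b) (hom D (FObj F a) (FObj F b)))"

definition monic :: "('o, 'm) cat \<Rightarrow> 'm \<Rightarrow> bool" where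
  "monic C f \<longleftrightarrow> f \<in> Arr C \<and>
     (\<forall>u\<in>Arr C. \<forall>v\<in>Arr C. Dom C u = Dom C v \<and> Cod C u = Dom C f \<and> Cod C v = Dom C f \<and>
        f \<cdot>\<^bsub>C\<^esub> u = f \<cdot>\<^bsub>C\<^esub> v \<longrightarrow> u = v)"

definition is_coequalizer :: "('o, 'm) cat \<Rightarrow> 'm \<Rightarrow> 'm \<Rightarrow> 'm \<Rightarrow> bool" where
  "is_coequalizer C u v e \<longleftrightarrow>
     u \<in> Arr C \<and> v \<in> Arr C \<and> e \<in> Arr C \<and> Dom C u = Dom C v \<and>
     Cod C u = Dom C e \<and> Cod C v = Dom C e \<and> e \<cdot>\<^bsub>C\<^esub> u = e \<cdot>\<^bsub>C\<^esub> v \<and>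
     (\<forall>h\<in>Arr C. Dom C h = Dom C e \<and> h \<cdot>\<^bsub>C\<^esub> u = h \<cdot>\<^bsub>C\<^esub> v \<longrightarrow>
        (\<exists>!w. w \<in> hom C (Cod C e) (Cod C h) \<and> w \<cdot>\<^bsub>C\<^esub> e = h))"

definition regular_epi :: "('o, 'm) cat \<Rightarrow> 'm \<Rightarrow> bool" where
  "regular_epi C e \<longleftrightarrow> (\<exists>u v. is_coequalizer C u v e)"


section \<open>Limits and coproducts\<close>

text \<open>Where a construction depends on chosen (co)limits, they are chosen once and for all by
  Hilbert choice; the chosen data are meaningful in categories having the (co)limits in question.\<close>

definition is_cone ::
    "('i, 'j) cat \<Rightarrow> ('o, 'm) cat \<Rightarrow> ('i, 'j, 'o, 'm) funct \<Rightarrow> 'o \<Rightarrow> ('i \<Rightarrow> 'm) \<Rightarrow> bool" where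
  "is_cone D C F l \<pi> \<longleftrightarrow> l \<in> Obj C \<and>
     (\<forall>i\<in>Obj D. \<pi> i \<in> hom C l (FObj F i)) \<and>
     (\<forall>j\<in>Arr D. FArr F j \<cdot>\<^bsub>C\<^esub> \<pi> (Dom D j) = \<pi> (Cod D j))"

definition is_limit ::
    "('i, 'j) cat \<Rightarrow> ('o, 'm) cat \<Rightarrow> ('i, 'j, 'o, 'm) funct \<Rightarrow> 'o \<Rightarrow> ('i \<Rightarrow> 'm) \<Rightarrow> bool" where
  "is_limit D C F l \<pi> \<longleftrightarrow> is_cone D C F l \<pi> \<and>
     (\<forall>x \<xi>. is_cone D C F x \<xi> \<longrightarrow>
        (\<exists>!w. w \<in> hom C x l \<and> (\<forall>i\<in>Obj D. \<pi> i \<cdot>\<^bsub>C\<^esub> w = \<xi> i)))"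

text \<open>Every finite category is isomorphic to one whose objects and arrows are natural numbers.\<close>

definition has_finite_limits :: "('o, 'm) cat \<Rightarrow> bool" where
  "has_finite_limits C \<longleftrightarrow>
     (\<forall>(D :: (nat, nat) cat) F.
        category D \<and> finite (Obj D) \<and> finite (Arr D) \<and> is_functor D C F \<longrightarrow>
        (\<exists>l \<pi>. is_limit D C F l \<pi>))"

definition is_terminal :: "('o, 'm) cat \<Rightarrow> 'o \<Rightarrow> bool" where
  "is_terminal C t \<longleftrightarrow> t \<in> Obj C \<and> (\<forall>a\<in>Obj C. \<exists>!f. f \<in> hom C a t)"

definition is_initial :: "('o, 'm) cat \<Rightarrow> 'o \<Rightarrow> bool" where
  "is_initial C z \<longleftrightarrow> z \<in> Obj C \<and> (\<forall>a\<in>Obj C. \<exists>!f. f \<in> hom C z a)"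

definition term_obj :: "('o, 'm) cat \<Rightarrow> 'o" where
  "term_obj C = (SOME t. is_terminal C t)"

definition bang :: "('o, 'm) cat \<Rightarrow> 'o \<Rightarrow> 'm" where
  "bang C a = (THE f. f \<in> hom C a (term_obj C))"

definition is_product :: "('o, 'm) cat \<Rightarrow> 'o \<Rightarrow> 'o \<Rightarrow> 'm \<Rightarrow> 'm \<Rightarrow> bool" where
  "is_product C a b p q \<longleftrightarrow>
     p \<in> Arr C \<and> q \<in> Arr C \<and> Dom C p = Dom C q \<and> Cod C p = a \<and> Cod C q = b \<and>
     (\<forall>u\<in>Arr C. \<forall>v\<in>Arr C. Dom C u = Dom C v \<and> Cod C u = a \<and> Cod C v = b \<longrightarrow>
        (\<exists>!w. w \<in> hom C (Dom C u) (Dom C p) \<and> p \<cdot>\<^bsub>C\<^esub> w = u \<and> q \<cdot>\<^bsub>C\<^esub> w = v))"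

definition prod_fst :: "('o, 'm) cat \<Rightarrow> 'o \<Rightarrow> 'o \<Rightarrow> 'm" where
  "prod_fst C a b = fst (SOME (p, q). is_product C a b p q)"

definition prod_snd :: "('o, 'm) cat \<Rightarrow> 'o \<Rightarrow> 'o \<Rightarrow> 'm" where
  "prod_snd C a b = snd (SOME (p, q). is_product C a b p q)"

definition prod_obj :: "('o, 'm) cat \<Rightarrow> 'o \<Rightarrow> 'o \<Rightarrow> 'o" where
  "prod_obj C a b = Dom C (prod_fst C a b)"

definition prod_pair :: "('o, 'm) cat \<Rightarrow> 'm \<Rightarrow> 'm \<Rightarrow> 'm" where
  "prod_pair C u v = (THE w. w \<in> hom C (Dom C u) (prod_obj C (Cod C u) (Cod C v)) \<and>
     prod_fst C (Cod C u) (Cod C v) \<cdot>\<^bsub>C\<^esub> w = u \<and> prod_snd C (Cod C u) (Cod C v) \<cdot>\<^bsub>C\<^esub> w = v)"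

definition prod_arr :: "('o, 'm) cat \<Rightarrow> 'm \<Rightarrow> 'm \<Rightarrow> 'm" where
  "prod_arr C f g = prod_pair C (f \<cdot>\<^bsub>C\<^esub> prod_fst C (Dom C f) (Dom C g))
                               (g \<cdot>\<^bsub>C\<^esub> prod_snd C (Dom C f) (Dom C g))"

text \<open>The associator \<open>(a \<times> b) \<times> c \<rightarrow> a \<times> (b \<times> c)\<close> of the cartesian monoidal structure; the right and
  left unitors are \<open>prod_fst C a (term_obj C)\<close> and \<open>prod_snd C (term_obj C) a\<close>.\<close>

definition prod_assoc :: "('o, 'm) cat \<Rightarrow> 'o \<Rightarrow> 'o \<Rightarrow> 'o \<Rightarrow> 'm" where
  "prod_assoc C a b c =
     (let p = prod_fst C (prod_obj C a b) c; q = prod_snd C (prod_obj C a b) c in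
      prod_pair C (prod_fst C a b \<cdot>\<^bsub>C\<^esub> p) (prod_pair C (prod_snd C a b \<cdot>\<^bsub>C\<^esub> p) q))"

definition is_pullback :: "('o, 'm) cat \<Rightarrow> 'm \<Rightarrow> 'm \<Rightarrow> 'm \<Rightarrow> 'm \<Rightarrow> bool" where
  "is_pullback C f g p q \<longleftrightarrow>
     f \<in> Arr C \<and> g \<in> Arr C \<and> p \<in> Arr C \<and> q \<in> Arr C \<and> Cod C f = Cod C g \<and>
     Dom C p = Dom C q \<and> Cod C p = Dom C f \<and> Cod C q = Dom C g \<and> f \<cdot>\<^bsub>C\<^esub> p = g \<cdot>\<^bsub>C\<^esub> q \<and>
     (\<forall>u\<in>Arr C. \<forall>v\<in>Arr C. Dom C u = Dom C v \<and> Cod C u = Dom C f \<and> Cod C v = Dom C g \<and>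
        f \<cdot>\<^bsub>C\<^esub> u = g \<cdot>\<^bsub>C\<^esub> v \<longrightarrow>
        (\<exists>!w. w \<in> hom C (Dom C u) (Dom C p) \<and> p \<cdot>\<^bsub>C\<^esub> w = u \<and> q \<cdot>\<^bsub>C\<^esub> w = v))"

definition pb_fst :: "('o, 'm) cat \<Rightarrow> 'm \<Rightarrow> 'm \<Rightarrow> 'm" where
  "pb_fst C f g = fst (SOME (p, q). is_pullback C f g p q)"

definition pb_snd :: "('o, 'm) cat \<Rightarrow> 'm \<Rightarrow> 'm \<Rightarrow> 'm" where
  "pb_snd C f g = snd (SOME (p, q). is_pullback C f g p q)"

definition pb_obj :: "('o, 'm) cat \<Rightarrow> 'm \<Rightarrow> 'm \<Rightarrow> 'o" where
  "pb_obj C f g = Dom C (pb_fst C f g)"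

definition pb_pair :: "('o, 'm) cat \<Rightarrow> 'm \<Rightarrow> 'm \<Rightarrow> 'm \<Rightarrow> 'm \<Rightarrow> 'm" where
  "pb_pair C f g u v = (THE w. w \<in> hom C (Dom C u) (pb_obj C f g) \<and>
     pb_fst C f g \<cdot>\<^bsub>C\<^esub> w = u \<and> pb_snd C f g \<cdot>\<^bsub>C\<^esub> w = v)"

definition is_coproduct :: "('o, 'm) cat \<Rightarrow> 'i set \<Rightarrow> ('i \<Rightarrow> 'o) \<Rightarrow> 'o \<Rightarrow> ('i \<Rightarrow> 'm) \<Rightarrow> bool" where
  "is_coproduct C I X s \<iota> \<longleftrightarrow> s \<in> Obj C \<and> (\<forall>i\<in>I. \<iota> i \<in> hom C (X i) s) \<and>
     (\<forall>t\<in>Obj C. \<forall>u. (\<forall>i\<in>I. u i \<in> hom C (X i) t) \<longrightarrow>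
        (\<exists>!w. w \<in> hom C s t \<and> (\<forall>i\<in>I. w \<cdot>\<^bsub>C\<^esub> \<iota> i = u i)))"

definition csum :: "('o, 'm) cat \<Rightarrow> 'i set \<Rightarrow> ('i \<Rightarrow> 'o) \<Rightarrow> 'o" where
  "csum C I X = fst (SOME (s, \<iota>). is_coproduct C I X s \<iota>)"

definition csum_in :: "('o, 'm) cat \<Rightarrow> 'i set \<Rightarrow> ('i \<Rightarrow> 'o) \<Rightarrow> 'i \<Rightarrow> 'm" where
  "csum_in C I X = snd (SOME (s, \<iota>). is_coproduct C I X s \<iota>)"

definition cotuple :: "('o, 'm) cat \<Rightarrow> 'i set \<Rightarrow> ('i \<Rightarrow> 'o) \<Rightarrow> 'o \<Rightarrow> ('i \<Rightarrow> 'm) \<Rightarrow> 'm" where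
  "cotuple C I X t u =
     (THE w. w \<in> hom C (csum C I X) t \<and> (\<forall>i\<in>I. w \<cdot>\<^bsub>C\<^esub> csum_in C I X i = u i))"


section \<open>Small sets and infinitary lextensive categories\<close>

text \<open>Smallness is relative to a Grothendieck universe, presented up to bijection: a predicate on
  subsets of a type \<open>'u\<close> that is closed under subsets, unions of families indexed by small sets and
  (encoded) power sets.  Closure under images and, up to bijection, binary products follows.  As in
  SGA 4, existence of an infinite member is not required.\<close>

definition universe :: "('u set \<Rightarrow> bool) \<Rightarrow> bool" where
  "universe small \<longleftrightarrow>
     (\<forall>x. small {x}) \<and>
     (\<forall>A B. small A \<and> B \<subseteq> A \<longrightarrow> small B) \<and>
     (\<forall>I (X :: 'u \<Rightarrow> 'u set). small I \<and> (\<forall>i\<in>I. small (X i)) \<longrightarrow> small (\<Union>i\<in>I. X i)) \<and>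
     (\<forall>A. small A \<longrightarrow> (\<exists>e :: 'u set \<Rightarrow> 'u. inj_on e (Pow A) \<and> small (e ` Pow A)))"

definition set_cat :: "('u set \<Rightarrow> bool) \<Rightarrow> ('u set, 'u set \<times> ('u \<Rightarrow> 'u) \<times> 'u set) cat" where
  "set_cat small = \<lparr>Obj = {A. small A},
     Arr = {(A, f, B). small A \<and> small B \<and> f \<in> A \<rightarrow>\<^sub>E B},
     Dom = (\<lambda>(A, f, B). A), Cod = (\<lambda>(A, f, B). B),
     Ident = (\<lambda>A. (A, (\<lambda>x\<in>A. x), A)),
     Comp = (\<lambda>(B', g, D) (A, f, B). (A, compose A g f, D))\<rparr>"

definition infinitary_lextensive :: "('u set \<Rightarrow> bool) \<Rightarrow> ('o, 'm) cat \<Rightarrow> bool" where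
  "infinitary_lextensive small C \<longleftrightarrow> category C \<and> has_finite_limits C \<and>
     (\<forall>(I :: 'u set) X. small I \<and> (\<forall>i\<in>I. X i \<in> Obj C) \<longrightarrow> (\<exists>s \<iota>. is_coproduct C I X s \<iota>)) \<and>
     (\<forall>(I :: 'u set) X s \<iota>. small I \<and> is_coproduct C I X s \<iota> \<longrightarrow>
        \<comment> \<open>disjoint:\<close>
        (\<forall>i\<in>I. monic C (\<iota> i)) \<and>
        (\<forall>i\<in>I. \<forall>j\<in>I. \<forall>p q. i \<noteq> j \<and> is_pullback C (\<iota> i) (\<iota> j) p q \<longrightarrow> is_initial C (Dom C p)) \<and>
        \<comment> \<open>stable under pullback:\<close>
        (\<forall>f\<in>Arr C. \<forall>p q. Cod C f = s \<and> (\<forall>i\<in>I. is_pullback C f (\<iota> i) (p i) (q i)) \<longrightarrow>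
           is_coproduct C I (\<lambda>i. Dom C (p i)) (Dom C f) p))"

definition J_obj :: "('o, 'm) cat \<Rightarrow> 'u set \<Rightarrow> 'o" where
  "J_obj V A = csum V A (\<lambda>_. term_obj V)"

definition J_in :: "('o, 'm) cat \<Rightarrow> 'u set \<Rightarrow> 'u \<Rightarrow> 'm" where
  "J_in V A = csum_in V A (\<lambda>_. term_obj V)"

definition J_arr :: "('o, 'm) cat \<Rightarrow> 'u set \<Rightarrow> ('u \<Rightarrow> 'u) \<Rightarrow> 'u set \<Rightarrow> 'm" where
  "J_arr V A f B = cotuple V A (\<lambda>_. term_obj V) (J_obj V B) (\<lambda>a. J_in V B (f a))"

definition J_funct ::
    "('o, 'm) cat \<Rightarrow> ('u set, 'u set \<times> ('u \<Rightarrow> 'u) \<times> 'u set, 'o, 'm) funct" where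
  "J_funct V = \<lparr>FObj = J_obj V, FArr = (\<lambda>(A, f, B). J_arr V A f B)\<rparr>"


section \<open>Internal categories\<close>

text \<open>The object of composable pairs is the pullback of \<open>src\<close> and \<open>tgt\<close>, so a generalized element of
  it is a pair \<open>(g, f)\<close> with \<open>src g = tgt f\<close>, and \<open>mult (g, f)\<close> is \<open>g\<close> after \<open>f\<close>.\<close>

record ('o, 'm) icat =
  iobj :: 'o
  imor :: 'o
  src :: 'm
  tgt :: 'm
  unt :: 'm
  mult :: 'm

definition is_icat :: "('o, 'm) cat \<Rightarrow> ('o, 'm) icat \<Rightarrow> bool" where
  "is_icat V X \<longleftrightarrow>
     (let s = src X; t = tgt X; e = unt X; m = mult X;
          p = pb_fst V s t; q = pb_snd V s t;
          \<comment> \<open>composable triples \<open>((h, g), f)\<close>\<close>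
          p' = pb_fst V (s \<cdot>\<^bsub>V\<^esub> q) t; q' = pb_snd V (s \<cdot>\<^bsub>V\<^esub> q) t;
          h = p \<cdot>\<^bsub>V\<^esub> p'; g = q \<cdot>\<^bsub>V\<^esub> p'; f = q' in
      iobj X \<in> Obj V \<and> imor X \<in> Obj V \<and>
      s \<in> hom V (imor X) (iobj X) \<and> t \<in> hom V (imor X) (iobj X) \<and>
      e \<in> hom V (iobj X) (imor X) \<and> m \<in> hom V (pb_obj V s t) (imor X) \<and>
      s \<cdot>\<^bsub>V\<^esub> e = Ident V (iobj X) \<and> t \<cdot>\<^bsub>V\<^esub> e = Ident V (iobj X) \<and>
      s \<cdot>\<^bsub>V\<^esub> m = s \<cdot>\<^bsub>V\<^esub> q \<and> t \<cdot>\<^bsub>V\<^esub> m = t \<cdot>\<^bsub>V\<^esub> p \<and>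
      m \<cdot>\<^bsub>V\<^esub> pb_pair V s t (Ident V (imor X)) (e \<cdot>\<^bsub>V\<^esub> s) = Ident V (imor X) \<and>
      m \<cdot>\<^bsub>V\<^esub> pb_pair V s t (e \<cdot>\<^bsub>V\<^esub> t) (Ident V (imor X)) = Ident V (imor X) \<and>
      m \<cdot>\<^bsub>V\<^esub> pb_pair V s t (m \<cdot>\<^bsub>V\<^esub> pb_pair V s t h g) f =
      m \<cdot>\<^bsub>V\<^esub> pb_pair V s t h (m \<cdot>\<^bsub>V\<^esub> pb_pair V s t g f))"

record ('o, 'm) ifun =
  ifdom :: "('o, 'm) icat"
  ifcod :: "('o, 'm) icat"
  if_obj :: 'm
  if_mor :: 'm

definition is_ifun :: "('o, 'm) cat \<Rightarrow> ('o, 'm) ifun \<Rightarrow> bool" where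
  "is_ifun V F \<longleftrightarrow>
     (let X = ifdom F; Y = ifcod F; f0 = if_obj F; f1 = if_mor F in
      is_icat V X \<and> is_icat V Y \<and>
      f0 \<in> hom V (iobj X) (iobj Y) \<and> f1 \<in> hom V (imor X) (imor Y) \<and>
      src Y \<cdot>\<^bsub>V\<^esub> f1 = f0 \<cdot>\<^bsub>V\<^esub> src X \<and> tgt Y \<cdot>\<^bsub>V\<^esub> f1 = f0 \<cdot>\<^bsub>V\<^esub> tgt X \<and>
      f1 \<cdot>\<^bsub>V\<^esub> unt X = unt Y \<cdot>\<^bsub>V\<^esub> f0 \<and>
      f1 \<cdot>\<^bsub>V\<^esub> mult X =
        mult Y \<cdot>\<^bsub>V\<^esub> pb_pair V (src Y) (tgt Y) (f1 \<cdot>\<^bsub>V\<^esub> pb_fst V (src X) (tgt X))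
                                               (f1 \<cdot>\<^bsub>V\<^esub> pb_snd V (src X) (tgt X)))"

definition int_cat :: "('o, 'm) cat \<Rightarrow> (('o, 'm) icat, ('o, 'm) ifun) cat" where
  "int_cat V = \<lparr>Obj = {X. is_icat V X}, Arr = {F. is_ifun V F}, Dom = ifdom, Cod = ifcod,
     Ident = (\<lambda>X. \<lparr>ifdom = X, ifcod = X, if_obj = Ident V (iobj X), if_mor = Ident V (imor X)\<rparr>),
     Comp = (\<lambda>G F. \<lparr>ifdom = ifdom F, ifcod = ifcod G,
                    if_obj = if_obj G \<cdot>\<^bsub>V\<^esub> if_obj F, if_mor = if_mor G \<cdot>\<^bsub>V\<^esub> if_mor F\<rparr>)\<rparr>"


section \<open>Categories enriched in the cartesian monoidal category V\<close>

text \<open>\<open>vhom M (x, y)\<close> is the hom-object from \<open>x\<close> to \<open>y\<close> and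
  \<open>vcomp M (x, y, z) : M(y,z) \<times> M(x,y) \<rightarrow> M(x,z)\<close>.  All families are extensional, so that equality
  of V-categories and V-functors is determined by their actual data.\<close>

record ('u, 'o, 'm) vcat =
  vobj :: "'u set"
  vhom :: "'u \<times> 'u \<Rightarrow> 'o"
  vcomp :: "'u \<times> 'u \<times> 'u \<Rightarrow> 'm"
  vid :: "'u \<Rightarrow> 'm"

definition is_vcat :: "('u set \<Rightarrow> bool) \<Rightarrow> ('o, 'm) cat \<Rightarrow> ('u, 'o, 'm) vcat \<Rightarrow> bool" where
  "is_vcat small V M \<longleftrightarrow>
     (let A = vobj M; H = (\<lambda>x y. vhom M (x, y)); c = (\<lambda>x y z. vcomp M (x, y, z));
          i = vid M; I = term_obj V in
      small A \<and>
      vhom M \<in> extensional (A \<times> A) \<and> vcomp M \<in> extensional (A \<times> A \<times> A) \<and> i \<in> extensional A \<and>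
      (\<forall>x\<in>A. \<forall>y\<in>A. H x y \<in> Obj V) \<and>
      (\<forall>x\<in>A. \<forall>y\<in>A. \<forall>z\<in>A. c x y z \<in> hom V (prod_obj V (H y z) (H x y)) (H x z)) \<and>
      (\<forall>x\<in>A. i x \<in> hom V I (H x x)) \<and>
      (\<forall>w\<in>A. \<forall>x\<in>A. \<forall>y\<in>A. \<forall>z\<in>A.
         c w x z \<cdot>\<^bsub>V\<^esub> prod_arr V (c x y z) (Ident V (H w x)) =
         (c w y z \<cdot>\<^bsub>V\<^esub> prod_arr V (Ident V (H y z)) (c w x y)) \<cdot>\<^bsub>V\<^esub>
            prod_assoc V (H y z) (H x y) (H w x)) \<and>
      (\<forall>x\<in>A. \<forall>y\<in>A.
         c x x y \<cdot>\<^bsub>V\<^esub> prod_arr V (Ident V (H x y)) (i x) = prod_fst V (H x y) I \<and>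
         c x y y \<cdot>\<^bsub>V\<^esub> prod_arr V (i y) (Ident V (H x y)) = prod_snd V I (H x y)))"

record ('u, 'o, 'm) vfun =
  vfdom :: "('u, 'o, 'm) vcat"
  vfcod :: "('u, 'o, 'm) vcat"
  vf_obj :: "'u \<Rightarrow> 'u"
  vf_hom :: "'u \<times> 'u \<Rightarrow> 'm"

definition is_vfun :: "('u set \<Rightarrow> bool) \<Rightarrow> ('o, 'm) cat \<Rightarrow> ('u, 'o, 'm) vfun \<Rightarrow> bool" where
  "is_vfun small V F \<longleftrightarrow>
     (let M = vfdom F; N = vfcod F; A = vobj M; f = vf_obj F; k = (\<lambda>x y. vf_hom F (x, y)) in
      is_vcat small V M \<and> is_vcat small V N \<and>
      f \<in> A \<rightarrow>\<^sub>E vobj N \<and> vf_hom F \<in> extensional (A \<times> A) \<and>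
      (\<forall>x\<in>A. \<forall>y\<in>A. k x y \<in> hom V (vhom M (x, y)) (vhom N (f x, f y))) \<and>
      (\<forall>x\<in>A. \<forall>y\<in>A. \<forall>z\<in>A.
         k x z \<cdot>\<^bsub>V\<^esub> vcomp M (x, y, z) =
         vcomp N (f x, f y, f z) \<cdot>\<^bsub>V\<^esub> prod_arr V (k y z) (k x y)) \<and>
      (\<forall>x\<in>A. k x x \<cdot>\<^bsub>V\<^esub> vid M x = vid N (f x)))"

definition V_cat ::
    "('u set \<Rightarrow> bool) \<Rightarrow> ('o, 'm) cat \<Rightarrow> (('u, 'o, 'm) vcat, ('u, 'o, 'm) vfun) cat" where
  "V_cat small V = \<lparr>Obj = {M. is_vcat small V M}, Arr = {F. is_vfun small V F},
     Dom = vfdom, Cod = vfcod,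
     Ident = (\<lambda>M. \<lparr>vfdom = M, vfcod = M, vf_obj = (\<lambda>x\<in>vobj M. x),
                   vf_hom = (\<lambda>xy\<in>vobj M \<times> vobj M. Ident V (vhom M xy))\<rparr>),
     Comp = (\<lambda>G F. \<lparr>vfdom = vfdom F, vfcod = vfcod G,
       vf_obj = compose (vobj (vfdom F)) (vf_obj G) (vf_obj F),
       vf_hom = (\<lambda>(x, y)\<in>vobj (vfdom F) \<times> vobj (vfdom F).
                   vf_hom G (vf_obj F x, vf_obj F y) \<cdot>\<^bsub>V\<^esub> vf_hom F (x, y))\<rparr>)\<rparr>"


section \<open>The functor from V-categories to internal categories\<close>

text \<open>In an infinitary lextensive category the object of composable pairs of \<open>Phi_obj V M\<close> is the
  coproduct of the \<open>M(y,z) \<times> M(x,y)\<close>, so composition is the unique arrow restricting to \<open>vcomp M\<close> on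
  each summand.\<close>

definition Phi_obj :: "('o, 'm) cat \<Rightarrow> ('u, 'o, 'm) vcat \<Rightarrow> ('o, 'm) icat" where
  "Phi_obj V M =
     (let A = vobj M; H = vhom M; S = csum V (A \<times> A) H; \<iota> = csum_in V (A \<times> A) H;
          s = cotuple V (A \<times> A) H (J_obj V A) (\<lambda>(x, y). J_in V A x \<cdot>\<^bsub>V\<^esub> bang V (H (x, y)));
          t = cotuple V (A \<times> A) H (J_obj V A) (\<lambda>(x, y). J_in V A y \<cdot>\<^bsub>V\<^esub> bang V (H (x, y))) in
      \<lparr>iobj = J_obj V A, imor = S, src = s, tgt = t,
       unt = cotuple V A (\<lambda>_. term_obj V) S (\<lambda>x. \<iota> (x, x) \<cdot>\<^bsub>V\<^esub> vid M x),
       mult = (THE m. m \<in> hom V (pb_obj V s t) S \<and>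
         (\<forall>x\<in>A. \<forall>y\<in>A. \<forall>z\<in>A.
            m \<cdot>\<^bsub>V\<^esub> pb_pair V s t (\<iota> (y, z) \<cdot>\<^bsub>V\<^esub> prod_fst V (H (y, z)) (H (x, y)))
                                 (\<iota> (x, y) \<cdot>\<^bsub>V\<^esub> prod_snd V (H (y, z)) (H (x, y))) =
            \<iota> (x, z) \<cdot>\<^bsub>V\<^esub> vcomp M (x, y, z)))\<rparr>)"

definition Phi_arr :: "('o, 'm) cat \<Rightarrow> ('u, 'o, 'm) vfun \<Rightarrow> ('o, 'm) ifun" where
  "Phi_arr V F =
     (let M = vfdom F; N = vfcod F; A = vobj M; B = vobj N; f = vf_obj F in
      \<lparr>ifdom = Phi_obj V M, ifcod = Phi_obj V N, if_obj = J_arr V A f B,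
       if_mor = cotuple V (A \<times> A) (vhom M) (csum V (B \<times> B) (vhom N))
         (\<lambda>(x, y). csum_in V (B \<times> B) (vhom N) (f x, f y) \<cdot>\<^bsub>V\<^esub> vf_hom F (x, y))\<rparr>)"

definition Phi ::
    "('o, 'm) cat \<Rightarrow>
     (('u, 'o, 'm) vcat, ('u, 'o, 'm) vfun, ('o, 'm) icat, ('o, 'm) ifun) funct" where
  "Phi V = \<lparr>FObj = Phi_obj V, FArr = Phi_arr V\<rparr>"


section \<open>Pseudofunctors into CAT and pseudonatural transformations\<close>

text \<open>The data of a pseudofunctor \<open>F\<close> from a category to CAT: values on objects and arrows, and the
  components at an object \<open>x\<close> of the coherence isomorphisms
  \<open>pf_comp F g f x : F g (F f x) \<rightarrow> F (g f) x\<close> and \<open>pf_unit F d x : x \<rightarrow> F (id d) x\<close>.\<close>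

record ('d, 'a, 'o, 'm) pseudofun =
  pf_obj :: "'d \<Rightarrow> ('o, 'm) cat"
  pf_arr :: "'a \<Rightarrow> ('o, 'm, 'o, 'm) funct"
  pf_comp :: "'a \<Rightarrow> 'a \<Rightarrow> 'o \<Rightarrow> 'm"
  pf_unit :: "'d \<Rightarrow> 'o \<Rightarrow> 'm"

definition const_pf :: "('o, 'm) cat \<Rightarrow> ('d, 'a, 'o, 'm) pseudofun" where
  "const_pf K = \<lparr>pf_obj = (\<lambda>_. K), pf_arr = (\<lambda>_. id_funct),
                 pf_comp = (\<lambda>_ _. Ident K), pf_unit = (\<lambda>_. Ident K)\<rparr>"

definition precomp_pf ::
    "('d, 'a, 'o, 'm) pseudofun \<Rightarrow> ('d1, 'a1, 'd, 'a) funct \<Rightarrow> ('d1, 'a1, 'o, 'm) pseudofun" where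
  "precomp_pf F K = \<lparr>pf_obj = (\<lambda>d. pf_obj F (FObj K d)), pf_arr = (\<lambda>f. pf_arr F (FArr K f)),
                     pf_comp = (\<lambda>g f. pf_comp F (FArr K g) (FArr K f)),
                     pf_unit = (\<lambda>d. pf_unit F (FObj K d))\<rparr>"

text \<open>A pseudonatural transformation \<open>\<alpha> : F \<Rightarrow> G\<close> has functors \<open>\<alpha> d : F d \<rightarrow> G d\<close> and invertible cells
  \<open>G f (\<alpha> d x) \<rightarrow> \<alpha> e (F f x)\<close> for \<open>f : d \<rightarrow> e\<close>.\<close>

record ('d, 'a, 'o1, 'm1, 'o2, 'm2) pnt =
  pn_fun :: "'d \<Rightarrow> ('o1, 'm1, 'o2, 'm2) funct"
  pn_cell :: "'a \<Rightarrow> 'o1 \<Rightarrow> 'm2"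

definition is_pnt ::
    "('d, 'a) cat \<Rightarrow> ('d, 'a, 'o1, 'm1) pseudofun \<Rightarrow> ('d, 'a, 'o2, 'm2) pseudofun \<Rightarrow>
     ('d, 'a, 'o1, 'm1, 'o2, 'm2) pnt \<Rightarrow> bool" where
  "is_pnt D F G \<alpha> \<longleftrightarrow>
     pn_fun \<alpha> \<in> extensional (Obj D) \<and> pn_cell \<alpha> \<in> extensional (Arr D) \<and>
     (\<forall>d\<in>Obj D. is_functor (pf_obj F d) (pf_obj G d) (pn_fun \<alpha> d) \<and>
        FObj (pn_fun \<alpha> d) \<in> extensional (Obj (pf_obj F d)) \<and>
        FArr (pn_fun \<alpha> d) \<in> extensional (Arr (pf_obj F d))) \<and>
     (\<forall>f\<in>Arr D. pn_cell \<alpha> f \<in> extensional (Obj (pf_obj F (Dom D f))) \<and>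
        nat_iso (pf_obj F (Dom D f)) (pf_obj G (Cod D f))
          (comp_funct (pf_arr G f) (pn_fun \<alpha> (Dom D f)))
          (comp_funct (pn_fun \<alpha> (Cod D f)) (pf_arr F f)) (pn_cell \<alpha> f)) \<and>
     (\<forall>d\<in>Obj D. \<forall>x\<in>Obj (pf_obj F d).
        pn_cell \<alpha> (Ident D d) x \<cdot>\<^bsub>pf_obj G d\<^esub> pf_unit G d (FObj (pn_fun \<alpha> d) x) =
        FArr (pn_fun \<alpha> d) (pf_unit F d x)) \<and>
     (\<forall>f\<in>Arr D. \<forall>g\<in>Arr D. Cod D f = Dom D g \<longrightarrow>
        (\<forall>x\<in>Obj (pf_obj F (Dom D f)).
           pn_cell \<alpha> (g \<cdot>\<^bsub>D\<^esub> f) x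
             \<cdot>\<^bsub>pf_obj G (Cod D g)\<^esub> pf_comp G g f (FObj (pn_fun \<alpha> (Dom D f)) x) =
           FArr (pn_fun \<alpha> (Cod D g)) (pf_comp F g f x)
             \<cdot>\<^bsub>pf_obj G (Cod D g)\<^esub> (pn_cell \<alpha> g (FObj (pf_arr F f) x)
             \<cdot>\<^bsub>pf_obj G (Cod D g)\<^esub> FArr (pf_arr G g) (pn_cell \<alpha> f x))))"

definition is_modif ::
    "('d, 'a) cat \<Rightarrow> ('d, 'a, 'o1, 'm1) pseudofun \<Rightarrow> ('d, 'a, 'o2, 'm2) pseudofun \<Rightarrow>
     ('d, 'a, 'o1, 'm1, 'o2, 'm2) pnt \<Rightarrow> ('d, 'a, 'o1, 'm1, 'o2, 'm2) pnt \<Rightarrow>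
     ('d \<Rightarrow> 'o1 \<Rightarrow> 'm2) \<Rightarrow> bool" where
  "is_modif D F G \<alpha> \<beta> \<Gamma> \<longleftrightarrow> \<Gamma> \<in> extensional (Obj D) \<and>
     (\<forall>d\<in>Obj D. \<Gamma> d \<in> extensional (Obj (pf_obj F d)) \<and>
        nat_trans (pf_obj F d) (pf_obj G d) (pn_fun \<alpha> d) (pn_fun \<beta> d) (\<Gamma> d)) \<and>
     (\<forall>f\<in>Arr D. \<forall>x\<in>Obj (pf_obj F (Dom D f)).
        pn_cell \<beta> f x \<cdot>\<^bsub>pf_obj G (Cod D f)\<^esub> FArr (pf_arr G f) (\<Gamma> (Dom D f) x) =
        \<Gamma> (Cod D f) (FObj (pf_arr F f) x) \<cdot>\<^bsub>pf_obj G (Cod D f)\<^esub> pn_cell \<alpha> f x)"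

definition pnt_cat ::
    "('d, 'a) cat \<Rightarrow> ('d, 'a, 'o1, 'm1) pseudofun \<Rightarrow> ('d, 'a, 'o2, 'm2) pseudofun \<Rightarrow>
     (('d, 'a, 'o1, 'm1, 'o2, 'm2) pnt,
      ('d, 'a, 'o1, 'm1, 'o2, 'm2) pnt \<times> ('d \<Rightarrow> 'o1 \<Rightarrow> 'm2) \<times>
        ('d, 'a, 'o1, 'm1, 'o2, 'm2) pnt) cat" where
  "pnt_cat D F G = \<lparr>Obj = {\<alpha>. is_pnt D F G \<alpha>},
     Arr = {(\<alpha>, \<Gamma>, \<beta>). is_pnt D F G \<alpha> \<and> is_pnt D F G \<beta> \<and> is_modif D F G \<alpha> \<beta> \<Gamma>},
     Dom = (\<lambda>(\<alpha>, \<Gamma>, \<beta>). \<alpha>), Cod = (\<lambda>(\<alpha>, \<Gamma>, \<beta>). \<beta>),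
     Ident = (\<lambda>\<alpha>. (\<alpha>, (\<lambda>d\<in>Obj D. \<lambda>x\<in>Obj (pf_obj F d).
                        Ident (pf_obj G d) (FObj (pn_fun \<alpha> d) x)), \<alpha>)),
     Comp = (\<lambda>(\<beta>', \<Delta>, \<gamma>) (\<alpha>, \<Gamma>, \<beta>).
               (\<alpha>, (\<lambda>d\<in>Obj D. \<lambda>x\<in>Obj (pf_obj F d). \<Delta> d x \<cdot>\<^bsub>pf_obj G d\<^esub> \<Gamma> d x), \<gamma>))\<rparr>"


section \<open>The basic fibration\<close>

text \<open>An arrow \<open>(x, h, y)\<close> of the slice is the arrow \<open>h\<close> from \<open>x\<close> to \<open>y\<close> over \<open>b\<close>.\<close>

definition slice :: "('o, 'm) cat \<Rightarrow> 'o \<Rightarrow> ('m, 'm \<times> 'm \<times> 'm) cat" where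
  "slice C b = \<lparr>Obj = {x \<in> Arr C. Cod C x = b},
     Arr = {(x, h, y). x \<in> Arr C \<and> y \<in> Arr C \<and> Cod C x = b \<and> Cod C y = b \<and>
                       h \<in> hom C (Dom C x) (Dom C y) \<and> y \<cdot>\<^bsub>C\<^esub> h = x},
     Dom = (\<lambda>(x, h, y). x), Cod = (\<lambda>(x, h, y). y),
     Ident = (\<lambda>x. (x, Ident C (Dom C x), x)),
     Comp = (\<lambda>(y', k, z) (x, h, y). (x, k \<cdot>\<^bsub>C\<^esub> h, z))\<rparr>"

definition base_change ::
    "('o, 'm) cat \<Rightarrow> 'm \<Rightarrow> ('m, 'm \<times> 'm \<times> 'm, 'm, 'm \<times> 'm \<times> 'm) funct" where
  "base_change C p = \<lparr>FObj = (\<lambda>x. pb_fst C p x),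
     FArr = (\<lambda>(x, h, y). (pb_fst C p x,
                         pb_pair C p y (pb_fst C p x) (h \<cdot>\<^bsub>C\<^esub> pb_snd C p x),
                         pb_fst C p y))\<rparr>"

text \<open>A pseudofunctor on \<open>op_cat C\<close>: the composite there of \<open>f\<close> followed by \<open>g\<close> is \<open>f \<cdot> g\<close> in \<open>C\<close>, and
  the compositor is the canonical comparison from \<open>g^* (f^* x)\<close> to \<open>(f \<cdot> g)^* x\<close>.\<close>

definition basic_fibration ::
    "('o, 'm) cat \<Rightarrow> ('o, 'm, 'm, 'm \<times> 'm \<times> 'm) pseudofun" where
  "basic_fibration C = \<lparr>pf_obj = slice C, pf_arr = base_change C,
     pf_comp = (\<lambda>g f x. let x1 = pb_fst C f x; x2 = pb_fst C g x1 in
        (x2, pb_pair C (f \<cdot>\<^bsub>C\<^esub> g) x x2 (pb_snd C f x \<cdot>\<^bsub>C\<^esub> pb_snd C g x1),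
         pb_fst C (f \<cdot>\<^bsub>C\<^esub> g) x)),
     pf_unit = (\<lambda>b x. (x, pb_pair C (Ident C b) x x (Ident C (Dom C x)),
                       pb_fst C (Ident C b) x))\<rparr>"


section \<open>Effective descent\<close>

text \<open>The finite ordinal \<open>n\<close> is \<open>{..<n}\<close>.\<close>

definition aug_simplex :: "(nat, nat \<times> (nat \<Rightarrow> nat) \<times> nat) cat" where
  "aug_simplex = \<lparr>Obj = UNIV,
     Arr = {(m, \<sigma>, n). \<sigma> \<in> {..<m} \<rightarrow>\<^sub>E {..<n} \<and> mono_on {..<m} \<sigma>},
     Dom = (\<lambda>(m, \<sigma>, n). m), Cod = (\<lambda>(m, \<sigma>, n). n),
     Ident = (\<lambda>n. (n, (\<lambda>i\<in>{..<n}. i), n)),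
     Comp = (\<lambda>(n', \<tau>, k) (m, \<sigma>, n). (m, compose {..<m} \<tau> \<sigma>, k))\<rparr>"

definition full_subcat :: "('o, 'm) cat \<Rightarrow> 'o set \<Rightarrow> ('o, 'm) cat" where
  "full_subcat C S = C\<lparr>Obj := Obj C \<inter> S, Arr := {f \<in> Arr C. Dom C f \<in> S \<and> Cod C f \<in> S}\<rparr>"

definition simplex :: "(nat, nat \<times> (nat \<Rightarrow> nat) \<times> nat) cat" where
  "simplex = full_subcat aug_simplex {n. 0 < n}"

definition from_zero :: "nat \<Rightarrow> nat \<times> (nat \<Rightarrow> nat) \<times> nat" where
  "from_zero n = (0, (\<lambda>i\<in>{..<0}. i), n)"

text \<open>For \<open>p : E \<rightarrow> B\<close>, the structure map to \<open>B\<close> of the \<open>n\<close>-fold iterated pullback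
  \<open>E \<times>\<^sub>B \<dots> \<times>\<^sub>B E\<close> (which is \<open>B\<close> for \<open>n = 0\<close> and \<open>E\<close> for \<open>n = 1\<close>), and its projections to \<open>E\<close>.\<close>

fun fib_pow :: "('o, 'm) cat \<Rightarrow> 'm \<Rightarrow> nat \<Rightarrow> 'm" where
  "fib_pow C p 0 = Ident C (Cod C p)"
| "fib_pow C p (Suc 0) = p"
| "fib_pow C p (Suc (Suc n)) = fib_pow C p (Suc n) \<cdot>\<^bsub>C\<^esub> pb_fst C (fib_pow C p (Suc n)) p"

fun fib_proj :: "('o, 'm) cat \<Rightarrow> 'm \<Rightarrow> nat \<Rightarrow> nat \<Rightarrow> 'm" where
  "fib_proj C p 0 i = undefined"
| "fib_proj C p (Suc 0) i = Ident C (Dom C p)"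
| "fib_proj C p (Suc (Suc n)) i =
     (if i = Suc n then pb_snd C (fib_pow C p (Suc n)) p
      else fib_proj C p (Suc n) i \<cdot>\<^bsub>C\<^esub> pb_fst C (fib_pow C p (Suc n)) p)"

text \<open>The augmented simplicial diagram of \<open>p\<close>, as a functor from \<open>aug_simplex\<close> to \<open>op_cat C\<close>:
  \<open>\<sigma> : m \<rightarrow> n\<close> is sent to the arrow from the \<open>n\<close>-fold to the \<open>m\<close>-fold fibre power over \<open>B\<close> whose
  \<open>i\<close>-th projection is the \<open>\<sigma> i\<close>-th projection.\<close>

definition descent_diagram ::
    "('o, 'm) cat \<Rightarrow> 'm \<Rightarrow> (nat, nat \<times> (nat \<Rightarrow> nat) \<times> nat, 'o, 'm) funct" where
  "descent_diagram C p = \<lparr>FObj = (\<lambda>n. Dom C (fib_pow C p n)),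
     FArr = (\<lambda>(m, \<sigma>, n). THE u. u \<in> hom C (Dom C (fib_pow C p n)) (Dom C (fib_pow C p m)) \<and>
        fib_pow C p m \<cdot>\<^bsub>C\<^esub> u = fib_pow C p n \<and>
        (\<forall>i<m. fib_proj C p m i \<cdot>\<^bsub>C\<^esub> u = fib_proj C p n (\<sigma> i)))\<rparr>"

definition descent_pf ::
    "('o, 'm) cat \<Rightarrow> 'm \<Rightarrow> (nat, nat \<times> (nat \<Rightarrow> nat) \<times> nat, 'm, 'm \<times> 'm \<times> 'm) pseudofun" where
  "descent_pf C p = precomp_pf (basic_fibration C) (descent_diagram C p)"

text \<open>A pseudofunctor record does not mention its domain, so the restriction along the inclusion of
  \<open>simplex\<close> in \<open>aug_simplex\<close> is given by the same record.\<close>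

definition descent_cat where
  "descent_cat C p = pnt_cat simplex (const_pf one_cat) (descent_pf C p)"

text \<open>The canonical comparison from \<open>A 0\<close> to the descent category of a pseudofunctor \<open>A\<close> on
  \<open>aug_simplex\<close>: \<open>x\<close> goes to the family of the \<open>A (0 \<rightarrow> n) x\<close>, with cells given by the compositors
  \<open>A \<sigma> (A (0 \<rightarrow> m) x) \<rightarrow> A (0 \<rightarrow> n) x\<close> for \<open>\<sigma> : m \<rightarrow> n\<close>.\<close>

definition comparison_obj ::
    "(nat, nat \<times> (nat \<Rightarrow> nat) \<times> nat, 'o, 'm) pseudofun \<Rightarrow> 'o \<Rightarrow>
     (nat, nat \<times> (nat \<Rightarrow> nat) \<times> nat, unit, unit, 'o, 'm) pnt" where
  "comparison_obj A x =
     \<lparr>pn_fun = (\<lambda>n\<in>Obj simplex.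
        \<lparr>FObj = (\<lambda>_. FObj (pf_arr A (from_zero n)) x),
         FArr = (\<lambda>_. Ident (pf_obj A n) (FObj (pf_arr A (from_zero n)) x))\<rparr>),
      pn_cell = (\<lambda>\<sigma>\<in>Arr simplex. \<lambda>_. pf_comp A \<sigma> (from_zero (Dom simplex \<sigma>)) x)\<rparr>"

definition comparison where
  "comparison A =
     \<lparr>FObj = comparison_obj A,
      FArr = (\<lambda>h. (comparison_obj A (Dom (pf_obj A 0) h),
                  (\<lambda>n\<in>Obj simplex. \<lambda>_::unit. FArr (pf_arr A (from_zero n)) h),
                  comparison_obj A (Cod (pf_obj A 0) h)))\<rparr>"

text \<open>For an arrow \<open>p\<close> of a category \<open>C\<close> with pullbacks.\<close>

definition effective_descent :: "('o, 'm) cat \<Rightarrow> 'm \<Rightarrow> bool" where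
  "effective_descent C p \<longleftrightarrow>
     equivalence (slice C (Cod C p)) (descent_cat C p) (comparison (descent_pf C p))"

end

theory Submission
  imports Defs
begin

text \<open>Effective descent of \<open>p\<close> amounts to two conditions on its Cech nerve: every object over the base
  is the colimit of its pullbacks to the fibre powers of \<open>p\<close>, and every cartesian family over the fibre
  powers arises by pulling back an object over the base.  Now \<open>\<Phi>\<close> is fully faithful, and its essential
  image consists of the internal categories whose object of objects is discrete, that is, a coproduct
  of copies of \<open>I\<close>; in particular it is closed under pullbacks.  Hence \<open>\<Phi>\<close> reflects the first condition,
  and it reflects the second one as soon as the object glued in \<open>Cat(V)\<close> has a discrete object of
  objects.  The first condition makes \<open>p\<close> extremal, so \<open>p\<close> is surjective on objects because it factors
  through its full image.  Therefore every point \<open>b\<close> of the base lifts along \<open>p\<close>, and the fibre over \<open>b\<close>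
  of the glued object of objects is a fibre of its discrete pullback along \<open>p\<close>; the glued object of
  objects is the coproduct of these fibres.\<close>

text \<open>Pullbacks are chosen separately in \<open>V_cat small V\<close> and in
  \<open>int_cat V\<close>, so \<open>Phi V\<close> preserves them only up to isomorphism, while the
  coherence isomorphisms of a descent datum live over the chosen ones. Both conditions are therefore
  stated with arbitrary pullback squares: a descent datum becomes a family of objects with strictly
  composing cartesian lifts, a notion that a fully faithful functor preserving pullbacks transports
  directly. Closure of discrete objects under pullback rests on full faithfulness of J: a point of
  \<open>J_obj V A\<close> is one of the injections, and two injections have as pullback the
  terminal or the initial object. Passing between internal and enriched categories means cutting the
  object of morphisms into the pieces with given source and target. Pieces of composable pairs whose
  middle objects differ are initial, so extensivity lets every law be checked on matching pieces,
  where it is a law of the enriched category.\<close>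

notation comp_in ("(_ \<cdot>[_] _)" [71, 0, 70] 70)

abbreviation "sdom \<equiv> Dom aug_simplex"
abbreviation "scod \<equiv> Cod aug_simplex"

section \<open>Calculating in categories\<close>

lemma category_simps [simp]:
  assumes "category C"
  shows "f \<in> Arr C ==> Dom C f \<in> Obj C"
    and "f \<in> Arr C ==> Cod C f \<in> Obj C"
    and "a \<in> Obj C ==> Ident C a \<in> Arr C"
    and "a \<in> Obj C ==> Dom C (Ident C a) = a"
    and "a \<in> Obj C ==> Cod C (Ident C a) = a"
    and "f \<in> Arr C ==> g \<in> Arr C ==> Cod C f = Dom C g ==> g \<cdot>[C] f \<in> Arr C"
    and "f \<in> Arr C ==> g \<in> Arr C ==> Cod C f = Dom C g ==> Dom C (g \<cdot>[C] f) = Dom C f"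
    and "f \<in> Arr C ==> g \<in> Arr C ==> Cod C f = Dom C g ==> Cod C (g \<cdot>[C] f) = Cod C g"
    and "f \<in> Arr C ==> Dom C f = a ==> f \<cdot>[C] Ident C a = f"
    and "f \<in> Arr C ==> Cod C f = a ==> Ident C a \<cdot>[C] f = f"
  using assms unfolding category_def hom_def by auto

lemma comp_assoc [simp]:
  assumes "category C" "f \<in> Arr C" "g \<in> Arr C" "h \<in> Arr C" "Cod C f = Dom C g" "Cod C g = Dom C h"
  shows "(h \<cdot>[C] g) \<cdot>[C] f = h \<cdot>[C] (g \<cdot>[C] f)"
  using assms unfolding category_def by blast

lemma in_hom [simp]: "f \<in> hom C a b \<longleftrightarrow> f \<in> Arr C \<and> Dom C f = a \<and> Cod C f = b"
  by (simp add: hom_def)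

text \<open>Extends an equation between composites by a common precomposite, in the associated form that
  the simplifier produces.\<close>

lemma extend:
  assumes "g \<cdot>[C] f = k" "category C" "f \<in> Arr C" "g \<in> Arr C" "Cod C f = Dom C g"
    "r \<in> Arr C" "Cod C r = Dom C f"
  shows "g \<cdot>[C] (f \<cdot>[C] r) = k \<cdot>[C] r"
  using assms comp_assoc by metis

lemma isoD:
  assumes "category C" "iso C f"
  obtains g where "g \<in> Arr C" "Dom C g = Cod C f" "Cod C g = Dom C f"
    "g \<cdot>[C] f = Ident C (Dom C f)" "f \<cdot>[C] g = Ident C (Cod C f)"
  using assms unfolding iso_def by auto

lemma isoI:
  assumes "f \<in> Arr C" "g \<in> Arr C" "Dom C g = Cod C f" "Cod C g = Dom C f"
    "g \<cdot>[C] f = Ident C (Dom C f)" "f \<cdot>[C] g = Ident C (Cod C f)"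
  shows "iso C f"
  using assms unfolding iso_def by auto

lemma iso_arr [simp]: "iso C f ==> f \<in> Arr C"
  by (simp add: iso_def)

lemma iso_ident [simp]: "category C ==> a \<in> Obj C ==> iso C (Ident C a)"
  by (rule isoI[where g = "Ident C a"]) auto

lemma iso_cancel_right:
  assumes C: "category C" and i: "iso C i" and f: "f \<in> Arr C" "Dom C f = Cod C i"
    and g: "g \<in> Arr C" "Dom C g = Cod C i" and eq: "f \<cdot>[C] i = g \<cdot>[C] i"
  shows "f = g"
proof -
  obtain j where j: "j \<in> Arr C" "Dom C j = Cod C i" "Cod C j = Dom C i"
    "i \<cdot>[C] j = Ident C (Cod C i)" using isoD[OF C i] by metis
  have "f = (f \<cdot>[C] i) \<cdot>[C] j" using C i f j by simp
  also have "\<dots> = (g \<cdot>[C] i) \<cdot>[C] j" using eq by simp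
  also have "\<dots> = g" using C i g j by simp
  finally show ?thesis .
qed

lemma iso_cancel_left:
  assumes C: "category C" and i: "iso C i" and f: "f \<in> Arr C" "Cod C f = Dom C i"
    and g: "g \<in> Arr C" "Cod C g = Dom C i" and eq: "i \<cdot>[C] f = i \<cdot>[C] g"
  shows "f = g"
proof -
  obtain j where j: "j \<in> Arr C" "Dom C j = Cod C i" "Cod C j = Dom C i"
    "j \<cdot>[C] i = Ident C (Dom C i)" using isoD[OF C i] by metis
  have "f = (j \<cdot>[C] i) \<cdot>[C] f" using C i f j by simp
  also have "\<dots> = j \<cdot>[C] (i \<cdot>[C] f)" using C i f j(1-3) by simp
  also have "\<dots> = j \<cdot>[C] (i \<cdot>[C] g)" using eq by simp
  also have "\<dots> = (j \<cdot>[C] i) \<cdot>[C] g" using C i g j(1-3) by simp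
  also have "\<dots> = g" using C i g j by simp
  finally show ?thesis .
qed

lemma iso_comp:
  assumes C: "category C" and f: "iso C f" and g: "iso C g" and fg: "Cod C f = Dom C g"
  shows "iso C (g \<cdot>[C] f)"
proof -
  obtain f' where f': "f' \<in> Arr C" "Dom C f' = Cod C f" "Cod C f' = Dom C f"
    "f' \<cdot>[C] f = Ident C (Dom C f)" "f \<cdot>[C] f' = Ident C (Cod C f)" using isoD[OF C f] by metis
  obtain g' where g': "g' \<in> Arr C" "Dom C g' = Cod C g" "Cod C g' = Dom C g"
    "g' \<cdot>[C] g = Ident C (Dom C g)" "g \<cdot>[C] g' = Ident C (Cod C g)" using isoD[OF C g] by metis
  have "g' \<cdot>[C] (g \<cdot>[C] f) = f" "f \<cdot>[C] (f' \<cdot>[C] g') = g'"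
    using C f g fg f' g' extend[OF g'(4)] extend[OF f'(5)] by simp_all
  then show ?thesis using C f g fg f' g' by (intro isoI[where g = "f' \<cdot>[C] g'"]) simp_all
qed

lemma op_cat_simps [simp]:
  "Obj (op_cat C) = Obj C" "Arr (op_cat C) = Arr C" "Dom (op_cat C) = Cod C" "Cod (op_cat C) = Dom C"
  "Ident (op_cat C) = Ident C" "Comp (op_cat C) g f = f \<cdot>[C] g"
  by (simp_all add: op_cat_def)

lemma functor_simps [simp]:
  assumes "is_functor C D F"
  shows "a \<in> Obj C ==> FObj F a \<in> Obj D"
    and "f \<in> Arr C ==> FArr F f \<in> Arr D"
    and "f \<in> Arr C ==> Dom D (FArr F f) = FObj F (Dom C f)"
    and "f \<in> Arr C ==> Cod D (FArr F f) = FObj F (Cod C f)"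
    and "a \<in> Obj C ==> FArr F (Ident C a) = Ident D (FObj F a)"
    and "f \<in> Arr C ==> g \<in> Arr C ==> Cod C f = Dom C g ==>
      FArr F (g \<cdot>[C] f) = FArr F g \<cdot>[D] FArr F f"
  using assms unfolding is_functor_def by auto

lemma fully_faithfulD:
  assumes "fully_faithful C D F" "a \<in> Obj C" "b \<in> Obj C"
  shows "g \<in> Arr D ==> Dom D g = FObj F a ==> Cod D g = FObj F b ==>
      \<exists>f\<in>Arr C. Dom C f = a \<and> Cod C f = b \<and> FArr F f = g"
    and "f \<in> hom C a b ==> f' \<in> hom C a b ==> FArr F f = FArr F f' ==> f = f'"
proof -
  have b: "bij_betw (FArr F) (hom C a b) (hom D (FObj F a) (FObj F b))"
    using assms unfolding fully_faithful_def by blast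
  show "\<exists>f\<in>Arr C. Dom C f = a \<and> Cod C f = b \<and> FArr F f = g"
    if "g \<in> Arr D" "Dom D g = FObj F a" "Cod D g = FObj F b"
  proof -
    have "g \<in> FArr F ` hom C a b" using b that unfolding bij_betw_def by simp
    then show ?thesis by auto
  qed
  show "f = f'" if "f \<in> hom C a b" "f' \<in> hom C a b" "FArr F f = FArr F f'"
    using b that unfolding bij_betw_def by (metis inj_onD)
qed

lemma functor_iso:
  assumes F: "is_functor C D F" and C: "category C" and f: "iso C f"
  shows "iso D (FArr F f)"
proof -
  obtain g where g: "g \<in> Arr C" "Dom C g = Cod C f" "Cod C g = Dom C f"
    "g \<cdot>[C] f = Ident C (Dom C f)" "f \<cdot>[C] g = Ident C (Cod C f)" using isoD[OF C f] by metis
  have "FArr F g \<cdot>[D] FArr F f = Ident D (FObj F (Dom C f))"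
    using functor_simps(6)[OF F iso_arr[OF f] g(1)] g F C f by simp
  moreover have "FArr F f \<cdot>[D] FArr F g = Ident D (FObj F (Cod C f))"
    using functor_simps(6)[OF F g(1) iso_arr[OF f]] g F C f by simp
  ultimately show ?thesis
    using F g f by (intro isoI[where g = "FArr F g"]) simp_all
qed

subsection \<open>Equivalences\<close>

text \<open>Forward, naturality of \<epsilon> makes G faithful, and naturality of \<eta> then yields
  a preimage of each arrow. Backward, an object and an isomorphism are chosen over each d, and G
  acts on an arrow by conjugating with these isomorphisms and lifting the result through F.\<close>

lemma equivalence_iff:
  assumes C: "category C" and D: "category D"
  shows "equivalence C D F \<longleftrightarrow> is_functor C D F \<and> fully_faithful C D F \<and>
    (\<forall>d\<in>Obj D. \<exists>c\<in>Obj C. \<exists>\<phi>. iso D \<phi> \<and> Dom D \<phi> = FObj F c \<and> Cod D \<phi> = d)"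
proof
  assume "equivalence C D F"
  then obtain G \<eta> \<epsilon> where F: "is_functor C D F" and G: "is_functor D C G"
    and \<eta>: "nat_iso C C id_funct (comp_funct G F) \<eta>" and \<epsilon>: "nat_iso D D (comp_funct F G) id_funct \<epsilon>"
    unfolding equivalence_def by blast
  have \<eta>1 [simp]: "iso C (\<eta> a)" "Dom C (\<eta> a) = a" "Cod C (\<eta> a) = FObj G (FObj F a)" if "a \<in> Obj C" for a
    using \<eta> that unfolding nat_iso_def nat_trans_def id_funct_def comp_funct_def by auto
  have \<eta>2: "\<eta> (Cod C f) \<cdot>[C] f = FArr G (FArr F f) \<cdot>[C] \<eta> (Dom C f)" if "f \<in> Arr C" for f
    using \<eta> that unfolding nat_iso_def nat_trans_def id_funct_def comp_funct_def by auto
  have \<epsilon>1 [simp]: "iso D (\<epsilon> a)" "Dom D (\<epsilon> a) = FObj F (FObj G a)" "Cod D (\<epsilon> a) = a" if "a \<in> Obj D" for a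
    using \<epsilon> that unfolding nat_iso_def nat_trans_def id_funct_def comp_funct_def by auto
  have \<epsilon>2: "\<epsilon> (Cod D f) \<cdot>[D] FArr F (FArr G f) = f \<cdot>[D] \<epsilon> (Dom D f)" if "f \<in> Arr D" for f
    using \<epsilon> that unfolding nat_iso_def nat_trans_def id_funct_def comp_funct_def by auto
  \<comment> \<open>Naturality of \<epsilon> determines g from G g, because the component of
    \<epsilon> at the domain is invertible.\<close>
  have Ginj: "g = g'" if "g \<in> Arr D" "g' \<in> Arr D" "Dom D g = Dom D g'" "Cod D g = Cod D g'" "FArr G g = FArr G g'"
    for g g'
  proof (rule iso_cancel_right[OF D, where i = "\<epsilon> (Dom D g)"])
    show "g \<cdot>[D] \<epsilon> (Dom D g) = g' \<cdot>[D] \<epsilon> (Dom D g)"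
      using \<epsilon>2[OF that(1)] \<epsilon>2[OF that(2)] that(3-5) by metis
  qed (use that D in simp_all)
  have "fully_faithful C D F"
    unfolding fully_faithful_def bij_betw_def
  proof (intro ballI conjI inj_onI)
    fix a b f f' assume ab: "a \<in> Obj C" "b \<in> Obj C" and f: "f \<in> hom C a b" "f' \<in> hom C a b"
      and eq: "FArr F f = FArr F f'"
    show "f = f'"
      using \<eta>2[of f] \<eta>2[of f'] f eq ab C
      by (rule_tac iso_cancel_left[where i = "\<eta> b"]) auto
  next
    fix a b assume ab: "a \<in> Obj C" "b \<in> Obj C"
    show "FArr F ` hom C a b = hom D (FObj F a) (FObj F b)"
    proof
      show "FArr F ` hom C a b \<subseteq> hom D (FObj F a) (FObj F b)" using F by auto
      show "hom D (FObj F a) (FObj F b) \<subseteq> FArr F ` hom C a b"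
      proof
        fix g assume g: "g \<in> hom D (FObj F a) (FObj F b)"
        obtain j where j: "j \<in> Arr C" "Dom C j = FObj G (FObj F b)" "Cod C j = b"
          "\<eta> b \<cdot>[C] j = Ident C (FObj G (FObj F b))" using isoD[OF C \<eta>1(1)[OF ab(2)]] ab by auto
        \<comment> \<open>The only possible preimage of g: naturality of \<eta> at a preimage f
          forces f to be G g conjugated by the components of \<eta>.\<close>
        define f where "f = j \<cdot>[C] (FArr G g \<cdot>[C] \<eta> a)"
        have f: "f \<in> Arr C" "Dom C f = a" "Cod C f = b" using C G g ab j by (auto simp: f_def)
        have "FArr G (FArr F f) \<cdot>[C] \<eta> a = \<eta> b \<cdot>[C] f" using \<eta>2[of f] f by simp
        also have "\<dots> = FArr G g \<cdot>[C] \<eta> a"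
          unfolding f_def using C G g ab j F extend[OF j(4) C] by simp
        finally have "FArr G (FArr F f) = FArr G g"
          using C G F g f ab by (rule_tac iso_cancel_right[where i = "\<eta> a"]) auto
        then have "FArr F f = g" using F g f by (rule_tac Ginj) auto
        then show "g \<in> FArr F ` hom C a b" using f by auto
      qed
    qed
  qed
  moreover have "\<exists>c\<in>Obj C. \<exists>\<phi>. iso D \<phi> \<and> Dom D \<phi> = FObj F c \<and> Cod D \<phi> = d" if "d \<in> Obj D" for d
    using that G by (intro bexI[of _ "FObj G d"] exI[of _ "\<epsilon> d"]) auto
  ultimately show "is_functor C D F \<and> fully_faithful C D F \<and>
    (\<forall>d\<in>Obj D. \<exists>c\<in>Obj C. \<exists>\<phi>. iso D \<phi> \<and> Dom D \<phi> = FObj F c \<and> Cod D \<phi> = d)" using F by blast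
next
  assume *: "is_functor C D F \<and> fully_faithful C D F \<and>
    (\<forall>d\<in>Obj D. \<exists>c\<in>Obj C. \<exists>\<phi>. iso D \<phi> \<and> Dom D \<phi> = FObj F c \<and> Cod D \<phi> = d)"
  then have F: "is_functor C D F" and ff: "fully_faithful C D F" by blast+
  obtain g0 \<epsilon> where g0: "\<And>d. d \<in> Obj D ==> g0 d \<in> Obj C \<and> iso D (\<epsilon> d) \<and> Dom D (\<epsilon> d) = FObj F (g0 d) \<and> Cod D (\<epsilon> d) = d"
    using * by metis
  have "\<exists>h. h \<in> Arr D \<and> Dom D h = d \<and> Cod D h = FObj F (g0 d)
      \<and> h \<cdot>[D] \<epsilon> d = Ident D (FObj F (g0 d)) \<and> \<epsilon> d \<cdot>[D] h = Ident D d" if "d \<in> Obj D" for d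
    using isoD[OF D, of "\<epsilon> d"] g0[OF that] by metis
  then obtain \<epsilon>' where \<epsilon>': "\<And>d. d \<in> Obj D ==> \<epsilon>' d \<in> Arr D \<and> Dom D (\<epsilon>' d) = d \<and> Cod D (\<epsilon>' d) = FObj F (g0 d)
      \<and> \<epsilon>' d \<cdot>[D] \<epsilon> d = Ident D (FObj F (g0 d)) \<and> \<epsilon> d \<cdot>[D] \<epsilon>' d = Ident D d"
    by metis
  \<comment> \<open>The arrow assigned to h lies over the conjugate of h by the chosen isomorphisms,
    which makes \<epsilon> natural by construction.\<close>
  have "\<exists>f. f \<in> Arr C \<and> Dom C f = g0 (Dom D h) \<and> Cod C f = g0 (Cod D h) \<and>
      FArr F f = \<epsilon>' (Cod D h) \<cdot>[D] (h \<cdot>[D] \<epsilon> (Dom D h))" if "h \<in> Arr D" for h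
    using fully_faithfulD(1)[OF ff, of "g0 (Dom D h)" "g0 (Cod D h)" "\<epsilon>' (Cod D h) \<cdot>[D] (h \<cdot>[D] \<epsilon> (Dom D h))"]
      that g0 \<epsilon>' D by auto
  then obtain g1 where g1: "\<And>h. h \<in> Arr D ==> g1 h \<in> Arr C \<and> Dom C (g1 h) = g0 (Dom D h) \<and>
     Cod C (g1 h) = g0 (Cod D h) \<and> FArr F (g1 h) = \<epsilon>' (Cod D h) \<cdot>[D] (h \<cdot>[D] \<epsilon> (Dom D h))" by metis
  have \<epsilon>\<epsilon>: "\<epsilon> d \<cdot>[D] (\<epsilon>' d \<cdot>[D] r) = r"
    if "d \<in> Obj D" "r \<in> Arr D" "Cod D r = d" for d r
    using that g0 \<epsilon>' D extend[of D "\<epsilon> d" "\<epsilon>' d" "Ident D d" r] by simp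
  define G where "G = \<lparr>FObj = g0, FArr = g1\<rparr>"
  have Fid: "FArr F (Ident C (g0 d)) = Ident D (FObj F (g0 d))" if "d \<in> Obj D" for d
    using F g0 that by simp
  have G: "is_functor D C G"
    unfolding is_functor_def
  proof (intro conjI ballI impI)
    show "FObj G a \<in> Obj C" if "a \<in> Obj D" for a using that g0 by (simp add: G_def)
    show "FArr G f \<in> hom C (FObj G (Dom D f)) (FObj G (Cod D f))" if "f \<in> Arr D" for f
      using that g1 by (simp add: G_def)
    show "FArr G (Ident D a) = Ident C (FObj G a)" if "a \<in> Obj D" for a
      using that g0 g1[of "Ident D a"] \<epsilon>' D C Fid
      by (rule_tac fully_faithfulD(2)[OF ff, of "g0 a" "g0 a"]) (simp_all add: G_def)
    show "FArr G (g \<cdot>[D] f) = FArr G g \<cdot>[C] FArr G f"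
      if "f \<in> Arr D" "g \<in> Arr D" "Cod D f = Dom D g" for f g
      using that g0 g1[of "g \<cdot>[D] f"] g1[of f] g1[of g] \<epsilon>' D C \<epsilon>\<epsilon> F
      by (rule_tac fully_faithfulD(2)[OF ff, of "g0 (Dom D f)" "g0 (Cod D g)"]) (simp_all add: G_def)
  qed
  have "\<exists>f. f \<in> Arr C \<and> Dom C f = a \<and> Cod C f = g0 (FObj F a) \<and> FArr F f = \<epsilon>' (FObj F a)" if "a \<in> Obj C" for a
    using fully_faithfulD(1)[OF ff, of a "g0 (FObj F a)" "\<epsilon>' (FObj F a)"] that g0 \<epsilon>' F by auto
  then obtain \<eta> where \<eta>: "\<And>a. a \<in> Obj C ==> \<eta> a \<in> Arr C \<and> Dom C (\<eta> a) = a \<and> Cod C (\<eta> a) = g0 (FObj F a) \<and>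
    FArr F (\<eta> a) = \<epsilon>' (FObj F a)" by metis
  have "\<exists>f. f \<in> Arr C \<and> Cod C f = a \<and> Dom C f = g0 (FObj F a) \<and> FArr F f = \<epsilon> (FObj F a)" if "a \<in> Obj C" for a
    using fully_faithfulD(1)[OF ff, of "g0 (FObj F a)" a "\<epsilon> (FObj F a)"] that g0 \<epsilon>' F by auto
  then obtain \<eta>' where \<eta>': "\<And>a. a \<in> Obj C ==> \<eta>' a \<in> Arr C \<and> Cod C (\<eta>' a) = a \<and> Dom C (\<eta>' a) = g0 (FObj F a) \<and>
    FArr F (\<eta>' a) = \<epsilon> (FObj F a)" by metis
  have "nat_iso C C id_funct (comp_funct G F) \<eta>"
    unfolding nat_iso_def nat_trans_def
  proof (intro conjI ballI)
    fix a assume a: "a \<in> Obj C"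
    show "\<eta> a \<in> hom C (FObj id_funct a) (FObj (comp_funct G F) a)"
      using \<eta> a by (simp add: id_funct_def comp_funct_def G_def)
    have "\<eta>' a \<cdot>[C] \<eta> a = Ident C a"
      using a \<eta>[OF a] \<eta>'[OF a] C F g0 \<epsilon>' by (rule_tac fully_faithfulD(2)[OF ff, of a a]) simp_all
    moreover have "\<eta> a \<cdot>[C] \<eta>' a = Ident C (g0 (FObj F a))"
      using a \<eta>[OF a] \<eta>'[OF a] C F g0 \<epsilon>' Fid
      by (rule_tac fully_faithfulD(2)[OF ff, of "g0 (FObj F a)" "g0 (FObj F a)"]) simp_all
    ultimately show "iso C (\<eta> a)" using \<eta>[OF a] \<eta>'[OF a] by (intro isoI[where g = "\<eta>' a"]) simp_all
  next
    fix f assume f: "f \<in> Arr C"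
    show "\<eta> (Cod C f) \<cdot>[C] FArr id_funct f = FArr (comp_funct G F) f \<cdot>[C] \<eta> (Dom C f)"
      using f \<eta>[of "Dom C f"] \<eta>[of "Cod C f"] C F D g0 \<epsilon>' g1[of "FArr F f"]
      by (rule_tac fully_faithfulD(2)[OF ff, of "Dom C f" "g0 (FObj F (Cod C f))"])
        (simp_all add: id_funct_def comp_funct_def G_def)
  qed
  moreover have "nat_iso D D (comp_funct F G) id_funct \<epsilon>"
    unfolding nat_iso_def nat_trans_def
    using g0 g1 \<epsilon>\<epsilon> D by (simp add: id_funct_def comp_funct_def G_def)
  ultimately show "equivalence C D F" unfolding equivalence_def using F G by blast
qed

subsection \<open>Pullbacks\<close>

lemma pullback_simps:
  assumes "is_pullback C f g p q"
  shows "f \<in> Arr C" "g \<in> Arr C" "p \<in> Arr C" "q \<in> Arr C" "Cod C f = Cod C g" "Dom C q = Dom C p"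
    "Cod C p = Dom C f" "Cod C q = Dom C g" "f \<cdot>[C] p = g \<cdot>[C] q"
  using assms unfolding is_pullback_def by simp_all

lemma pullback_ex1:
  assumes "is_pullback C f g p q" "u \<in> Arr C" "v \<in> Arr C" "Dom C v = Dom C u" "Cod C u = Dom C f"
    "Cod C v = Dom C g" "f \<cdot>[C] u = g \<cdot>[C] v"
  shows "\<exists>!w. w \<in> hom C (Dom C u) (Dom C p) \<and> p \<cdot>[C] w = u \<and> q \<cdot>[C] w = v"
proof -
  have "\<forall>u\<in>Arr C. \<forall>v\<in>Arr C. Dom C u = Dom C v \<and> Cod C u = Dom C f \<and> Cod C v = Dom C g \<and>
        f \<cdot>[C] u = g \<cdot>[C] v \<longrightarrow>
        (\<exists>!w. w \<in> hom C (Dom C u) (Dom C p) \<and> p \<cdot>[C] w = u \<and> q \<cdot>[C] w = v)"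
    using assms(1) unfolding is_pullback_def by blast
  then show ?thesis using assms(2-) by metis
qed

lemma pullback_lift:
  assumes "is_pullback C f g p q" "u \<in> Arr C" "v \<in> Arr C" "Dom C v = Dom C u" "Cod C u = Dom C f"
    "Cod C v = Dom C g" "f \<cdot>[C] u = g \<cdot>[C] v"
  obtains w where "w \<in> Arr C" "Dom C w = Dom C u" "Cod C w = Dom C p" "p \<cdot>[C] w = u" "q \<cdot>[C] w = v"
  using pullback_ex1[OF assms] that by auto

lemma pullback_eqI:
  assumes pb: "is_pullback C f g p q" and C: "category C"
    and "a \<in> Arr C" "b \<in> Arr C" "Dom C a = Dom C b" "Cod C a = Dom C p" "Cod C b = Dom C p"
    and eq: "p \<cdot>[C] a = p \<cdot>[C] b" "q \<cdot>[C] a = q \<cdot>[C] b"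
  shows "a = b"
proof -
  note s = pullback_simps[OF pb]
  define u v where "u = p \<cdot>[C] b" and "v = q \<cdot>[C] b"
  have "f \<cdot>[C] u = g \<cdot>[C] v" "u \<in> Arr C" "v \<in> Arr C" "Dom C u = Dom C v" "Cod C u = Dom C f" "Cod C v = Dom C g"
    using extend[OF s(9) C] s(1-8) assms(2-7) by (simp_all add: u_def v_def)
  then have "\<exists>!w. w \<in> hom C (Dom C u) (Dom C p) \<and> p \<cdot>[C] w = u \<and> q \<cdot>[C] w = v"
    using pb unfolding is_pullback_def by blast
  then have "\<exists>!w. w \<in> hom C (Dom C (p \<cdot>[C] b)) (Dom C p) \<and> p \<cdot>[C] w = p \<cdot>[C] b \<and> q \<cdot>[C] w = q \<cdot>[C] b"
    unfolding u_def v_def .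
  moreover have "a \<in> hom C (Dom C (p \<cdot>[C] b)) (Dom C p)" "b \<in> hom C (Dom C (p \<cdot>[C] b)) (Dom C p)"
    using s(1-8) assms(2-7) by simp_all
  ultimately show ?thesis using eq by blast
qed

lemma is_pullbackI:
  assumes "f \<in> Arr C" "g \<in> Arr C" "p \<in> Arr C" "q \<in> Arr C" "Cod C f = Cod C g" "Dom C p = Dom C q"
    "Cod C p = Dom C f" "Cod C q = Dom C g" "f \<cdot>[C] p = g \<cdot>[C] q"
    and "\<And>u v. u \<in> Arr C ==> v \<in> Arr C ==> Dom C u = Dom C v ==> Cod C u = Dom C f ==>
      Cod C v = Dom C g ==> f \<cdot>[C] u = g \<cdot>[C] v ==>
      \<exists>w\<in>Arr C. Dom C w = Dom C u \<and> Cod C w = Dom C p \<and> p \<cdot>[C] w = u \<and> q \<cdot>[C] w = v"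
    and "\<And>a b. a \<in> Arr C ==> b \<in> Arr C ==> Dom C a = Dom C b ==> Cod C a = Dom C p ==>
      Cod C b = Dom C p ==> p \<cdot>[C] a = p \<cdot>[C] b ==> q \<cdot>[C] a = q \<cdot>[C] b ==> a = b"
  shows "is_pullback C f g p q"
  unfolding is_pullback_def
proof (intro conjI ballI impI)
  fix u v assume uv: "u \<in> Arr C" "v \<in> Arr C"
    "Dom C u = Dom C v \<and> Cod C u = Dom C f \<and> Cod C v = Dom C g \<and> f \<cdot>[C] u = g \<cdot>[C] v"
  obtain w where "w \<in> Arr C" "Dom C w = Dom C u" "Cod C w = Dom C p" "p \<cdot>[C] w = u" "q \<cdot>[C] w = v"
    using assms(10)[of u v] uv by blast
  then show "\<exists>!w. w \<in> hom C (Dom C u) (Dom C p) \<and> p \<cdot>[C] w = u \<and> q \<cdot>[C] w = v"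
    using assms(11) by (intro ex1I[of _ w]) auto
qed (use assms in simp_all)

lemma pullback_sym:
  assumes "is_pullback C f g p q" shows "is_pullback C g f q p"
proof -
  note s = pullback_simps[OF assms]
  show ?thesis
    unfolding is_pullback_def
  proof (intro conjI ballI impI)
    fix u v assume "u \<in> Arr C" "v \<in> Arr C"
      "Dom C u = Dom C v \<and> Cod C u = Dom C g \<and> Cod C v = Dom C f \<and> g \<cdot>[C] u = f \<cdot>[C] v"
    then have "\<exists>!w. w \<in> hom C (Dom C v) (Dom C p) \<and> p \<cdot>[C] w = v \<and> q \<cdot>[C] w = u"
      using assms unfolding is_pullback_def by (metis (no_types, lifting))
    then show "\<exists>!w. w \<in> hom C (Dom C u) (Dom C q) \<and> q \<cdot>[C] w = u \<and> p \<cdot>[C] w = v"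
      using s \<open>Dom C u = Dom C v \<and> _\<close> by (simp add: conj_commute del: in_hom)
  qed (use s in simp_all)
qed

lemma pullback_paste:
  assumes C: "category C" and pb1: "is_pullback C f g p q" and pb2: "is_pullback C h p r s"
  shows "is_pullback C (f \<cdot>[C] h) g r (q \<cdot>[C] s)"
proof -
  note s1 = pullback_simps[OF pb1] and s2 = pullback_simps[OF pb2]
  note [simp] = C s1(1-8) s2(1-8)
  show ?thesis
  proof (rule is_pullbackI)
    show "(f \<cdot>[C] h) \<cdot>[C] r = g \<cdot>[C] (q \<cdot>[C] s)"
      using s2(9) extend[OF s1(9) C] by simp
  next
    fix u v assume uv [simp]: "u \<in> Arr C" "v \<in> Arr C" "Dom C u = Dom C v" "Cod C u = Dom C (f \<cdot>[C] h)"
      "Cod C v = Dom C g" and eq: "(f \<cdot>[C] h) \<cdot>[C] u = g \<cdot>[C] v"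
    obtain w where w: "w \<in> Arr C" "Dom C w = Dom C v" "Cod C w = Dom C p" "p \<cdot>[C] w = h \<cdot>[C] u" "q \<cdot>[C] w = v"
      using eq by (rule_tac pullback_lift[OF pb1, of "h \<cdot>[C] u" v]) simp_all
    obtain z where z: "z \<in> Arr C" "Dom C z = Dom C v" "Cod C z = Dom C r" "r \<cdot>[C] z = u" "s \<cdot>[C] z = w"
      using w by (rule_tac pullback_lift[OF pb2, of u w]) simp_all
    show "\<exists>w\<in>Arr C. Dom C w = Dom C u \<and> Cod C w = Dom C r \<and> r \<cdot>[C] w = u \<and> (q \<cdot>[C] s) \<cdot>[C] w = v"
      using z w by (intro bexI[of _ z]) simp_all
  next
    fix a b assume ab [simp]: "a \<in> Arr C" "b \<in> Arr C" "Dom C a = Dom C b" "Cod C a = Dom C r" "Cod C b = Dom C r"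
      and eq: "r \<cdot>[C] a = r \<cdot>[C] b" "(q \<cdot>[C] s) \<cdot>[C] a = (q \<cdot>[C] s) \<cdot>[C] b"
    have "p \<cdot>[C] (s \<cdot>[C] a) = p \<cdot>[C] (s \<cdot>[C] b)"
      using eq(1) by (simp add: extend[OF s2(9)[symmetric] C])
    then have "s \<cdot>[C] a = s \<cdot>[C] b" using eq by (rule_tac pullback_eqI[OF pb1 C]) simp_all
    then show "a = b" using eq by (rule_tac pullback_eqI[OF pb2 C]) simp_all
  qed simp_all
qed

text \<open>The cancellation half of the pasting law: cones over the left cospan become cones over
  the outer one by composing with q, and the right square tells their mediating arrows
  apart.\<close>

lemma pullback_unpaste:
  assumes C: "category C" and pb1: "is_pullback C f g p q" and pb: "is_pullback C (f \<cdot>[C] h) g r t"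
    and h: "h \<in> Arr C" "Cod C h = Dom C f"
    and s: "s \<in> Arr C" "Dom C s = Dom C r" "Cod C s = Dom C p" "p \<cdot>[C] s = h \<cdot>[C] r" "q \<cdot>[C] s = t"
  shows "is_pullback C h p r s"
proof -
  note s1 = pullback_simps[OF pb1] and s2 = pullback_simps[OF pb]
  have [simp]: "Cod C r = Dom C h" using s2(7) h C s1 by simp
  note [simp] = C s1(1-8) s2(2-6,8) h s(1-3)
  show ?thesis
  proof (rule is_pullbackI)
    fix u v assume uv [simp]: "u \<in> Arr C" "v \<in> Arr C" "Dom C u = Dom C v" "Cod C u = Dom C h"
      "Cod C v = Dom C p" and eq: "h \<cdot>[C] u = p \<cdot>[C] v"
    obtain z where z: "z \<in> Arr C" "Dom C z = Dom C v" "Cod C z = Dom C r" "r \<cdot>[C] z = u" "t \<cdot>[C] z = q \<cdot>[C] v"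
      using eq extend[OF s1(9) C] by (rule_tac pullback_lift[OF pb, of u "q \<cdot>[C] v"]) simp_all
    have "p \<cdot>[C] (s \<cdot>[C] z) = p \<cdot>[C] v" "q \<cdot>[C] (s \<cdot>[C] z) = q \<cdot>[C] v"
      using z eq by (simp_all add: extend[OF s(4) C] extend[OF s(5) C])
    then have "s \<cdot>[C] z = v"
      using z(1-3) by (rule_tac pullback_eqI[OF pb1 C]) simp_all
    then show "\<exists>w\<in>Arr C. Dom C w = Dom C u \<and> Cod C w = Dom C r \<and> r \<cdot>[C] w = u \<and> s \<cdot>[C] w = v"
      using z by (intro bexI[of _ z]) simp_all
  next
    fix a b assume ab [simp]: "a \<in> Arr C" "b \<in> Arr C" "Dom C a = Dom C b" "Cod C a = Dom C r" "Cod C b = Dom C r"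
      and eq: "r \<cdot>[C] a = r \<cdot>[C] b" "s \<cdot>[C] a = s \<cdot>[C] b"
    have "t \<cdot>[C] a = t \<cdot>[C] b"
      using extend[OF s(5) C, of a] extend[OF s(5) C, of b] eq by simp
    then show "a = b" using eq by (rule_tac pullback_eqI[OF pb C]) simp_all
  qed (use s in simp_all)
qed

lemma pullback_iso_left:
  assumes C: "category C" and pb: "is_pullback C f g p q" and i: "iso C i" "Cod C i = Dom C p"
  shows "is_pullback C f g (p \<cdot>[C] i) (q \<cdot>[C] i)"
proof -
  note s = pullback_simps[OF pb]
  obtain j where j: "j \<in> Arr C" "Dom C j = Dom C p" "Cod C j = Dom C i"
    "i \<cdot>[C] j = Ident C (Dom C p)" using isoD[OF C i(1)] i by metis
  note [simp] = C s(1-8) i j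
  show ?thesis
  proof (rule is_pullbackI)
    show "f \<cdot>[C] (p \<cdot>[C] i) = g \<cdot>[C] (q \<cdot>[C] i)" using extend[OF s(9) C] by simp
  next
    fix u v assume uv [simp]: "u \<in> Arr C" "v \<in> Arr C" "Dom C u = Dom C v" "Cod C u = Dom C f"
      "Cod C v = Dom C g" and eq: "f \<cdot>[C] u = g \<cdot>[C] v"
    obtain w where w: "w \<in> Arr C" "Dom C w = Dom C v" "Cod C w = Dom C p" "p \<cdot>[C] w = u" "q \<cdot>[C] w = v"
      using eq by (rule_tac pullback_lift[OF pb, of u v]) simp_all
    show "\<exists>w\<in>Arr C. Dom C w = Dom C u \<and> Cod C w = Dom C (p \<cdot>[C] i) \<and> (p \<cdot>[C] i) \<cdot>[C] w = u \<and> (q \<cdot>[C] i) \<cdot>[C] w = v"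
      using w extend[OF j(4) C] by (intro bexI[of _ "j \<cdot>[C] w"]) simp_all
  next
    fix a b assume ab [simp]: "a \<in> Arr C" "b \<in> Arr C" "Dom C a = Dom C b" "Cod C a = Dom C (p \<cdot>[C] i)"
        "Cod C b = Dom C (p \<cdot>[C] i)"
      and eq: "(p \<cdot>[C] i) \<cdot>[C] a = (p \<cdot>[C] i) \<cdot>[C] b" "(q \<cdot>[C] i) \<cdot>[C] a = (q \<cdot>[C] i) \<cdot>[C] b"
    have "i \<cdot>[C] a = i \<cdot>[C] b" using eq by (rule_tac pullback_eqI[OF pb C]) simp_all
    then show "a = b" by (rule_tac iso_cancel_left[OF C i(1)]) simp_all
  qed simp_all
qed

lemma pullback_compare:
  assumes C: "category C" and pb: "is_pullback C f g p q" and pb': "is_pullback C f g p' q'"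
  obtains i where "iso C i" "Dom C i = Dom C p'" "Cod C i = Dom C p" "p \<cdot>[C] i = p'" "q \<cdot>[C] i = q'"
proof -
  note s = pullback_simps[OF pb] and s' = pullback_simps[OF pb']
  note [simp] = C s(1-8) s'(3-8)
  obtain i where i: "i \<in> Arr C" "Dom C i = Dom C p'" "Cod C i = Dom C p" "p \<cdot>[C] i = p'" "q \<cdot>[C] i = q'"
    using s'(9) by (rule_tac pullback_lift[OF pb, of p' q']) simp_all
  obtain j where j: "j \<in> Arr C" "Dom C j = Dom C p" "Cod C j = Dom C p'" "p' \<cdot>[C] j = p" "q' \<cdot>[C] j = q"
    using s(9) by (rule_tac pullback_lift[OF pb', of p q]) simp_all
  have "j \<cdot>[C] i = Ident C (Dom C p')"
    using i j extend[OF j(4) C] extend[OF j(5) C] by (rule_tac pullback_eqI[OF pb' C]) simp_all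
  moreover have "i \<cdot>[C] j = Ident C (Dom C p)"
    using i j extend[OF i(4) C] extend[OF i(5) C] by (rule_tac pullback_eqI[OF pb C]) simp_all
  ultimately have "iso C i" using i j by (intro isoI[where g = j]) simp_all
  then show ?thesis using that i by blast
qed

text \<open>The arrow f' is f after the inverse of i, so the square changes only at the corner
  \<open>Dom C f\<close>.\<close>

lemma pullback_change_base_left:
  assumes C: "category C" and pb: "is_pullback C f g p q" and i: "iso C i" "Dom C i = Dom C f"
    and f': "f' \<in> Arr C" "Dom C f' = Cod C i" "f' \<cdot>[C] i = f"
  shows "is_pullback C f' g (i \<cdot>[C] p) q"
proof -
  note s = pullback_simps[OF pb]
  obtain j where j: "j \<in> Arr C" "Dom C j = Cod C i" "Cod C j = Dom C f"
    "i \<cdot>[C] j = Ident C (Cod C i)" using isoD[OF C i(1)] i by metis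
  have [simp]: "Cod C f' = Cod C f" using f' i C s by auto
  have f'e: "f \<cdot>[C] j = f'"
    using f' i j C s extend[OF f'(3), of j] by simp
  note [simp] = C s(1-8) i j f'(1,2)
  show ?thesis
  proof (rule is_pullbackI)
    show "f' \<cdot>[C] (i \<cdot>[C] p) = g \<cdot>[C] q" using extend[OF f'(3) C] s(9) by simp
  next
    fix u v assume uv [simp]: "u \<in> Arr C" "v \<in> Arr C" "Dom C u = Dom C v" "Cod C u = Dom C f'"
      "Cod C v = Dom C g" and eq: "f' \<cdot>[C] u = g \<cdot>[C] v"
    obtain w where w: "w \<in> Arr C" "Dom C w = Dom C v" "Cod C w = Dom C p" "p \<cdot>[C] w = j \<cdot>[C] u" "q \<cdot>[C] w = v"
      using eq extend[OF f'e C] by (rule_tac pullback_lift[OF pb, of "j \<cdot>[C] u" v]) simp_all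
    show "\<exists>w\<in>Arr C. Dom C w = Dom C u \<and> Cod C w = Dom C (i \<cdot>[C] p) \<and> (i \<cdot>[C] p) \<cdot>[C] w = u \<and> q \<cdot>[C] w = v"
      using w extend[OF j(4) C] by (intro bexI[of _ w]) simp_all
  next
    fix a b assume ab [simp]: "a \<in> Arr C" "b \<in> Arr C" "Dom C a = Dom C b" "Cod C a = Dom C (i \<cdot>[C] p)"
        "Cod C b = Dom C (i \<cdot>[C] p)"
      and eq: "(i \<cdot>[C] p) \<cdot>[C] a = (i \<cdot>[C] p) \<cdot>[C] b" "q \<cdot>[C] a = q \<cdot>[C] b"
    have "p \<cdot>[C] a = p \<cdot>[C] b" using eq by (rule_tac iso_cancel_left[OF C i(1)]) simp_all
    then show "a = b" using eq by (rule_tac pullback_eqI[OF pb C]) simp_all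
  qed simp_all
qed

definition has_pullbacks :: "('o, 'm) cat \<Rightarrow> bool" where
  "has_pullbacks C \<longleftrightarrow>
     (\<forall>f\<in>Arr C. \<forall>g\<in>Arr C. Cod C f = Cod C g \<longrightarrow> (\<exists>p q. is_pullback C f g p q))"

lemma chosen_pullback:
  assumes "has_pullbacks C" "f \<in> Arr C" "g \<in> Arr C" "Cod C f = Cod C g"
  shows "is_pullback C f g (pb_fst C f g) (pb_snd C f g)"
proof -
  have "\<exists>x. case x of (p, q) \<Rightarrow> is_pullback C f g p q" using assms unfolding has_pullbacks_def by auto
  then have "case SOME x. case x of (p, q) \<Rightarrow> is_pullback C f g p q of (p, q) \<Rightarrow> is_pullback C f g p q"
    by (rule someI_ex)
  then show ?thesis unfolding pb_fst_def pb_snd_def by (simp add: case_prod_unfold)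
qed

lemma pb_simps [simp]:
  assumes "has_pullbacks C" "f \<in> Arr C" "g \<in> Arr C" "Cod C f = Cod C g"
  shows "pb_fst C f g \<in> Arr C" "pb_snd C f g \<in> Arr C"
    "Dom C (pb_fst C f g) = pb_obj C f g" "Dom C (pb_snd C f g) = pb_obj C f g"
    "Cod C (pb_fst C f g) = Dom C f" "Cod C (pb_snd C f g) = Dom C g"
  using pullback_simps[OF chosen_pullback[OF assms]] by (simp_all add: pb_obj_def)

lemma pb_commute:
  assumes "has_pullbacks C" "f \<in> Arr C" "g \<in> Arr C" "Cod C f = Cod C g"
  shows "f \<cdot>[C] pb_fst C f g = g \<cdot>[C] pb_snd C f g"
  using pullback_simps(9)[OF chosen_pullback[OF assms]] .

lemma pb_obj_in [simp]:
  assumes "category C" "has_pullbacks C" "f \<in> Arr C" "g \<in> Arr C" "Cod C f = Cod C g"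
  shows "pb_obj C f g \<in> Obj C"
  using category_simps(1)[of C "pb_fst C f g"] assms by simp

lemma pb_pair_simps [simp]:
  assumes "has_pullbacks C" "f \<in> Arr C" "g \<in> Arr C" "Cod C f = Cod C g"
    "u \<in> Arr C" "v \<in> Arr C" "Dom C v = Dom C u" "Cod C u = Dom C f" "Cod C v = Dom C g"
    "f \<cdot>[C] u = g \<cdot>[C] v"
  shows "pb_pair C f g u v \<in> Arr C" "Dom C (pb_pair C f g u v) = Dom C u"
    "Cod C (pb_pair C f g u v) = pb_obj C f g"
    "pb_fst C f g \<cdot>[C] pb_pair C f g u v = u" "pb_snd C f g \<cdot>[C] pb_pair C f g u v = v"
proof -
  have "\<exists>!w. w \<in> hom C (Dom C u) (Dom C (pb_fst C f g)) \<and> pb_fst C f g \<cdot>[C] w = u \<and> pb_snd C f g \<cdot>[C] w = v"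
    using pullback_ex1[OF chosen_pullback[OF assms(1-4)] assms(5-)] .
  then have "\<exists>!w. w \<in> hom C (Dom C u) (pb_obj C f g) \<and> pb_fst C f g \<cdot>[C] w = u \<and> pb_snd C f g \<cdot>[C] w = v"
    using assms by simp
  from theI'[OF this] show "pb_pair C f g u v \<in> Arr C" "Dom C (pb_pair C f g u v) = Dom C u"
    "Cod C (pb_pair C f g u v) = pb_obj C f g"
    "pb_fst C f g \<cdot>[C] pb_pair C f g u v = u" "pb_snd C f g \<cdot>[C] pb_pair C f g u v = v"
    unfolding pb_pair_def by simp_all
qed

lemma pb_pair_extend [simp]:
  assumes "category C" "has_pullbacks C" "f \<in> Arr C" "g \<in> Arr C" "Cod C f = Cod C g"
    "u \<in> Arr C" "v \<in> Arr C" "Dom C v = Dom C u" "Cod C u = Dom C f" "Cod C v = Dom C g"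
    "f \<cdot>[C] u = g \<cdot>[C] v" "r \<in> Arr C" "Cod C r = Dom C u"
  shows "pb_fst C f g \<cdot>[C] (pb_pair C f g u v \<cdot>[C] r) = u \<cdot>[C] r"
    "pb_snd C f g \<cdot>[C] (pb_pair C f g u v \<cdot>[C] r) = v \<cdot>[C] r"
  using assms by (auto intro!: extend)

lemma pb_eqI:
  assumes "category C" "has_pullbacks C" "f \<in> Arr C" "g \<in> Arr C" "Cod C f = Cod C g"
    and "a \<in> Arr C" "b \<in> Arr C" "Dom C a = Dom C b" "Cod C a = pb_obj C f g" "Cod C b = pb_obj C f g"
    and "pb_fst C f g \<cdot>[C] a = pb_fst C f g \<cdot>[C] b" "pb_snd C f g \<cdot>[C] a = pb_snd C f g \<cdot>[C] b"
  shows "a = b"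
  using assms by (rule_tac pullback_eqI[OF chosen_pullback[OF assms(2-5)] assms(1)]) simp_all

lemma pb_pair_comp:
  assumes "category C" "has_pullbacks C" "f \<in> Arr C" "g \<in> Arr C" "Cod C f = Cod C g"
    "u \<in> Arr C" "v \<in> Arr C" "Dom C v = Dom C u" "Cod C u = Dom C f" "Cod C v = Dom C g"
    "f \<cdot>[C] u = g \<cdot>[C] v" "r \<in> Arr C" "Cod C r = Dom C u"
  shows "pb_pair C f g u v \<cdot>[C] r = pb_pair C f g (u \<cdot>[C] r) (v \<cdot>[C] r)"
proof -
  have "f \<cdot>[C] (u \<cdot>[C] r) = g \<cdot>[C] (v \<cdot>[C] r)"
    using assms extend[OF assms(11)] by simp
  then show ?thesis using assms by (rule_tac pb_eqI[of C f g]) simp_all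
qed

section \<open>Descent data as cartesian families\<close>

lemma aug_simplex_simps [simp]:
  "Obj aug_simplex = UNIV" "sdom (m, s, n) = m" "scod (m, s, n) = n"
  "(m, s, n) \<in> Arr aug_simplex \<longleftrightarrow> s \<in> {..<m} \<rightarrow>\<^sub>E {..<n} \<and> mono_on {..<m} s"
  by (simp_all add: aug_simplex_def)

lemma category_aug_simplex [simp]: "category aug_simplex"
  unfolding category_def aug_simplex_def hom_def
  by (auto simp: compose_def mono_on_def PiE_def Pi_def extensional_def restrict_def fun_eq_iff)

lemma simplex_simps [simp]:
  "Obj simplex = {n. 0 < n}" "Dom simplex = sdom" "Cod simplex = scod"
  "Ident simplex = Ident aug_simplex" "Comp simplex = Comp aug_simplex"
  "\<mu> \<in> Arr simplex \<longleftrightarrow> \<mu> \<in> Arr aug_simplex \<and> 0 < sdom \<mu> \<and> 0 < scod \<mu>"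
  by (auto simp: simplex_def full_subcat_def aug_simplex_def)

lemma from_zero_simps [simp]:
  "from_zero n \<in> Arr aug_simplex" "sdom (from_zero n) = 0" "scod (from_zero n) = n"
  by (simp_all add: from_zero_def mono_on_def restrict_def)

text \<open>The ordinal 0 is initial in \<open>aug_simplex\<close>. The equality is literal because
  any function restricted to the empty set is the constant \<open>undefined\<close>.\<close>

lemma comp_from_zero:
  assumes "\<mu> \<in> Arr aug_simplex" "sdom \<mu> = m"
  shows "\<mu> \<cdot>[aug_simplex] from_zero m = from_zero (scod \<mu>)"
proof -
  have "restrict f {} = (\<lambda>_. undefined)" for f :: "nat \<Rightarrow> nat" by (simp add: restrict_def)
  then show ?thesis
    using assms by (cases \<mu>) (simp add: from_zero_def aug_simplex_def compose_def)
qed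

section \<open>Slices and base change\<close>

lemma slice_simps [simp]:
  "x \<in> Obj (slice C b) \<longleftrightarrow> x \<in> Arr C \<and> Cod C x = b"
  "(x, h, y) \<in> Arr (slice C b) \<longleftrightarrow> x \<in> Arr C \<and> y \<in> Arr C \<and> Cod C x = b \<and> Cod C y = b \<and>
     h \<in> Arr C \<and> Dom C h = Dom C x \<and> Cod C h = Dom C y \<and> y \<cdot>[C] h = x"
  "Dom (slice C b) (x, h, y) = x" "Cod (slice C b) (x, h, y) = y"
  "Ident (slice C b) x = (x, Ident C (Dom C x), x)"
  "(y', k, z) \<cdot>[slice C b] (x, h, y) = (x, k \<cdot>[C] h, z)"
  by (auto simp: slice_def)

lemma category_slice [simp]:
  assumes C: "category C" shows "category (slice C b)"
proof -
  have 1: "(h \<cdot>[slice C b] g) \<cdot>[slice C b] f = h \<cdot>[slice C b] (g \<cdot>[slice C b] f)"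
    if "f \<in> Arr (slice C b)" "g \<in> Arr (slice C b)" "h \<in> Arr (slice C b)"
      "Cod (slice C b) f = Dom (slice C b) g" "Cod (slice C b) g = Dom (slice C b) h" for f g h
    using that C by (cases f; cases g; cases h) auto
  have 2: "g \<cdot>[slice C b] f \<in> hom (slice C b) (Dom (slice C b) f) (Cod (slice C b) g)"
    if "f \<in> Arr (slice C b)" "g \<in> Arr (slice C b)" "Cod (slice C b) f = Dom (slice C b) g" for f g
    using that C by (cases f; cases g) (auto simp flip: comp_assoc)
  have 3: "f \<cdot>[slice C b] Ident (slice C b) (Dom (slice C b) f) = f \<and>
      Ident (slice C b) (Cod (slice C b) f) \<cdot>[slice C b] f = f \<and>
      Dom (slice C b) f \<in> Obj (slice C b) \<and> Cod (slice C b) f \<in> Obj (slice C b)"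
    if "f \<in> Arr (slice C b)" for f
    using that C by (cases f) auto
  show ?thesis
    unfolding category_def using 1 2 3 C by auto
qed

text \<open>The forgetful functor from a slice reflects isomorphisms: the inverse in C of an arrow
  over b is automatically over b.\<close>

lemma iso_slice [simp]:
  assumes C: "category C"
  shows "iso (slice C b) (x, h, y) \<longleftrightarrow> (x, h, y) \<in> Arr (slice C b) \<and> iso C h"
proof
  assume "iso (slice C b) (x, h, y)"
  then obtain k where k: "(x, h, y) \<in> Arr (slice C b)" "k \<in> Arr (slice C b)" "Dom (slice C b) k = y" "Cod (slice C b) k = x"
    "k \<cdot>[slice C b] (x, h, y) = Ident (slice C b) x" "(x, h, y) \<cdot>[slice C b] k = Ident (slice C b) y"
    unfolding iso_def by auto
  obtain x' h' y' where k': "k = (x', h', y')" by (cases k)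
  show "(x, h, y) \<in> Arr (slice C b) \<and> iso C h"
    using k unfolding k' by (auto intro: isoI[where g = h'])
next
  assume *: "(x, h, y) \<in> Arr (slice C b) \<and> iso C h"
  then obtain k where k: "k \<in> Arr C" "Dom C k = Dom C y" "Cod C k = Dom C x"
    "k \<cdot>[C] h = Ident C (Dom C x)" "h \<cdot>[C] k = Ident C (Dom C y)" using isoD[OF C, of h] by auto
  then have "x \<cdot>[C] k = y" using * C extend[of C y h x k] by simp
  then show "iso (slice C b) (x, h, y)"
    using * k by (intro isoI[where g = "(y, k, x)"]) auto
qed

lemma base_change_simps [simp]:
  "FObj (base_change C p) x = pb_fst C p x"
  "FArr (base_change C p) (x, h, y) =
     (pb_fst C p x, pb_pair C p y (pb_fst C p x) (h \<cdot>[C] pb_snd C p x), pb_fst C p y)"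
  by (simp_all add: base_change_def)

text \<open>The commuting square whose mediating arrow is the base change of h along p.\<close>

lemma base_change_lift:
  assumes C: "category C" "has_pullbacks C" and "p \<in> Arr C" "(x, h, y) \<in> Arr (slice C (Cod C p))"
  shows "p \<cdot>[C] pb_fst C p x = y \<cdot>[C] (h \<cdot>[C] pb_snd C p x)"
  using assms extend[of C y h x "pb_snd C p x"] by (simp add: pb_commute)

lemma base_change_functor:
  assumes C [simp]: "category C" "has_pullbacks C" and p [simp]: "p \<in> Arr C" "Cod C p = b" "Dom C p = e"
  shows "is_functor (slice C b) (slice C e) (base_change C p)"
proof -
  have arr: "FArr (base_change C p) f \<in> hom (slice C e)
      (FObj (base_change C p) (Dom (slice C b) f)) (FObj (base_change C p) (Cod (slice C b) f))"
    if f: "f \<in> Arr (slice C b)" for f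
  proof (cases f)
    case (fields x h y)
    with f base_change_lift[OF C, of p x h y] show ?thesis by simp
  qed
  have ident: "FArr (base_change C p) (Ident (slice C b) x) = Ident (slice C e) (FObj (base_change C p) x)"
    if x: "x \<in> Obj (slice C b)" for x
    using x by (simp, rule_tac pb_eqI[OF C, of p x]) (simp_all add: pb_commute)
  have comp: "FArr (base_change C p) (g \<cdot>[slice C b] f) =
      FArr (base_change C p) g \<cdot>[slice C e] FArr (base_change C p) f"
    if fg: "f \<in> Arr (slice C b)" "g \<in> Arr (slice C b)" "Cod (slice C b) f = Dom (slice C b) g" for f g
  proof (cases f, cases g)
    fix x h y y' k z assume [simp]: "f = (x, h, y)" "g = (y', k, z)"
    have [simp]: "y' = y" using fg by simp
    have z: "z \<cdot>[C] (k \<cdot>[C] h) = x"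
      using fg extend[of C z k y h] by simp
    show ?thesis
      using fg z base_change_lift[OF C, of p x h y] base_change_lift[OF C, of p y k z]
        base_change_lift[OF C, of p x "k \<cdot>[C] h" z]
      by (simp, rule_tac pb_eqI[OF C, of p z]) simp_all
  qed
  have obj: "FObj (base_change C p) a \<in> Obj (slice C e)" if "a \<in> Obj (slice C b)" for a
    using that by simp
  show ?thesis unfolding is_functor_def using arr ident comp obj by blast
qed

section \<open>Pseudonatural transformations out of the terminal category\<close>

lemma one_cat_simps [simp]: "Obj one_cat = UNIV" "Arr one_cat = UNIV"
  by (simp_all add: one_cat_def)

lemma is_pntD:
  assumes "is_pnt D F G \<alpha>"
  shows "pn_fun \<alpha> \<in> extensional (Obj D)" "pn_cell \<alpha> \<in> extensional (Arr D)"
    and "d \<in> Obj D ==> is_functor (pf_obj F d) (pf_obj G d) (pn_fun \<alpha> d)"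
    and "f \<in> Arr D ==> nat_iso (pf_obj F (Dom D f)) (pf_obj G (Cod D f))
          (comp_funct (pf_arr G f) (pn_fun \<alpha> (Dom D f)))
          (comp_funct (pn_fun \<alpha> (Cod D f)) (pf_arr F f)) (pn_cell \<alpha> f)"
    and "d \<in> Obj D ==> x \<in> Obj (pf_obj F d) ==>
      pn_cell \<alpha> (Ident D d) x \<cdot>[pf_obj G d] pf_unit G d (FObj (pn_fun \<alpha> d) x) =
        FArr (pn_fun \<alpha> d) (pf_unit F d x)"
    and "f \<in> Arr D ==> g \<in> Arr D ==> Cod D f = Dom D g ==> x \<in> Obj (pf_obj F (Dom D f)) ==>
           pn_cell \<alpha> (g \<cdot>[D] f) x
             \<cdot>[pf_obj G (Cod D g)] pf_comp G g f (FObj (pn_fun \<alpha> (Dom D f)) x) =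
           FArr (pn_fun \<alpha> (Cod D g)) (pf_comp F g f x)
             \<cdot>[pf_obj G (Cod D g)] (pn_cell \<alpha> g (FObj (pf_arr F f) x)
             \<cdot>[pf_obj G (Cod D g)] FArr (pf_arr G g) (pn_cell \<alpha> f x))"
  using assms unfolding is_pnt_def by blast+

locale pb_category =
  fixes C :: "('o, 'm) cat"
  assumes C [simp]: "category C" and P [simp]: "has_pullbacks C"
begin

abbreviation comp_C (infixr "\<cdot>" 70) where "g \<cdot> f \<equiv> Comp C g f"
abbreviation arr where "arr f \<equiv> f \<in> Arr C"
abbreviation dom where "dom \<equiv> Dom C"
abbreviation cod where "cod \<equiv> Cod C"

end

text \<open>The analysis of the comparison functor depends only on having a functor on
  \<open>aug_simplex\<close>, not on its being a Cech nerve, so it is carried out for an arbitrary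
  A.\<close>

locale aug_diagram = pb_category C for C :: "('o, 'm) cat" +
  fixes A :: "(nat, nat \<times> (nat \<Rightarrow> nat) \<times> nat, 'o, 'm) funct"
  assumes A: "is_functor aug_simplex (op_cat C) A"
begin

abbreviation F :: "(nat, nat \<times> (nat \<Rightarrow> nat) \<times> nat, 'm, 'm \<times> 'm \<times> 'm) pseudofun" where
  "F \<equiv> precomp_pf (basic_fibration C) A"

abbreviation K :: "(nat, nat \<times> (nat \<Rightarrow> nat) \<times> nat, unit, unit) pseudofun" where
  "K \<equiv> const_pf one_cat"

abbreviation leg :: "nat \<Rightarrow> 'm" where
  "leg n \<equiv> FArr A (from_zero n)"

lemma A_simps [simp]:
  "FObj A n \<in> Obj C"
  "\<mu> \<in> Arr aug_simplex ==> arr (FArr A \<mu>)"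
  "\<mu> \<in> Arr aug_simplex ==> dom (FArr A \<mu>) = FObj A (scod \<mu>)"
  "\<mu> \<in> Arr aug_simplex ==> cod (FArr A \<mu>) = FObj A (sdom \<mu>)"
  "FArr A (Ident aug_simplex n) = Ident C (FObj A n)"
  "\<mu> \<in> Arr aug_simplex ==> \<tau> \<in> Arr aug_simplex ==> scod \<mu> = sdom \<tau> ==>
     FArr A (\<tau> \<cdot>[aug_simplex] \<mu>) = FArr A \<mu> \<cdot> FArr A \<tau>"
  using functor_simps[OF A] by simp_all

lemma leg_comp:
  assumes "\<mu> \<in> Arr aug_simplex" "sdom \<mu> = m" "scod \<mu> = n"
  shows "leg m \<cdot> FArr A \<mu> = leg n"
  using A_simps(6)[of "from_zero m" \<mu>] comp_from_zero[OF assms(1,2)] assms by simp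

lemma F_simps [simp]:
  "pf_obj F n = slice C (FObj A n)" "pf_arr F \<mu> = base_change C (FArr A \<mu>)"
  "pf_unit F n x = (x, pb_pair C (Ident C (FObj A n)) x x (Ident C (dom x)), pb_fst C (Ident C (FObj A n)) x)"
  "pf_comp F \<tau> \<mu> x =
     (pb_fst C (FArr A \<tau>) (pb_fst C (FArr A \<mu>) x),
      pb_pair C (FArr A \<mu> \<cdot> FArr A \<tau>) x (pb_fst C (FArr A \<tau>) (pb_fst C (FArr A \<mu>) x))
        (pb_snd C (FArr A \<mu>) x \<cdot> pb_snd C (FArr A \<tau>) (pb_fst C (FArr A \<mu>) x)),
      pb_fst C (FArr A \<mu> \<cdot> FArr A \<tau>) x)"
  by (simp_all add: precomp_pf_def basic_fibration_def Let_def)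

text \<open>A functor out of \<open>one_cat\<close> amounts to an object, since its arrow part is
  forced to be the identity, and the two ends of each cell are forced by the functors. What remains
  of a pseudonatural transformation is the objects x and the underlying arrows h of the
  cells.\<close>

definition fam :: "(nat \<Rightarrow> 'm) \<Rightarrow> (nat \<times> (nat \<Rightarrow> nat) \<times> nat \<Rightarrow> 'm) \<Rightarrow>
    (nat, nat \<times> (nat \<Rightarrow> nat) \<times> nat, unit, unit, 'm, 'm \<times> 'm \<times> 'm) pnt" where
  "fam x h = \<lparr>pn_fun = (\<lambda>n\<in>Obj simplex. \<lparr>FObj = (\<lambda>_. x n), FArr = (\<lambda>_. (x n, Ident C (dom (x n)), x n))\<rparr>),
     pn_cell = (\<lambda>\<mu>\<in>Arr simplex. \<lambda>_.
       (pb_fst C (FArr A \<mu>) (x (sdom \<mu>)), h \<mu>, x (scod \<mu>)))\<rparr>"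

abbreviation pnt :: "(nat, nat \<times> (nat \<Rightarrow> nat) \<times> nat, unit, unit, 'm, 'm \<times> 'm \<times> 'm) pnt \<Rightarrow> bool" where
  "pnt \<equiv> is_pnt simplex K F"

lemma fam_simps [simp]:
  "0 < n ==> FObj (pn_fun (fam x h) n) a = x n"
  "0 < n ==> FArr (pn_fun (fam x h) n) b = (x n, Ident C (dom (x n)), x n)"
  "\<mu> \<in> Arr simplex ==> pn_cell (fam x h) \<mu> a =
     (pb_fst C (FArr A \<mu>) (x (sdom \<mu>)), h \<mu>, x (scod \<mu>))"
  by (simp_all add: fam_def)

text \<open>The coherence laws of \<open>is_pnt\<close>, read off on underlying arrows of C. The
  identity factor in the last clause is the image of the compositor of the constant
  pseudofunctor.\<close>

lemma pnt_famD:
  assumes "pnt (fam x h)"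
  shows "0 < n ==> arr (x n) \<and> cod (x n) = FObj A n"
    and "\<mu> \<in> Arr simplex ==> iso C (h \<mu>) \<and> dom (h \<mu>) = pb_obj C (FArr A \<mu>) (x (sdom \<mu>)) \<and>
       cod (h \<mu>) = dom (x (scod \<mu>)) \<and>
       x (scod \<mu>) \<cdot> h \<mu> = pb_fst C (FArr A \<mu>) (x (sdom \<mu>))"
    and "0 < n ==>
       h (Ident aug_simplex n) \<cdot> pb_pair C (Ident C (FObj A n)) (x n) (x n) (Ident C (dom (x n))) =
       Ident C (dom (x n))"
    and "\<mu> \<in> Arr simplex ==> \<tau> \<in> Arr simplex ==> scod \<mu> = sdom \<tau> ==>
       h (\<tau> \<cdot>[aug_simplex] \<mu>) \<cdot> fst (snd (pf_comp F \<tau> \<mu> (x (sdom \<mu>)))) =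
       Ident C (dom (x (scod \<tau>))) \<cdot>
         (h \<tau> \<cdot> fst (snd (FArr (base_change C (FArr A \<tau>))
         (pb_fst C (FArr A \<mu>) (x (sdom \<mu>)), h \<mu>, x (scod \<mu>)))))"
proof -
  note p = is_pntD[OF assms]
  show X: "arr (x n) \<and> cod (x n) = FObj A n" if "0 < n" for n
  proof -
    have "is_functor (pf_obj K n) (pf_obj F n) (pn_fun (fam x h) n)" using p(3)[of n] that by simp
    from functor_simps(1)[OF this, of "()"] show ?thesis using that by (simp add: const_pf_def)
  qed
  show "iso C (h \<mu>) \<and> dom (h \<mu>) = pb_obj C (FArr A \<mu>) (x (sdom \<mu>)) \<and>
       cod (h \<mu>) = dom (x (scod \<mu>)) \<and>
       x (scod \<mu>) \<cdot> h \<mu> = pb_fst C (FArr A \<mu>) (x (sdom \<mu>))" if s: "\<mu> \<in> Arr simplex"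
  proof -
    have "iso (slice C (FObj A (scod \<mu>))) (pn_cell (fam x h) \<mu> ())"
      using p(4)[OF s] unfolding nat_iso_def by (simp add: const_pf_def)
    then show ?thesis using s X[of "sdom \<mu>"] X[of "scod \<mu>"] by simp
  qed
  show "h (Ident aug_simplex n) \<cdot> pb_pair C (Ident C (FObj A n)) (x n) (x n) (Ident C (dom (x n))) =
       Ident C (dom (x n))" if n: "0 < n"
  proof -
    have "pn_cell (fam x h) (Ident aug_simplex n) () \<cdot>[slice C (FObj A n)] pf_unit F n (x n) =
        FArr (pn_fun (fam x h) n) (pf_unit K n ())"
      using p(5)[of n "()"] n by (simp add: const_pf_def)
    then show ?thesis using n by simp
  qed
  show "h (\<tau> \<cdot>[aug_simplex] \<mu>) \<cdot> fst (snd (pf_comp F \<tau> \<mu> (x (sdom \<mu>)))) =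
       Ident C (dom (x (scod \<tau>))) \<cdot>
         (h \<tau> \<cdot> fst (snd (FArr (base_change C (FArr A \<tau>))
         (pb_fst C (FArr A \<mu>) (x (sdom \<mu>)), h \<mu>, x (scod \<mu>)))))"
    if st: "\<mu> \<in> Arr simplex" "\<tau> \<in> Arr simplex" "scod \<mu> = sdom \<tau>"
  proof -
    let ?S = "slice C (FObj A (scod \<tau>))"
    have "pn_cell (fam x h) (\<tau> \<cdot>[aug_simplex] \<mu>) () \<cdot>[?S] pf_comp F \<tau> \<mu> (FObj (pn_fun (fam x h) (sdom \<mu>)) ()) =
        FArr (pn_fun (fam x h) (scod \<tau>)) (pf_comp K \<tau> \<mu> ()) \<cdot>[?S]
        (pn_cell (fam x h) \<tau> (FObj (pf_arr K \<mu>) ()) \<cdot>[?S] FArr (pf_arr F \<tau>) (pn_cell (fam x h) \<mu> ()))"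
      using p(6)[OF st(1,2), of "()"] st(3) by (simp add: const_pf_def del: F_simps(3-) fam_simps)
    then show ?thesis using st by simp
  qed
qed

lemma pnt_famI:
  assumes X: "\<And>n. 0 < n ==> arr (x n) \<and> cod (x n) = FObj A n"
    and H: "\<And>\<mu>. \<mu> \<in> Arr simplex ==> iso C (h \<mu>) \<and> dom (h \<mu>) = pb_obj C (FArr A \<mu>) (x (sdom \<mu>)) \<and>
       cod (h \<mu>) = dom (x (scod \<mu>)) \<and>
       x (scod \<mu>) \<cdot> h \<mu> = pb_fst C (FArr A \<mu>) (x (sdom \<mu>))"
    and U: "\<And>n. 0 < n ==>
       h (Ident aug_simplex n) \<cdot> pb_pair C (Ident C (FObj A n)) (x n) (x n) (Ident C (dom (x n))) =
       Ident C (dom (x n))"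
    and CO: "\<And>\<mu> \<tau>. \<mu> \<in> Arr simplex ==> \<tau> \<in> Arr simplex ==> scod \<mu> = sdom \<tau> ==>
       h (\<tau> \<cdot>[aug_simplex] \<mu>) \<cdot> fst (snd (pf_comp F \<tau> \<mu> (x (sdom \<mu>)))) =
       Ident C (dom (x (scod \<tau>))) \<cdot>
         (h \<tau> \<cdot> fst (snd (FArr (base_change C (FArr A \<tau>))
         (pb_fst C (FArr A \<mu>) (x (sdom \<mu>)), h \<mu>, x (scod \<mu>)))))"
  shows "pnt (fam x h)"
  unfolding is_pnt_def
proof (intro conjI ballI impI)
  show "pn_fun (fam x h) \<in> extensional (Obj simplex)" "pn_cell (fam x h) \<in> extensional (Arr simplex)"
    by (simp_all add: fam_def del: simplex_simps)
next
  fix n assume "n \<in> Obj simplex"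
  then show "is_functor (pf_obj K n) (pf_obj F n) (pn_fun (fam x h) n)"
    "FObj (pn_fun (fam x h) n) \<in> extensional (Obj (pf_obj K n))"
    "FArr (pn_fun (fam x h) n) \<in> extensional (Arr (pf_obj K n))"
    using X[of n] unfolding is_functor_def by (simp_all add: const_pf_def extensional_def)
next
  fix \<mu> assume s: "\<mu> \<in> Arr simplex"
  show "pn_cell (fam x h) \<mu> \<in> extensional (Obj (pf_obj K (Dom simplex \<mu>)))"
    by (simp add: const_pf_def extensional_def)
  let ?m = "sdom \<mu>" and ?n = "scod \<mu>"
  have "pb_pair C (FArr A \<mu>) (x ?m) (pb_fst C (FArr A \<mu>) (x ?m))
      (Ident C (dom (x ?m)) \<cdot> pb_snd C (FArr A \<mu>) (x ?m)) =
      Ident C (pb_obj C (FArr A \<mu>) (x ?m))"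
    using X[of ?m] s by (rule_tac pb_eqI[OF C P, of "FArr A \<mu>" "x ?m"]) (simp_all add: pb_commute)
  then show "nat_iso (pf_obj K (Dom simplex \<mu>)) (pf_obj F (Cod simplex \<mu>))
         (comp_funct (pf_arr F \<mu>) (pn_fun (fam x h) (Dom simplex \<mu>)))
         (comp_funct (pn_fun (fam x h) (Cod simplex \<mu>)) (pf_arr K \<mu>))
         (pn_cell (fam x h) \<mu>)"
    unfolding nat_iso_def nat_trans_def
    using X[of ?m] X[of ?n] H[OF s] s by (simp add: const_pf_def comp_funct_def id_funct_def)
next
  fix n a assume "n \<in> Obj simplex"
  then show "pn_cell (fam x h) (Ident simplex n) a \<cdot>[pf_obj F n] pf_unit F n (FObj (pn_fun (fam x h) n) a) =
           FArr (pn_fun (fam x h) n) (pf_unit K n a)"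
    using X[of n] U[of n] by simp
next
  fix \<mu> \<tau> a assume "\<mu> \<in> Arr simplex" "\<tau> \<in> Arr simplex" "Cod simplex \<mu> = Dom simplex \<tau>"
  then show "pn_cell (fam x h) (\<tau> \<cdot>[simplex] \<mu>) a
             \<cdot>\<^bsub>pf_obj F (Cod simplex \<tau>)\<^esub> pf_comp F \<tau> \<mu> (FObj (pn_fun (fam x h) (Dom simplex \<mu>)) a) =
           FArr (pn_fun (fam x h) (Cod simplex \<tau>)) (pf_comp K \<tau> \<mu> a)
             \<cdot>\<^bsub>pf_obj F (Cod simplex \<tau>)\<^esub> (pn_cell (fam x h) \<tau> (FObj (pf_arr K \<mu>) a)
             \<cdot>\<^bsub>pf_obj F (Cod simplex \<tau>)\<^esub> FArr (pf_arr F \<tau>) (pn_cell (fam x h) \<mu> a))"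
    using CO[of \<mu> \<tau>] by simp
qed

text \<open>Extensionality leaves no freedom outside \<open>simplex\<close>, and inside it
  everything except x and h is forced.\<close>

lemma pnt_is_fam:
  assumes "pnt \<alpha>"
  obtains x h where "\<alpha> = fam x h"
proof -
  note p = is_pntD[OF assms]
  define x where "x n = FObj (pn_fun \<alpha> n) ()" for n
  define h where "h \<mu> = fst (snd (pn_cell \<alpha> \<mu> ()))" for \<mu>
  have "pn_fun \<alpha> n = pn_fun (fam x h) n" for n
  proof (cases "n > 0")
    case True
    then have f: "is_functor (pf_obj K n) (pf_obj F n) (pn_fun \<alpha> n)" using p(3)[of n] by simp
    from functor_simps(5)[OF this, of "()"] have "FArr (pn_fun \<alpha> n) () = (x n, Ident C (dom (x n)), x n)"
      by (simp add: const_pf_def x_def)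
    then show ?thesis using True by (simp add: fam_def fun_eq_iff x_def)
  next
    case False
    then show ?thesis using p(1) by (simp add: fam_def extensional_def)
  qed
  moreover have "pn_cell \<alpha> \<mu> = pn_cell (fam x h) \<mu>" for \<mu>
  proof (cases "\<mu> \<in> Arr simplex")
    case True
    then have "pn_cell \<alpha> \<mu> () \<in> hom (slice C (FObj A (scod \<mu>)))
        (pb_fst C (FArr A \<mu>) (x (sdom \<mu>))) (x (scod \<mu>))"
      using p(4)[OF True] unfolding nat_iso_def nat_trans_def
      by (simp add: const_pf_def x_def comp_funct_def id_funct_def)
    then show ?thesis using True by (cases "pn_cell \<alpha> \<mu> ()") (simp add: fun_eq_iff h_def)
  next
    case False
    then show ?thesis by (simp add: fam_def extensional_arb[OF p(2)] del: simplex_simps)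
  qed
  ultimately have "\<alpha> = fam x h" by (intro pnt.equality) auto
  then show ?thesis by (rule that)
qed

end

text \<open>A lift of the diagram along the codomain fibration that sends every \<mu> to a pullback
  square. The lifts u compose strictly, and this replaces the coherence conditions on isomorphisms
  between chosen pullbacks. Only positive n occur, since 0 is where the glued object is
  sought.\<close>

definition cart_family where
  "cart_family C A x u \<longleftrightarrow>
     (\<forall>n>0. x n \<in> Arr C \<and> Cod C (x n) = FObj A n) \<and>
     (\<forall>\<mu>\<in>Arr simplex.
        is_pullback C (FArr A \<mu>) (x (sdom \<mu>)) (x (scod \<mu>)) (u \<mu>)) \<and>
     (\<forall>n>0. u (Ident aug_simplex n) = Ident C (Dom C (x n))) \<and>
     (\<forall>\<mu>\<in>Arr simplex. \<forall>\<tau>\<in>Arr simplex. scod \<mu> = sdom \<tau> \<longrightarrow>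
        u (\<tau> \<cdot>[aug_simplex] \<mu>) = u \<mu> \<cdot>[C] u \<tau>)"

lemma cart_familyD:
  assumes "cart_family C A x u"
  shows "0 < n ==> x n \<in> Arr C" "0 < n ==> Cod C (x n) = FObj A n"
    and "\<mu> \<in> Arr simplex ==>
        is_pullback C (FArr A \<mu>) (x (sdom \<mu>)) (x (scod \<mu>)) (u \<mu>)"
    and "0 < n ==> u (Ident aug_simplex n) = Ident C (Dom C (x n))"
    and "\<mu> \<in> Arr simplex ==> \<tau> \<in> Arr simplex ==> scod \<mu> = sdom \<tau> ==>
        u (\<tau> \<cdot>[aug_simplex] \<mu>) = u \<mu> \<cdot>[C] u \<tau>"
  using assms unfolding cart_family_def by blast+

text \<open>The squares are arbitrary pullbacks and not the chosen ones, so that the notion survives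
  transport along isomorphisms and along functors preserving pullbacks.\<close>

definition pulled_back where
  "pulled_back C A z x v \<longleftrightarrow> z \<in> Arr C \<and> Cod C z = FObj A 0 \<and>
     (\<forall>n>0. is_pullback C (FArr A (from_zero n)) z (x n) (v n))"

text \<open>The comparison functor of the diagram \<open>A\<close> is fully faithful if and only if every \<open>z\<close> over \<open>A 0\<close>
  is, in the slice, the colimit of its pullbacks along the \<open>A (0 \<rightarrow> n)\<close> with \<open>0 < n\<close>.\<close>

definition colimit_cond where
  "colimit_cond C A \<longleftrightarrow> (\<forall>z x v w t. pulled_back C A z x v \<and> w \<in> Arr C \<and> Cod C w = FObj A 0 \<and>
     (\<forall>n>0. t n \<in> hom C (Dom C (x n)) (Dom C w) \<and> w \<cdot>[C] t n = z \<cdot>[C] v n) \<and>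
     (\<forall>\<mu>\<in>Arr simplex. \<forall>r\<in>hom C (Dom C (x (scod \<mu>))) (Dom C (x (sdom \<mu>))).
        x (sdom \<mu>) \<cdot>[C] r = FArr A \<mu> \<cdot>[C] x (scod \<mu>) \<and>
        v (sdom \<mu>) \<cdot>[C] r = v (scod \<mu>) \<longrightarrow>
        t (sdom \<mu>) \<cdot>[C] r = t (scod \<mu>)) \<longrightarrow>
     (\<exists>!k. k \<in> hom C (Dom C z) (Dom C w) \<and> w \<cdot>[C] k = z \<and> (\<forall>n>0. k \<cdot>[C] v n = t n)))"

text \<open>The equation on v says that z induces the given lifts u and not merely the objects x: it
  makes each u the canonical transition between pullbacks of z.\<close>

definition gluing_cond where
  "gluing_cond C A \<longleftrightarrow> (\<forall>x u. cart_family C A x u \<longrightarrow> (\<exists>z v. pulled_back C A z x v \<and>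
     (\<forall>\<mu>\<in>Arr simplex. v (sdom \<mu>) \<cdot>[C] u \<mu> = v (scod \<mu>))))"

context aug_diagram
begin

abbreviation cells where
  "cells x u h \<equiv> \<forall>\<mu>\<in>Arr simplex. arr (h \<mu>) \<and>
     dom (h \<mu>) = pb_obj C (FArr A \<mu>) (x (sdom \<mu>)) \<and>
     cod (h \<mu>) = dom (x (scod \<mu>)) \<and>
     x (scod \<mu>) \<cdot> h \<mu> = pb_fst C (FArr A \<mu>) (x (sdom \<mu>)) \<and>
     u \<mu> \<cdot> h \<mu> = pb_snd C (FArr A \<mu>) (x (sdom \<mu>))"

text \<open>The two encodings of descent data side by side: h starts at the chosen pullback, as a
  descent datum requires, and u is the second projection after the inverse of h. Over given x, each
  of them determines the other.\<close>

definition datum where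
  "datum x h u \<longleftrightarrow> cart_family C A x u \<and> cells x u h"

lemma cart_simps:
  assumes c: "cart_family C A x u"
  shows "\<mu> \<in> Arr simplex ==> arr (u \<mu>)"
    "\<mu> \<in> Arr simplex ==> dom (u \<mu>) = dom (x (scod \<mu>))"
    "\<mu> \<in> Arr simplex ==> cod (u \<mu>) = dom (x (sdom \<mu>))"
    "\<mu> \<in> Arr simplex ==> x (sdom \<mu>) \<cdot> u \<mu> = FArr A \<mu> \<cdot> x (scod \<mu>)"
  using pullback_simps[OF cart_familyD(3)[OF c]] by metis+

text \<open>The cell is the unique comparison from the chosen pullback to the pullback square of the
  family.\<close>

lemma cells_iso:
  assumes c: "cart_family C A x u" "cells x u h" and s: "\<mu> \<in> Arr simplex"
  shows "iso C (h \<mu>)"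
proof -
  note pb = cart_familyD(3)[OF c(1) s]
  let ?m = "sdom \<mu>"
  have xm: "arr (x ?m)" "cod (x ?m) = FObj A ?m" using s cart_familyD(1,2)[OF c(1)] by auto
  have cp: "is_pullback C (FArr A \<mu>) (x ?m) (pb_fst C (FArr A \<mu>) (x ?m)) (pb_snd C (FArr A \<mu>) (x ?m))"
    using s xm by (intro chosen_pullback) auto
  obtain i where i: "iso C i" "dom i = dom (pb_fst C (FArr A \<mu>) (x ?m))" "cod i = dom (x (scod \<mu>))"
      "x (scod \<mu>) \<cdot> i = pb_fst C (FArr A \<mu>) (x ?m)" "u \<mu> \<cdot> i = pb_snd C (FArr A \<mu>) (x ?m)"
    using pullback_compare[OF C pb cp] .
  have "h \<mu> = i" using c(2) s i xm by (rule_tac pullback_eqI[OF pb C]) auto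
  then show ?thesis using i by simp
qed

lemma cells_exist:
  assumes c: "cart_family C A x u"
  obtains h where "cells x u h"
proof -
  have "\<exists>h. arr h \<and>
     dom h = pb_obj C (FArr A \<mu>) (x (sdom \<mu>)) \<and>
     cod h = dom (x (scod \<mu>)) \<and>
     x (scod \<mu>) \<cdot> h = pb_fst C (FArr A \<mu>) (x (sdom \<mu>)) \<and>
     u \<mu> \<cdot> h = pb_snd C (FArr A \<mu>) (x (sdom \<mu>))" if s: "\<mu> \<in> Arr simplex" for \<mu>
  proof -
    note pb = cart_familyD(3)[OF c s]
    let ?m = "sdom \<mu>"
    have xm: "arr (x ?m)" "cod (x ?m) = FObj A ?m" using s cart_familyD(1,2)[OF c] by auto
    have cp: "is_pullback C (FArr A \<mu>) (x ?m) (pb_fst C (FArr A \<mu>) (x ?m)) (pb_snd C (FArr A \<mu>) (x ?m))"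
      using s xm by (intro chosen_pullback) auto
    obtain i where "iso C i" "dom i = dom (pb_fst C (FArr A \<mu>) (x ?m))" "cod i = dom (x (scod \<mu>))"
        "x (scod \<mu>) \<cdot> i = pb_fst C (FArr A \<mu>) (x ?m)" "u \<mu> \<cdot> i = pb_snd C (FArr A \<mu>) (x ?m)"
      using pullback_compare[OF C pb cp] .
    then show ?thesis using xm s by (intro exI[of _ i]) auto
  qed
  then show ?thesis using that by metis
qed

text \<open>The outer square of two pasted chosen pullbacks; the compositor is the mediating arrow
  that it induces.\<close>

lemma compositor_lift:
  assumes "\<mu> \<in> Arr aug_simplex" "\<tau> \<in> Arr aug_simplex" "scod \<mu> = sdom \<tau>"
    and "arr x" "cod x = FObj A (sdom \<mu>)"
  shows "FArr A \<mu> \<cdot> (FArr A \<tau> \<cdot> pb_fst C (FArr A \<tau>) (pb_fst C (FArr A \<mu>) x)) =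
    x \<cdot> (pb_snd C (FArr A \<mu>) x \<cdot> pb_snd C (FArr A \<tau>) (pb_fst C (FArr A \<mu>) x))"
  using assms by (simp add: pb_commute[OF P, of "FArr A \<tau>"] extend[OF pb_commute[OF P, of "FArr A \<mu>" x] C])

text \<open>Both coherence laws are equations between arrows into the apex of a pullback, so they
  can be checked after x and after u. After x they compare projections of chosen pullbacks; after u
  they become the preservation of identities and composites by u.\<close>

lemma datum_pnt:
  assumes d: "datum x h u"
  shows "pnt (fam x h)"
proof -
  have c: "cart_family C A x u" and cl: "cells x u h" using d unfolding datum_def by blast+
  note [simp] = cart_familyD(1,2)[OF c] cart_simps(1-3)[OF c]
  show ?thesis
  proof (rule pnt_famI)
    fix n :: nat assume n: "0 < n"
    show "arr (x n) \<and> cod (x n) = FObj A n" using n by simp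
    have s: "Ident aug_simplex n \<in> Arr simplex" "sdom (Ident aug_simplex n) = n"
      "scod (Ident aug_simplex n) = n" using n by simp_all
    note pb = cart_familyD(3)[OF c s(1), unfolded s(2,3)]
    have hh: "arr (h (Ident aug_simplex n))" "dom (h (Ident aug_simplex n)) = pb_obj C (Ident C (FObj A n)) (x n)"
      "cod (h (Ident aug_simplex n)) = dom (x n)"
      "x n \<cdot> h (Ident aug_simplex n) = pb_fst C (Ident C (FObj A n)) (x n)"
      "u (Ident aug_simplex n) \<cdot> h (Ident aug_simplex n) = pb_snd C (Ident C (FObj A n)) (x n)"
      using bspec[OF cl s(1)] s by simp_all
    show "h (Ident aug_simplex n) \<cdot> pb_pair C (Ident C (FObj A n)) (x n) (x n) (Ident C (dom (x n))) =
         Ident C (dom (x n))"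
      using n hh(1-3) extend[OF hh(4) C] extend[OF hh(5) C] cart_familyD(4)[OF c n]
      by (rule_tac pullback_eqI[OF pb C]) simp_all
  next
    fix \<mu> assume s: "\<mu> \<in> Arr simplex"
    then show "iso C (h \<mu>) \<and> dom (h \<mu>) = pb_obj C (FArr A \<mu>) (x (sdom \<mu>)) \<and>
       cod (h \<mu>) = dom (x (scod \<mu>)) \<and>
       x (scod \<mu>) \<cdot> h \<mu> = pb_fst C (FArr A \<mu>) (x (sdom \<mu>))"
      using cl cells_iso[OF c cl s] by blast
  next
    fix \<mu> \<tau> assume st: "\<mu> \<in> Arr simplex" "\<tau> \<in> Arr simplex" "scod \<mu> = sdom \<tau>"
    let ?k = "sdom \<mu>" and ?m = "sdom \<tau>" and ?n = "scod \<tau>"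
    let ?ts = "\<tau> \<cdot>[aug_simplex] \<mu>"
    have ts: "?ts \<in> Arr simplex" "sdom ?ts = ?k" "scod ?ts = ?n" using st by simp_all
    note pb = cart_familyD(3)[OF c ts(1), unfolded ts(2,3)]
    have h\<mu>: "arr (h \<mu>)" "dom (h \<mu>) = pb_obj C (FArr A \<mu>) (x ?k)" "cod (h \<mu>) = dom (x ?m)"
      "x ?m \<cdot> h \<mu> = pb_fst C (FArr A \<mu>) (x ?k)" "u \<mu> \<cdot> h \<mu> = pb_snd C (FArr A \<mu>) (x ?k)"
      using bspec[OF cl st(1)] st(3) by simp_all
    have h\<tau>: "arr (h \<tau>)" "dom (h \<tau>) = pb_obj C (FArr A \<tau>) (x ?m)" "cod (h \<tau>) = dom (x ?n)"
      "x ?n \<cdot> h \<tau> = pb_fst C (FArr A \<tau>) (x ?m)" "u \<tau> \<cdot> h \<tau> = pb_snd C (FArr A \<tau>) (x ?m)"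
      using bspec[OF cl st(2)] by simp_all
    have hts: "arr (h ?ts)" "dom (h ?ts) = pb_obj C (FArr A \<mu> \<cdot> FArr A \<tau>) (x ?k)" "cod (h ?ts) = dom (x ?n)"
      "x ?n \<cdot> h ?ts = pb_fst C (FArr A \<mu> \<cdot> FArr A \<tau>) (x ?k)" "u ?ts \<cdot> h ?ts = pb_snd C (FArr A \<mu> \<cdot> FArr A \<tau>) (x ?k)"
      using bspec[OF cl ts(1)] st by simp_all
    note u\<mu>\<tau> = cart_familyD(5)[OF c st]
    have lift: "FArr A \<tau> \<cdot> pb_fst C (FArr A \<tau>) (pb_fst C (FArr A \<mu>) (x ?k)) =
        x ?m \<cdot> (h \<mu> \<cdot> pb_snd C (FArr A \<tau>) (pb_fst C (FArr A \<mu>) (x ?k)))"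
      using st h\<mu> by (intro base_change_lift[OF C P]) simp_all
    note lift' = compositor_lift[of \<mu> \<tau> "x ?k"]
    let ?b = "pb_pair C (FArr A \<tau>) (x ?m) (pb_fst C (FArr A \<tau>) (pb_fst C (FArr A \<mu>) (x ?k)))
       (h \<mu> \<cdot> pb_snd C (FArr A \<tau>) (pb_fst C (FArr A \<mu>) (x ?k)))"
    show "h ?ts \<cdot> fst (snd (pf_comp F \<tau> \<mu> (x ?k))) =
       Ident C (dom (x ?n)) \<cdot> (h \<tau> \<cdot> fst (snd (FArr (base_change C (FArr A \<tau>))
         (pb_fst C (FArr A \<mu>) (x ?k), h \<mu>, x (scod \<mu>)))))"
    proof (rule pullback_eqI[OF pb C])
      show "x ?n \<cdot> (h ?ts \<cdot> fst (snd (pf_comp F \<tau> \<mu> (x ?k)))) =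
        x ?n \<cdot> (Ident C (dom (x ?n)) \<cdot> (h \<tau> \<cdot> fst (snd (FArr (base_change C (FArr A \<tau>))
         (pb_fst C (FArr A \<mu>) (x ?k), h \<mu>, x (scod \<mu>))))))"
        using st h\<mu>(1-3) h\<tau>(1-3) hts(1-3) lift lift' by (simp add: extend[OF h\<tau>(4) C] extend[OF hts(4) C])
      show "u ?ts \<cdot> (h ?ts \<cdot> fst (snd (pf_comp F \<tau> \<mu> (x ?k)))) =
        u ?ts \<cdot> (Ident C (dom (x ?n)) \<cdot> (h \<tau> \<cdot> fst (snd (FArr (base_change C (FArr A \<tau>))
         (pb_fst C (FArr A \<mu>) (x ?k), h \<mu>, x (scod \<mu>))))))"
      proof -
        have "u ?ts \<cdot> (h ?ts \<cdot> fst (snd (pf_comp F \<tau> \<mu> (x ?k)))) =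
          pb_snd C (FArr A \<mu>) (x ?k) \<cdot> pb_snd C (FArr A \<tau>) (pb_fst C (FArr A \<mu>) (x ?k))"
          using st ts hts(1-3) lift' by (simp add: extend[OF hts(5) C])
        also have "\<dots> = u \<mu> \<cdot> (u \<tau> \<cdot> (h \<tau> \<cdot> ?b))"
          using st h\<mu>(1-3) h\<tau>(1-3) lift
          by (simp add: extend[OF h\<tau>(5) C] extend[OF h\<mu>(5) C])
        also have "\<dots> = u ?ts \<cdot> (h \<tau> \<cdot> ?b)"
          using st h\<tau>(1-3) h\<mu>(1-3) lift unfolding u\<mu>\<tau> by simp
        finally show ?thesis using st h\<tau>(1-3) h\<mu>(1-3) lift by simp
      qed
    qed (use st ts h\<mu>(1-3) h\<tau>(1-3) hts(1-3) lift lift' in simp_all)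
  qed
qed

text \<open>The inverse of a cell turns the second projection of the chosen pullback into a lift u.
  The unit law of the transformation gives its behaviour on identities, the cocycle law its
  behaviour on composites.\<close>

lemma pnt_datum:
  assumes p: "pnt (fam x h)"
  obtains u where "datum x h u"
proof -
  note X = pnt_famD(1)[OF p] and H = pnt_famD(2)[OF p] and U = pnt_famD(3)[OF p] and CO = pnt_famD(4)[OF p]
  have [simp]: "arr (x n)" "cod (x n) = FObj A n" if "0 < n" for n using X that by auto
  have "\<exists>j. arr j \<and> dom j = cod (h \<mu>) \<and> cod j = dom (h \<mu>) \<and>
    j \<cdot> h \<mu> = Ident C (dom (h \<mu>)) \<and> h \<mu> \<cdot> j = Ident C (cod (h \<mu>))" if "\<mu> \<in> Arr simplex" for \<mu>
    using H[OF that] isoD[OF C, of "h \<mu>"] by metis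
  then obtain j where j: "\<And>\<mu>. \<mu> \<in> Arr simplex ==> arr (j \<mu>) \<and> dom (j \<mu>) = cod (h \<mu>) \<and> cod (j \<mu>) = dom (h \<mu>) \<and>
    j \<mu> \<cdot> h \<mu> = Ident C (dom (h \<mu>)) \<and> h \<mu> \<cdot> j \<mu> = Ident C (cod (h \<mu>))" by metis
  define u where "u \<mu> = pb_snd C (FArr A \<mu>) (x (sdom \<mu>)) \<cdot> j \<mu>" for \<mu>
  have uh: "arr (u \<mu>)" "dom (u \<mu>) = dom (x (scod \<mu>))" "cod (u \<mu>) = dom (x (sdom \<mu>))"
    "u \<mu> \<cdot> h \<mu> = pb_snd C (FArr A \<mu>) (x (sdom \<mu>))" if s: "\<mu> \<in> Arr simplex" for \<mu>
    using j[OF s] H[OF s] s by (simp_all add: u_def)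
  have cl: "cells x u h" using H uh by auto
  have "cart_family C A x u"
    unfolding cart_family_def
  proof (intro conjI allI impI ballI)
    fix \<mu> assume s: "\<mu> \<in> Arr simplex"
    let ?m = "sdom \<mu>"
    have ij: "iso C (j \<mu>)" using j[OF s] H[OF s] by (intro isoI[where g = "h \<mu>"]) auto
    have "is_pullback C (FArr A \<mu>) (x ?m) (pb_fst C (FArr A \<mu>) (x ?m) \<cdot> j \<mu>) (pb_snd C (FArr A \<mu>) (x ?m) \<cdot> j \<mu>)"
      using s ij j[OF s] H[OF s] by (intro pullback_iso_left[OF C chosen_pullback]) simp_all
    moreover have "pb_fst C (FArr A \<mu>) (x ?m) \<cdot> j \<mu> = x (scod \<mu>)"
    proof -
      have "pb_fst C (FArr A \<mu>) (x ?m) \<cdot> j \<mu> = (x (scod \<mu>) \<cdot> h \<mu>) \<cdot> j \<mu>"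
        using H[OF s] by simp
      also have "\<dots> = x (scod \<mu>) \<cdot> (h \<mu> \<cdot> j \<mu>)"
        using s j[OF s] H[OF s] by (intro comp_assoc[OF C]) simp_all
      also have "\<dots> = x (scod \<mu>)" using s j[OF s] H[OF s] by simp
      finally show ?thesis .
    qed
    ultimately show "is_pullback C (FArr A \<mu>) (x ?m) (x (scod \<mu>)) (u \<mu>)" by (simp add: u_def)
  next
    fix n :: nat assume n: "0 < n"
    have s: "Ident aug_simplex n \<in> Arr simplex" "sdom (Ident aug_simplex n) = n"
      "scod (Ident aug_simplex n) = n" using n by simp_all
    have hn: "arr (h (Ident aug_simplex n))" "dom (h (Ident aug_simplex n)) = pb_obj C (Ident C (FObj A n)) (x n)"
      "cod (h (Ident aug_simplex n)) = dom (x n)" using H[OF s(1)] s by simp_all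
    have "u (Ident aug_simplex n) = u (Ident aug_simplex n) \<cdot>
        (h (Ident aug_simplex n) \<cdot> pb_pair C (Ident C (FObj A n)) (x n) (x n) (Ident C (dom (x n))))"
      using U[OF n] uh(1-3)[OF s(1)] s by simp
    also have "\<dots> = Ident C (dom (x n))"
      using uh(1-3)[OF s(1)] s hn n by (simp add: extend[OF uh(4)[OF s(1)] C])
    finally show "u (Ident aug_simplex n) = Ident C (dom (x n))" .
  next
    fix \<mu> \<tau> assume st: "\<mu> \<in> Arr simplex" "\<tau> \<in> Arr simplex" "scod \<mu> = sdom \<tau>"
    let ?k = "sdom \<mu>" and ?m = "sdom \<tau>" and ?n = "scod \<tau>"
    let ?ts = "\<tau> \<cdot>[aug_simplex] \<mu>"
    have ts: "?ts \<in> Arr simplex" "sdom ?ts = ?k" "scod ?ts = ?n" using st by simp_all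
    have h\<mu>: "arr (h \<mu>)" "dom (h \<mu>) = pb_obj C (FArr A \<mu>) (x ?k)" "cod (h \<mu>) = dom (x ?m)"
      "x ?m \<cdot> h \<mu> = pb_fst C (FArr A \<mu>) (x ?k)" "iso C (h \<mu>)"
      using H[OF st(1)] st(3) by simp_all
    have h\<tau>: "arr (h \<tau>)" "dom (h \<tau>) = pb_obj C (FArr A \<tau>) (x ?m)" "cod (h \<tau>) = dom (x ?n)" "iso C (h \<tau>)"
      using H[OF st(2)] by simp_all
    have hts: "arr (h ?ts)" "dom (h ?ts) = pb_obj C (FArr A \<mu> \<cdot> FArr A \<tau>) (x ?k)" "cod (h ?ts) = dom (x ?n)"
      using H[OF ts(1)] st by simp_all
    let ?b = "pb_pair C (FArr A \<tau>) (x ?m) (pb_fst C (FArr A \<tau>) (pb_fst C (FArr A \<mu>) (x ?k)))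
       (h \<mu> \<cdot> pb_snd C (FArr A \<tau>) (pb_fst C (FArr A \<mu>) (x ?k)))"
    let ?c = "fst (snd (pf_comp F \<tau> \<mu> (x ?k)))"
    have lift: "FArr A \<tau> \<cdot> pb_fst C (FArr A \<tau>) (pb_fst C (FArr A \<mu>) (x ?k)) =
        x ?m \<cdot> (h \<mu> \<cdot> pb_snd C (FArr A \<tau>) (pb_fst C (FArr A \<mu>) (x ?k)))"
      using st h\<mu> by (intro base_change_lift[OF C P]) simp_all
    note lift' = compositor_lift[of \<mu> \<tau> "x ?k"]
    have "iso (slice C (FObj A ?n)) (FArr (base_change C (FArr A \<tau>)) (pb_fst C (FArr A \<mu>) (x ?k), h \<mu>, x ?m))"
      using st h\<mu> by (intro functor_iso[OF base_change_functor[of C "FArr A \<tau>" "FObj A ?m"]]) simp_all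
    then have b: "iso C ?b" "arr ?b" "dom ?b = pb_obj C (FArr A \<tau>) (pb_fst C (FArr A \<mu>) (x ?k))"
        "cod ?b = pb_obj C (FArr A \<tau>) (x ?m)"
      "pb_snd C (FArr A \<tau>) (x ?m) \<cdot> ?b = h \<mu> \<cdot> pb_snd C (FArr A \<tau>) (pb_fst C (FArr A \<mu>) (x ?k))"
      using st h\<mu> lift by simp_all
    \<comment> \<open>Functoriality of u is tested after this isomorphism, because there the cocycle
      law \<open>co\<close> turns both sides into composites of second projections of chosen
      pullbacks.\<close>
    have hb: "iso C (h \<tau> \<cdot> ?b)" using h\<tau> b by (intro iso_comp[OF C]) simp_all
    have co: "h ?ts \<cdot> ?c = h \<tau> \<cdot> ?b" using CO[OF st] st h\<tau> b(2-4) by simp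
    have c: "arr ?c" "dom ?c = pb_obj C (FArr A \<tau>) (pb_fst C (FArr A \<mu>) (x ?k))"
        "cod ?c = pb_obj C (FArr A \<mu> \<cdot> FArr A \<tau>) (x ?k)"
       "pb_snd C (FArr A \<mu> \<cdot> FArr A \<tau>) (x ?k) \<cdot> ?c =
         pb_snd C (FArr A \<mu>) (x ?k) \<cdot> pb_snd C (FArr A \<tau>) (pb_fst C (FArr A \<mu>) (x ?k))"
      using st lift' by simp_all
    have uts: "u ?ts \<cdot> h ?ts = pb_snd C (FArr A \<mu> \<cdot> FArr A \<tau>) (x ?k)"
      "arr (u ?ts)" "dom (u ?ts) = dom (x ?n)" "cod (u ?ts) = dom (x ?k)"
      using uh[OF ts(1)] st by simp_all
    have "u ?ts \<cdot> (h \<tau> \<cdot> ?b) = u ?ts \<cdot> (h ?ts \<cdot> ?c)" using co by simp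
    also have "\<dots> = pb_snd C (FArr A \<mu>) (x ?k) \<cdot> pb_snd C (FArr A \<tau>) (pb_fst C (FArr A \<mu>) (x ?k))"
      using extend[OF uts(1) C hts(1) uts(2) _ c(1)] uts hts c by (simp del: F_simps)
    also have "\<dots> = u \<mu> \<cdot> (u \<tau> \<cdot> (h \<tau> \<cdot> ?b))"
      using st uh(1-3)[OF st(1)] uh(1-3)[OF st(2)] h\<tau>(1-3) h\<mu>(1-3) b(2-5) lift
      by (simp add: extend[OF uh(4)[OF st(1)] C] extend[OF uh(4)[OF st(2)] C])
    finally have e: "u ?ts \<cdot> (h \<tau> \<cdot> ?b) = (u \<mu> \<cdot> u \<tau>) \<cdot> (h \<tau> \<cdot> ?b)"
      using st uh(1-3)[OF st(1)] uh(1-3)[OF st(2)] h\<tau>(1-3) b(2-4) by simp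
    show "u ?ts = u \<mu> \<cdot> u \<tau>"
      by (rule iso_cancel_right[OF C hb _ _ _ _ e])
        (use st uh(1-3)[OF st(1)] uh(1-3)[OF st(2)] h\<tau>(1-3) b(2-4) uts in simp_all)
  qed auto
  with cl show ?thesis using that unfolding datum_def by blast
qed

section \<open>The descent category in terms of cartesian families\<close>

abbreviation DC where
  "DC \<equiv> pnt_cat simplex K F"

definition mor :: "(nat \<Rightarrow> 'm) \<Rightarrow> (nat \<Rightarrow> 'm) \<Rightarrow> (nat \<Rightarrow> 'm) \<Rightarrow> nat \<Rightarrow> unit \<Rightarrow> 'm \<times> 'm \<times> 'm" where
  "mor x g y = (\<lambda>n\<in>Obj simplex. \<lambda>_. (x n, g n, y n))"

lemma mor_apply [simp]: "0 < n ==> mor x g y n a = (x n, g n, y n)"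
  by (simp add: mor_def)

lemma mor_inject: "mor x g y = mor x' g' y' \<longleftrightarrow> (\<forall>n>0. x n = x' n \<and> g n = g' n \<and> y n = y' n)"
  by (auto simp: mor_def fun_eq_iff restrict_def)

text \<open>Modifications freed from the chosen pullbacks: the naturality condition at \<mu> refers
  only to the lifts u and w.\<close>

definition hom_fam where
  "hom_fam x u y w g \<longleftrightarrow> (\<forall>n>0. arr (g n) \<and> dom (g n) = dom (x n) \<and> cod (g n) = dom (y n) \<and>
       y n \<cdot> g n = x n) \<and>
     (\<forall>\<mu>\<in>Arr simplex. w \<mu> \<cdot> g (scod \<mu>) = g (sdom \<mu>) \<cdot> u \<mu>)"

lemma datumD:
  assumes "datum x h u"
  shows "cart_family C A x u" "cells x u h"
  using assms unfolding datum_def by blast+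

text \<open>The modification law and compatibility with the lifts differ by the cells. In one
  direction the isomorphism \<open>h \<mu>\<close> is cancelled; in the other the equation is tested
  against the jointly monic pair y, w of a pullback square.\<close>

lemma modif_mor_iff:
  assumes d: "datum x h u" and e: "datum y k w"
  shows "is_modif simplex K F (fam x h) (fam y k) (mor x g y) \<longleftrightarrow> hom_fam x u y w g"
proof -
  note dx = datumD[OF d] and dy = datumD[OF e]
  note [simp] = cart_familyD(1,2)[OF dx(1)] cart_simps(1-3)[OF dx(1)] cart_familyD(1,2)[OF dy(1)] cart_simps(1-3)[OF dy(1)]
  let ?G = "\<forall>n>0. arr (g n) \<and> dom (g n) = dom (x n) \<and> cod (g n) = dom (y n) \<and> y n \<cdot> g n = x n"
  have 1: "is_modif simplex K F (fam x h) (fam y k) (mor x g y) \<longleftrightarrow> ?G \<and>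
     (\<forall>\<mu>\<in>Arr simplex. k \<mu> \<cdot> pb_pair C (FArr A \<mu>) (y (sdom \<mu>)) (pb_fst C (FArr A \<mu>) (x (sdom \<mu>)))
          (g (sdom \<mu>) \<cdot> pb_snd C (FArr A \<mu>) (x (sdom \<mu>))) =
        g (scod \<mu>) \<cdot> h \<mu>)" (is "?M \<longleftrightarrow> ?G \<and> ?E")
  proof
    assume M: ?M
    have G: ?G
    proof (intro allI impI)
      fix n :: nat assume n: "0 < n"
      have "nat_trans (pf_obj K n) (pf_obj F n) (pn_fun (fam x h) n) (pn_fun (fam y k) n) (mor x g y n)"
        using M n unfolding is_modif_def by simp
      then have "mor x g y n () \<in> hom (slice C (FObj A n)) (x n) (y n)"
        using n unfolding nat_trans_def by (simp add: const_pf_def)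
      then show "arr (g n) \<and> dom (g n) = dom (x n) \<and> cod (g n) = dom (y n) \<and> y n \<cdot> g n = x n"
        using n by simp
    qed
    have ?E
    proof
      fix \<mu> assume s: "\<mu> \<in> Arr simplex"
      have "pn_cell (fam y k) \<mu> () \<cdot>\<^bsub>pf_obj F (Cod simplex \<mu>)\<^esub> FArr (pf_arr F \<mu>) (mor x g y (Dom simplex \<mu>) ()) =
        mor x g y (Cod simplex \<mu>) (FObj (pf_arr K \<mu>) ()) \<cdot>\<^bsub>pf_obj F (Cod simplex \<mu>)\<^esub> pn_cell (fam x h) \<mu> ()"
        using M s unfolding is_modif_def by (simp add: const_pf_def del: F_simps fam_simps simplex_simps mor_apply)
      then show "k \<mu> \<cdot> pb_pair C (FArr A \<mu>) (y (sdom \<mu>)) (pb_fst C (FArr A \<mu>) (x (sdom \<mu>)))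
          (g (sdom \<mu>) \<cdot> pb_snd C (FArr A \<mu>) (x (sdom \<mu>))) =
        g (scod \<mu>) \<cdot> h \<mu>" using s by simp
    qed
    with G show "?G \<and> ?E" by blast
  next
    assume GE: "?G \<and> ?E"
    show ?M
      unfolding is_modif_def nat_trans_def
    proof (intro conjI ballI)
      show "mor x g y \<in> extensional (Obj simplex)" by (simp add: mor_def)
    next
      fix n assume n: "n \<in> Obj simplex"
      show "mor x g y n \<in> extensional (Obj (pf_obj K n))" by (simp add: const_pf_def extensional_def)
      show "mor x g y n a \<in> hom (pf_obj F n) (FObj (pn_fun (fam x h) n) a) (FObj (pn_fun (fam y k) n) a)" for a
        using GE n by simp
      show "mor x g y n (Cod (pf_obj K n) f) \<cdot>[pf_obj F n] FArr (pn_fun (fam x h) n) f =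
        FArr (pn_fun (fam y k) n) f \<cdot>[pf_obj F n] mor x g y n (Dom (pf_obj K n) f)" for f
        using GE n by simp
    next
      fix \<mu> a assume "\<mu> \<in> Arr simplex"
      then show "pn_cell (fam y k) \<mu> a \<cdot>\<^bsub>pf_obj F (Cod simplex \<mu>)\<^esub> FArr (pf_arr F \<mu>) (mor x g y (Dom simplex \<mu>) a) =
       mor x g y (Cod simplex \<mu>) (FObj (pf_arr K \<mu>) a) \<cdot>\<^bsub>pf_obj F (Cod simplex \<mu>)\<^esub> pn_cell (fam x h) \<mu> a"
        using GE by simp
    qed
  qed
  have 2: "k \<mu> \<cdot> pb_pair C (FArr A \<mu>) (y (sdom \<mu>)) (pb_fst C (FArr A \<mu>) (x (sdom \<mu>)))
          (g (sdom \<mu>) \<cdot> pb_snd C (FArr A \<mu>) (x (sdom \<mu>))) =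
        g (scod \<mu>) \<cdot> h \<mu> \<longleftrightarrow>
      w \<mu> \<cdot> g (scod \<mu>) = g (sdom \<mu>) \<cdot> u \<mu>"
    if G: ?G and s: "\<mu> \<in> Arr simplex" for \<mu>
  proof -
    let ?m = "sdom \<mu>" and ?n = "scod \<mu>"
    let ?Q = "pb_pair C (FArr A \<mu>) (y ?m) (pb_fst C (FArr A \<mu>) (x ?m)) (g ?m \<cdot> pb_snd C (FArr A \<mu>) (x ?m))"
    have s': "\<mu> \<in> Arr aug_simplex" "0 < ?m" "0 < ?n" using s by simp_all
    have gm: "arr (g ?m)" "dom (g ?m) = dom (x ?m)" "cod (g ?m) = dom (y ?m)" "y ?m \<cdot> g ?m = x ?m"
      using G s' by blast+
    have gn: "arr (g ?n)" "dom (g ?n) = dom (x ?n)" "cod (g ?n) = dom (y ?n)" "y ?n \<cdot> g ?n = x ?n"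
      using G s' by blast+
    have hs: "arr (h \<mu>)" "dom (h \<mu>) = pb_obj C (FArr A \<mu>) (x ?m)" "cod (h \<mu>) = dom (x ?n)"
      "x ?n \<cdot> h \<mu> = pb_fst C (FArr A \<mu>) (x ?m)" "u \<mu> \<cdot> h \<mu> = pb_snd C (FArr A \<mu>) (x ?m)"
      using bspec[OF dx(2) s] by simp_all
    have ks: "arr (k \<mu>)" "dom (k \<mu>) = pb_obj C (FArr A \<mu>) (y ?m)" "cod (k \<mu>) = dom (y ?n)"
      "y ?n \<cdot> k \<mu> = pb_fst C (FArr A \<mu>) (y ?m)" "w \<mu> \<cdot> k \<mu> = pb_snd C (FArr A \<mu>) (y ?m)"
      using bspec[OF dy(2) s] by simp_all
    have Q: "arr ?Q" "dom ?Q = pb_obj C (FArr A \<mu>) (x ?m)" "cod ?Q = pb_obj C (FArr A \<mu>) (y ?m)"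
        "pb_fst C (FArr A \<mu>) (y ?m) \<cdot> ?Q = pb_fst C (FArr A \<mu>) (x ?m)"
        "pb_snd C (FArr A \<mu>) (y ?m) \<cdot> ?Q = g ?m \<cdot> pb_snd C (FArr A \<mu>) (x ?m)"
      using s' gm base_change_lift[OF C P, of "FArr A \<mu>" "x ?m" "g ?m" "y ?m"] by simp_all
    have wkQ: "w \<mu> \<cdot> (k \<mu> \<cdot> ?Q) = (g ?m \<cdot> u \<mu>) \<cdot> h \<mu>"
    proof -
      have "w \<mu> \<cdot> (k \<mu> \<cdot> ?Q) = pb_snd C (FArr A \<mu>) (y ?m) \<cdot> ?Q"
        by (rule extend[OF ks(5) C]) (use s s' ks(1-3) Q(1-3) in simp_all)
      also have "\<dots> = g ?m \<cdot> (u \<mu> \<cdot> h \<mu>)" unfolding Q(5) hs(5) ..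
      finally show ?thesis using s s' gm(1-3) hs(1-3) by simp
    qed
    show ?thesis
    proof
      assume "k \<mu> \<cdot> ?Q = g ?n \<cdot> h \<mu>"
      then have "(w \<mu> \<cdot> g ?n) \<cdot> h \<mu> = (g ?m \<cdot> u \<mu>) \<cdot> h \<mu>"
        using wkQ s s' gn hs by simp
      then show "w \<mu> \<cdot> g ?n = g ?m \<cdot> u \<mu>"
        using s s' gn(1-3) gm(1-3) hs(1-3)
        by (rule_tac iso_cancel_right[OF C cells_iso[OF dx s]]) simp_all
    next
      assume *: "w \<mu> \<cdot> g ?n = g ?m \<cdot> u \<mu>"
      note pb = cart_familyD(3)[OF dy(1) s]
      show "k \<mu> \<cdot> ?Q = g ?n \<cdot> h \<mu>"
      proof (rule pullback_eqI[OF pb C])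
        show "y ?n \<cdot> (k \<mu> \<cdot> ?Q) = y ?n \<cdot> (g ?n \<cdot> h \<mu>)"
          using s s' gn(1-3) hs(1-4) ks(1-3) Q(1-4) by (simp add: extend[OF ks(4) C] extend[OF gn(4) C])
        show "w \<mu> \<cdot> (k \<mu> \<cdot> ?Q) = w \<mu> \<cdot> (g ?n \<cdot> h \<mu>)"
          unfolding wkQ using s s' gn(1-3) gm(1-3) hs(1-3) by (simp add: extend[OF * C])
      qed (use s s' gn(1-3) hs(1-3) ks(1-3) Q(1-3) in simp_all)
    qed
  qed
  show ?thesis unfolding 1 hom_fam_def using 2 by (auto simp del: simplex_simps)
qed

lemma modif_is_mor:
  assumes "is_modif simplex K F (fam x h) (fam y k) \<Gamma>"
  obtains g where "\<Gamma> = mor x g y"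
proof -
  define g where "g n = fst (snd (\<Gamma> n ()))" for n
  have "\<Gamma> n = mor x g y n" for n
  proof (cases "n > 0")
    case True
    then have "nat_trans (pf_obj K n) (pf_obj F n) (pn_fun (fam x h) n) (pn_fun (fam y k) n) (\<Gamma> n)"
      using assms unfolding is_modif_def by simp
    then have "\<Gamma> n () \<in> hom (slice C (FObj A n)) (x n) (y n)"
      using True unfolding nat_trans_def by (simp add: const_pf_def)
    then show ?thesis using True by (cases "\<Gamma> n ()") (simp add: g_def fun_eq_iff mor_def)
  next
    case False
    have "\<Gamma> \<in> extensional (Obj simplex)" using assms unfolding is_modif_def by blast
    then show ?thesis using False by (simp add: extensional_def mor_def)
  qed
  then show ?thesis using that by blast
qed

lemma DC_obj: "\<alpha> \<in> Obj DC \<longleftrightarrow> (\<exists>x h u. \<alpha> = fam x h \<and> datum x h u)"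
  unfolding pnt_cat_def using pnt_is_fam pnt_datum datum_pnt by (simp, metis)

lemma DC_arrI:
  assumes "datum x h u" "datum y k w" "hom_fam x u y w g"
  shows "(fam x h, mor x g y, fam y k) \<in> Arr DC"
  using assms modif_mor_iff[OF assms(1,2)] datum_pnt by (simp add: pnt_cat_def)

lemma DC_arrE:
  assumes "f \<in> Arr DC"
  obtains x h u y k w g where "datum x h u" "datum y k w" "hom_fam x u y w g" "f = (fam x h, mor x g y, fam y k)"
proof -
  obtain \<alpha> \<Gamma> \<beta> where f: "f = (\<alpha>, \<Gamma>, \<beta>)" "pnt \<alpha>" "pnt \<beta>" "is_modif simplex K F \<alpha> \<beta> \<Gamma>"
    using assms by (auto simp: pnt_cat_def)
  obtain x h where x: "\<alpha> = fam x h" using pnt_is_fam f(2) by blast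
  obtain y k where y: "\<beta> = fam y k" using pnt_is_fam f(3) by blast
  obtain u where u: "datum x h u" using pnt_datum f(2) x by blast
  obtain w where w: "datum y k w" using pnt_datum f(3) y by blast
  obtain g where g: "\<Gamma> = mor x g y" using modif_is_mor f(4) x y by blast
  have "hom_fam x u y w g" using modif_mor_iff[OF u w] f(4) x y g by simp
  then show ?thesis using that u w f(1) x y g by blast
qed

text \<open>The objects and arrows of the descent category are those of the form \<open>fam x h\<close> and
  \<open>mor x g y\<close>; the components at positive \<open>n\<close> of \<open>x\<close> are determined by \<open>fam x h\<close>.\<close>

lemma fam_eqD: "fam x h = fam x' h' ==> 0 < n ==> x n = x' n"
  using fam_simps(1)[of n x h] fam_simps(1)[of n x' h'] by metis

lemma DC_simps [simp]:
  "Dom DC (\<alpha>, \<Gamma>, \<beta>) = \<alpha>" "Cod DC (\<alpha>, \<Gamma>, \<beta>) = \<beta>"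
  by (simp_all add: pnt_cat_def)

lemma DC_ident: "Ident DC (fam x h) = (fam x h, mor x (\<lambda>n. Ident C (dom (x n))) x, fam x h)"
  unfolding pnt_cat_def by (simp add: const_pf_def fun_eq_iff mor_def)

lemma DC_comp:
  "(fam y k, mor y g' z, fam z l) \<cdot>[DC] (fam x h, mor x g y, fam y k) =
   (fam x h, mor x (\<lambda>n. g' n \<cdot> g n) z, fam z l)"
  unfolding pnt_cat_def by (simp add: const_pf_def fun_eq_iff mor_def)

lemma hom_fam_ident:
  assumes "datum x h u" shows "hom_fam x u x u (\<lambda>n. Ident C (dom (x n)))"
  using cart_familyD[OF datumD(1)[OF assms]] cart_simps[OF datumD(1)[OF assms]]
  unfolding hom_fam_def by simp

lemma hom_fam_comp:
  assumes d: "datum x h u" "datum y k w" "datum z l v" and f: "hom_fam x u y w f" and g: "hom_fam y w z v g"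
  shows "hom_fam x u z v (\<lambda>n. g n \<cdot> f n)"
proof -
  note X = cart_familyD(1,2)[OF datumD(1)[OF d(1)]] cart_simps(1-3)[OF datumD(1)[OF d(1)]]
  note Y = cart_familyD(1,2)[OF datumD(1)[OF d(2)]] cart_simps(1-3)[OF datumD(1)[OF d(2)]]
  note Z = cart_familyD(1,2)[OF datumD(1)[OF d(3)]] cart_simps(1-3)[OF datumD(1)[OF d(3)]]
  have F: "arr (f n)" "dom (f n) = dom (x n)" "cod (f n) = dom (y n)" "y n \<cdot> f n = x n" if "0 < n" for n
    using f that unfolding hom_fam_def by blast+
  have G: "arr (g n)" "dom (g n) = dom (y n)" "cod (g n) = dom (z n)" "z n \<cdot> g n = y n" if "0 < n" for n
    using g that unfolding hom_fam_def by blast+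
  have F2: "w \<mu> \<cdot> f (scod \<mu>) = f (sdom \<mu>) \<cdot> u \<mu>" if "\<mu> \<in> Arr simplex" for \<mu>
    using f that unfolding hom_fam_def by blast
  have G2: "v \<mu> \<cdot> g (scod \<mu>) = g (sdom \<mu>) \<cdot> w \<mu>" if "\<mu> \<in> Arr simplex" for \<mu>
    using g that unfolding hom_fam_def by blast
  show ?thesis
    unfolding hom_fam_def
  proof (intro conjI allI impI ballI)
    fix n :: nat assume n: "0 < n"
    show "z n \<cdot> (g n \<cdot> f n) = x n"
      using n F G X Y Z extend[OF G(4)[OF n] C] by simp
  next
    fix \<mu> assume s: "\<mu> \<in> Arr simplex"
    let ?m = "sdom \<mu>" and ?n = "scod \<mu>"
    have s': "0 < ?m" "0 < ?n" using s by simp_all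
    note m = F(1-3)[OF s'(1)] G(1-3)[OF s'(1)] and n = F(1-3)[OF s'(2)] G(1-3)[OF s'(2)]
    note xyz = X(3-5)[OF s] Y(3-5)[OF s] Z(3-5)[OF s]
    have "v \<mu> \<cdot> (g ?n \<cdot> f ?n) = g ?m \<cdot> (w \<mu> \<cdot> f ?n)"
      using m n xyz by (simp add: extend[OF G2[OF s] C])
    also have "\<dots> = (g ?m \<cdot> f ?m) \<cdot> u \<mu>" using m n xyz by (simp add: F2[OF s])
    finally show "v \<mu> \<cdot> (g ?n \<cdot> f ?n) = (g ?m \<cdot> f ?m) \<cdot> u \<mu>" .
  qed (use F G in simp_all)
qed

text \<open>\<open>fam x h\<close> does not see \<open>x 0\<close>, so the parameters found for an
  arrow need not be those of the prescribed datum. They agree at positive n, and \<open>mor\<close>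
  depends on nothing else.\<close>

lemma DC_arrE':
  assumes "f \<in> Arr DC" "Dom DC f = fam x h" "datum x h u"
  obtains y k w g where "datum y k w" "hom_fam x u y w g" "f = (fam x h, mor x g y, fam y k)"
proof -
  obtain x' h' u' y k w g where d: "datum x' h' u'" "datum y k w" "hom_fam x' u' y w g" "f = (fam x' h', mor x' g y, fam y k)"
    using DC_arrE[OF assms(1)] .
  have e: "fam x' h' = fam x h" using d assms by simp
  have "mor x' g y = mor x g y" using fam_eqD[OF e] by (auto simp: mor_inject)
  then have f: "f = (fam x h, mor x g y, fam y k)" using d e by simp
  have "is_modif simplex K F (fam x h) (fam y k) (mor x g y)"
    using assms(1) unfolding f by (simp add: pnt_cat_def)
  then have "hom_fam x u y w g" using modif_mor_iff[OF assms(3) d(2)] by simp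
  then show ?thesis using that d(2) f by blast
qed

lemma DC_arrE2:
  assumes "f \<in> Arr DC" "Dom DC f = fam x h" "datum x h u" "Cod DC f = fam y k" "datum y k w"
  obtains g where "hom_fam x u y w g" "f = (fam x h, mor x g y, fam y k)"
proof -
  obtain y' k' w' g where d: "datum y' k' w'" "hom_fam x u y' w' g" "f = (fam x h, mor x g y', fam y' k')"
    using DC_arrE'[OF assms(1-3)] .
  have e: "fam y' k' = fam y k" using d assms by simp
  have "mor x g y' = mor x g y" using fam_eqD[OF e] by (auto simp: mor_inject)
  then have f: "f = (fam x h, mor x g y, fam y k)" using d e by simp
  have "is_modif simplex K F (fam x h) (fam y k) (mor x g y)"
    using assms(1) unfolding f by (simp add: pnt_cat_def)
  then have "hom_fam x u y w g" using modif_mor_iff[OF assms(3,5)] by simp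
  then show ?thesis using that f by blast
qed

lemma hom_famD:
  assumes "hom_fam x u y w g"
  shows "0 < n ==> arr (g n)" "0 < n ==> dom (g n) = dom (x n)" "0 < n ==> cod (g n) = dom (y n)"
    "0 < n ==> y n \<cdot> g n = x n"
    "\<mu> \<in> Arr simplex ==> w \<mu> \<cdot> g (scod \<mu>) = g (sdom \<mu>) \<cdot> u \<mu>"
  using assms unfolding hom_fam_def by blast+

lemma category_DC: "category DC"
  unfolding category_def
proof (intro conjI ballI impI)
  fix f assume f: "f \<in> Arr DC"
  obtain x h u y k w g where d: "datum x h u" "datum y k w" and g: "hom_fam x u y w g"
    and ff: "f = (fam x h, mor x g y, fam y k)" using DC_arrE[OF f] .
  show "Dom DC f \<in> Obj DC" "Cod DC f \<in> Obj DC" using d unfolding ff DC_obj by auto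
  have e: "mor x (\<lambda>n. g n \<cdot> Ident C (dom (x n))) y = mor x g y"
      "mor x (\<lambda>n. Ident C (dom (y n)) \<cdot> g n) y = mor x g y"
    using hom_famD[OF g] by (auto simp: mor_inject)
  show "f \<cdot>[DC] Ident DC (Dom DC f) = f" unfolding ff using e by (simp add: DC_ident DC_comp)
  show "Ident DC (Cod DC f) \<cdot>[DC] f = f" unfolding ff using e by (simp add: DC_ident DC_comp)
next
  fix \<alpha> assume "\<alpha> \<in> Obj DC"
  then obtain x h u where d: "\<alpha> = fam x h" "datum x h u" unfolding DC_obj by blast
  show "Ident DC \<alpha> \<in> hom DC \<alpha> \<alpha>"
    using DC_arrI[OF d(2) d(2) hom_fam_ident[OF d(2)]] by (simp add: d(1) DC_ident)
next
  fix f f' assume f: "f \<in> Arr DC" "f' \<in> Arr DC" and ff': "Cod DC f = Dom DC f'"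
  obtain x h u y k w g where d: "datum x h u" "datum y k w" and g: "hom_fam x u y w g"
    and ff: "f = (fam x h, mor x g y, fam y k)" using DC_arrE[OF f(1)] .
  obtain z l v g' where d': "datum z l v" and g': "hom_fam y w z v g'"
    and f'f: "f' = (fam y k, mor y g' z, fam z l)"
  proof -
    have "Dom DC f' = fam y k" using ff ff' by simp
    from DC_arrE'[OF f(2) this d(2)] that show thesis by metis
  qed
  show "f' \<cdot>[DC] f \<in> hom DC (Dom DC f) (Cod DC f')"
    using DC_arrI[OF d(1) d' hom_fam_comp[OF d d' g g']] by (simp add: ff f'f DC_comp)
next
  fix f f' f'' assume f: "f \<in> Arr DC" "f' \<in> Arr DC" "f'' \<in> Arr DC"
    and ff': "Cod DC f = Dom DC f' \<and> Cod DC f' = Dom DC f''"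
  obtain x h u y k w g where d: "datum x h u" "datum y k w" and g: "hom_fam x u y w g"
    and ff: "f = (fam x h, mor x g y, fam y k)" using DC_arrE[OF f(1)] .
  obtain z l v g' where d': "datum z l v" and g': "hom_fam y w z v g'"
    and f'f: "f' = (fam y k, mor y g' z, fam z l)"
  proof -
    have "Dom DC f' = fam y k" using ff ff' by simp
    from DC_arrE'[OF f(2) this d(2)] that show thesis by metis
  qed
  obtain z' l' v' g'' where d'': "datum z' l' v'" and g'': "hom_fam z v z' v' g''"
    and f''f: "f'' = (fam z l, mor z g'' z', fam z' l')"
  proof -
    have "Dom DC f'' = fam z l" using f'f ff' by simp
    from DC_arrE'[OF f(3) this d'] that show thesis by metis
  qed
  have "mor x (\<lambda>n. (g'' n \<cdot> g' n) \<cdot> g n) z' = mor x (\<lambda>n. g'' n \<cdot> (g' n \<cdot> g n)) z'"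
    using hom_famD(1-3)[OF g] hom_famD(1-3)[OF g'] hom_famD(1-3)[OF g''] by (auto simp: mor_inject)
  then show "(f'' \<cdot>[DC] f') \<cdot>[DC] f = f'' \<cdot>[DC] (f' \<cdot>[DC] f)"
    by (simp add: ff f'f f''f DC_comp)
qed

text \<open>Levelwise inverses again lie over the diagram and commute with the lifts, so they
  assemble to an inverse in the descent category.\<close>

lemma DC_isoI:
  assumes d: "datum x h u" "datum y k w" and g: "hom_fam x u y w g" and i: "\<And>n. 0 < n ==> iso C (g n)"
  shows "iso DC (fam x h, mor x g y, fam y k)"
proof -
  have "\<exists>j. arr j \<and> dom j = cod (g n) \<and> cod j = dom (g n) \<and>
    j \<cdot> g n = Ident C (dom (g n)) \<and> g n \<cdot> j = Ident C (cod (g n))" if "0 < n" for n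
    using i[OF that] isoD[OF C, of "g n"] by metis
  then obtain j where "\<And>n. 0 < n ==> arr (j n) \<and> dom (j n) = cod (g n) \<and> cod (j n) = dom (g n) \<and>
    j n \<cdot> g n = Ident C (dom (g n)) \<and> g n \<cdot> j n = Ident C (cod (g n))" by metis
  then have j: "\<And>n. 0 < n ==> arr (j n)" "\<And>n. 0 < n ==> dom (j n) = dom (y n)"
    "\<And>n. 0 < n ==> cod (j n) = dom (x n)"
    "\<And>n. 0 < n ==> j n \<cdot> g n = Ident C (dom (x n))"
    "\<And>n. 0 < n ==> g n \<cdot> j n = Ident C (dom (y n))"
    using hom_famD[OF g] by metis+
  note X = cart_familyD(1,2)[OF datumD(1)[OF d(1)]] cart_simps(1-3)[OF datumD(1)[OF d(1)]]
  note Y = cart_familyD(1,2)[OF datumD(1)[OF d(2)]] cart_simps(1-3)[OF datumD(1)[OF d(2)]]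
  note G = hom_famD(1-3)[OF g]
  have "hom_fam y w x u j"
    unfolding hom_fam_def
  proof (intro conjI allI impI ballI)
    fix n :: nat assume n: "0 < n"
    have "x n \<cdot> j n = y n \<cdot> (g n \<cdot> j n)"
      using n G j(1-3) X Y by (simp add: extend[OF hom_famD(4)[OF g n] C])
    then show "x n \<cdot> j n = y n" using n j Y by simp
  next
    fix \<mu> assume s: "\<mu> \<in> Arr simplex"
    let ?m = "sdom \<mu>" and ?n = "scod \<mu>"
    have s': "0 < ?m" "0 < ?n" using s by simp_all
    note m = G[OF s'(1)] j(1-3)[OF s'(1)] and n = G[OF s'(2)] j(1-3)[OF s'(2)]
    note xy = X(3-5)[OF s] Y(3-5)[OF s]
    have "u \<mu> = j ?m \<cdot> (g ?m \<cdot> u \<mu>)"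
      using m xy by (simp add: extend[OF j(4)[OF s'(1)] C])
    also have "\<dots> = j ?m \<cdot> (w \<mu> \<cdot> g ?n)" using hom_famD(5)[OF g s] by simp
    finally have u: "u \<mu> = j ?m \<cdot> (w \<mu> \<cdot> g ?n)" .
    have "u \<mu> \<cdot> j ?n = j ?m \<cdot> (w \<mu> \<cdot> (g ?n \<cdot> j ?n))"
      unfolding u using m n xy by simp
    then show "u \<mu> \<cdot> j ?n = j ?m \<cdot> w \<mu>" using j(5)[OF s'(2)] m n xy by simp
  qed (use j in simp_all)
  note arr = DC_arrI[OF d g] DC_arrI[OF d(2,1) this]
  have "mor x (\<lambda>n. j n \<cdot> g n) x = mor x (\<lambda>n. Ident C (dom (x n))) x"
    "mor y (\<lambda>n. g n \<cdot> j n) y = mor y (\<lambda>n. Ident C (dom (y n))) y"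
    using j by (auto simp: mor_inject)
  then show ?thesis using arr by (intro isoI[where g = "(fam y k, mor y j x, fam x h)"]) (simp_all add: DC_comp DC_ident)
qed

lemma DC_isoD:
  assumes d: "datum x h u" "datum y k w" and i: "iso DC (fam x h, mor x g y, fam y k)" and n: "0 < n"
  shows "iso C (g n)"
proof -
  let ?f = "(fam x h, mor x g y, fam y k)"
  obtain f' where f': "f' \<in> Arr DC" "Dom DC f' = fam y k" "Cod DC f' = fam x h"
    "f' \<cdot>[DC] ?f = Ident DC (fam x h)" "?f \<cdot>[DC] f' = Ident DC (fam y k)"
    using isoD[OF category_DC i] by auto
  obtain j where j: "hom_fam y w x u j" "f' = (fam y k, mor y j x, fam x h)"
    using DC_arrE2[OF f'(1,2) d(2) f'(3) d(1)] .
  have "?f \<in> Arr DC" using i by simp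
  then have "hom_fam x u y w g" using modif_mor_iff[OF d] by (simp add: pnt_cat_def)
  from hom_famD(1-3)[OF this n] hom_famD(1-3)[OF j(1) n] show ?thesis
    using f'(4,5) n unfolding j(2) DC_comp DC_ident prod.inject mor_inject
    by (intro isoI[where g = "j n"]) simp_all
qed

section \<open>The comparison functor on objects and arrows\<close>

lemma pulled_backD:
  assumes "pulled_back C A z x v"
  shows "arr z" "cod z = FObj A 0"
    and "0 < n ==> is_pullback C (leg n) z (x n) (v n)"
    and "0 < n ==> arr (x n)" "0 < n ==> arr (v n)" "0 < n ==> cod (x n) = FObj A n"
    "0 < n ==> dom (v n) = dom (x n)" "0 < n ==> cod (v n) = dom z"
    "0 < n ==> leg n \<cdot> x n = z \<cdot> v n"
proof -
  show 1: "arr z" "cod z = FObj A 0" and 2: "0 < n ==> is_pullback C (leg n) z (x n) (v n)"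
    using assms unfolding pulled_back_def by blast+
  show "0 < n ==> arr (x n)" "0 < n ==> arr (v n)" "0 < n ==> cod (x n) = FObj A n"
    "0 < n ==> dom (v n) = dom (x n)" "0 < n ==> cod (v n) = dom z"
    "0 < n ==> leg n \<cdot> x n = z \<cdot> v n"
    using pullback_simps[OF 2] by simp_all
qed

text \<open>The transition over \<mu> is induced by the universal property of the pullback at
  \<open>sdom \<mu>\<close>, since the legs commute with \<mu>. Cancellation in the pasting law
  makes it cartesian, and uniqueness of mediating arrows makes it functorial.\<close>

lemma pulled_back_family:
  assumes p: "pulled_back C A z x v"
  obtains u where "cart_family C A x u"
    "\<forall>\<mu>\<in>Arr simplex. v (sdom \<mu>) \<cdot> u \<mu> = v (scod \<mu>)"
proof -
  note z = pulled_backD(1,2)[OF p] and pb = pulled_backD(3)[OF p] and xv = pulled_backD(4-8)[OF p]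
  have "\<exists>r. arr r \<and> dom r = dom (x (scod \<mu>)) \<and> cod r = dom (x (sdom \<mu>)) \<and>
     x (sdom \<mu>) \<cdot> r = FArr A \<mu> \<cdot> x (scod \<mu>) \<and>
     v (sdom \<mu>) \<cdot> r = v (scod \<mu>)" if s: "\<mu> \<in> Arr simplex" for \<mu>
  proof -
    let ?m = "sdom \<mu>" and ?n = "scod \<mu>"
    have s': "\<mu> \<in> Arr aug_simplex" "0 < ?m" "0 < ?n" using s by simp_all
    have "leg ?m \<cdot> (FArr A \<mu> \<cdot> x ?n) = z \<cdot> v ?n"
      using s' xv[OF s'(3)] pulled_backD(9)[OF p s'(3)]
      by (simp add: extend[OF leg_comp[OF s'(1) refl refl] C])
    then show ?thesis
      using s' xv[OF s'(3)] by (rule_tac pullback_lift[OF pb[OF s'(2)], of "FArr A \<mu> \<cdot> x ?n" "v ?n"]) auto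
  qed
  then obtain u where u: "\<And>\<mu>. \<mu> \<in> Arr simplex ==> arr (u \<mu>) \<and> dom (u \<mu>) = dom (x (scod \<mu>)) \<and>
     cod (u \<mu>) = dom (x (sdom \<mu>)) \<and>
     x (sdom \<mu>) \<cdot> u \<mu> = FArr A \<mu> \<cdot> x (scod \<mu>) \<and>
     v (sdom \<mu>) \<cdot> u \<mu> = v (scod \<mu>)" by metis
  have U: "arr (u \<mu>)" "dom (u \<mu>) = dom (x (scod \<mu>))"
     "cod (u \<mu>) = dom (x (sdom \<mu>))"
     "x (sdom \<mu>) \<cdot> u \<mu> = FArr A \<mu> \<cdot> x (scod \<mu>)"
     "v (sdom \<mu>) \<cdot> u \<mu> = v (scod \<mu>)" if "\<mu> \<in> Arr simplex" for \<mu>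
    using u[OF that] by blast+
  have "cart_family C A x u"
    unfolding cart_family_def
  proof (intro conjI allI impI ballI)
    fix \<mu> assume s: "\<mu> \<in> Arr simplex"
    let ?m = "sdom \<mu>" and ?n = "scod \<mu>"
    have s': "\<mu> \<in> Arr aug_simplex" "0 < ?m" "0 < ?n" using s by simp_all
    have "is_pullback C (leg ?m \<cdot> FArr A \<mu>) z (x ?n) (v ?n)"
      using pb[OF s'(3)] leg_comp[OF s'(1)] by simp
    then show "is_pullback C (FArr A \<mu>) (x ?m) (x ?n) (u \<mu>)"
      using U[OF s] s' by (intro pullback_unpaste[OF C pb[OF s'(2)]]) simp_all
  next
    fix n :: nat assume n: "0 < n"
    have s: "Ident aug_simplex n \<in> Arr simplex" "sdom (Ident aug_simplex n) = n"
      "scod (Ident aug_simplex n) = n" using n by simp_all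
    show "u (Ident aug_simplex n) = Ident C (dom (x n))"
      using U[OF s(1), unfolded s(2,3)] xv[OF n] by (rule_tac pullback_eqI[OF pb[OF n] C]) simp_all
  next
    fix \<mu> \<tau> assume st: "\<mu> \<in> Arr simplex" "\<tau> \<in> Arr simplex" "scod \<mu> = sdom \<tau>"
    let ?ts = "\<tau> \<cdot>[aug_simplex] \<mu>"
    let ?k = "sdom \<mu>" and ?m = "sdom \<tau>" and ?n = "scod \<tau>"
    have ts: "?ts \<in> Arr simplex" "sdom ?ts = ?k" "scod ?ts = ?n" using st by simp_all
    have p': "0 < ?k" "0 < ?m" "0 < ?n" using st by simp_all
    note U\<mu> = U[OF st(1), unfolded st(3)] and U\<tau> = U[OF st(2)] and Uts = U[OF ts(1), unfolded ts(2,3)]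
    show "u ?ts = u \<mu> \<cdot> u \<tau>"
    proof (rule pullback_eqI[OF pb[OF p'(1)] C])
      show "x ?k \<cdot> u ?ts = x ?k \<cdot> (u \<mu> \<cdot> u \<tau>)"
        using st U\<mu>(1-3) U\<tau> Uts xv[OF p'(1)] xv[OF p'(2)] xv[OF p'(3)]
        by (simp add: extend[OF U\<mu>(4) C])
      show "v ?k \<cdot> u ?ts = v ?k \<cdot> (u \<mu> \<cdot> u \<tau>)"
        using st U\<mu>(1-3) U\<tau> Uts xv[OF p'(1)] xv[OF p'(2)] xv[OF p'(3)]
        by (simp add: extend[OF U\<mu>(5) C])
    qed (use U\<mu>(1-3) U\<tau>(1-3) Uts(1-3) in simp_all)
  qed (use xv in simp_all)
  then show ?thesis using U(5) that by (metis (no_types, lifting))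
qed

abbreviation "px z \<equiv> \<lambda>n. pb_fst C (leg n) z"
abbreviation "pv z \<equiv> \<lambda>n. pb_snd C (leg n) z"
abbreviation "ph z \<equiv> \<lambda>\<mu>. fst (snd (pf_comp F \<mu> (from_zero (sdom \<mu>)) z))"

lemma pulled_back_chosen:
  assumes "z \<in> Obj (slice C (FObj A 0))"
  shows "pulled_back C A z (px z) (pv z)"
  using assms by (auto simp: pulled_back_def intro!: chosen_pullback)

text \<open>Because 0 is initial, \<open>leg (sdom \<mu>)\<close> after \<open>FArr A \<mu>\<close>
  equals \<open>leg (scod \<mu>)\<close>. Hence the compositor ends exactly at the chosen pullback
  along the latter, as the form of \<open>fam\<close> requires.\<close>

lemma comparison_fam:
  assumes "z \<in> Obj (slice C (FObj A 0))"
  shows "comparison_obj F z = fam (px z) (ph z)"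
proof -
  have 1: "FObj (pf_arr F (from_zero n)) z = px z n" for n by simp
  have 2: "pf_comp F \<mu> (from_zero (Dom simplex \<mu>)) z =
      (pb_fst C (FArr A \<mu>) (px z (sdom \<mu>)), ph z \<mu>, px z (scod \<mu>))"
    if s: "\<mu> \<in> Arr simplex" for \<mu>
    using s leg_comp[of \<mu>] by simp
  have 3: "(\<lambda>\<mu>\<in>Arr simplex. \<lambda>_::unit. pf_comp F \<mu> (from_zero (Dom simplex \<mu>)) z) =
      (\<lambda>\<mu>\<in>Arr simplex. \<lambda>_. (pb_fst C (FArr A \<mu>) (px z (sdom \<mu>)), ph z \<mu>, px z (scod \<mu>)))"
    by (intro restrict_ext ext) (rule 2)
  show ?thesis
    unfolding comparison_obj_def fam_def 1 3 by simp
qed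

text \<open>The transitions given by the universal property are the ones that the compositors
  encode; the two are compared after both projections of the chosen pullback at
  \<open>sdom \<mu>\<close>.\<close>

lemma comparison_datum:
  assumes z: "z \<in> Obj (slice C (FObj A 0))"
  obtains u where "datum (px z) (ph z) u"
    "\<forall>\<mu>\<in>Arr simplex. pv z (sdom \<mu>) \<cdot> u \<mu> = pv z (scod \<mu>)"
proof -
  note p = pulled_back_chosen[OF z]
  obtain u where u: "cart_family C A (px z) u"
    "\<forall>\<mu>\<in>Arr simplex. pv z (sdom \<mu>) \<cdot> u \<mu> = pv z (scod \<mu>)"
    using pulled_back_family[OF p] .
  have "cells (px z) u (ph z)"
  proof
    fix \<mu> assume s: "\<mu> \<in> Arr simplex"
    let ?m = "sdom \<mu>" and ?n = "scod \<mu>"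
    have s': "\<mu> \<in> Arr aug_simplex" "0 < ?m" "0 < ?n" using s by simp_all
    note lc = leg_comp[OF s'(1) refl refl]
    note us = cart_simps[OF u(1) s] bspec[OF u(2) s]
    have z': "arr z" "cod z = FObj A 0" using z by simp_all
    let ?x1 = "pb_fst C (leg ?m) z" let ?x2 = "pb_fst C (FArr A \<mu>) ?x1"
    let ?s = "pb_snd C (leg ?m) z \<cdot> pb_snd C (FArr A \<mu>) ?x1"
    have "leg ?m \<cdot> (FArr A \<mu> \<cdot> ?x2) = z \<cdot> ?s"
      using s' z' comp_from_zero[OF s'(1) refl] compositor_lift[of "from_zero ?m" \<mu> z] by simp
    then have lift: "leg ?n \<cdot> ?x2 = z \<cdot> ?s"
      using s' z' by (simp add: extend[OF lc C])
    have ph: "ph z \<mu> = pb_pair C (leg ?n) z ?x2 ?s" using lc by simp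
    have phs: "arr (ph z \<mu>)" "dom (ph z \<mu>) = pb_obj C (FArr A \<mu>) ?x1" "cod (ph z \<mu>) = pb_obj C (leg ?n) z"
      "px z ?n \<cdot> ph z \<mu> = ?x2" "pv z ?n \<cdot> ph z \<mu> = ?s"
      unfolding ph using lift s' z' by simp_all
    have "u \<mu> \<cdot> ph z \<mu> = pb_snd C (FArr A \<mu>) ?x1"
    proof (rule pb_eqI[OF C P, of "leg ?m" z])
      have "pb_fst C (leg ?m) z \<cdot> (u \<mu> \<cdot> ph z \<mu>) = FArr A \<mu> \<cdot> ?x2"
        using s' z' us(1-3) phs(1-4) by (simp add: extend[OF us(4) C] del: F_simps)
      also have "\<dots> = ?x1 \<cdot> pb_snd C (FArr A \<mu>) ?x1" using s' z' by (simp add: pb_commute)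
      finally show "pb_fst C (leg ?m) z \<cdot> (u \<mu> \<cdot> ph z \<mu>) = ?x1 \<cdot> pb_snd C (FArr A \<mu>) ?x1" .
      show "pb_snd C (leg ?m) z \<cdot> (u \<mu> \<cdot> ph z \<mu>) = pb_snd C (leg ?m) z \<cdot> pb_snd C (FArr A \<mu>) ?x1"
        using s' z' us(1-3) phs(1-3,5) by (simp add: extend[OF us(5) C] del: F_simps)
    qed (use s' z' us(1-3) phs(1-3) in \<open>simp_all del: F_simps\<close>)
    then show "arr (ph z \<mu>) \<and> dom (ph z \<mu>) = pb_obj C (FArr A \<mu>) (px z ?m) \<and>
     cod (ph z \<mu>) = dom (px z ?n) \<and> px z ?n \<cdot> ph z \<mu> = pb_fst C (FArr A \<mu>) (px z ?m) \<and>
     u \<mu> \<cdot> ph z \<mu> = pb_snd C (FArr A \<mu>) (px z ?m)"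
      using phs s' z' by (simp del: F_simps)
  qed
  with u that show ?thesis unfolding datum_def by blast
qed

abbreviation pg where
  "pg z k w \<equiv> \<lambda>n. pb_pair C (leg n) w (pb_fst C (leg n) z) (k \<cdot> pb_snd C (leg n) z)"

lemma comparison_FObj: "FObj (comparison F) z = comparison_obj F z"
  by (simp add: comparison_def)

lemma comparison_FArr:
  "FArr (comparison F) (z, k, w) = (comparison_obj F z, mor (px z) (pg z k w) (px w), comparison_obj F w)"
  by (simp add: comparison_def mor_def)

lemma pg_simps:
  assumes "(z, k, w) \<in> Arr (slice C (FObj A 0))"
  shows "arr (pg z k w n)" "dom (pg z k w n) = pb_obj C (leg n) z" "cod (pg z k w n) = pb_obj C (leg n) w"
    "pb_fst C (leg n) w \<cdot> pg z k w n = pb_fst C (leg n) z"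
    "pb_snd C (leg n) w \<cdot> pg z k w n = k \<cdot> pb_snd C (leg n) z"
  using assms base_change_lift[OF C P, of "leg n" z k w] by simp_all

lemma comparison_hom_fam:
  assumes k: "(z, k, w) \<in> Arr (slice C (FObj A 0))"
    and u: "datum (px z) (ph z) u" "\<forall>\<mu>\<in>Arr simplex. pv z (sdom \<mu>) \<cdot> u \<mu> = pv z (scod \<mu>)"
    and u': "datum (px w) (ph w) u'" "\<forall>\<mu>\<in>Arr simplex. pv w (sdom \<mu>) \<cdot> u' \<mu> = pv w (scod \<mu>)"
    and g: "\<And>n. 0 < n ==> g n = pb_pair C (leg n) w (pb_fst C (leg n) z) (t n)"
    and t: "\<And>n. 0 < n ==> t n = k \<cdot> pb_snd C (leg n) z"
  shows "hom_fam (px z) u (px w) u' g"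
  unfolding hom_fam_def
proof (intro conjI allI impI ballI)
  note gs = pg_simps[OF k]
  have zw: "arr z" "cod z = FObj A 0" "arr w" "cod w = FObj A 0" "arr k" "dom k = dom z" "cod k = dom w"
    using k by simp_all
  {
    fix n :: nat assume n: "0 < n"
    have [simp]: "g n = pg z k w n" using n g t by simp
    show "arr (g n)" "dom (g n) = dom (px z n)" "cod (g n) = dom (px w n)" "px w n \<cdot> g n = px z n"
      using gs[of n] zw by simp_all
  }
  fix \<mu> assume s: "\<mu> \<in> Arr simplex"
  let ?m = "sdom \<mu>" and ?n = "scod \<mu>"
  have s': "\<mu> \<in> Arr aug_simplex" "0 < ?m" "0 < ?n" using s by simp_all
  have ge: "g ?m = pg z k w ?m" "g ?n = pg z k w ?n" using s' g t by simp_all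
  define gm gn where "gm = pg z k w ?m" and "gn = pg z k w ?n"
  note gm = gs[of ?m, folded gm_def] and gn = gs[of ?n, folded gn_def]
  note us = cart_simps[OF datumD(1)[OF u(1)] s] bspec[OF u(2) s]
  note us' = cart_simps[OF datumD(1)[OF u'(1)] s] bspec[OF u'(2) s]
  show "u' \<mu> \<cdot> g ?n = g ?m \<cdot> u \<mu>"
    unfolding ge gm_def[symmetric] gn_def[symmetric]
  proof (rule pb_eqI[OF C P, of "leg ?m" w])
    have "pb_fst C (leg ?m) w \<cdot> (u' \<mu> \<cdot> gn) = FArr A \<mu> \<cdot> pb_fst C (leg ?n) z"
      using zw us'(1-3) gn s' by (simp add: extend[OF us'(4) C])
    also have "\<dots> = pb_fst C (leg ?m) w \<cdot> (gm \<cdot> u \<mu>)"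
      using zw us(1-4) gm(1-3) s' by (simp add: extend[OF gm(4) C])
    finally show "pb_fst C (leg ?m) w \<cdot> (u' \<mu> \<cdot> gn) = pb_fst C (leg ?m) w \<cdot> (gm \<cdot> u \<mu>)" .
    have "pb_snd C (leg ?m) w \<cdot> (u' \<mu> \<cdot> gn) = k \<cdot> pb_snd C (leg ?n) z"
      using zw us'(1-3) gn s' by (simp add: extend[OF us'(5) C])
    also have "\<dots> = pb_snd C (leg ?m) w \<cdot> (gm \<cdot> u \<mu>)"
      using zw us(1-3,5) gm(1-3) s' by (simp add: extend[OF gm(5) C])
    finally show "pb_snd C (leg ?m) w \<cdot> (u' \<mu> \<cdot> gn) = pb_snd C (leg ?m) w \<cdot> (gm \<cdot> u \<mu>)" .
  qed (use s' zw us(1-3) us'(1-3) gm(1-3) gn(1-3) in simp_all)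
qed

lemma comparison_functor: "is_functor (slice C (FObj A 0)) DC (comparison F)"
  unfolding is_functor_def
proof (intro conjI ballI impI)
  fix z assume z: "z \<in> Obj (slice C (FObj A 0))"
  obtain u where u: "datum (px z) (ph z) u"
    using comparison_datum[OF z] by blast
  show "FObj (comparison F) z \<in> Obj DC"
    using u by (auto simp: comparison_FObj comparison_fam[OF z] DC_obj simp del: F_simps)
  have k: "(z, Ident C (dom z), z) \<in> Arr (slice C (FObj A 0))" using z by simp
  have "pg z (Ident C (dom z)) z n = Ident C (dom (px z n))" for n
  proof (rule pb_eqI[OF C P, of "leg n" z])
    show "pb_fst C (leg n) z \<cdot> pg z (Ident C (dom z)) z n = pb_fst C (leg n) z \<cdot> Ident C (dom (px z n))"
      unfolding pg_simps(4)[OF k] using z by simp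
    show "pb_snd C (leg n) z \<cdot> pg z (Ident C (dom z)) z n = pb_snd C (leg n) z \<cdot> Ident C (dom (px z n))"
      unfolding pg_simps(5)[OF k] using z by simp
  qed (use z pg_simps(1-3)[OF k] in simp_all)
  then show "FArr (comparison F) (Ident (slice C (FObj A 0)) z) = Ident DC (FObj (comparison F) z)"
    by (simp add: comparison_FObj comparison_FArr comparison_fam[OF z] DC_ident mor_inject del: F_simps)
next
  fix f assume f: "f \<in> Arr (slice C (FObj A 0))"
  obtain z k w where k: "f = (z, k, w)" by (cases f)
  note f = f[unfolded k]
  have z: "z \<in> Obj (slice C (FObj A 0))" and w: "w \<in> Obj (slice C (FObj A 0))" using f by simp_all
  obtain u where u: "datum (px z) (ph z) u"
    "\<forall>\<mu>\<in>Arr simplex. pv z (sdom \<mu>) \<cdot> u \<mu> = pv z (scod \<mu>)"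
    using comparison_datum[OF z] .
  obtain u' where u': "datum (px w) (ph w) u'"
    "\<forall>\<mu>\<in>Arr simplex. pv w (sdom \<mu>) \<cdot> u' \<mu> = pv w (scod \<mu>)"
    using comparison_datum[OF w] .
  have "hom_fam (px z) u (px w) u' (pg z k w)"
    by (rule comparison_hom_fam[OF f u u']) simp_all
  from DC_arrI[OF u(1) u'(1) this]
  show "FArr (comparison F) f \<in> hom DC (FObj (comparison F) (Dom (slice C (FObj A 0)) f))
     (FObj (comparison F) (Cod (slice C (FObj A 0)) f))"
    unfolding k by (simp add: comparison_FObj comparison_FArr comparison_fam[OF z] comparison_fam[OF w] del: F_simps)
next
  fix f f' assume f: "f \<in> Arr (slice C (FObj A 0))" and f': "f' \<in> Arr (slice C (FObj A 0))"
    and ff': "Cod (slice C (FObj A 0)) f = Dom (slice C (FObj A 0)) f'"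
  obtain z k w where k: "f = (z, k, w)" by (cases f)
  obtain k' w' where k': "f' = (w, k', w')" using ff' k by (cases f') auto
  note f = f[unfolded k] and f' = f'[unfolded k']
  have z: "z \<in> Obj (slice C (FObj A 0))" and w: "w \<in> Obj (slice C (FObj A 0))" and w': "w' \<in> Obj (slice C (FObj A 0))"
    using f f' by simp_all
  have kk: "(z, k' \<cdot> k, w') \<in> Arr (slice C (FObj A 0))"
    using f f' extend[of C w' k' w k] by simp
  have "pg z (k' \<cdot> k) w' n = pg w k' w' n \<cdot> pg z k w n" for n
  proof -
    define a b where "a = pg z k w n" and "b = pg w k' w' n"
    note a = pg_simps[OF f, of n, folded a_def] and b = pg_simps[OF f', of n, folded b_def]
    have "pg z (k' \<cdot> k) w' n = b \<cdot> a"
    proof (rule pb_eqI[OF C P, of "leg n" w'])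
      show "pb_fst C (leg n) w' \<cdot> pg z (k' \<cdot> k) w' n = pb_fst C (leg n) w' \<cdot> (b \<cdot> a)"
        unfolding pg_simps(4)[OF kk] using a b(1-3) f f' by (simp add: extend[OF b(4) C])
      show "pb_snd C (leg n) w' \<cdot> pg z (k' \<cdot> k) w' n = pb_snd C (leg n) w' \<cdot> (b \<cdot> a)"
        unfolding pg_simps(5)[OF kk] using a b(1-3) f f' by (simp add: extend[OF b(5) C])
    qed (use a(1-3) b(1-3) pg_simps(1-3)[OF kk] f f' in simp_all)
    then show ?thesis by (simp add: a_def b_def)
  qed
  then show "FArr (comparison F) (f' \<cdot>[slice C (FObj A 0)] f) = FArr (comparison F) f' \<cdot>[DC] FArr (comparison F) f"
    unfolding k k'
    by (simp add: comparison_FArr comparison_fam[OF z] comparison_fam[OF w] comparison_fam[OF w'] DC_comp mor_inject del: F_simps)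
qed

section \<open>Full faithfulness and essential surjectivity of the comparison functor\<close>

lemma colimit_condD:
  assumes "colimit_cond C A" "pulled_back C A z x v" "arr w" "cod w = FObj A 0"
    and "\<And>n. 0 < n ==> arr (t n) \<and> dom (t n) = dom (x n) \<and> cod (t n) = dom w \<and> w \<cdot> t n = z \<cdot> v n"
    and "\<And>\<mu> r. \<mu> \<in> Arr simplex ==> arr r ==> dom r = dom (x (scod \<mu>)) ==>
      cod r = dom (x (sdom \<mu>)) ==>
      x (sdom \<mu>) \<cdot> r = FArr A \<mu> \<cdot> x (scod \<mu>) ==>
      v (sdom \<mu>) \<cdot> r = v (scod \<mu>) ==>
      t (sdom \<mu>) \<cdot> r = t (scod \<mu>)"
  shows "\<exists>!k. k \<in> hom C (dom z) (dom w) \<and> w \<cdot> k = z \<and> (\<forall>n>0. k \<cdot> v n = t n)"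
  using assms(1)[unfolded colimit_cond_def, rule_format, of z x v w t] assms(2-) by simp

text \<open>A compatible family t amounts to an arrow of the descent category between the comparison
  images of z and w, and fullness turns it into the glued arrow k. The given pullbacks need not be
  the chosen ones, so t is carried over along the comparison isomorphisms i.\<close>

lemma full_imp_colimit_ex:
  assumes ff: "fully_faithful (slice C (FObj A 0)) DC (comparison F)"
    and p: "pulled_back C A z x v" and w: "arr w" "cod w = FObj A 0"
    and t: "\<And>n. 0 < n ==> arr (t n) \<and> dom (t n) = dom (x n) \<and> cod (t n) = dom w \<and> w \<cdot> t n = z \<cdot> v n"
    and tr: "\<And>\<mu> r. \<mu> \<in> Arr simplex ==> arr r ==> dom r = dom (x (scod \<mu>)) ==>
      cod r = dom (x (sdom \<mu>)) ==>
      x (sdom \<mu>) \<cdot> r = FArr A \<mu> \<cdot> x (scod \<mu>) ==>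
      v (sdom \<mu>) \<cdot> r = v (scod \<mu>) ==>
      t (sdom \<mu>) \<cdot> r = t (scod \<mu>)"
  obtains k where "arr k" "dom k = dom z" "cod k = dom w" "w \<cdot> k = z" "\<And>n. 0 < n ==> k \<cdot> v n = t n"
proof -
  note zz = pulled_backD(1,2)[OF p] and pb = pulled_backD(3)[OF p] and xv = pulled_backD(4-8)[OF p]
  have z: "z \<in> Obj (slice C (FObj A 0))" and w': "w \<in> Obj (slice C (FObj A 0))" using zz w by simp_all
  note pz = pulled_back_chosen[OF z]
  have "\<exists>i. iso C i \<and> dom i = pb_obj C (leg n) z \<and> cod i = dom (x n) \<and> x n \<cdot> i = pb_fst C (leg n) z \<and>
     v n \<cdot> i = pb_snd C (leg n) z" if n: "0 < n" for n
    using pullback_compare[OF C pb[OF n] pulled_backD(3)[OF pz n]] zz by (simp, metis)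
  then obtain i where i: "\<And>n. 0 < n ==> iso C (i n) \<and> dom (i n) = pb_obj C (leg n) z \<and> cod (i n) = dom (x n) \<and> x n \<cdot> i n = pb_fst C (leg n) z \<and>
     v n \<cdot> i n = pb_snd C (leg n) z" by metis
  have I: "iso C (i n)" "arr (i n)" "dom (i n) = pb_obj C (leg n) z" "cod (i n) = dom (x n)"
    "x n \<cdot> i n = pb_fst C (leg n) z" "v n \<cdot> i n = pb_snd C (leg n) z" if "0 < n" for n
    using i[OF that] by auto
  have T: "arr (t n)" "dom (t n) = dom (x n)" "cod (t n) = dom w" "w \<cdot> t n = z \<cdot> v n" if "0 < n" for n
    using t[OF that] by auto
  define s where "s n = t n \<cdot> i n" for n
  have S: "arr (s n)" "dom (s n) = pb_obj C (leg n) z" "cod (s n) = dom w" if "0 < n" for n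
    using T[OF that] I[OF that] by (simp_all add: s_def)
  have lift: "leg n \<cdot> pb_fst C (leg n) z = w \<cdot> s n" if n: "0 < n" for n
  proof -
    have "w \<cdot> s n = z \<cdot> pb_snd C (leg n) z"
      using T(1-3)[OF n] I[OF n] w zz xv[OF n] by (simp add: s_def extend[OF T(4)[OF n] C])
    then show ?thesis using zz by (simp add: pb_commute)
  qed
  define g where "g n = pb_pair C (leg n) w (pb_fst C (leg n) z) (s n)" for n
  have G: "arr (g n)" "dom (g n) = pb_obj C (leg n) z" "cod (g n) = pb_obj C (leg n) w"
    "pb_fst C (leg n) w \<cdot> g n = pb_fst C (leg n) z" "pb_snd C (leg n) w \<cdot> g n = s n" if n: "0 < n" for n
    using lift[OF n] S[OF n] w zz by (simp_all add: g_def)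
  obtain u where u: "datum (px z) (ph z) u"
    "\<forall>\<mu>\<in>Arr simplex. pv z (sdom \<mu>) \<cdot> u \<mu> = pv z (scod \<mu>)"
    using comparison_datum[OF z] .
  obtain u' where u': "datum (px w) (ph w) u'"
    "\<forall>\<mu>\<in>Arr simplex. pv w (sdom \<mu>) \<cdot> u' \<mu> = pv w (scod \<mu>)"
    using comparison_datum[OF w'] .
  have sc: "s (sdom \<mu>) \<cdot> u \<mu> = s (scod \<mu>)" if \<mu>: "\<mu> \<in> Arr simplex" for \<mu>
  proof -
    let ?m = "sdom \<mu>" and ?n = "scod \<mu>"
    have s': "\<mu> \<in> Arr aug_simplex" "0 < ?m" "0 < ?n" using \<mu> by simp_all
    note us = cart_simps[OF datumD(1)[OF u(1)] \<mu>] bspec[OF u(2) \<mu>]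
    obtain j where j: "arr j" "dom j = dom (x ?n)" "cod j = pb_obj C (leg ?n) z"
      "j \<cdot> i ?n = Ident C (pb_obj C (leg ?n) z)" "i ?n \<cdot> j = Ident C (dom (x ?n))"
      using isoD[OF C I(1)[OF s'(3)]] I(3,4)[OF s'(3)] by metis
    note m = I(2-4)[OF s'(2)] xv[OF s'(2)] and n = I(2-4)[OF s'(3)] xv[OF s'(3)]
    \<comment> \<open>The transition \<open>u \<mu>\<close> between chosen pullbacks, carried back
      to the given ones, where the compatibility hypothesis on t can be applied.\<close>
    define r where "r = i ?m \<cdot> (u \<mu> \<cdot> j)"
    have r: "arr r" "dom r = dom (x ?n)" "cod r = dom (x ?m)"
      using m us j(1-3) zz by (simp_all add: r_def)
    have ri: "r \<cdot> i ?n = i ?m \<cdot> u \<mu>"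
      using m n us(1-3) j zz by (simp add: r_def)
    have "x ?m \<cdot> r = FArr A \<mu> \<cdot> x ?n"
    proof (rule iso_cancel_right[OF C I(1)[OF s'(3)]])
      have "x ?m \<cdot> (r \<cdot> i ?n) = FArr A \<mu> \<cdot> (x ?n \<cdot> i ?n)"
        unfolding ri using m us(1-4) zz I(5)[OF s'(3)] by (simp add: extend[OF I(5)[OF s'(2)] C])
      then show "(x ?m \<cdot> r) \<cdot> i ?n = (FArr A \<mu> \<cdot> x ?n) \<cdot> i ?n" using r m n s' by simp
    qed (use r m n s' in simp_all)
    moreover have "v ?m \<cdot> r = v ?n"
    proof (rule iso_cancel_right[OF C I(1)[OF s'(3)]])
      have "v ?m \<cdot> (r \<cdot> i ?n) = v ?n \<cdot> i ?n"
        unfolding ri using m us(1-3,5) zz I(6)[OF s'(3)] by (simp add: extend[OF I(6)[OF s'(2)] C])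
      then show "(v ?m \<cdot> r) \<cdot> i ?n = v ?n \<cdot> i ?n" using r m n s' by simp
    qed (use r m n s' in simp_all)
    ultimately have "t ?m \<cdot> r = t ?n" using tr[OF \<mu> r] by blast
    then have "t ?m \<cdot> (r \<cdot> i ?n) = t ?n \<cdot> i ?n"
      using extend[of C "t ?m" r "t ?n" "i ?n"] r m n T[OF s'(2)] by simp
    then show ?thesis unfolding ri s_def using m us(1-3) T[OF s'(2)] zz by simp
  qed
  have "hom_fam (px z) u (px w) u' g"
    unfolding hom_fam_def
  proof (intro conjI allI impI ballI)
    fix \<mu> assume \<mu>: "\<mu> \<in> Arr simplex"
    let ?m = "sdom \<mu>" and ?n = "scod \<mu>"
    have s': "\<mu> \<in> Arr aug_simplex" "0 < ?m" "0 < ?n" using \<mu> by simp_all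
    note us = cart_simps[OF datumD(1)[OF u(1)] \<mu>] bspec[OF u(2) \<mu>]
    note us' = cart_simps[OF datumD(1)[OF u'(1)] \<mu>] bspec[OF u'(2) \<mu>]
    note gm = G[OF s'(2)] and gn = G[OF s'(3)]
    show "u' \<mu> \<cdot> g ?n = g ?m \<cdot> u \<mu>"
    proof (rule pb_eqI[OF C P, of "leg ?m" w])
      have "pb_fst C (leg ?m) w \<cdot> (u' \<mu> \<cdot> g ?n) = FArr A \<mu> \<cdot> pb_fst C (leg ?n) z"
        using zz w us'(1-3) gn s' by (simp add: extend[OF us'(4) C])
      also have "\<dots> = pb_fst C (leg ?m) w \<cdot> (g ?m \<cdot> u \<mu>)"
        using zz w us(1-4) gm(1-3) s' by (simp add: extend[OF gm(4) C])
      finally show "pb_fst C (leg ?m) w \<cdot> (u' \<mu> \<cdot> g ?n) = pb_fst C (leg ?m) w \<cdot> (g ?m \<cdot> u \<mu>)" .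
      have "pb_snd C (leg ?m) w \<cdot> (u' \<mu> \<cdot> g ?n) = s ?n"
        using zz w us'(1-3) gn s' by (simp add: extend[OF us'(5) C])
      also have "\<dots> = pb_snd C (leg ?m) w \<cdot> (g ?m \<cdot> u \<mu>)"
        using zz w us(1-3,5) gm(1-3) s' sc[OF \<mu>] by (simp add: extend[OF gm(5) C])
      finally show "pb_snd C (leg ?m) w \<cdot> (u' \<mu> \<cdot> g ?n) = pb_snd C (leg ?m) w \<cdot> (g ?m \<cdot> u \<mu>)" .
    qed (use s' zz w us(1-3) us'(1-3) gm(1-3) gn(1-3) in simp_all)
  qed (use G zz w in simp_all)
  from DC_arrI[OF u(1) u'(1) this]
  obtain f where f: "f \<in> Arr (slice C (FObj A 0))" "Dom (slice C (FObj A 0)) f = z" "Cod (slice C (FObj A 0)) f = w"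
    "FArr (comparison F) f = (fam (px z) (ph z), mor (px z) g (px w), fam (px w) (ph w))"
    using fully_faithfulD(1)[OF ff z w', of "(fam (px z) (ph z), mor (px z) g (px w), fam (px w) (ph w))"]
    by (auto simp: comparison_FObj comparison_fam[OF z] comparison_fam[OF w'] simp del: F_simps)
  obtain k where k: "f = (z, k, w)" using f(2,3) by (cases f) auto
  have kk: "(z, k, w) \<in> Arr (slice C (FObj A 0))" using f(1) k by simp
  have kg: "pg z k w n = g n" if "0 < n" for n
    using f(4) that unfolding k comparison_FArr prod.inject mor_inject by blast
  have kv: "k \<cdot> v n = t n" if n: "0 < n" for n
  proof (rule iso_cancel_right[OF C I(1)[OF n]])
    have "k \<cdot> pb_snd C (leg n) z = s n"
      using pg_simps(5)[OF kk, of n] G(5)[OF n] kg[OF n] by simp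
    then show "(k \<cdot> v n) \<cdot> i n = t n \<cdot> i n"
      using kk xv[OF n] I[OF n] by (simp add: s_def)
  qed (use kk xv[OF n] T[OF n] I[OF n] in simp_all)
  show ?thesis using that[of k] kk kv by simp
qed

text \<open>Two candidates that agree on every pullback of z have the same image under the
  comparison functor.\<close>

lemma faithful_imp_colimit_unique:
  assumes ff: "fully_faithful (slice C (FObj A 0)) DC (comparison F)"
    and p: "pulled_back C A z x v" and w: "arr w" "cod w = FObj A 0"
    and k: "arr k" "dom k = dom z" "cod k = dom w" "w \<cdot> k = z"
    and k': "arr k'" "dom k' = dom z" "cod k' = dom w" "w \<cdot> k' = z"
    and eq: "\<And>n. 0 < n ==> k \<cdot> v n = k' \<cdot> v n"
  shows "k = k'"
proof -
  note zz = pulled_backD(1,2)[OF p] and pb = pulled_backD(3)[OF p] and xv = pulled_backD(4-8)[OF p]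
  have z: "z \<in> Obj (slice C (FObj A 0))" and w': "w \<in> Obj (slice C (FObj A 0))" using zz w by simp_all
  note pz = pulled_back_chosen[OF z]
  have "pg z k w n = pg z k' w n" if n: "0 < n" for n
  proof -
    obtain i where i: "iso C i" "dom i = dom (px z n)" "cod i = dom (x n)" "x n \<cdot> i = px z n" "v n \<cdot> i = pv z n"
      using pullback_compare[OF C pb[OF n] pulled_backD(3)[OF pz n]] .
    have "k \<cdot> (v n \<cdot> i) = k' \<cdot> (v n \<cdot> i)"
      using i(1-3) k(1-3) k'(1-3) xv[OF n] extend[OF eq[OF n] C, of i] by simp
    then show ?thesis using i(5) by simp
  qed
  then have "FArr (comparison F) (z, k, w) = FArr (comparison F) (z, k', w)"
    unfolding comparison_FArr by (simp add: mor_inject)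
  then have "(z, k, w) = (z, k', w)"
    using zz w k k' by (intro fully_faithfulD(2)[OF ff z w']) simp_all
  then show ?thesis by simp
qed

lemma fully_faithful_imp_colimit_cond:
  assumes ff: "fully_faithful (slice C (FObj A 0)) DC (comparison F)"
  shows "colimit_cond C A"
  unfolding colimit_cond_def
proof (intro allI impI, elim conjE)
  fix z x v w t
  assume p: "pulled_back C A z x v" and w: "arr w" "cod w = FObj A 0"
    and t: "\<forall>n>0. t n \<in> hom C (dom (x n)) (dom w) \<and> w \<cdot> t n = z \<cdot> v n"
    and tr: "\<forall>\<mu>\<in>Arr simplex. \<forall>r\<in>hom C (dom (x (scod \<mu>))) (dom (x (sdom \<mu>))).
        x (sdom \<mu>) \<cdot> r = FArr A \<mu> \<cdot> x (scod \<mu>) \<and>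
        v (sdom \<mu>) \<cdot> r = v (scod \<mu>) \<longrightarrow>
        t (sdom \<mu>) \<cdot> r = t (scod \<mu>)"
  obtain k where k: "arr k" "dom k = dom z" "cod k = dom w" "w \<cdot> k = z" "\<And>n. 0 < n ==> k \<cdot> v n = t n"
  proof (rule full_imp_colimit_ex[OF ff p w, of t])
    show "arr (t n) \<and> dom (t n) = dom (x n) \<and> cod (t n) = dom w \<and> w \<cdot> t n = z \<cdot> v n" if "0 < n" for n
      using t that by simp
    fix \<mu> r assume "\<mu> \<in> Arr simplex" "arr r" "dom r = dom (x (scod \<mu>))"
      "cod r = dom (x (sdom \<mu>))"
      "x (sdom \<mu>) \<cdot> r = FArr A \<mu> \<cdot> x (scod \<mu>)"
      "v (sdom \<mu>) \<cdot> r = v (scod \<mu>)"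
    then show "t (sdom \<mu>) \<cdot> r = t (scod \<mu>)"
      using tr[rule_format, of \<mu> r] by simp
  qed blast
  show "\<exists>!k. k \<in> hom C (dom z) (dom w) \<and> w \<cdot> k = z \<and> (\<forall>n>0. k \<cdot> v n = t n)"
  proof (rule ex1I[of _ k])
    fix k' assume k': "k' \<in> hom C (dom z) (dom w) \<and> w \<cdot> k' = z \<and> (\<forall>n>0. k' \<cdot> v n = t n)"
    show "k' = k"
      using k k' by (rule_tac faithful_imp_colimit_unique[OF ff p w]) simp_all
  qed (use k in simp)
qed

text \<open>For fixed z and w an arrow g of the descent category yields the compatible family
  \<open>pv w n \<cdot> g n\<close>. Existence of the glued arrow makes the comparison functor
  surjective on this hom-set, uniqueness makes it injective.\<close>

lemma colimit_cond_imp_fully_faithful: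
  assumes cc: "colimit_cond C A"
  shows "fully_faithful (slice C (FObj A 0)) DC (comparison F)"
  unfolding fully_faithful_def
proof (intro ballI)
  fix z w assume z: "z \<in> Obj (slice C (FObj A 0))" and w: "w \<in> Obj (slice C (FObj A 0))"
  note p = pulled_back_chosen[OF z]
  have zz: "arr z" "cod z = FObj A 0" and ww: "arr w" "cod w = FObj A 0" using z w by simp_all
  obtain u where u: "datum (px z) (ph z) u"
    "\<forall>\<mu>\<in>Arr simplex. pv z (sdom \<mu>) \<cdot> u \<mu> = pv z (scod \<mu>)"
    using comparison_datum[OF z] .
  obtain u' where u': "datum (px w) (ph w) u'"
    "\<forall>\<mu>\<in>Arr simplex. pv w (sdom \<mu>) \<cdot> u' \<mu> = pv w (scod \<mu>)"
    using comparison_datum[OF w] .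
  let ?S = "slice C (FObj A 0)" let ?K = "comparison F"
  have ex: "\<exists>!k. k \<in> hom C (dom z) (dom w) \<and> w \<cdot> k = z \<and> (\<forall>n>0. k \<cdot> pv z n = pv w n \<cdot> g n)"
    if g: "hom_fam (px z) u (px w) u' g" for g
  proof (rule colimit_condD[OF cc p ww])
    note gs = hom_famD(1-4)[OF g]
    show "arr (pv w n \<cdot> g n) \<and> dom (pv w n \<cdot> g n) = dom (px z n) \<and> cod (pv w n \<cdot> g n) = dom w \<and>
       w \<cdot> (pv w n \<cdot> g n) = z \<cdot> pv z n" if n: "0 < n" for n
      using gs[OF n] zz ww pb_commute[OF P, of "leg n" z]
      by (simp add: extend[OF pb_commute[OF P, of "leg n" w, symmetric] C])
    fix \<mu> r assume \<mu>: "\<mu> \<in> Arr simplex" and r: "arr r" "dom r = dom (px z (scod \<mu>))"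
      "cod r = dom (px z (sdom \<mu>))"
      "px z (sdom \<mu>) \<cdot> r = FArr A \<mu> \<cdot> px z (scod \<mu>)"
      "pv z (sdom \<mu>) \<cdot> r = pv z (scod \<mu>)"
    let ?m = "sdom \<mu>" and ?n = "scod \<mu>"
    have s': "\<mu> \<in> Arr aug_simplex" "0 < ?m" "0 < ?n" using \<mu> by simp_all
    note us = cart_simps[OF datumD(1)[OF u(1)] \<mu>] bspec[OF u(2) \<mu>]
    note us' = cart_simps[OF datumD(1)[OF u'(1)] \<mu>] bspec[OF u'(2) \<mu>]
    \<comment> \<open>The two projections of a pullback determine an arrow into it, so quantifying
      over every r with these equations singles out the canonical transition.\<close>
    have ru: "r = u \<mu>" using us r zz by (rule_tac pb_eqI[OF C P, of "leg ?m" z]) simp_all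
    have "(pv w ?m \<cdot> g ?m) \<cdot> r = pv w ?m \<cdot> (g ?m \<cdot> u \<mu>)"
      unfolding ru using gs(1-3)[OF s'(2)] us(1-3) zz ww by simp
    also have "\<dots> = pv w ?m \<cdot> (u' \<mu> \<cdot> g ?n)" using hom_famD(5)[OF g \<mu>] by simp
    also have "\<dots> = pv w ?n \<cdot> g ?n"
      using gs(1-3)[OF s'(3)] us'(1-3) ww s' by (simp add: extend[OF us'(5) C])
    finally show "(pv w ?m \<cdot> g ?m) \<cdot> r = pv w ?n \<cdot> g ?n" .
  qed
  show "bij_betw (FArr ?K) (hom ?S z w) (hom DC (FObj ?K z) (FObj ?K w))"
    unfolding bij_betw_def
  proof
    show "inj_on (FArr ?K) (hom ?S z w)"
    proof (rule inj_onI)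
      fix f f' assume f: "f \<in> hom ?S z w" and f': "f' \<in> hom ?S z w" and eq: "FArr ?K f = FArr ?K f'"
      obtain k where k: "f = (z, k, w)" using f by (cases f) auto
      obtain k' where k': "f' = (z, k', w)" using f' by (cases f') auto
      have kk: "(z, k, w) \<in> Arr ?S" "(z, k', w) \<in> Arr ?S" using f f' k k' by simp_all
      have e: "pg z k w n = pg z k' w n" if "0 < n" for n
        using eq that unfolding k k' comparison_FArr prod.inject mor_inject by blast
      have hf: "hom_fam (px z) u (px w) u' (pg z k w)"
        by (rule comparison_hom_fam[OF kk(1) u u']) simp_all
      have "\<forall>n>0. k \<cdot> pv z n = pv w n \<cdot> pg z k w n" using pg_simps(5)[OF kk(1)] by simp
      moreover have "\<forall>n>0. k' \<cdot> pv z n = pv w n \<cdot> pg z k w n"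
        using pg_simps(5)[OF kk(2)] e by simp
      ultimately have "k = k'" using ex[OF hf] kk by auto
      then show "f = f'" using k k' by simp
    qed
    show "FArr ?K ` hom ?S z w = hom DC (FObj ?K z) (FObj ?K w)"
    proof
      show "FArr ?K ` hom ?S z w \<subseteq> hom DC (FObj ?K z) (FObj ?K w)"
        using comparison_functor by auto
      show "hom DC (FObj ?K z) (FObj ?K w) \<subseteq> FArr ?K ` hom ?S z w"
      proof
        fix h assume "h \<in> hom DC (FObj ?K z) (FObj ?K w)"
        then have h: "h \<in> Arr DC" "Dom DC h = fam (px z) (ph z)" "Cod DC h = fam (px w) (ph w)"
          by (simp_all add: comparison_FObj comparison_fam[OF z] comparison_fam[OF w] del: F_simps)
        obtain g where g: "hom_fam (px z) u (px w) u' g" "h = (fam (px z) (ph z), mor (px z) g (px w), fam (px w) (ph w))"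
          using DC_arrE2[OF h(1,2) u(1) h(3) u'(1)] .
        obtain k where k: "arr k" "dom k = dom z" "cod k = dom w" "w \<cdot> k = z"
           "\<And>n. 0 < n ==> k \<cdot> pv z n = pv w n \<cdot> g n"
          using ex[OF g(1)] by auto
        have kk: "(z, k, w) \<in> Arr ?S" using k zz ww by simp
        have "pg z k w n = g n" if n: "0 < n" for n
          using pg_simps[OF kk, of n] hom_famD(1-4)[OF g(1) n] k(5)[OF n] zz ww
          by (rule_tac pb_eqI[OF C P, of "leg n" w]) simp_all
        then have "FArr ?K (z, k, w) = h"
          unfolding comparison_FArr g(2) comparison_fam[OF z] comparison_fam[OF w] by (simp add: mor_inject)
        then show "h \<in> FArr ?K ` hom ?S z w" using kk by force
      qed
    qed
  qed
qed

text \<open>An isomorphism from the comparison image of z to the datum carries the chosen pullback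
  squares of z to pullback squares with the given objects x; compatibility with u comes from its
  commuting with the lifts.\<close>

lemma ess_surj_imp_gluing_cond:
  assumes es: "\<forall>\<alpha>\<in>Obj DC. \<exists>z\<in>Obj (slice C (FObj A 0)). \<exists>\<phi>. iso DC \<phi> \<and> Dom DC \<phi> = FObj (comparison F) z \<and> Cod DC \<phi> = \<alpha>"
  shows "gluing_cond C A"
  unfolding gluing_cond_def
proof (intro allI impI)
  fix x u assume c: "cart_family C A x u"
  obtain h where h: "cells x u h" using cells_exist[OF c] .
  then have d: "datum x h u" using c unfolding datum_def by blast
  then have "fam x h \<in> Obj DC" unfolding DC_obj by blast
  then obtain z \<phi> where z: "z \<in> Obj (slice C (FObj A 0))" and \<phi>': "iso DC \<phi>" "Dom DC \<phi> = FObj (comparison F) z" "Cod DC \<phi> = fam x h"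
    using es by blast
  note \<phi> = \<phi>'(1) \<phi>'(2)[unfolded comparison_FObj comparison_fam[OF z]] \<phi>'(3)
  obtain u0 where u0: "datum (px z) (ph z) u0"
    "\<forall>\<mu>\<in>Arr simplex. pv z (sdom \<mu>) \<cdot> u0 \<mu> = pv z (scod \<mu>)"
    using comparison_datum[OF z] .
  obtain g where g: "hom_fam (px z) u0 x u g" "\<phi> = (fam (px z) (ph z), mor (px z) g x, fam x h)"
    using DC_arrE2[OF iso_arr[OF \<phi>(1)] \<phi>(2) u0(1) \<phi>(3) d] .
  have gi: "iso C (g n)" if "0 < n" for n using DC_isoD[OF u0(1) d _ that] \<phi>(1) g(2) by blast
  note gs = hom_famD[OF g(1)]
  have "\<exists>j. arr j \<and> dom j = dom (x n) \<and> cod j = dom (px z n) \<and>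
    j \<cdot> g n = Ident C (dom (px z n)) \<and> g n \<cdot> j = Ident C (dom (x n))" if n: "0 < n" for n
    using isoD[OF C gi[OF n]] gs(2,3)[OF n] by metis
  then obtain j where "\<And>n. 0 < n ==> arr (j n) \<and> dom (j n) = dom (x n) \<and> cod (j n) = dom (px z n) \<and>
    j n \<cdot> g n = Ident C (dom (px z n)) \<and> g n \<cdot> j n = Ident C (dom (x n))" by metis
  then have J: "arr (j n)" "dom (j n) = dom (x n)" "cod (j n) = dom (px z n)"
    "j n \<cdot> g n = Ident C (dom (px z n))" "g n \<cdot> j n = Ident C (dom (x n))" if "0 < n" for n
    using that by blast+
  have zz: "arr z" "cod z = FObj A 0" using z by simp_all
  define v where "v n = pv z n \<cdot> j n" for n
  have V: "arr (v n)" "dom (v n) = dom (x n)" "cod (v n) = dom z" if "0 < n" for n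
    using J[OF that] zz by (simp_all add: v_def)
  have vg: "v n \<cdot> g n = pv z n" if n: "0 < n" for n
    using J[OF n] gs(1-3)[OF n] zz by (simp add: v_def)
  have "is_pullback C (leg n) z (x n) (v n)" if n: "0 < n" for n
  proof -
    have "px z n \<cdot> j n = x n \<cdot> (g n \<cdot> j n)"
      using gs(1-3)[OF n] J(1-3)[OF n] cart_familyD(1)[OF c n] by (simp add: extend[OF gs(4)[OF n] C])
    then have "px z n \<cdot> j n = x n" using J(5)[OF n] cart_familyD(1)[OF c n] by simp
    moreover have "iso C (j n)" using J[OF n] gs(1-3)[OF n] by (intro isoI[where g = "g n"]) simp_all
    ultimately show ?thesis
      using pullback_iso_left[OF C pulled_backD(3)[OF pulled_back_chosen[OF z] n], of "j n"] J[OF n] by (simp add: v_def)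
  qed
  then have "pulled_back C A z x v" using zz unfolding pulled_back_def by blast
  moreover have "v (sdom \<mu>) \<cdot> u \<mu> = v (scod \<mu>)" if \<mu>: "\<mu> \<in> Arr simplex" for \<mu>
  proof -
    let ?m = "sdom \<mu>" and ?n = "scod \<mu>"
    have s': "\<mu> \<in> Arr aug_simplex" "0 < ?m" "0 < ?n" using \<mu> by simp_all
    note us = cart_simps[OF datumD(1)[OF d] \<mu>]
    note us0 = cart_simps[OF datumD(1)[OF u0(1)] \<mu>] bspec[OF u0(2) \<mu>]
    have "(v ?m \<cdot> u \<mu>) \<cdot> g ?n = v ?m \<cdot> (g ?m \<cdot> u0 \<mu>)"
      using us(1-3) V[OF s'(2)] gs(1-3)[OF s'(3)] gs(5)[OF \<mu>] by simp
    also have "\<dots> = v ?n \<cdot> g ?n"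
      using us0(1-3,5) V[OF s'(2)] gs(1-3)[OF s'(2)] vg[OF s'(3)] by (simp add: extend[OF vg[OF s'(2)] C])
    finally show ?thesis
      using us(1-3) V[OF s'(2)] V[OF s'(3)] gs(1-3)[OF s'(3)]
      by (rule_tac iso_cancel_right[OF C gi[OF s'(3)]]) simp_all
  qed
  ultimately show "\<exists>z v. pulled_back C A z x v \<and>
     (\<forall>\<mu>\<in>Arr simplex. v (sdom \<mu>) \<cdot> u \<mu> = v (scod \<mu>))" by blast
qed

text \<open>The squares supplied by gluing and the chosen ones are pullbacks of the same cospans.
  Their comparison isomorphisms commute with the transitions because both families are compatible
  with the projections to z.\<close>

lemma gluing_cond_imp_ess_surj:
  assumes gc: "gluing_cond C A" and \<alpha>: "\<alpha> \<in> Obj DC"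
  shows "\<exists>z\<in>Obj (slice C (FObj A 0)). \<exists>\<phi>. iso DC \<phi> \<and> Dom DC \<phi> = FObj (comparison F) z \<and> Cod DC \<phi> = \<alpha>"
proof -
  obtain x h u where a: "\<alpha> = fam x h" and d: "datum x h u" using \<alpha> unfolding DC_obj by blast
  note c = datumD(1)[OF d]
  obtain z v where p: "pulled_back C A z x v"
    and vu: "\<forall>\<mu>\<in>Arr simplex. v (sdom \<mu>) \<cdot> u \<mu> = v (scod \<mu>)"
    using gc c unfolding gluing_cond_def by blast
  note zz = pulled_backD(1,2)[OF p] and xv = pulled_backD(4-8)[OF p]
  have z: "z \<in> Obj (slice C (FObj A 0))" using zz by simp
  obtain u0 where u0: "datum (px z) (ph z) u0"
    "\<forall>\<mu>\<in>Arr simplex. pv z (sdom \<mu>) \<cdot> u0 \<mu> = pv z (scod \<mu>)"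
    using comparison_datum[OF z] .
  have "\<exists>i. iso C i \<and> dom i = dom (px z n) \<and> cod i = dom (x n) \<and> x n \<cdot> i = px z n \<and>
     v n \<cdot> i = pv z n" if n: "0 < n" for n
    using pullback_compare[OF C pulled_backD(3)[OF p n] pulled_backD(3)[OF pulled_back_chosen[OF z] n]] by metis
  then obtain g where "\<And>n. 0 < n ==> iso C (g n) \<and> dom (g n) = dom (px z n) \<and> cod (g n) = dom (x n) \<and> x n \<cdot> g n = px z n \<and>
     v n \<cdot> g n = pv z n" by metis
  then have G: "iso C (g n)" "dom (g n) = dom (px z n)" "cod (g n) = dom (x n)" "x n \<cdot> g n = px z n"
     "v n \<cdot> g n = pv z n" if "0 < n" for n using that by blast+
  have "hom_fam (px z) u0 x u g"
    unfolding hom_fam_def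
  proof (intro conjI allI impI ballI)
    fix \<mu> assume \<mu>: "\<mu> \<in> Arr simplex"
    let ?m = "sdom \<mu>" and ?n = "scod \<mu>"
    have s': "\<mu> \<in> Arr aug_simplex" "0 < ?m" "0 < ?n" using \<mu> by simp_all
    note us = cart_simps[OF datumD(1)[OF d] \<mu>] bspec[OF vu \<mu>]
    note us0 = cart_simps[OF datumD(1)[OF u0(1)] \<mu>] bspec[OF u0(2) \<mu>]
    note gm = iso_arr[OF G(1)[OF s'(2)]] G(2-5)[OF s'(2)] and gn = iso_arr[OF G(1)[OF s'(3)]] G(2-5)[OF s'(3)]
    note xm = xv[OF s'(2)] and xn = xv[OF s'(3)]
    show "u \<mu> \<cdot> g ?n = g ?m \<cdot> u0 \<mu>"
    proof (rule pullback_eqI[OF pulled_backD(3)[OF p s'(2)] C])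
      have "x ?m \<cdot> (u \<mu> \<cdot> g ?n) = FArr A \<mu> \<cdot> px z ?n"
        using us(1-3) gn xm xn s' by (simp add: extend[OF us(4) C])
      also have "\<dots> = x ?m \<cdot> (g ?m \<cdot> u0 \<mu>)"
        using us0(1-4) gm(1-3) xm by (simp add: extend[OF gm(4) C])
      finally show "x ?m \<cdot> (u \<mu> \<cdot> g ?n) = x ?m \<cdot> (g ?m \<cdot> u0 \<mu>)" .
      have "v ?m \<cdot> (u \<mu> \<cdot> g ?n) = pv z ?n"
        using us(1-3) gn xm xn s' by (simp add: extend[OF us(5) C])
      also have "\<dots> = v ?m \<cdot> (g ?m \<cdot> u0 \<mu>)"
        using us0(1-3,5) gm(1-3) xm by (simp add: extend[OF gm(5) C])
      finally show "v ?m \<cdot> (u \<mu> \<cdot> g ?n) = v ?m \<cdot> (g ?m \<cdot> u0 \<mu>)" .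
    qed (use us(1-3) us0(1-3) gm(1-3) gn(1-3) xm in simp_all)
  qed (use G in auto)
  then have "iso DC (fam (px z) (ph z), mor (px z) g x, fam x h)"
    using G by (intro DC_isoI[OF u0(1) d]) simp_all
  moreover have "FObj (comparison F) z = fam (px z) (ph z)" using comparison_FObj comparison_fam[OF z] by metis
  ultimately show ?thesis
    by (intro bexI[OF _ z] exI[of _ "(fam (px z) (ph z), mor (px z) g x, fam x h)"]) (simp add: a del: F_simps)
qed

theorem equivalence_comparison_iff:
  "equivalence (slice C (FObj A 0)) DC (comparison F) \<longleftrightarrow> colimit_cond C A \<and> gluing_cond C A"
  using equivalence_iff[OF category_slice[OF C] category_DC] comparison_functor
    fully_faithful_imp_colimit_cond colimit_cond_imp_fully_faithful
    ess_surj_imp_gluing_cond gluing_cond_imp_ess_surj by blast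

end

section \<open>Fibre powers\<close>

text \<open>The product of n copies of p in the slice over \<open>Cod C p\<close>. The structure map
  b is carried alongside the projections so that n = 0 makes sense and gives the terminal object of
  the slice.\<close>

definition is_fpow :: "('o, 'm) cat \<Rightarrow> 'm \<Rightarrow> nat \<Rightarrow> 'm \<Rightarrow> (nat \<Rightarrow> 'm) \<Rightarrow> bool" where
  "is_fpow C p n b \<pi> \<longleftrightarrow> b \<in> Arr C \<and> Cod C b = Cod C p \<and>
     (\<forall>i<n. \<pi> i \<in> Arr C \<and> Dom C (\<pi> i) = Dom C b \<and> Cod C (\<pi> i) = Dom C p \<and> p \<cdot>[C] \<pi> i = b) \<and>
     (\<forall>t g. t \<in> Arr C \<and> Cod C t = Cod C p \<and>
        (\<forall>i<n. g i \<in> Arr C \<and> Dom C (g i) = Dom C t \<and> Cod C (g i) = Dom C p \<and> p \<cdot>[C] g i = t) \<longrightarrow>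
        (\<exists>!u. u \<in> hom C (Dom C t) (Dom C b) \<and> b \<cdot>[C] u = t \<and> (\<forall>i<n. \<pi> i \<cdot>[C] u = g i)))"

lemma is_fpowD:
  assumes "is_fpow C p n b \<pi>"
  shows "b \<in> Arr C" "Cod C b = Cod C p" "i < n ==> \<pi> i \<in> Arr C" "i < n ==> Dom C (\<pi> i) = Dom C b"
    "i < n ==> Cod C (\<pi> i) = Dom C p" "i < n ==> p \<cdot>[C] \<pi> i = b"
  using assms unfolding is_fpow_def by blast+

lemma fpow_ex1:
  assumes "is_fpow C p n b \<pi>" "t \<in> Arr C" "Cod C t = Cod C p"
    "\<And>i. i < n ==> g i \<in> Arr C \<and> Dom C (g i) = Dom C t \<and> Cod C (g i) = Dom C p \<and> p \<cdot>[C] g i = t"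
  shows "\<exists>!u. u \<in> hom C (Dom C t) (Dom C b) \<and> b \<cdot>[C] u = t \<and> (\<forall>i<n. \<pi> i \<cdot>[C] u = g i)"
  using assms unfolding is_fpow_def by blast

lemma fpow_eqI:
  assumes f: "is_fpow C p n b \<pi>" and C: "category C" and p: "p \<in> Arr C"
    and u: "u \<in> Arr C" "Cod C u = Dom C b" and v: "v \<in> Arr C" "Dom C v = Dom C u" "Cod C v = Dom C b"
    and eq: "b \<cdot>[C] u = b \<cdot>[C] v" "\<And>i. i < n ==> \<pi> i \<cdot>[C] u = \<pi> i \<cdot>[C] v"
  shows "u = v"
proof -
  define t g where "t = b \<cdot>[C] v" and "g i = \<pi> i \<cdot>[C] v" for i
  note d = is_fpowD[OF f]
  have t: "t \<in> Arr C" "Cod C t = Cod C p" "Dom C t = Dom C u" using C d(1,2) v by (simp_all add: t_def)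
  have g: "g i \<in> Arr C \<and> Dom C (g i) = Dom C t \<and> Cod C (g i) = Dom C p \<and> p \<cdot>[C] g i = t" if "i < n" for i
    using C p d(1-5) v that t by (simp add: g_def t_def extend[OF d(6)[OF that] C])
  have "\<exists>!u. u \<in> hom C (Dom C t) (Dom C b) \<and> b \<cdot>[C] u = t \<and> (\<forall>i<n. \<pi> i \<cdot>[C] u = g i)"
    by (rule fpow_ex1[OF f t(1,2) g])
  moreover have "u \<in> hom C (Dom C t) (Dom C b) \<and> b \<cdot>[C] u = t \<and> (\<forall>i<n. \<pi> i \<cdot>[C] u = g i)"
    using u t eq by (simp add: t_def[symmetric] g_def[symmetric])
  moreover have "v \<in> hom C (Dom C t) (Dom C b) \<and> b \<cdot>[C] v = t \<and> (\<forall>i<n. \<pi> i \<cdot>[C] v = g i)"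
    using v t by (simp add: t_def[symmetric] g_def[symmetric])
  ultimately show ?thesis by blast
qed

lemma is_fpow_0:
  assumes C: "category C" and p: "p \<in> Arr C"
  shows "is_fpow C p 0 (Ident C (Cod C p)) \<pi>"
  unfolding is_fpow_def using C p by auto

lemma is_fpow_1:
  assumes C: "category C" and p: "p \<in> Arr C"
  shows "is_fpow C p (Suc 0) p (\<lambda>i. Ident C (Dom C p))"
  unfolding is_fpow_def
proof (intro conjI allI impI)
  fix t g assume a: "t \<in> Arr C \<and> Cod C t = Cod C p \<and>
    (\<forall>i<Suc 0. g i \<in> Arr C \<and> Dom C (g i) = Dom C t \<and> Cod C (g i) = Dom C p \<and> p \<cdot>[C] g i = t)"
  then have g: "g 0 \<in> Arr C" "Dom C (g 0) = Dom C t" "Cod C (g 0) = Dom C p" "p \<cdot>[C] g 0 = t" by blast+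
  show "\<exists>!u. u \<in> hom C (Dom C t) (Dom C p) \<and> p \<cdot>[C] u = t \<and> (\<forall>i<Suc 0. Ident C (Dom C p) \<cdot>[C] u = g i)"
    using g C p by (intro ex1I[of _ "g 0"]) auto
qed (use C p in auto)

lemma is_fpow_Suc:
  assumes C: "category C" and p: "p \<in> Arr C" and f: "is_fpow C p n b \<pi>" and pb: "is_pullback C b p r q"
  shows "is_fpow C p (Suc n) (b \<cdot>[C] r) (\<lambda>i. if i = n then q else \<pi> i \<cdot>[C] r)"
proof -
  note d = is_fpowD[OF f] and s = pullback_simps[OF pb]
  note [simp] = C p d(1-5) s(2-8)
  have br: "b \<cdot>[C] r \<in> Arr C" "Dom C (b \<cdot>[C] r) = Dom C r" "Cod C (b \<cdot>[C] r) = Cod C p" by simp_all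
  show ?thesis
    unfolding is_fpow_def
  proof (intro conjI allI impI)
    fix i assume i: "i < Suc n"
    show "(if i = n then q else \<pi> i \<cdot>[C] r) \<in> Arr C" "Dom C (if i = n then q else \<pi> i \<cdot>[C] r) = Dom C (b \<cdot>[C] r)"
      "Cod C (if i = n then q else \<pi> i \<cdot>[C] r) = Dom C p"
      using i by auto
    show "p \<cdot>[C] (if i = n then q else \<pi> i \<cdot>[C] r) = b \<cdot>[C] r"
      using i s(9) extend[OF d(6) C, of i r] by auto
  next
    fix t g assume a: "t \<in> Arr C \<and> Cod C t = Cod C p \<and>
      (\<forall>i<Suc n. g i \<in> Arr C \<and> Dom C (g i) = Dom C t \<and> Cod C (g i) = Dom C p \<and> p \<cdot>[C] g i = t)"
    then have t: "t \<in> Arr C" "Cod C t = Cod C p"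
      and g: "\<And>i. i < Suc n ==> g i \<in> Arr C \<and> Dom C (g i) = Dom C t \<and> Cod C (g i) = Dom C p \<and> p \<cdot>[C] g i = t" by blast+
    obtain u where u: "u \<in> Arr C" "Dom C u = Dom C t" "Cod C u = Dom C b" "b \<cdot>[C] u = t" "\<And>i. i < n ==> \<pi> i \<cdot>[C] u = g i"
      using fpow_ex1[OF f t, of g] g by auto
    obtain w where w: "w \<in> Arr C" "Dom C w = Dom C t" "Cod C w = Dom C r" "r \<cdot>[C] w = u" "q \<cdot>[C] w = g n"
      using u g[of n] by (rule_tac pullback_lift[OF pb, of u "g n"]) simp_all
    show "\<exists>!u. u \<in> hom C (Dom C t) (Dom C (b \<cdot>[C] r)) \<and> (b \<cdot>[C] r) \<cdot>[C] u = t \<and>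
       (\<forall>i<Suc n. (if i = n then q else \<pi> i \<cdot>[C] r) \<cdot>[C] u = g i)"
    proof (rule ex1I[of _ w])
      show "w \<in> hom C (Dom C t) (Dom C (b \<cdot>[C] r)) \<and> (b \<cdot>[C] r) \<cdot>[C] w = t \<and>
       (\<forall>i<Suc n. (if i = n then q else \<pi> i \<cdot>[C] r) \<cdot>[C] w = g i)"
        using w u by (auto simp: less_Suc_eq)
    next
      fix v assume v: "v \<in> hom C (Dom C t) (Dom C (b \<cdot>[C] r)) \<and> (b \<cdot>[C] r) \<cdot>[C] v = t \<and>
       (\<forall>i<Suc n. (if i = n then q else \<pi> i \<cdot>[C] r) \<cdot>[C] v = g i)"
      then have v1: "v \<in> Arr C" "Dom C v = Dom C t" "Cod C v = Dom C r" by simp_all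
      have v2: "b \<cdot>[C] (r \<cdot>[C] v) = t" using v v1 by simp
      have v3: "\<pi> i \<cdot>[C] (r \<cdot>[C] v) = g i" if "i < n" for i
      proof -
        have "(if i = n then q else \<pi> i \<cdot>[C] r) \<cdot>[C] v = g i" using v that less_SucI by blast
        then show ?thesis using that v1 by simp
      qed
      have v4: "q \<cdot>[C] v = g n" using v by auto
      have "r \<cdot>[C] v = u"
        using v1 v2 v3 u by (rule_tac fpow_eqI[OF f C p]) simp_all
      then show "v = w" using v1 v4 w by (rule_tac pullback_eqI[OF pb C]) simp_all
    qed
  qed (use br in simp_all)
qed

text \<open>The 1-fold power is p itself and not a pullback of the 0-fold one, so the induction
  starts at 1 and the case n = 0 is added at the end.\<close>

lemma fib_pow_is_fpow:
  assumes C: "category C" and P: "has_pullbacks C" and p: "p \<in> Arr C"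
  shows "is_fpow C p n (fib_pow C p n) (fib_proj C p n)"
proof -
  have eq: "fib_proj C p (Suc (Suc n)) =
      (\<lambda>i. if i = Suc n then pb_snd C (fib_pow C p (Suc n)) p else fib_proj C p (Suc n) i \<cdot>[C] pb_fst C (fib_pow C p (Suc n)) p)" for n
    by (simp add: fun_eq_iff)
  have one: "fib_proj C p (Suc 0) = (\<lambda>i. Ident C (Dom C p))" by (simp add: fun_eq_iff)
  have *: "is_fpow C p (Suc n) (fib_pow C p (Suc n)) (fib_proj C p (Suc n))" for n
  proof (induction n)
    case 0
    show ?case using is_fpow_1[OF C p] by (simp add: one)
  next
    case (Suc n)
    note d = is_fpowD[OF Suc]
    have "is_pullback C (fib_pow C p (Suc n)) p (pb_fst C (fib_pow C p (Suc n)) p) (pb_snd C (fib_pow C p (Suc n)) p)"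
      using d by (intro chosen_pullback[OF P _ p]) auto
    from is_fpow_Suc[OF C p Suc this] show ?case unfolding eq by simp
  qed
  show ?thesis using * is_fpow_0[OF C p] by (cases n) auto
qed

section \<open>The Cech nerve as a functor\<close>

lemma fpow_arrow_ex1:
  assumes f: "is_fpow C p m b \<pi>" and f': "is_fpow C p n b' \<pi>'" and s: "(m, s, n) \<in> Arr aug_simplex"
  shows "\<exists>!u. u \<in> hom C (Dom C b') (Dom C b) \<and> b \<cdot>[C] u = b' \<and> (\<forall>i<m. \<pi> i \<cdot>[C] u = \<pi>' (s i))"
proof (rule fpow_ex1[OF f is_fpowD(1,2)[OF f']])
  fix i assume "i < m"
  then have "s i < n" using s by auto
  then show "\<pi>' (s i) \<in> Arr C \<and> Dom C (\<pi>' (s i)) = Dom C b' \<and> Cod C (\<pi>' (s i)) = Dom C p \<and> p \<cdot>[C] \<pi>' (s i) = b'"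
    using is_fpowD[OF f'] by blast
qed

lemma descent_diagram_obj: "FObj (descent_diagram C p) n = Dom C (fib_pow C p n)"
  by (simp add: descent_diagram_def)

lemma descent_diagram_arr:
  assumes C: "category C" and P: "has_pullbacks C" and p: "p \<in> Arr C" and s: "(m, s, n) \<in> Arr aug_simplex"
  defines "u \<equiv> FArr (descent_diagram C p) (m, s, n)"
  shows "u \<in> Arr C" "Dom C u = Dom C (fib_pow C p n)" "Cod C u = Dom C (fib_pow C p m)"
    "fib_pow C p m \<cdot>[C] u = fib_pow C p n" "i < m ==> fib_proj C p m i \<cdot>[C] u = fib_proj C p n (s i)"
proof -
  note f = fib_pow_is_fpow[OF C P p]
  have "u = (THE u. u \<in> hom C (Dom C (fib_pow C p n)) (Dom C (fib_pow C p m)) \<and>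
        fib_pow C p m \<cdot>[C] u = fib_pow C p n \<and>
        (\<forall>i<m. fib_proj C p m i \<cdot>[C] u = fib_proj C p n (s i)))"
    by (simp add: u_def descent_diagram_def)
  then have "u \<in> hom C (Dom C (fib_pow C p n)) (Dom C (fib_pow C p m)) \<and>
        fib_pow C p m \<cdot>[C] u = fib_pow C p n \<and>
        (\<forall>i<m. fib_proj C p m i \<cdot>[C] u = fib_proj C p n (s i))"
    using theI'[OF fpow_arrow_ex1[OF f f s]] by simp
  then show "u \<in> Arr C" "Dom C u = Dom C (fib_pow C p n)" "Cod C u = Dom C (fib_pow C p m)"
    "fib_pow C p m \<cdot>[C] u = fib_pow C p n" "i < m ==> fib_proj C p m i \<cdot>[C] u = fib_proj C p n (s i)"
    by simp_all
qed

text \<open>The 0-fold power has the identity of the base as structure map, so the equation over the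
  base alone already determines the arrow.\<close>

lemma descent_diagram_leg:
  assumes C: "category C" and P: "has_pullbacks C" and p: "p \<in> Arr C"
  shows "FArr (descent_diagram C p) (from_zero n) = fib_pow C p n"
proof -
  have z: "(0, (\<lambda>i\<in>{..<0}. i), n) \<in> Arr aug_simplex" using from_zero_simps(1)[of n] by (simp only: from_zero_def)
  note d = descent_diagram_arr[OF C P p z]
  show ?thesis using d(1,3,4) C p by (simp add: from_zero_def)
qed

text \<open>An arrow into a fibre power is determined by its structure map and its projections, and
  on the projections the diagram acts by reindexing, which is functorial.\<close>

lemma descent_diagram_functor:
  assumes C: "category C" and P: "has_pullbacks C" and p: "p \<in> Arr C"
  shows "is_functor aug_simplex (op_cat C) (descent_diagram C p)"
proof -
  note f = fib_pow_is_fpow[OF C P p] and d = descent_diagram_arr[OF C P p]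
  have fd: "fib_pow C p n \<in> Arr C" "i < n ==> fib_proj C p n i \<in> Arr C"
    "i < n ==> Dom C (fib_proj C p n i) = Dom C (fib_pow C p n)" for n i using is_fpowD[OF f] by blast+
  show ?thesis
    unfolding is_functor_def
  proof (intro conjI ballI impI)
    fix n show "FObj (descent_diagram C p) n \<in> Obj (op_cat C)" using fd C by (simp add: descent_diagram_obj)
    have i: "Ident aug_simplex n = (n, (\<lambda>i\<in>{..<n}. i), n)" by (simp add: aug_simplex_def)
    have "Ident aug_simplex n \<in> Arr aug_simplex" by simp
    note e = d[OF this[unfolded i]]
    have "FArr (descent_diagram C p) (n, (\<lambda>i\<in>{..<n}. i), n) = Ident C (Dom C (fib_pow C p n))"
      using e fd C p by (rule_tac fpow_eqI[OF f[of n] C p]) simp_all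
    then show "FArr (descent_diagram C p) (Ident aug_simplex n) = Ident (op_cat C) (FObj (descent_diagram C p) n)"
      unfolding i by (simp add: descent_diagram_obj)
  next
    fix \<mu> assume "\<mu> \<in> Arr aug_simplex"
    then show "FArr (descent_diagram C p) \<mu> \<in> hom (op_cat C)
       (FObj (descent_diagram C p) (sdom \<mu>)) (FObj (descent_diagram C p) (scod \<mu>))"
      using d by (cases \<mu>) (simp add: descent_diagram_obj del: aug_simplex_simps(4))
  next
    fix \<mu> \<tau> assume st: "\<mu> \<in> Arr aug_simplex" "\<tau> \<in> Arr aug_simplex" "scod \<mu> = sdom \<tau>"
    obtain k s m where \<mu>: "\<mu> = (k, s, m)" by (cases \<mu>)
    obtain t n where \<tau>: "\<tau> = (m, t, n)" using st(3) \<mu> by (cases \<tau>) auto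
    have c: "\<tau> \<cdot>[aug_simplex] \<mu> = (k, compose {..<k} t s, n)" by (simp add: \<mu> \<tau> aug_simplex_def)
    have "\<tau> \<cdot>[aug_simplex] \<mu> \<in> Arr aug_simplex" using st by (simp del: aug_simplex_simps(4))
    note e = d[OF this[unfolded c]] and e1 = d[OF st(1)[unfolded \<mu>]] and e2 = d[OF st(2)[unfolded \<tau>]]
    have s: "s i < m" if "i < k" for i using st(1) that unfolding \<mu> by auto
    have "FArr (descent_diagram C p) (k, compose {..<k} t s, n) =
        FArr (descent_diagram C p) (k, s, m) \<cdot>[C] FArr (descent_diagram C p) (m, t, n)"
    proof (rule fpow_eqI[OF f[of k] C p])
      show "fib_pow C p k \<cdot>[C] FArr (descent_diagram C p) (k, compose {..<k} t s, n) =
        fib_pow C p k \<cdot>[C] (FArr (descent_diagram C p) (k, s, m) \<cdot>[C] FArr (descent_diagram C p) (m, t, n))"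
        using e(4) e1(1-3) e2 fd C by (simp add: extend[OF e1(4) C])
      show "fib_proj C p k i \<cdot>[C] FArr (descent_diagram C p) (k, compose {..<k} t s, n) =
        fib_proj C p k i \<cdot>[C] (FArr (descent_diagram C p) (k, s, m) \<cdot>[C] FArr (descent_diagram C p) (m, t, n))" if i: "i < k" for i
        using e(5)[OF i] e1(1-3) e2(1-3) e2(5)[OF s[OF i]] fd(2,3)[OF i] C i
        by (simp add: extend[OF e1(5)[OF i] C] compose_def)
    qed (use e(1-3) e1(1-3) e2(1-3) fd C in simp_all)
    then show "FArr (descent_diagram C p) (\<tau> \<cdot>[aug_simplex] \<mu>) =
       FArr (descent_diagram C p) \<tau> \<cdot>[op_cat C] FArr (descent_diagram C p) \<mu>"
      unfolding c by (simp add: \<mu> \<tau>)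
  qed
qed

theorem effective_descent_iff:
  assumes C: "category C" and P: "has_pullbacks C" and p: "p \<in> Arr C"
  shows "effective_descent C p \<longleftrightarrow>
    colimit_cond C (descent_diagram C p) \<and> gluing_cond C (descent_diagram C p)"
proof -
  interpret aug_diagram C "descent_diagram C p"
    by unfold_locales (use assms descent_diagram_functor in auto)
  have "FObj (descent_diagram C p) 0 = Cod C p" using C p by (simp add: descent_diagram_obj)
  with equivalence_comparison_iff show ?thesis
    by (simp add: effective_descent_def descent_cat_def descent_pf_def)
qed

section \<open>Reflecting effective descent along a fully faithful functor\<close>

text \<open>Composing both legs with the isomorphism j keeps the square a pullback because j can be
  cancelled; afterwards the corner \<open>Dom C f\<close> is replaced along i.\<close>

lemma pullback_change_cospan:
  assumes C: "category C" and pb: "is_pullback C f g p q"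
    and i: "iso C i" "Dom C i = Dom C f" and j: "iso C j" "Dom C j = Cod C f"
    and f': "f' \<in> Arr C" "Dom C f' = Cod C i" "f' \<cdot>[C] i = j \<cdot>[C] f"
  shows "is_pullback C f' (j \<cdot>[C] g) (i \<cdot>[C] p) q"
proof -
  note s = pullback_simps[OF pb]
  note [simp] = C s(1-8) iso_arr[OF i(1)] iso_arr[OF j(1)] i(2) j(2)
  have "is_pullback C (j \<cdot>[C] f) (j \<cdot>[C] g) p q"
  proof (rule is_pullbackI)
    show "(j \<cdot>[C] f) \<cdot>[C] p = (j \<cdot>[C] g) \<cdot>[C] q" using s(9) by simp
  next
    fix u v assume uv [simp]: "u \<in> Arr C" "v \<in> Arr C" "Dom C u = Dom C v" "Cod C u = Dom C (j \<cdot>[C] f)"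
      "Cod C v = Dom C (j \<cdot>[C] g)" and eq: "(j \<cdot>[C] f) \<cdot>[C] u = (j \<cdot>[C] g) \<cdot>[C] v"
    have "f \<cdot>[C] u = g \<cdot>[C] v" using eq by (rule_tac iso_cancel_left[OF C j(1)]) simp_all
    then obtain w where "w \<in> Arr C" "Dom C w = Dom C u" "Cod C w = Dom C p" "p \<cdot>[C] w = u" "q \<cdot>[C] w = v"
      by (rule_tac pullback_lift[OF pb, of u v]) simp_all
    then show "\<exists>w\<in>Arr C. Dom C w = Dom C u \<and> Cod C w = Dom C p \<and> p \<cdot>[C] w = u \<and> q \<cdot>[C] w = v" by blast
  next
    fix a b assume "a \<in> Arr C" "b \<in> Arr C" "Dom C a = Dom C b" "Cod C a = Dom C p" "Cod C b = Dom C p"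
      "p \<cdot>[C] a = p \<cdot>[C] b" "q \<cdot>[C] a = q \<cdot>[C] b"
    then show "a = b" using pullback_eqI[OF pb C] by blast
  qed simp_all
  from pullback_change_base_left[OF C this i(1) _ f'] show ?thesis by simp
qed

locale ff_functor =
  fixes X :: "('o1, 'm1) cat" and Y :: "('o2, 'm2) cat" and \<Phi> :: "('o1, 'm1, 'o2, 'm2) funct"
  assumes X [simp]: "category X" and Y [simp]: "category Y" and \<Phi>: "is_functor X Y \<Phi>"
    and ff: "fully_faithful X Y \<Phi>" and PY [simp]: "has_pullbacks Y"
begin

lemmas \<Phi>_simps [simp] = functor_simps[OF \<Phi>]

text \<open>Essential rather than literal image, since pullbacks and glued objects in Y are
  determined only up to isomorphism.\<close>

definition in_image :: "'o2 \<Rightarrow> bool" where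
  "in_image Z \<longleftrightarrow> (\<exists>M\<in>Obj X. \<exists>\<phi>. iso Y \<phi> \<and> Dom Y \<phi> = FObj \<Phi> M \<and> Cod Y \<phi> = Z)"

lemma full:
  assumes "g \<in> Arr Y" "Dom Y g = FObj \<Phi> a" "Cod Y g = FObj \<Phi> b" "a \<in> Obj X" "b \<in> Obj X"
  obtains f where "f \<in> Arr X" "Dom X f = a" "Cod X f = b" "FArr \<Phi> f = g"
  using fully_faithfulD(1)[OF ff assms(4,5,1-3)] that by blast

lemma faithful:
  assumes "f \<in> Arr X" "f' \<in> Arr X" "Dom X f' = Dom X f" "Cod X f' = Cod X f" "FArr \<Phi> f = FArr \<Phi> f'"
  shows "f = f'"
  using assms by (intro fully_faithfulD(2)[OF ff, of "Dom X f" "Cod X f"]) simp_all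

text \<open>Mediating arrows are lifted from Y by fullness, and their equations by
  faithfulness.\<close>

lemma reflects_pullback:
  assumes a: "f \<in> Arr X" "g \<in> Arr X" "p \<in> Arr X" "q \<in> Arr X" "Cod X f = Cod X g" "Dom X q = Dom X p"
    "Cod X p = Dom X f" "Cod X q = Dom X g"
    and pb: "is_pullback Y (FArr \<Phi> f) (FArr \<Phi> g) (FArr \<Phi> p) (FArr \<Phi> q)"
  shows "is_pullback X f g p q"
proof -
  note [simp] = a
  show ?thesis
  proof (rule is_pullbackI)
    have "FArr \<Phi> (f \<cdot>[X] p) = FArr \<Phi> (g \<cdot>[X] q)"
      using pullback_simps(9)[OF pb] functor_simps(6)[OF \<Phi>] by simp
    then show "f \<cdot>[X] p = g \<cdot>[X] q" by (rule_tac faithful) simp_all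
  next
    fix u v assume uv: "u \<in> Arr X" "v \<in> Arr X" "Dom X u = Dom X v" "Cod X u = Dom X f" "Cod X v = Dom X g"
      and eq: "f \<cdot>[X] u = g \<cdot>[X] v"
    have "FArr \<Phi> f \<cdot>[Y] FArr \<Phi> u = FArr \<Phi> g \<cdot>[Y] FArr \<Phi> v"
      using functor_simps(6)[OF \<Phi>, of u f] functor_simps(6)[OF \<Phi>, of v g] uv eq by simp
    then obtain w where w: "w \<in> Arr Y" "Dom Y w = FObj \<Phi> (Dom X v)" "Cod Y w = FObj \<Phi> (Dom X p)"
      "FArr \<Phi> p \<cdot>[Y] w = FArr \<Phi> u" "FArr \<Phi> q \<cdot>[Y] w = FArr \<Phi> v"
      using uv by (rule_tac pullback_lift[OF pb, of "FArr \<Phi> u" "FArr \<Phi> v"]) simp_all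
    obtain k where k: "k \<in> Arr X" "Dom X k = Dom X v" "Cod X k = Dom X p" "FArr \<Phi> k = w"
      using full[OF w(1-3)] uv by auto
    have "p \<cdot>[X] k = u" using k w uv functor_simps(6)[OF \<Phi>, of k p] by (rule_tac faithful) simp_all
    moreover have "q \<cdot>[X] k = v" using k w uv functor_simps(6)[OF \<Phi>, of k q] by (rule_tac faithful) simp_all
    ultimately show "\<exists>w\<in>Arr X. Dom X w = Dom X u \<and> Cod X w = Dom X p \<and> p \<cdot>[X] w = u \<and> q \<cdot>[X] w = v"
      using k uv by (intro bexI[of _ k]) simp_all
  next
    fix a b assume ab: "a \<in> Arr X" "b \<in> Arr X" "Dom X a = Dom X b" "Cod X a = Dom X p" "Cod X b = Dom X p"
      and eq: "p \<cdot>[X] a = p \<cdot>[X] b" "q \<cdot>[X] a = q \<cdot>[X] b"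
    have "FArr \<Phi> p \<cdot>[Y] FArr \<Phi> a = FArr \<Phi> p \<cdot>[Y] FArr \<Phi> b"
      using functor_simps(6)[OF \<Phi>, of a p] functor_simps(6)[OF \<Phi>, of b p] ab eq by simp
    moreover have "FArr \<Phi> q \<cdot>[Y] FArr \<Phi> a = FArr \<Phi> q \<cdot>[Y] FArr \<Phi> b"
      using functor_simps(6)[OF \<Phi>, of a q] functor_simps(6)[OF \<Phi>, of b q] ab eq by simp
    ultimately have "FArr \<Phi> a = FArr \<Phi> b" using ab by (rule_tac pullback_eqI[OF pb Y]) simp_all
    then show "a = b" using ab by (rule_tac faithful) simp_all
  qed simp_all
qed

end

locale ff_functor_pb = ff_functor +
  assumes closed: "\<And>f g p q. f \<in> Arr X ==> g \<in> Arr X ==> Cod X f = Cod X g ==>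
    is_pullback Y (FArr \<Phi> f) (FArr \<Phi> g) p q ==> in_image (Dom Y p)"
begin

text \<open>The apex in Y lies in the essential image, so an isomorphic copy of the square is the
  image of a square in X, which is then reflected.\<close>

lemma creates_pullback:
  assumes f: "f \<in> Arr X" "g \<in> Arr X" "Cod X f = Cod X g"
  obtains p q where "is_pullback X f g p q" "is_pullback Y (FArr \<Phi> f) (FArr \<Phi> g) (FArr \<Phi> p) (FArr \<Phi> q)"
proof -
  let ?p = "pb_fst Y (FArr \<Phi> f) (FArr \<Phi> g)" and ?q = "pb_snd Y (FArr \<Phi> f) (FArr \<Phi> g)"
  have pb: "is_pullback Y (FArr \<Phi> f) (FArr \<Phi> g) ?p ?q"
    using f by (intro chosen_pullback) simp_all
  note s = pullback_simps[OF pb]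
  obtain M \<phi> where M: "M \<in> Obj X" and \<phi>: "iso Y \<phi>" "Dom Y \<phi> = FObj \<Phi> M" "Cod Y \<phi> = Dom Y ?p"
    using closed[OF f pb] unfolding in_image_def by blast
  note pb' = pullback_iso_left[OF Y pb \<phi>(1,3)]
  obtain p where p: "p \<in> Arr X" "Dom X p = M" "Cod X p = Dom X f" "FArr \<Phi> p = ?p \<cdot>[Y] \<phi>"
    using s \<phi> f M by (rule_tac full[of "?p \<cdot>[Y] \<phi>" M "Dom X f"]) simp_all
  obtain q where q: "q \<in> Arr X" "Dom X q = M" "Cod X q = Dom X g" "FArr \<Phi> q = ?q \<cdot>[Y] \<phi>"
    using s \<phi> f M by (rule_tac full[of "?q \<cdot>[Y] \<phi>" M "Dom X g"]) simp_all
  have "is_pullback Y (FArr \<Phi> f) (FArr \<Phi> g) (FArr \<Phi> p) (FArr \<Phi> q)" using pb' p q by simp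
  moreover from this have "is_pullback X f g p q" using f p q by (intro reflects_pullback) simp_all
  ultimately show ?thesis using that by blast
qed

lemma PX [simp]: "has_pullbacks X"
  unfolding has_pullbacks_def using creates_pullback by metis

text \<open>Any pullback in X is isomorphic to a created one, and that one is preserved by
  construction.\<close>

lemma preserves_pullback:
  assumes pb: "is_pullback X f g p q"
  shows "is_pullback Y (FArr \<Phi> f) (FArr \<Phi> g) (FArr \<Phi> p) (FArr \<Phi> q)"
proof -
  note s = pullback_simps[OF pb]
  obtain p' q' where pb': "is_pullback X f g p' q'" and pbY: "is_pullback Y (FArr \<Phi> f) (FArr \<Phi> g) (FArr \<Phi> p') (FArr \<Phi> q')"
    using creates_pullback[OF s(1,2,5)] .
  note s' = pullback_simps[OF pb']
  obtain i where i: "iso X i" "Dom X i = Dom X p" "Cod X i = Dom X p'" "p' \<cdot>[X] i = p" "q' \<cdot>[X] i = q"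
    using pullback_compare[OF X pb' pb] .
  have "FArr \<Phi> p' \<cdot>[Y] FArr \<Phi> i = FArr \<Phi> p" "FArr \<Phi> q' \<cdot>[Y] FArr \<Phi> i = FArr \<Phi> q"
    using functor_simps(6)[OF \<Phi>, of i p'] functor_simps(6)[OF \<Phi>, of i q'] i s' by simp_all
  moreover have "Cod Y (FArr \<Phi> i) = Dom Y (FArr \<Phi> p')" using i s' by simp
  ultimately show ?thesis
    using pullback_iso_left[OF Y pbY functor_iso[OF \<Phi> X i(1)]] by simp
qed

text \<open>The induction runs parallel to the construction of the chosen powers in X: each chosen
  pullback is preserved, so its image is the next fibre power of
  \<open>FArr \<Phi> p\<close>.\<close>

lemma image_fpow:
  assumes p: "p \<in> Arr X"
  shows "is_fpow Y (FArr \<Phi> p) n (FArr \<Phi> (fib_pow X p n)) (\<lambda>i. FArr \<Phi> (fib_proj X p n i))"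
proof -
  have *: "is_fpow Y (FArr \<Phi> p) (Suc n) (FArr \<Phi> (fib_pow X p (Suc n))) (\<lambda>i. FArr \<Phi> (fib_proj X p (Suc n) i))" for n
  proof (induction n)
    case 0
    show ?case using is_fpow_1[OF Y, of "FArr \<Phi> p"] p by simp
  next
    case (Suc n)
    let ?b = "fib_pow X p (Suc n)"
    note d = is_fpowD[OF fib_pow_is_fpow[OF X PX p, of "Suc n"]]
    have pb: "is_pullback X ?b p (pb_fst X ?b p) (pb_snd X ?b p)"
      using d(1,2) by (intro chosen_pullback[OF PX _ p])
    have b: "FArr \<Phi> ?b \<cdot>[Y] FArr \<Phi> (pb_fst X ?b p) = FArr \<Phi> (fib_pow X p (Suc (Suc n)))"
      using functor_simps(6)[OF \<Phi>, of "pb_fst X ?b p" ?b] d(1,2) p by simp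
    have "(if i = Suc n then FArr \<Phi> (pb_snd X ?b p) else FArr \<Phi> (fib_proj X p (Suc n) i) \<cdot>[Y] FArr \<Phi> (pb_fst X ?b p)) =
      FArr \<Phi> (fib_proj X p (Suc (Suc n)) i)" if "i < Suc (Suc n)" for i
      using functor_simps(6)[OF \<Phi>, of "pb_fst X ?b p" "fib_proj X p (Suc n) i"] d(1,2) d(3,4)[of i] p that by auto
    then have e: "is_fpow Y (FArr \<Phi> p) (Suc (Suc n)) b (\<lambda>i. if i = Suc n then FArr \<Phi> (pb_snd X ?b p) else FArr \<Phi> (fib_proj X p (Suc n) i) \<cdot>[Y] FArr \<Phi> (pb_fst X ?b p))
      \<longleftrightarrow> is_fpow Y (FArr \<Phi> p) (Suc (Suc n)) b (\<lambda>i. FArr \<Phi> (fib_proj X p (Suc (Suc n)) i))" for b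
      unfolding is_fpow_def by simp
    show ?case using is_fpow_Suc[OF Y _ Suc preserves_pullback[OF pb]] p unfolding b e by simp
  qed
  show ?thesis using * is_fpow_0[OF Y, of "FArr \<Phi> p" "\<lambda>i. FArr \<Phi> (fib_proj X p 0 i)"] p by (cases n) simp_all
qed

text \<open>The image of the nerve of p and the chosen nerve of \<open>FArr \<Phi> p\<close> consist
  of fibre powers of the same arrow. The unique comparison \<theta> between them is natural, as its
  structure maps and projections show.\<close>

lemma nerve_comparison:
  assumes p: "p \<in> Arr X"
  defines "A \<equiv> descent_diagram X p" and "A' \<equiv> descent_diagram Y (FArr \<Phi> p)"
  obtains \<theta> where "\<And>n. iso Y (\<theta> n)" "\<And>n. Dom Y (\<theta> n) = FObj \<Phi> (FObj A n)" "\<And>n. Cod Y (\<theta> n) = FObj A' n"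
    "\<And>\<mu>. \<mu> \<in> Arr aug_simplex ==> FArr A' \<mu> \<cdot>[Y] \<theta> (scod \<mu>) = \<theta> (sdom \<mu>) \<cdot>[Y] FArr \<Phi> (FArr A \<mu>)"
    "\<And>n. FArr A' (from_zero n) \<cdot>[Y] \<theta> n = FArr \<Phi> (FArr A (from_zero n))"
proof -
  have p': "FArr \<Phi> p \<in> Arr Y" using p by simp
  note f = image_fpow[OF p] and f' = fib_pow_is_fpow[OF Y PY p']
  let ?b = "fib_pow Y (FArr \<Phi> p)" and ?\<pi> = "fib_proj Y (FArr \<Phi> p)"
  note dX = is_fpowD[OF fib_pow_is_fpow[OF X PX p]] and d = is_fpowD[OF f] and d' = is_fpowD[OF f']
  have "\<exists>t. t \<in> Arr Y \<and> Dom Y t = Dom Y (FArr \<Phi> (fib_pow X p n)) \<and> Cod Y t = Dom Y (?b n) \<and> ?b n \<cdot>[Y] t = FArr \<Phi> (fib_pow X p n)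
    \<and> (\<forall>i<n. ?\<pi> n i \<cdot>[Y] t = FArr \<Phi> (fib_proj X p n i))" for n
    using fpow_ex1[OF f'[of n] d(1,2)[of n], of "\<lambda>i. FArr \<Phi> (fib_proj X p n i)"] d(1,2)[of n] d(3-6)[of _ n] by auto
  then obtain \<theta> where T: "\<And>n. \<theta> n \<in> Arr Y" "\<And>n. Dom Y (\<theta> n) = Dom Y (FArr \<Phi> (fib_pow X p n))"
    "\<And>n. Cod Y (\<theta> n) = Dom Y (?b n)" "\<And>n. ?b n \<cdot>[Y] \<theta> n = FArr \<Phi> (fib_pow X p n)"
    "\<And>n i. i < n ==> ?\<pi> n i \<cdot>[Y] \<theta> n = FArr \<Phi> (fib_proj X p n i)" by metis
  have iso: "iso Y (\<theta> n)" for n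
  proof -
    obtain s where s: "s \<in> Arr Y" "Dom Y s = Dom Y (?b n)" "Cod Y s = Dom Y (FArr \<Phi> (fib_pow X p n))"
      "FArr \<Phi> (fib_pow X p n) \<cdot>[Y] s = ?b n" "\<And>i. i < n ==> FArr \<Phi> (fib_proj X p n i) \<cdot>[Y] s = ?\<pi> n i"
      using fpow_ex1[OF f[of n] d'(1,2)[of n], of "?\<pi> n"] d'(1,2)[of n] d'(3-6)[of _ n] by auto
    have "s \<cdot>[Y] \<theta> n = Ident Y (Dom Y (\<theta> n))"
      using s T(1-3)[of n] d(1,2)[of n] d(3-6)[of _ n]
      by (rule_tac fpow_eqI[OF f[of n] Y p']) (simp_all add: extend[OF s(4) Y] extend[OF s(5) Y] T(4,5))
    moreover have "\<theta> n \<cdot>[Y] s = Ident Y (Cod Y (\<theta> n))"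
      using s T(1-3)[of n] d'(1,2)[of n] d'(3-6)[of _ n]
      by (rule_tac fpow_eqI[OF f'[of n] Y p']) (simp_all add: extend[OF T(4) Y] extend[OF T(5) Y])
    ultimately show ?thesis using s T(1-3) by (intro isoI[where g = s]) simp_all
  qed
  have legs: "FArr A' (from_zero n) = ?b n" "FArr A (from_zero n) = fib_pow X p n" for n
    unfolding A_def A'_def using descent_diagram_leg[OF Y PY p'] descent_diagram_leg[OF X PX p] by simp_all
  show ?thesis
  proof (rule that[of \<theta>])
    show "Dom Y (\<theta> n) = FObj \<Phi> (FObj A n)" for n
      using T(2)[of n] dX(1)[of n] by (simp add: A_def descent_diagram_obj)
    show "Cod Y (\<theta> n) = FObj A' n" for n using T(3) by (simp add: A'_def descent_diagram_obj)
    show "FArr A' (from_zero n) \<cdot>[Y] \<theta> n = FArr \<Phi> (FArr A (from_zero n))" for n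
      unfolding legs by (rule T(4))
    fix \<mu> assume \<mu>: "\<mu> \<in> Arr aug_simplex"
    obtain m s n where [simp]: "\<mu> = (m, s, n)" by (cases \<mu>)
    note e = descent_diagram_arr[OF X PX p \<mu>[simplified \<open>\<mu> = (m, s, n)\<close>], folded A_def]
    note e' = descent_diagram_arr[OF Y PY p' \<mu>[simplified \<open>\<mu> = (m, s, n)\<close>], folded A'_def]
    have sn: "s i < n" if "i < m" for i using \<mu> that by auto
    have "FArr A' (m, s, n) \<cdot>[Y] \<theta> n = \<theta> m \<cdot>[Y] FArr \<Phi> (FArr A (m, s, n))"
    proof (rule fpow_eqI[OF f'[of m] Y p'])
      have "?b m \<cdot>[Y] (FArr A' (m, s, n) \<cdot>[Y] \<theta> n) = FArr \<Phi> (fib_pow X p n)"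
        using e'(1-3) T(1-3) d'(1) by (simp add: extend[OF e'(4) Y] T(4))
      also have "\<dots> = FArr \<Phi> (fib_pow X p m) \<cdot>[Y] FArr \<Phi> (FArr A (m, s, n))"
        using e functor_simps(6)[OF \<Phi>, of "FArr A (m, s, n)" "fib_pow X p m"] dX(1) by simp
      also have "\<dots> = ?b m \<cdot>[Y] (\<theta> m \<cdot>[Y] FArr \<Phi> (FArr A (m, s, n)))"
        using e(1-3) T(1-3) d'(1) dX(1) by (simp add: extend[OF T(4) Y])
      finally show "?b m \<cdot>[Y] (FArr A' (m, s, n) \<cdot>[Y] \<theta> n) = ?b m \<cdot>[Y] (\<theta> m \<cdot>[Y] FArr \<Phi> (FArr A (m, s, n)))" .
      fix i assume i: "i < m"
      have "?\<pi> m i \<cdot>[Y] (FArr A' (m, s, n) \<cdot>[Y] \<theta> n) = FArr \<Phi> (fib_proj X p n (s i))"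
        using e'(1-3) T(1-3) d'(3,4)[OF i] T(5)[OF sn[OF i]] by (simp add: extend[OF e'(5)[OF i] Y])
      also have "\<dots> = FArr \<Phi> (fib_proj X p m i) \<cdot>[Y] FArr \<Phi> (FArr A (m, s, n))"
        using e(1-3) e(5)[OF i] functor_simps(6)[OF \<Phi>, of "FArr A (m, s, n)" "fib_proj X p m i"] dX(3,4)[OF i] by simp
      also have "\<dots> = ?\<pi> m i \<cdot>[Y] (\<theta> m \<cdot>[Y] FArr \<Phi> (FArr A (m, s, n)))"
        using e(1-3) T(1-3) d'(3,4)[OF i] dX(1) by (simp add: extend[OF T(5)[OF i] Y])
      finally show "?\<pi> m i \<cdot>[Y] (FArr A' (m, s, n) \<cdot>[Y] \<theta> n) = ?\<pi> m i \<cdot>[Y] (\<theta> m \<cdot>[Y] FArr \<Phi> (FArr A (m, s, n)))" .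
    qed (use e(1-3) e'(1-3) T(1-3) dX(1) in simp_all)
    then show "FArr A' \<mu> \<cdot>[Y] \<theta> (scod \<mu>) = \<theta> (sdom \<mu>) \<cdot>[Y] FArr \<Phi> (FArr A \<mu>)" by simp
  qed (rule iso)
qed

end

text \<open>A monomorphism with a right inverse is invertible, so the condition says that p does not
  factor through a proper subobject. The right inverse is the form in which the condition is both
  produced and used.\<close>

definition extremal :: "('o, 'm) cat \<Rightarrow> 'm \<Rightarrow> bool" where
  "extremal C p \<longleftrightarrow> (\<forall>i p'. monic C i \<and> p' \<in> Arr C \<and> Cod C p' = Dom C i \<and> i \<cdot>[C] p' = p \<longrightarrow>
     (\<exists>k\<in>Arr C. Dom C k = Cod C i \<and> Cod C k = Dom C i \<and> i \<cdot>[C] k = Ident C (Cod C i)))"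

lemma monicD:
  assumes "monic C f" "u \<in> Arr C" "v \<in> Arr C" "Dom C u = Dom C v" "Cod C u = Dom C f" "Cod C v = Dom C f"
    "f \<cdot>[C] u = f \<cdot>[C] v"
  shows "u = v"
  using assms unfolding monic_def by blast

lemma pullback_ident:
  assumes "category C" "f \<in> Arr C" "Dom C f = a" "Cod C f = b"
  shows "is_pullback C f (Ident C b) (Ident C a) f"
  using assms by (intro is_pullbackI) auto

text \<open>The colimit condition is applied to the identity of the base, whose pullbacks are the
  fibre powers themselves. If p is i after p', a projection followed by p' gives a cocone with
  values in the domain of i, compatible because i is monic, and the induced arrow is the right
  inverse of i.\<close>

lemma colimit_cond_extremal:
  assumes C: "category C" and P: "has_pullbacks C" and p: "p \<in> Arr C"
    and cc: "colimit_cond C (descent_diagram C p)"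
  shows "extremal C p"
  unfolding extremal_def
proof (intro allI impI, elim conjE)
  fix i p' assume i: "monic C i" and p': "p' \<in> Arr C" "Cod C p' = Dom C i" "i \<cdot>[C] p' = p"
  let ?A = "descent_diagram C p" let ?b = "fib_pow C p" let ?\<pi> = "fib_proj C p"
  interpret aug_diagram C ?A
    by unfold_locales (use C P p descent_diagram_functor in auto)
  note d = is_fpowD[OF fib_pow_is_fpow[OF C P p]]
  note l = descent_diagram_leg[OF C P p]
  have ia: "i \<in> Arr C" using i unfolding monic_def by blast
  have ci: "Cod C i = Cod C p" "Dom C p = Dom C p'" using p'(1,2) ia C unfolding p'(3)[symmetric] by simp_all
  have A0: "FObj ?A 0 = Cod C p" using C p by (simp add: descent_diagram_obj)
  have pb: "pulled_back C ?A (Ident C (Cod C p)) (\<lambda>n. Ident C (FObj ?A n)) ?b"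
    unfolding pulled_back_def using C p d(1,2) pullback_ident[OF C]
    by (simp add: A0 l descent_diagram_obj)
  \<comment> \<open>Projection number 0 exists because n is positive. Any other projection would
    give the same arrow, since i is monic and the composite with i is the structure map.\<close>
  define t where "t n = p' \<cdot>[C] ?\<pi> n 0" for n
  have t: "t n \<in> Arr C" "Dom C (t n) = FObj ?A n" "Cod C (t n) = Dom C i" "i \<cdot>[C] t n = ?b n" if n: "0 < n" for n
    using d(1,2)[of n] d(3-6)[OF n] C p p'(1,2) ia ci
    by (simp_all add: t_def descent_diagram_obj extend[OF p'(3) C])
  have tr: "t (sdom \<mu>) \<cdot>[C] r = t (scod \<mu>)"
    if \<mu>: "\<mu> \<in> Arr simplex" and r: "r \<in> Arr C" "Dom C r = Dom C (Ident C (FObj ?A (scod \<mu>)))"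
      "Cod C r = Dom C (Ident C (FObj ?A (sdom \<mu>)))"
      "?b (sdom \<mu>) \<cdot>[C] r = ?b (scod \<mu>)" for \<mu> r
  proof -
    let ?m = "sdom \<mu>" and ?n = "scod \<mu>"
    have s': "0 < ?m" "0 < ?n" using \<mu> by simp_all
    note tm = t[OF s'(1)] and tn = t[OF s'(2)]
    have rr: "Dom C r = FObj ?A ?n" "Cod C r = FObj ?A ?m" using r(2,3) by simp_all
    have "i \<cdot>[C] (t ?m \<cdot>[C] r) = ?b ?m \<cdot>[C] r"
      by (rule extend[OF tm(4) C]) (simp_all only: tm tn ia r(1) rr)
    then have "i \<cdot>[C] (t ?m \<cdot>[C] r) = i \<cdot>[C] t ?n" unfolding tn(4) r(4) .
    moreover have "t ?m \<cdot>[C] r \<in> Arr C" "Dom C (t ?m \<cdot>[C] r) = Dom C (t ?n)" "Cod C (t ?m \<cdot>[C] r) = Dom C i"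
      using category_simps(6,7,8)[OF C r(1) tm(1)] tm(2,3) tn(2) rr by metis+
    ultimately show ?thesis using monicD[OF i _ tn(1) _ _ tn(3)] by blast
  qed
  obtain k where k: "k \<in> Arr C" "Dom C k = Cod C p" "Cod C k = Dom C i" "i \<cdot>[C] k = Ident C (Cod C p)"
  proof -
    have "\<exists>!k. k \<in> hom C (Dom C (Ident C (Cod C p))) (Dom C i) \<and> i \<cdot>[C] k = Ident C (Cod C p) \<and> (\<forall>n>0. k \<cdot>[C] ?b n = t n)"
    proof (rule colimit_condD[OF cc pb ia])
      show "Cod C i = FObj ?A 0" using ci A0 by simp
      show "t n \<in> Arr C \<and> Dom C (t n) = Dom C (Ident C (FObj ?A n)) \<and> Cod C (t n) = Dom C i \<and>
        i \<cdot>[C] t n = Ident C (Cod C p) \<cdot>[C] ?b n" if n: "0 < n" for n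
        using t[OF n] d(1,2)[of n] C p by simp
    qed (rule tr)
    then obtain k where "k \<in> hom C (Dom C (Ident C (Cod C p))) (Dom C i) \<and> i \<cdot>[C] k = Ident C (Cod C p)" by blast
    then show thesis using that[of k] C p by simp
  qed
  then show "\<exists>k\<in>Arr C. Dom C k = Cod C i \<and> Cod C k = Dom C i \<and> i \<cdot>[C] k = Ident C (Cod C i)"
    using ci by auto
qed

section \<open>Transfer of both conditions along the functor\<close>

context ff_functor_pb
begin

lemma comp_image:
  assumes "FArr \<Phi> f \<cdot>[Y] FArr \<Phi> g = FArr \<Phi> h \<cdot>[Y] FArr \<Phi> k"
    "f \<in> Arr X" "g \<in> Arr X" "h \<in> Arr X" "k \<in> Arr X" "Cod X g = Dom X f" "Cod X k = Dom X h"
    "Dom X g = Dom X k" "Cod X f = Cod X h"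
  shows "f \<cdot>[X] g = h \<cdot>[X] k"
  using assms by (rule_tac faithful) simp_all

lemma image_comp:
  assumes "f \<cdot>[X] g = h \<cdot>[X] k" "f \<in> Arr X" "g \<in> Arr X" "h \<in> Arr X" "k \<in> Arr X"
    "Cod X g = Dom X f" "Cod X k = Dom X h"
  shows "FArr \<Phi> f \<cdot>[Y] FArr \<Phi> g = FArr \<Phi> h \<cdot>[Y] FArr \<Phi> k"
  using \<Phi>_simps(6)[of g f] \<Phi>_simps(6)[of k h] assms by simp

text \<open>Here \<open>A'\<close> stands for the chosen diagram in Y, and \<theta> compares it with
  the image of A. At 0 the two agree literally, because a nerve has the base itself there.\<close>

context
  fixes A A' \<theta>
  assumes AX: "aug_diagram X A" and AY: "aug_diagram Y A'"
    and \<theta>: "\<And>n. iso Y (\<theta> n)" "\<And>n. Dom Y (\<theta> n) = FObj \<Phi> (FObj A n)" "\<And>n. Cod Y (\<theta> n) = FObj A' n"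
    and \<theta>nat: "\<And>\<mu>. \<mu> \<in> Arr aug_simplex ==> FArr A' \<mu> \<cdot>[Y] \<theta> (scod \<mu>) = \<theta> (sdom \<mu>) \<cdot>[Y] FArr \<Phi> (FArr A \<mu>)"
    and \<theta>leg: "\<And>n. FArr A' (from_zero n) \<cdot>[Y] \<theta> n = FArr \<Phi> (FArr A (from_zero n))"
    and A0: "FObj A' 0 = FObj \<Phi> (FObj A 0)"
begin

interpretation AX: aug_diagram X A by (rule AX)
interpretation AY: aug_diagram Y A' by (rule AY)

lemma \<theta>_simps [simp]: "\<theta> n \<in> Arr Y" "Dom Y (\<theta> n) = FObj \<Phi> (FObj A n)" "Cod Y (\<theta> n) = FObj A' n"
  using \<theta> by auto

text \<open>The legs of the two diagrams agree up to \<theta>, which is absorbed into the arrows to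
  the diagram.\<close>

lemma pulled_back_transfer:
  assumes p: "pulled_back X A z x v"
  shows "pulled_back Y A' (FArr \<Phi> z) (\<lambda>n. \<theta> n \<cdot>[Y] FArr \<Phi> (x n)) (\<lambda>n. FArr \<Phi> (v n))"
proof -
  note zz = AX.pulled_backD(1,2)[OF p] and pb = AX.pulled_backD(3)[OF p]
  have "is_pullback Y (FArr A' (from_zero n)) (FArr \<Phi> z) (\<theta> n \<cdot>[Y] FArr \<Phi> (x n)) (FArr \<Phi> (v n))" if n: "0 < n" for n
    by (rule pullback_change_base_left[OF Y preserves_pullback[OF pb[OF n]] \<theta>(1)])
      (simp_all add: \<theta>leg)
  then show ?thesis using zz by (simp add: pulled_back_def A0)
qed

text \<open>Applying \<Phi> to a test family over A gives one over \<open>A'\<close>: by fullness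
  every transition in Y between the objects concerned comes from X, so compatibility is inherited.
  The arrow found in Y lifts back, and uniqueness follows from faithfulness.\<close>

lemma colimit_cond_transfer:
  assumes cc: "colimit_cond Y A'"
  shows "colimit_cond X A"
  unfolding colimit_cond_def
proof (intro allI impI, elim conjE)
  fix z x v w t
  assume p: "pulled_back X A z x v" and w: "w \<in> Arr X" "Cod X w = FObj A 0"
    and t: "\<forall>n>0. t n \<in> hom X (Dom X (x n)) (Dom X w) \<and> w \<cdot>[X] t n = z \<cdot>[X] v n"
    and tr: "\<forall>\<mu>\<in>Arr simplex. \<forall>r\<in>hom X (Dom X (x (scod \<mu>))) (Dom X (x (sdom \<mu>))).
        x (sdom \<mu>) \<cdot>[X] r = FArr A \<mu> \<cdot>[X] x (scod \<mu>) \<and>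
        v (sdom \<mu>) \<cdot>[X] r = v (scod \<mu>) \<longrightarrow>
        t (sdom \<mu>) \<cdot>[X] r = t (scod \<mu>)"
  note zz = AX.pulled_backD(1,2)[OF p] and xv = AX.pulled_backD(4-8)[OF p]
  have T: "t n \<in> Arr X" "Dom X (t n) = Dom X (x n)" "Cod X (t n) = Dom X w" "w \<cdot>[X] t n = z \<cdot>[X] v n" if "0 < n" for n
    using t that by auto
  have TR: "t (sdom \<mu>) \<cdot>[X] r = t (scod \<mu>)"
    if "\<mu> \<in> Arr simplex" "r \<in> Arr X" "Dom X r = Dom X (x (scod \<mu>))" "Cod X r = Dom X (x (sdom \<mu>))"
      "x (sdom \<mu>) \<cdot>[X] r = FArr A \<mu> \<cdot>[X] x (scod \<mu>)"
        "v (sdom \<mu>) \<cdot>[X] r = v (scod \<mu>)" for \<mu> r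
    using tr[rule_format, of \<mu> r] that by simp
  let ?x = "\<lambda>n. \<theta> n \<cdot>[Y] FArr \<Phi> (x n)"
  have ex: "\<exists>!k. k \<in> hom Y (Dom Y (FArr \<Phi> z)) (Dom Y (FArr \<Phi> w)) \<and> FArr \<Phi> w \<cdot>[Y] k = FArr \<Phi> z \<and>
    (\<forall>n>0. k \<cdot>[Y] FArr \<Phi> (v n) = FArr \<Phi> (t n))"
  proof (rule AY.colimit_condD[OF cc pulled_back_transfer[OF p]])
    show "FArr \<Phi> w \<in> Arr Y" "Cod Y (FArr \<Phi> w) = FObj A' 0" using w A0 by simp_all
    show "FArr \<Phi> (t n) \<in> Arr Y \<and> Dom Y (FArr \<Phi> (t n)) = Dom Y (?x n) \<and> Cod Y (FArr \<Phi> (t n)) = Dom Y (FArr \<Phi> w) \<and>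
      FArr \<Phi> w \<cdot>[Y] FArr \<Phi> (t n) = FArr \<Phi> z \<cdot>[Y] FArr \<Phi> (v n)" if n: "0 < n" for n
      using T[OF n] w zz xv[OF n] image_comp[OF T(4)[OF n]] by simp
    fix \<mu> r assume \<mu>: "\<mu> \<in> Arr simplex" and r: "r \<in> Arr Y" "Dom Y r = Dom Y (?x (scod \<mu>))"
      "Cod Y r = Dom Y (?x (sdom \<mu>))"
      "?x (sdom \<mu>) \<cdot>[Y] r = FArr A' \<mu> \<cdot>[Y] ?x (scod \<mu>)"
      "FArr \<Phi> (v (sdom \<mu>)) \<cdot>[Y] r = FArr \<Phi> (v (scod \<mu>))"
    let ?m = "sdom \<mu>" and ?n = "scod \<mu>"
    have s': "\<mu> \<in> Arr aug_simplex" "0 < ?m" "0 < ?n" using \<mu> by simp_all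
    note m = xv[OF s'(2)] T(1-3)[OF s'(2)] and n = xv[OF s'(3)] T(1-3)[OF s'(3)]
    obtain q where q: "q \<in> Arr X" "Dom X q = Dom X (x ?n)" "Cod X q = Dom X (x ?m)" "FArr \<Phi> q = r"
      using r(1-3) m n by (rule_tac full[of r "Dom X (x ?n)" "Dom X (x ?m)"]) simp_all
    \<comment> \<open>Once \<theta> is cancelled, the equation satisfied by r is the image of an
      equation in X, which faithfulness brings back.\<close>
    have "\<theta> ?m \<cdot>[Y] (FArr \<Phi> (x ?m) \<cdot>[Y] FArr \<Phi> q) = \<theta> ?m \<cdot>[Y] (FArr \<Phi> (FArr A \<mu>) \<cdot>[Y] FArr \<Phi> (x ?n))"
      using r(4) q m n s' unfolding q(4)[symmetric] by (simp add: extend[OF \<theta>nat[OF s'(1)] Y])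
    then have "FArr \<Phi> (x ?m) \<cdot>[Y] FArr \<Phi> q = FArr \<Phi> (FArr A \<mu>) \<cdot>[Y] FArr \<Phi> (x ?n)"
      using q(1-3) m n s' by (rule_tac iso_cancel_left[OF Y \<theta>(1)[of ?m]]) simp_all
    then have 1: "x ?m \<cdot>[X] q = FArr A \<mu> \<cdot>[X] x ?n" using q(1-3) m n s' by (rule_tac comp_image) simp_all
    have 2: "v ?m \<cdot>[X] q = v ?n"
      using r(5) q m n s' by (rule_tac faithful) simp_all
    have "t ?m \<cdot>[X] q = t ?n" by (rule TR[OF \<mu> q(1-3) 1 2])
    then have "FArr \<Phi> (t ?m \<cdot>[X] q) = FArr \<Phi> (t ?n)" by simp
    then show "FArr \<Phi> (t ?m) \<cdot>[Y] r = FArr \<Phi> (t ?n)" using q m n by simp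
  qed
  then obtain k where k: "k \<in> Arr Y" "Dom Y k = FObj \<Phi> (Dom X z)" "Cod Y k = FObj \<Phi> (Dom X w)" "FArr \<Phi> w \<cdot>[Y] k = FArr \<Phi> z"
    "\<And>n. 0 < n ==> k \<cdot>[Y] FArr \<Phi> (v n) = FArr \<Phi> (t n)"
    using zz w by auto
  obtain l where l: "l \<in> Arr X" "Dom X l = Dom X z" "Cod X l = Dom X w" "FArr \<Phi> l = k"
    using k(1-3) zz w by (rule_tac full[of k "Dom X z" "Dom X w"]) simp_all
  show "\<exists>!k. k \<in> hom X (Dom X z) (Dom X w) \<and> w \<cdot>[X] k = z \<and> (\<forall>n>0. k \<cdot>[X] v n = t n)"
  proof (rule ex1I[of _ l])
    have "w \<cdot>[X] l = z" using k l zz w by (rule_tac faithful) simp_all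
    moreover have "l \<cdot>[X] v n = t n" if n: "0 < n" for n
      using k(5)[OF n] l T[OF n] xv[OF n] by (rule_tac faithful) simp_all
    ultimately show "l \<in> hom X (Dom X z) (Dom X w) \<and> w \<cdot>[X] l = z \<and> (\<forall>n>0. l \<cdot>[X] v n = t n)" using l by simp
  next
    fix l' assume l': "l' \<in> hom X (Dom X z) (Dom X w) \<and> w \<cdot>[X] l' = z \<and> (\<forall>n>0. l' \<cdot>[X] v n = t n)"
    have l'': "l' \<in> Arr X" "Dom X l' = Dom X z" "Cod X l' = Dom X w" "z = w \<cdot>[X] l'" using l' by auto
    have a: "FArr \<Phi> w \<cdot>[Y] FArr \<Phi> l' = FArr \<Phi> z"
      by (subst l''(4), rule \<Phi>_simps(6)[symmetric]) (use l'' w in simp_all)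
    have b: "FArr \<Phi> l' \<cdot>[Y] FArr \<Phi> (v n) = FArr \<Phi> (t n)" if n: "0 < n" for n
    proof -
      have t: "t n = l' \<cdot>[X] v n" using l' n by simp
      show ?thesis by (subst t, rule \<Phi>_simps(6)[symmetric]) (use l'' xv[OF n] in simp_all)
    qed
    have "FArr \<Phi> l' = k"
    proof -
      have "FArr \<Phi> l' \<in> hom Y (Dom Y (FArr \<Phi> z)) (Dom Y (FArr \<Phi> w)) \<and> FArr \<Phi> w \<cdot>[Y] FArr \<Phi> l' = FArr \<Phi> z \<and>
    (\<forall>n>0. FArr \<Phi> l' \<cdot>[Y] FArr \<Phi> (v n) = FArr \<Phi> (t n))"
        using l''(1-3) a b zz w by simp
      moreover have "k \<in> hom Y (Dom Y (FArr \<Phi> z)) (Dom Y (FArr \<Phi> w)) \<and> FArr \<Phi> w \<cdot>[Y] k = FArr \<Phi> z \<and>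
        (\<forall>n>0. k \<cdot>[Y] FArr \<Phi> (v n) = FArr \<Phi> (t n))"
        using k zz w by simp
      ultimately show ?thesis using ex by blast
    qed
    then show "l' = l" using l l' by (rule_tac faithful) simp_all
  qed
qed

text \<open>Gluing takes place in Y, and it is \<open>cl\<close> that brings the glued object back
  to the essential image: its pullback along the leg at 1 is the image of \<open>x 1\<close>. Once
  replaced by an image, the glued object has pullback squares that are reflected to X.\<close>

lemma gluing_cond_transfer:
  assumes gc: "gluing_cond Y A'"
    and cl: "\<And>F a b. is_pullback Y (FArr \<Phi> (FArr A (from_zero 1))) F a b ==> in_image (Dom Y a) ==> in_image (Dom Y F)"
  shows "gluing_cond X A"
  unfolding gluing_cond_def
proof (intro allI impI)
  fix x u assume c: "cart_family X A x u"
  note cx = cart_familyD(1,2)[OF c] and cu = AX.cart_simps[OF c]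
  let ?x = "\<lambda>n. \<theta> n \<cdot>[Y] FArr \<Phi> (x n)"
  have "cart_family Y A' ?x (\<lambda>\<mu>. FArr \<Phi> (u \<mu>))"
    unfolding cart_family_def
  proof (intro conjI allI impI ballI)
    fix \<mu> assume \<mu>: "\<mu> \<in> Arr simplex"
    let ?m = "sdom \<mu>" and ?n = "scod \<mu>"
    have s': "\<mu> \<in> Arr aug_simplex" "0 < ?m" "0 < ?n" using \<mu> by simp_all
    show "is_pullback Y (FArr A' \<mu>) (?x ?m) (?x ?n) (FArr \<Phi> (u \<mu>))"
      using s' by (intro pullback_change_cospan[OF Y preserves_pullback[OF cart_familyD(3)[OF c \<mu>]] \<theta>(1) _ \<theta>(1)])
        (simp_all add: \<theta>nat)
  next
    fix n :: nat assume n: "0 < n"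
    show "FArr \<Phi> (u (Ident aug_simplex n)) = Ident Y (Dom Y (?x n))" using cart_familyD(4)[OF c n] cx[OF n] by simp
  next
    fix \<mu> \<tau> assume st: "\<mu> \<in> Arr simplex" "\<tau> \<in> Arr simplex" "scod \<mu> = sdom \<tau>"
    show "FArr \<Phi> (u (\<tau> \<cdot>[aug_simplex] \<mu>)) = FArr \<Phi> (u \<mu>) \<cdot>[Y] FArr \<Phi> (u \<tau>)"
      using cart_familyD(5)[OF c st] cu(1-3)[OF st(1)] cu(1-3)[OF st(2)] st(3) by simp
  qed (use cx in simp_all)
  then obtain z' v' where p: "pulled_back Y A' z' ?x v'"
    and vu: "\<And>\<mu>. \<mu> \<in> Arr simplex ==> v' (sdom \<mu>) \<cdot>[Y] FArr \<Phi> (u \<mu>) = v' (scod \<mu>)"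
    using gc unfolding gluing_cond_def by blast
  note zz = AY.pulled_backD(1,2)[OF p] and pb = AY.pulled_backD(3)[OF p] and xv = AY.pulled_backD(4-8)[OF p]
  have xs: "Dom Y (?x n) = FObj \<Phi> (Dom X (x n))" if "0 < n" for n using cx[OF that] by simp
  have V: "v' n \<in> Arr Y" "Dom Y (v' n) = FObj \<Phi> (Dom X (x n))" "Cod Y (v' n) = Dom Y z'" if n: "0 < n" for n
    using xv[OF n] xs[OF n] by simp_all
  \<comment> \<open>The leg of \<open>A'\<close> is replaced by the image of the leg of A, which is
    the shape that \<open>cl\<close> and the reflection of pullbacks require.\<close>
  have pb': "is_pullback Y (FArr \<Phi> (FArr A (from_zero n))) z' (FArr \<Phi> (x n)) (v' n)" if n: "0 < n" for n
  proof -
    obtain j where j: "j \<in> Arr Y" "Dom Y j = FObj A' n" "Cod Y j = FObj \<Phi> (FObj A n)"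
      "j \<cdot>[Y] \<theta> n = Ident Y (FObj \<Phi> (FObj A n))" "\<theta> n \<cdot>[Y] j = Ident Y (FObj A' n)"
      using isoD[OF Y \<theta>(1)[of n]] \<theta>_simps by metis
    have ij: "iso Y j" using j by (intro isoI[where g = "\<theta> n"]) simp_all
    have "FArr \<Phi> (FArr A (from_zero n)) \<cdot>[Y] j = FArr A' (from_zero n)"
      unfolding \<theta>leg[symmetric] using j by simp
    from pullback_change_base_left[OF Y pb[OF n] ij _ _ _ this]
    have "is_pullback Y (FArr \<Phi> (FArr A (from_zero n))) z' (j \<cdot>[Y] ?x n) (v' n)" using j by simp
    moreover have "j \<cdot>[Y] ?x n = FArr \<Phi> (x n)"
      using j(1-3) cx[OF n] by (simp add: extend[OF j(4) Y])
    ultimately show ?thesis by simp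
  qed
  have "in_image (FObj \<Phi> (Dom X (x 1)))"
    unfolding in_image_def using cx[of 1] by (intro bexI[of _ "Dom X (x 1)"] exI[of _ "Ident Y (FObj \<Phi> (Dom X (x 1)))"]) simp_all
  then have "in_image (Dom Y z')" using cl[OF pb'[of 1]] cx[of 1] by simp
  then obtain M \<phi> where M: "M \<in> Obj X" and \<phi>: "iso Y \<phi>" "Dom Y \<phi> = FObj \<Phi> M" "Cod Y \<phi> = Dom Y z'"
    unfolding in_image_def by blast
  obtain \<psi> where \<psi>: "\<psi> \<in> Arr Y" "Dom Y \<psi> = Dom Y z'" "Cod Y \<psi> = FObj \<Phi> M" "\<psi> \<cdot>[Y] \<phi> = Ident Y (FObj \<Phi> M)"
    "\<phi> \<cdot>[Y] \<psi> = Ident Y (Dom Y z')"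
    using isoD[OF Y \<phi>(1)] \<phi>(2,3) by metis
  have i\<psi>: "iso Y \<psi>" using \<psi> \<phi> by (intro isoI[where g = \<phi>]) simp_all
  obtain z where z: "z \<in> Arr X" "Dom X z = M" "Cod X z = FObj A 0" "FArr \<Phi> z = z' \<cdot>[Y] \<phi>"
    using M \<phi> zz A0 by (rule_tac full[of "z' \<cdot>[Y] \<phi>" M "FObj A 0"]) simp_all
  have "\<exists>v. v \<in> Arr X \<and> Dom X v = Dom X (x n) \<and> Cod X v = M \<and> FArr \<Phi> v = \<psi> \<cdot>[Y] v' n" if n: "0 < n" for n
    using full[of "\<psi> \<cdot>[Y] v' n" "Dom X (x n)" M] \<psi> V[OF n] cx[OF n] M by auto
  then obtain v where v: "\<And>n. 0 < n ==> v n \<in> Arr X \<and> Dom X (v n) = Dom X (x n) \<and> Cod X (v n) = M \<and> FArr \<Phi> (v n) = \<psi> \<cdot>[Y] v' n"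
    by metis
  have vs: "v n \<in> Arr X" "Dom X (v n) = Dom X (x n)" "Cod X (v n) = M" "FArr \<Phi> (v n) = \<psi> \<cdot>[Y] v' n" if "0 < n" for n
    using v[OF that] by auto
  have z'\<phi>: "(z' \<cdot>[Y] \<phi>) \<cdot>[Y] \<psi> = z'" using zz \<phi> \<psi> by simp
  have "is_pullback X (FArr A (from_zero n)) z (x n) (v n)" if n: "0 < n" for n
  proof (rule reflects_pullback)
    have "is_pullback Y (z' \<cdot>[Y] \<phi>) (FArr \<Phi> (FArr A (from_zero n))) (\<psi> \<cdot>[Y] v' n) (FArr \<Phi> (x n))"
      by (rule pullback_change_base_left[OF Y pullback_sym[OF pb'[OF n]] i\<psi> _ _ _ z'\<phi>]) (use zz \<phi> \<psi> in simp_all)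
    then show "is_pullback Y (FArr \<Phi> (FArr A (from_zero n))) (FArr \<Phi> z) (FArr \<Phi> (x n)) (FArr \<Phi> (v n))"
      unfolding z(4) vs(4)[OF n] by (rule pullback_sym)
  qed (use z(1-3) vs(1-3)[OF n] cx[OF n] in simp_all)
  then have "pulled_back X A z x v" using z unfolding pulled_back_def by blast
  moreover have "v (sdom \<mu>) \<cdot>[X] u \<mu> = v (scod \<mu>)" if \<mu>: "\<mu> \<in> Arr simplex" for \<mu>
  proof -
    let ?m = "sdom \<mu>" and ?n = "scod \<mu>"
    have s': "0 < ?m" "0 < ?n" using \<mu> by simp_all
    show ?thesis
      using vs[OF s'(1)] vs[OF s'(2)] cu(1-3)[OF \<mu>] \<psi>(1-3) V[OF s'(1)] V[OF s'(2)] vu[OF \<mu>] cx[OF s'(1)] cx[OF s'(2)]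
      by (rule_tac faithful) simp_all
  qed
  ultimately show "\<exists>z v. pulled_back X A z x v \<and>
     (\<forall>\<mu>\<in>Arr simplex. v (sdom \<mu>) \<cdot>[X] u \<mu> = v (scod \<mu>))" by blast
qed

end

text \<open>The colimit condition is reflected without reference to \<open>cl\<close>, and it makes
  p extremal; this is why \<open>cl\<close> may assume extremality when it is used to reflect
  gluing.\<close>

theorem reflects_effective_descent:
  assumes p: "p \<in> Arr X" and ed: "effective_descent Y (FArr \<Phi> p)"
    and cl: "\<And>F a b. extremal X p ==> is_pullback Y (FArr \<Phi> p) F a b ==> in_image (Dom Y a) ==> in_image (Dom Y F)"
  shows "effective_descent X p"
proof -
  let ?A = "descent_diagram X p" and ?A' = "descent_diagram Y (FArr \<Phi> p)"
  have p': "FArr \<Phi> p \<in> Arr Y" using p by simp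
  have AX: "aug_diagram X ?A" and AY: "aug_diagram Y ?A'"
    using descent_diagram_functor[OF X PX p] descent_diagram_functor[OF Y PY p'] by unfold_locales simp_all
  obtain \<theta> where \<theta>: "\<And>n. iso Y (\<theta> n)" "\<And>n. Dom Y (\<theta> n) = FObj \<Phi> (FObj ?A n)" "\<And>n. Cod Y (\<theta> n) = FObj ?A' n"
    "\<And>\<mu>. \<mu> \<in> Arr aug_simplex ==> FArr ?A' \<mu> \<cdot>[Y] \<theta> (scod \<mu>) = \<theta> (sdom \<mu>) \<cdot>[Y] FArr \<Phi> (FArr ?A \<mu>)"
    "\<And>n. FArr ?A' (from_zero n) \<cdot>[Y] \<theta> n = FArr \<Phi> (FArr ?A (from_zero n))"
    by (rule nerve_comparison[OF p]) (rule that)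
  have A0: "FObj ?A' 0 = FObj \<Phi> (FObj ?A 0)" using p by (simp add: descent_diagram_obj)
  have cg: "colimit_cond Y ?A'" "gluing_cond Y ?A'" using ed effective_descent_iff[OF Y PY p'] by blast+
  have cc: "colimit_cond X ?A" by (rule colimit_cond_transfer[OF AX AY \<theta> A0 cg(1)])
  have l1: "FArr ?A (from_zero 1) = p" using descent_diagram_leg[OF X PX p, of 1] by simp
  have "gluing_cond X ?A"
    by (rule gluing_cond_transfer[OF AX AY \<theta> A0 cg(2)]) (use cl[OF colimit_cond_extremal[OF X PX p cc]] l1 in auto)
  with cc show ?thesis using effective_descent_iff[OF X PX p] by blast
qed

end

section \<open>Finite limits\<close>

lemma terminal_exists:
  assumes "has_finite_limits C"
  obtains t where "is_terminal C t"
proof -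
  define D :: "(nat, nat) cat" where "D = \<lparr>Obj = {}, Arr = {}, Dom = id, Cod = id, Ident = id, Comp = (\<lambda>g f. f)\<rparr>"
  define G :: "(nat, nat, 'a, 'b) funct" where "G = \<lparr>FObj = \<lambda>_. undefined, FArr = \<lambda>_. undefined\<rparr>"
  have "category D \<and> finite (Obj D) \<and> finite (Arr D) \<and> is_functor D C G"
    unfolding category_def is_functor_def by (simp add: D_def)
  then obtain l \<pi> where l: "is_limit D C G l \<pi>" using assms unfolding has_finite_limits_def by blast
  have "is_cone D C G a \<pi>" if "a \<in> Obj C" for a using that by (simp add: is_cone_def D_def)
  then have "is_terminal C l" using l unfolding is_limit_def is_terminal_def is_cone_def by (auto simp: D_def)
  then show ?thesis using that by blast
qed

text \<open>The shape 0 -> 2 <- 1: the numbers 0, 1, 2 double as identities, 3 goes from 0 to 2 and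
  4 from 1 to 2. In a composite at most one factor is not an identity, and the formula for
  \<open>Comp\<close> selects it.\<close>

definition cospan :: "(nat, nat) cat" where
  "cospan = \<lparr>Obj = {0, 1, 2}, Arr = {0, 1, 2, 3, 4},
     Dom = (\<lambda>j. if j = 3 then 0 else if j = 4 then 1 else j), Cod = (\<lambda>j. if j = 3 \<or> j = 4 then 2 else j),
     Ident = (\<lambda>a. a), Comp = (\<lambda>g f. if f = 3 \<or> f = 4 then f else g)\<rparr>"

text \<open>A cone on a cospan is determined by its two outer components, because the one at 2 is
  forced.\<close>

lemma finite_limits_pullbacks:
  assumes C: "category C" and L: "has_finite_limits C"
  shows "has_pullbacks C"
  unfolding has_pullbacks_def
proof (intro ballI impI)
  fix f g assume f: "f \<in> Arr C" "g \<in> Arr C" "Cod C f = Cod C g"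
  define G :: "(nat, nat, _, _) funct" where
    "G = \<lparr>FObj = (\<lambda>i. if i = 0 then Dom C f else if i = 1 then Dom C g else Cod C f),
          FArr = (\<lambda>j. if j = 3 then f else if j = 4 then g else if j = 0 then Ident C (Dom C f)
                  else if j = 1 then Ident C (Dom C g) else Ident C (Cod C f))\<rparr>"
  have G: "category cospan \<and> finite (Obj cospan) \<and> finite (Arr cospan) \<and> is_functor cospan C G"
    using C f unfolding category_def[of cospan] is_functor_def by (auto simp: cospan_def G_def)
  then obtain l \<pi> where l: "is_limit cospan C G l \<pi>"
    using L unfolding has_finite_limits_def by blast
  have cone: "is_cone cospan C G x \<xi> \<longleftrightarrow> x \<in> Obj C \<and> \<xi> 0 \<in> hom C x (Dom C f) \<and> \<xi> 1 \<in> hom C x (Dom C g) \<and>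
      \<xi> 2 \<in> hom C x (Cod C f) \<and> f \<cdot>[C] \<xi> 0 = \<xi> 2 \<and> g \<cdot>[C] \<xi> 1 = \<xi> 2" for x \<xi>
    using C f by (auto simp: is_cone_def cospan_def G_def)
  have lc: "l \<in> Obj C" "\<pi> 0 \<in> hom C l (Dom C f)" "\<pi> 1 \<in> hom C l (Dom C g)" "\<pi> 2 \<in> hom C l (Cod C f)"
      "f \<cdot>[C] \<pi> 0 = \<pi> 2" "g \<cdot>[C] \<pi> 1 = \<pi> 2"
    using l unfolding is_limit_def cone by blast+
  have "is_pullback C f g (\<pi> 0) (\<pi> 1)"
    unfolding is_pullback_def
  proof (intro conjI ballI impI)
    fix u v assume uv: "u \<in> Arr C" "v \<in> Arr C"
      "Dom C u = Dom C v \<and> Cod C u = Dom C f \<and> Cod C v = Dom C g \<and> f \<cdot>[C] u = g \<cdot>[C] v"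
    define \<xi> :: "nat \<Rightarrow> _" where "\<xi> i = (if i = 0 then u else if i = 1 then v else f \<cdot>[C] u)" for i
    have "is_cone cospan C G (Dom C u) \<xi>" unfolding cone using C f uv by (simp add: \<xi>_def)
    then have "\<exists>!w. w \<in> hom C (Dom C u) l \<and> (\<forall>i\<in>Obj cospan. \<pi> i \<cdot>[C] w = \<xi> i)"
      using l unfolding is_limit_def by blast
    moreover have "(\<forall>i\<in>Obj cospan. \<pi> i \<cdot>[C] w = \<xi> i) \<longleftrightarrow> \<pi> 0 \<cdot>[C] w = u \<and> \<pi> 1 \<cdot>[C] w = v"
      if w: "w \<in> hom C (Dom C u) l" for w
    proof -
      have "\<pi> 2 \<cdot>[C] w = f \<cdot>[C] (\<pi> 0 \<cdot>[C] w)" using w lc f C unfolding lc(5)[symmetric] by simp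
      then show ?thesis by (auto simp: cospan_def \<xi>_def)
    qed
    ultimately show "\<exists>!w. w \<in> hom C (Dom C u) (Dom C (\<pi> 0)) \<and> \<pi> 0 \<cdot>[C] w = u \<and> \<pi> 1 \<cdot>[C] w = v"
      using lc(2) by (simp del: in_hom add: hom_def[of C l]) (metis (no_types, lifting) in_hom)
  qed (use f lc in auto)
  then show "\<exists>p q. is_pullback C f g p q" by blast
qed

lemma chosen_terminal:
  assumes "is_terminal C t"
  shows "is_terminal C (term_obj C)"
  unfolding term_obj_def by (rule someI[of "is_terminal C", OF assms])

section \<open>The terminal object and binary products\<close>

locale cartesian = pb_category C for C :: "('o, 'm) cat" +
  assumes T: "\<exists>t. is_terminal C t"
begin

abbreviation one :: 'o where "one \<equiv> term_obj C"

lemma terminal_one: "is_terminal C one"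
proof -
  obtain t where "is_terminal C t" using T by blast
  then show ?thesis by (rule chosen_terminal)
qed

lemma one_obj [simp]: "one \<in> Obj C"
  using terminal_one unfolding is_terminal_def by blast

lemma bang_simps [simp]:
  assumes "a \<in> Obj C"
  shows "arr (bang C a)" "dom (bang C a) = a" "cod (bang C a) = one"
proof -
  have "\<exists>!f. f \<in> hom C a one" using terminal_one assms unfolding is_terminal_def by blast
  from theI'[OF this] show "arr (bang C a)" "dom (bang C a) = a" "cod (bang C a) = one"
    unfolding bang_def by simp_all
qed

lemma to_one_eq:
  assumes "arr f" "cod f = one" "arr g" "cod g = one" "dom f = dom g"
  shows "f = g"
proof -
  have "\<exists>!h. h \<in> hom C (dom f) one" using terminal_one assms unfolding is_terminal_def by simp
  moreover have "f \<in> hom C (dom f) one" "g \<in> hom C (dom f) one" using assms by simp_all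
  ultimately show ?thesis by blast
qed

lemma bang_comp [simp]:
  assumes "arr f" "cod f = a"
  shows "bang C a \<cdot> f = bang C (dom f)"
  using assms by (intro to_one_eq) auto

lemma bang_one [simp]: "bang C one = Ident C one"
  by (rule to_one_eq) simp_all

text \<open>A product is a pullback over the terminal object, where the commutativity condition is
  void.\<close>

lemma chosen_product:
  assumes ab: "a \<in> Obj C" "b \<in> Obj C"
  shows "is_product C a b (prod_fst C a b) (prod_snd C a b)"
proof -
  have "is_pullback C (bang C a) (bang C b) (pb_fst C (bang C a) (bang C b)) (pb_snd C (bang C a) (bang C b))"
    using ab by (intro chosen_pullback) simp_all
  then have "is_product C a b (pb_fst C (bang C a) (bang C b)) (pb_snd C (bang C a) (bang C b))"
    using ab unfolding is_pullback_def is_product_def by simp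
  then have "\<exists>x. case x of (p, q) \<Rightarrow> is_product C a b p q" by blast
  then have "case SOME x. case x of (p, q) \<Rightarrow> is_product C a b p q of (p, q) \<Rightarrow> is_product C a b p q"
    by (rule someI_ex)
  then show ?thesis unfolding prod_fst_def prod_snd_def by (simp add: case_prod_unfold)
qed

lemma prod_simps [simp]:
  assumes "a \<in> Obj C" "b \<in> Obj C"
  shows "arr (prod_fst C a b)" "arr (prod_snd C a b)"
    "dom (prod_fst C a b) = prod_obj C a b" "dom (prod_snd C a b) = prod_obj C a b"
    "cod (prod_fst C a b) = a" "cod (prod_snd C a b) = b"
  using chosen_product[OF assms] unfolding is_product_def prod_obj_def by auto

lemma prod_obj_in [simp]:
  assumes "a \<in> Obj C" "b \<in> Obj C"
  shows "prod_obj C a b \<in> Obj C"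
  using category_simps(1)[OF C prod_simps(1)[OF assms]] assms by simp

lemma prod_ex1:
  assumes "arr u" "arr v" "dom v = dom u" "cod u = a" "cod v = b"
  shows "\<exists>!w. w \<in> hom C (dom u) (prod_obj C a b) \<and> prod_fst C a b \<cdot> w = u \<and> prod_snd C a b \<cdot> w = v"
proof -
  have ab: "a \<in> Obj C" "b \<in> Obj C" using category_simps(2)[OF C] assms by auto
  have "\<forall>u\<in>Arr C. \<forall>v\<in>Arr C. dom u = dom v \<and> cod u = a \<and> cod v = b \<longrightarrow>
        (\<exists>!w. w \<in> hom C (dom u) (dom (prod_fst C a b)) \<and> prod_fst C a b \<cdot> w = u \<and> prod_snd C a b \<cdot> w = v)"
    using chosen_product[OF ab] unfolding is_product_def by blast
  then show ?thesis using assms unfolding prod_obj_def by metis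
qed

lemma prod_pair_simps [simp]:
  assumes "arr u" "arr v" "dom v = dom u"
  shows "arr (prod_pair C u v)" "dom (prod_pair C u v) = dom u"
    "cod (prod_pair C u v) = prod_obj C (cod u) (cod v)"
    "cod u = a ==> cod v = b ==> prod_fst C a b \<cdot> prod_pair C u v = u"
    "cod u = a ==> cod v = b ==> prod_snd C a b \<cdot> prod_pair C u v = v"
  using theI'[OF prod_ex1[OF assms refl refl]] unfolding prod_pair_def[symmetric] by auto

lemma prod_pair_extend [simp]:
  assumes "arr u" "arr v" "dom v = dom u" "cod u = a" "cod v = b" "arr r" "cod r = dom u"
  shows "prod_fst C a b \<cdot> (prod_pair C u v \<cdot> r) = u \<cdot> r"
    "prod_snd C a b \<cdot> (prod_pair C u v \<cdot> r) = v \<cdot> r"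
proof -
  have ab: "a \<in> Obj C" "b \<in> Obj C" using category_simps(2)[OF C] assms by auto
  show "prod_fst C a b \<cdot> (prod_pair C u v \<cdot> r) = u \<cdot> r"
    "prod_snd C a b \<cdot> (prod_pair C u v \<cdot> r) = v \<cdot> r"
    by (rule extend; use assms ab in simp)+
qed

lemma prod_eqI:
  assumes "arr u" "arr v" "dom u = dom v" "cod u = prod_obj C a b" "cod v = prod_obj C a b"
    and ab: "a \<in> Obj C" "b \<in> Obj C"
    and "prod_fst C a b \<cdot> u = prod_fst C a b \<cdot> v" "prod_snd C a b \<cdot> u = prod_snd C a b \<cdot> v"
  shows "u = v"
proof -
  have "\<exists>!w. w \<in> hom C (dom (prod_fst C a b \<cdot> v)) (prod_obj C a b) \<and>
     prod_fst C a b \<cdot> w = prod_fst C a b \<cdot> v \<and> prod_snd C a b \<cdot> w = prod_snd C a b \<cdot> v"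
    by (rule prod_ex1) (use assms(1-7) in simp_all)
  moreover have "u \<in> hom C (dom (prod_fst C a b \<cdot> v)) (prod_obj C a b)"
     "v \<in> hom C (dom (prod_fst C a b \<cdot> v)) (prod_obj C a b)"
    using assms(1-7) by simp_all
  ultimately show ?thesis using assms(8,9) by blast
qed

lemma prod_pair_comp:
  assumes "arr u" "arr v" "dom v = dom u" "arr r" "cod r = dom u"
  shows "prod_pair C u v \<cdot> r = prod_pair C (u \<cdot> r) (v \<cdot> r)"
  using assms by (rule_tac prod_eqI[of _ _ "cod u" "cod v"]) simp_all

lemma prod_pair_eta:
  assumes "a \<in> Obj C" "b \<in> Obj C" "arr w" "cod w = prod_obj C a b"
  shows "prod_pair C (prod_fst C a b \<cdot> w) (prod_snd C a b \<cdot> w) = w"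
  using assms by (rule_tac prod_eqI[of _ _ a b]) simp_all

lemma prod_arr_simps [simp]:
  assumes "arr f" "arr g"
  shows "arr (prod_arr C f g)" "dom (prod_arr C f g) = prod_obj C (dom f) (dom g)"
    "cod (prod_arr C f g) = prod_obj C (cod f) (cod g)"
  using assms by (simp_all add: prod_arr_def)

lemma prod_arr_pair:
  assumes "arr f" "arr g" "arr u" "arr v" "dom v = dom u" "cod u = dom f" "cod v = dom g"
  shows "prod_arr C f g \<cdot> prod_pair C u v = prod_pair C (f \<cdot> u) (g \<cdot> v)"
  using assms by (simp add: prod_arr_def prod_pair_comp)

lemma prod_assoc_simps [simp]:
  assumes "a \<in> Obj C" "b \<in> Obj C" "c \<in> Obj C"
  shows "arr (prod_assoc C a b c)" "dom (prod_assoc C a b c) = prod_obj C (prod_obj C a b) c"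
    "cod (prod_assoc C a b c) = prod_obj C a (prod_obj C b c)"
  using assms by (simp_all add: prod_assoc_def Let_def)

lemma prod_assoc_pair:
  assumes "arr u" "arr v" "arr w" "dom v = dom u" "dom w = dom u"
    "cod u = a" "cod v = b" "cod w = c"
  shows "prod_assoc C a b c \<cdot> prod_pair C (prod_pair C u v) w = prod_pair C u (prod_pair C v w)"
proof -
  have abc: "a \<in> Obj C" "b \<in> Obj C" "c \<in> Obj C" using category_simps(2)[OF C] assms by auto
  then show ?thesis using assms by (simp add: prod_assoc_def Let_def prod_pair_comp)
qed

end

section \<open>Small index sets\<close>

text \<open>Coproducts are also taken over index sets such as \<open>A \<times> A\<close>, whose type is not the type \<open>'u\<close> of
  the universe; these are small up to an injection.\<close>

definition smallish :: "('u set \<Rightarrow> bool) \<Rightarrow> 'i set \<Rightarrow> bool" where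
  "smallish small I \<longleftrightarrow> (\<exists>e :: 'i \<Rightarrow> 'u. inj_on e I \<and> small (e ` I))"

locale univ =
  fixes small :: "'u set \<Rightarrow> bool"
  assumes U: "universe small"
begin

lemmas universe_conjs = U[unfolded universe_def]

lemma small_singleton: "small {x}"
  using universe_conjs[THEN conjunct1] by simp

lemma small_subset: "small A ==> B \<subseteq> A ==> small B"
  using universe_conjs[THEN conjunct2, THEN conjunct1, rule_format, of A B] by simp

lemma small_Union: "small I ==> (\<And>i. i \<in> I ==> small (X i)) ==> small (\<Union>i\<in>I. X i)"
  for X :: "'u \<Rightarrow> 'u set"
  using universe_conjs[THEN conjunct2, THEN conjunct2, THEN conjunct1, rule_format, of I X] by simp

lemma small_Pow:
  assumes "small A"
  obtains e :: "'u set \<Rightarrow> 'u" where "inj_on e (Pow A)" "small (e ` Pow A)"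
  using universe_conjs[THEN conjunct2, THEN conjunct2, THEN conjunct2, rule_format, OF assms] that by blast

text \<open>The power set of a singleton has two elements, and their codes are distinct.\<close>

lemma two_small:
  obtains a b where "a \<noteq> b" "small {a, b}"
proof -
  obtain e :: "'u set \<Rightarrow> 'u" where e: "inj_on e (Pow {undefined})" "small (e ` Pow {undefined})"
    using small_Pow[OF small_singleton] .
  have "e {} \<noteq> e {undefined}" using e(1) by (auto dest: inj_onD)
  moreover have "small {e {}, e {undefined}}" by (rule small_subset[OF e(2)]) auto
  ultimately show ?thesis using that by blast
qed

lemma small_empty: "small {}"
  using small_subset[OF small_singleton] by blast

lemma small_Un:
  assumes "small A" "small B" shows "small (A \<union> B)"
proof -
  obtain a b :: 'u where ab: "a \<noteq> b" "small {a, b}" using two_small .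
  have "small (\<Union>i\<in>{a, b}. if i = a then A else B)"
    using assms by (intro small_Union[OF ab(2)]) auto
  then show ?thesis using ab(1) by (simp add: Un_commute)
qed

lemma smallish_small: "small A ==> smallish small A"
  unfolding smallish_def by (intro exI[of _ id]) simp

lemma smallish_subset:
  assumes "smallish small I" "J \<subseteq> I" shows "smallish small J"
proof -
  obtain e where e: "inj_on e I" "small (e ` I)" using assms(1) unfolding smallish_def by blast
  have "inj_on e J" "small (e ` J)"
    using inj_on_subset[OF e(1) assms(2)] small_subset[OF e(2) image_mono[OF assms(2)]] by auto
  then show ?thesis unfolding smallish_def by blast
qed

text \<open>Pairs are coded as Kuratowski pairs: one power set encoding codes {x} and {x, y}, and a
  second one codes the set of these two codes.\<close>

lemma smallish_small_Times:
  assumes "small A" "small B" shows "smallish small (A \<times> B)"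
proof -
  let ?W = "A \<union> B"
  obtain e :: "'u set \<Rightarrow> 'u" where e: "inj_on e (Pow ?W)" "small (e ` Pow ?W)"
    using small_Pow[OF small_Un[OF assms]] .
  obtain e' :: "'u set \<Rightarrow> 'u" where e': "inj_on e' (Pow (e ` Pow ?W))" "small (e' ` Pow (e ` Pow ?W))"
    using small_Pow[OF e(2)] .
  define k where "k = (\<lambda>(x, y). e' {e {x}, e {x, y}})"
  have "inj_on k (A \<times> B)"
  proof (rule inj_onI, clarify)
    fix x y x' y' assume a: "x \<in> A" "y \<in> B" "x' \<in> A" "y' \<in> B" and eq: "k (x, y) = k (x', y')"
    have "{e {x}, e {x, y}} = {e {x'}, e {x', y'}}"
      using eq a inj_onD[OF e'(1), of "{e {x}, e {x, y}}" "{e {x'}, e {x', y'}}"] unfolding k_def by auto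
    moreover have "e S = e S' \<longleftrightarrow> S = S'" if "S \<subseteq> ?W" "S' \<subseteq> ?W" for S S'
      using inj_on_eq_iff[OF e(1), of S S'] that by blast
    ultimately show "x = x' \<and> y = y'" using a by (auto simp: doubleton_eq_iff)
  qed
  moreover have "small (k ` (A \<times> B))"
    by (rule small_subset[OF e'(2)]) (auto simp: k_def)
  ultimately show ?thesis unfolding smallish_def by blast
qed

lemma smallish_Times:
  assumes "smallish small I" "smallish small J" shows "smallish small (I \<times> J)"
proof -
  obtain e where e: "inj_on e I" "small (e ` I)" using assms(1) unfolding smallish_def by blast
  obtain d where d: "inj_on d J" "small (d ` J)" using assms(2) unfolding smallish_def by blast
  obtain c where c: "inj_on c (e ` I \<times> d ` J)" "small (c ` (e ` I \<times> d ` J))"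
    using smallish_small_Times[OF e(2) d(2)] unfolding smallish_def by blast
  define k where "k = (\<lambda>(i, j). c (e i, d j))"
  have "inj_on k (I \<times> J)"
    using c(1) e(1) d(1) unfolding k_def by (auto simp: inj_on_def)
  moreover have "k ` (I \<times> J) = c ` (e ` I \<times> d ` J)" unfolding k_def by force
  ultimately show ?thesis using c(2) unfolding smallish_def by metis
qed

lemma smallish_Sigma:
  assumes "smallish small I" "small B" "\<And>i. i \<in> I ==> J i \<subseteq> B"
  shows "smallish small (Sigma I J)"
  by (rule smallish_subset[OF smallish_Times[OF assms(1) smallish_small[OF assms(2)]]])
    (use assms(3) in auto)

end

section \<open>Coproducts\<close>

lemma is_coproductD:
  assumes "is_coproduct C I X s \<iota>"
  shows "s \<in> Obj C" "i \<in> I ==> \<iota> i \<in> Arr C" "i \<in> I ==> Dom C (\<iota> i) = X i" "i \<in> I ==> Cod C (\<iota> i) = s"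
  using assms unfolding is_coproduct_def by auto

lemma coproduct_ex1:
  assumes "is_coproduct C I X s \<iota>" "t \<in> Obj C" "\<And>i. i \<in> I ==> u i \<in> hom C (X i) t"
  shows "\<exists>!w. w \<in> hom C s t \<and> (\<forall>i\<in>I. w \<cdot>[C] \<iota> i = u i)"
  using assms unfolding is_coproduct_def by blast

lemma coproduct_lift:
  assumes "is_coproduct C I X s \<iota>" "t \<in> Obj C"
    "\<And>i. i \<in> I ==> u i \<in> Arr C" "\<And>i. i \<in> I ==> Dom C (u i) = X i" "\<And>i. i \<in> I ==> Cod C (u i) = t"
  obtains w where "w \<in> Arr C" "Dom C w = s" "Cod C w = t" "\<And>i. i \<in> I ==> w \<cdot>[C] \<iota> i = u i"
proof -
  have "\<exists>!w. w \<in> hom C s t \<and> (\<forall>i\<in>I. w \<cdot>[C] \<iota> i = u i)"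
    using coproduct_ex1[OF assms(1,2), of u] assms(3-5) by simp
  then show ?thesis using that by auto
qed

lemma coproduct_eqI:
  assumes c: "is_coproduct C I X s \<iota>" and C: "category C" and a: "a \<in> Arr C" "Dom C a = s"
    and b: "b \<in> Arr C" "Dom C b = s" "Cod C b = Cod C a"
    and eq: "\<And>i. i \<in> I ==> a \<cdot>[C] \<iota> i = b \<cdot>[C] \<iota> i"
  shows "a = b"
proof -
  note d = is_coproductD[OF c]
  have "\<exists>!w. w \<in> hom C s (Cod C a) \<and> (\<forall>i\<in>I. w \<cdot>[C] \<iota> i = b \<cdot>[C] \<iota> i)"
    by (rule coproduct_ex1[OF c]) (use d C a(1) b in simp_all)
  moreover have "a \<in> hom C s (Cod C a)" "b \<in> hom C s (Cod C a)" using a b by simp_all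
  ultimately show ?thesis using eq by blast
qed

lemma is_coproductI:
  assumes "s \<in> Obj C" "\<And>i. i \<in> I ==> \<iota> i \<in> Arr C" "\<And>i. i \<in> I ==> Dom C (\<iota> i) = X i" "\<And>i. i \<in> I ==> Cod C (\<iota> i) = s"
    and "\<And>t u. t \<in> Obj C ==> (\<And>i. i \<in> I ==> u i \<in> Arr C) ==> (\<And>i. i \<in> I ==> Dom C (u i) = X i) ==>
      (\<And>i. i \<in> I ==> Cod C (u i) = t) ==> \<exists>w\<in>Arr C. Dom C w = s \<and> Cod C w = t \<and> (\<forall>i\<in>I. w \<cdot>[C] \<iota> i = u i)"
    and "\<And>a b. a \<in> Arr C ==> b \<in> Arr C ==> Dom C a = s ==> Dom C b = s ==> Cod C b = Cod C a ==>
      (\<And>i. i \<in> I ==> a \<cdot>[C] \<iota> i = b \<cdot>[C] \<iota> i) ==> a = b"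
  shows "is_coproduct C I X s \<iota>"
  unfolding is_coproduct_def
proof (intro conjI ballI allI impI)
  fix t u assume t: "t \<in> Obj C" and u: "\<forall>i\<in>I. u i \<in> hom C (X i) t"
  then obtain w where "w \<in> Arr C" "Dom C w = s" "Cod C w = t" "\<forall>i\<in>I. w \<cdot>[C] \<iota> i = u i"
    using assms(5)[OF t, of u] by auto
  then show "\<exists>!w. w \<in> hom C s t \<and> (\<forall>i\<in>I. w \<cdot>[C] \<iota> i = u i)"
    using assms(6) by (intro ex1I[of _ w]) auto
qed (use assms(1-4) in auto)

lemma coproduct_cong:
  assumes "\<And>i. i \<in> I ==> X i = X' i" "\<And>i. i \<in> I ==> \<iota> i = \<iota>' i"
  shows "is_coproduct C I X s \<iota> \<longleftrightarrow> is_coproduct C I X' s \<iota>'"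
  unfolding is_coproduct_def using assms by (simp cong: ball_cong)

lemma coproduct_reindex:
  assumes c: "is_coproduct C I X s \<iota>" and C: "category C" and h: "bij_betw h K I"
  shows "is_coproduct C K (\<lambda>k. X (h k)) s (\<lambda>k. \<iota> (h k))"
proof -
  note d = is_coproductD[OF c]
  have hK: "h k \<in> I" if "k \<in> K" for k using h that by (auto simp: bij_betw_def)
  have hI: "inv_into K h i \<in> K" "h (inv_into K h i) = i" if "i \<in> I" for i
    using h that by (auto simp: bij_betw_def inv_into_into f_inv_into_f)
  have hh: "inv_into K h (h k) = k" if "k \<in> K" for k using h that by (simp add: bij_betw_def)
  show ?thesis
  proof (rule is_coproductI)
    fix t u assume t: "t \<in> Obj C" "\<And>k. k \<in> K ==> u k \<in> Arr C" "\<And>k. k \<in> K ==> Dom C (u k) = X (h k)" "\<And>k. k \<in> K ==> Cod C (u k) = t"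
    obtain w where w: "w \<in> Arr C" "Dom C w = s" "Cod C w = t" "\<And>i. i \<in> I ==> w \<cdot>[C] \<iota> i = u (inv_into K h i)"
      using t hI by (rule_tac coproduct_lift[OF c t(1), of "\<lambda>i. u (inv_into K h i)"]) simp_all
    then show "\<exists>w\<in>Arr C. Dom C w = s \<and> Cod C w = t \<and> (\<forall>k\<in>K. w \<cdot>[C] \<iota> (h k) = u k)"
      using hK hh by (intro bexI[of _ w]) auto
  next
    fix a b assume ab: "a \<in> Arr C" "b \<in> Arr C" "Dom C a = s" "Dom C b = s" "Cod C b = Cod C a"
      and eq: "\<And>k. k \<in> K ==> a \<cdot>[C] \<iota> (h k) = b \<cdot>[C] \<iota> (h k)"
    show "a = b" using eq[OF hI(1)] hI(2) ab by (rule_tac coproduct_eqI[OF c C]) auto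
  qed (use d hK in auto)
qed

lemma coproduct_iso_summands:
  assumes c: "is_coproduct C I X s \<iota>" and C: "category C"
    and \<phi>: "\<And>i. i \<in> I ==> iso C (\<phi> i)" "\<And>i. i \<in> I ==> Cod C (\<phi> i) = X i" "\<And>i. i \<in> I ==> Dom C (\<phi> i) = X' i"
  shows "is_coproduct C I X' s (\<lambda>i. \<iota> i \<cdot>[C] \<phi> i)"
proof -
  note d = is_coproductD[OF c]
  have "\<exists>j. j \<in> Arr C \<and> Dom C j = X i \<and> Cod C j = X' i \<and> j \<cdot>[C] \<phi> i = Ident C (X' i)" if "i \<in> I" for i
    using isoD[OF C \<phi>(1)[OF that]] \<phi>(2,3)[OF that] by metis
  then obtain j where j: "\<And>i. i \<in> I ==> j i \<in> Arr C \<and> Dom C (j i) = X i \<and> Cod C (j i) = X' i \<and> j i \<cdot>[C] \<phi> i = Ident C (X' i)"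
    by metis
  show ?thesis
  proof (rule is_coproductI)
    fix t u assume t: "t \<in> Obj C" "\<And>k. k \<in> I ==> u k \<in> Arr C" "\<And>k. k \<in> I ==> Dom C (u k) = X' k" "\<And>k. k \<in> I ==> Cod C (u k) = t"
    obtain w where w: "w \<in> Arr C" "Dom C w = s" "Cod C w = t" "\<And>i. i \<in> I ==> w \<cdot>[C] \<iota> i = u i \<cdot>[C] j i"
      using t j C by (rule_tac coproduct_lift[OF c t(1), of "\<lambda>i. u i \<cdot>[C] j i"]) simp_all
    have "w \<cdot>[C] (\<iota> i \<cdot>[C] \<phi> i) = u i" if i: "i \<in> I" for i
      using w(1-3) d(2-4)[OF i] \<phi>[OF i] j[OF i] t(2-4)[OF i] by (simp add: extend[OF w(4)[OF i] C] C)
    then show "\<exists>w\<in>Arr C. Dom C w = s \<and> Cod C w = t \<and> (\<forall>k\<in>I. w \<cdot>[C] (\<iota> k \<cdot>[C] \<phi> k) = u k)"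
      using w by blast
  next
    fix a b assume ab: "a \<in> Arr C" "b \<in> Arr C" "Dom C a = s" "Dom C b = s" "Cod C b = Cod C a"
      and eq: "\<And>k. k \<in> I ==> a \<cdot>[C] (\<iota> k \<cdot>[C] \<phi> k) = b \<cdot>[C] (\<iota> k \<cdot>[C] \<phi> k)"
    have "a \<cdot>[C] \<iota> i = b \<cdot>[C] \<iota> i" if i: "i \<in> I" for i
      using eq[OF i] ab d(2-4)[OF i] \<phi>[OF i] C by (rule_tac iso_cancel_right[OF C \<phi>(1)[OF i]]) simp_all
    then show "a = b" using ab by (rule_tac coproduct_eqI[OF c C]) auto
  qed (use d \<phi> C in auto)
qed

lemma coproduct_iso_target:
  assumes c: "is_coproduct C I X s \<iota>" and C: "category C" and \<phi>: "iso C \<phi>" "Dom C \<phi> = s"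
  shows "is_coproduct C I X (Cod C \<phi>) (\<lambda>i. \<phi> \<cdot>[C] \<iota> i)"
proof -
  note d = is_coproductD[OF c]
  obtain j where j: "j \<in> Arr C" "Dom C j = Cod C \<phi>" "Cod C j = s" "j \<cdot>[C] \<phi> = Ident C s"
    using isoD[OF C \<phi>(1)] \<phi>(2) by metis
  show ?thesis
  proof (rule is_coproductI)
    fix t u assume t: "t \<in> Obj C" "\<And>k. k \<in> I ==> u k \<in> Arr C" "\<And>k. k \<in> I ==> Dom C (u k) = X k" "\<And>k. k \<in> I ==> Cod C (u k) = t"
    obtain w where w: "w \<in> Arr C" "Dom C w = s" "Cod C w = t" "\<And>i. i \<in> I ==> w \<cdot>[C] \<iota> i = u i"
      using t by (rule_tac coproduct_lift[OF c t(1), of u]) simp_all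
    have "(w \<cdot>[C] j) \<cdot>[C] (\<phi> \<cdot>[C] \<iota> i) = u i" if i: "i \<in> I" for i
      using w(1-3) d(2-4)[OF i] \<phi> j C w(4)[OF i] by (simp add: extend[OF j(4) C])
    then show "\<exists>w\<in>Arr C. Dom C w = Cod C \<phi> \<and> Cod C w = t \<and> (\<forall>k\<in>I. w \<cdot>[C] (\<phi> \<cdot>[C] \<iota> k) = u k)"
      using w j C by (intro bexI[of _ "w \<cdot>[C] j"]) simp_all
  next
    fix a b assume ab: "a \<in> Arr C" "b \<in> Arr C" "Dom C a = Cod C \<phi>" "Dom C b = Cod C \<phi>" "Cod C b = Cod C a"
      and eq: "\<And>k. k \<in> I ==> a \<cdot>[C] (\<phi> \<cdot>[C] \<iota> k) = b \<cdot>[C] (\<phi> \<cdot>[C] \<iota> k)"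
    have "a \<cdot>[C] \<phi> = b \<cdot>[C] \<phi>"
      using eq ab d(2-4) \<phi> C by (rule_tac coproduct_eqI[OF c C]) simp_all
    then show "a = b" using ab \<phi> by (rule_tac iso_cancel_right[OF C \<phi>(1)]) simp_all
  qed (use d \<phi> C in auto)
qed

lemma coproduct_compare:
  assumes c: "is_coproduct C I X s \<iota>" and c': "is_coproduct C I X s' \<iota>'" and C: "category C"
  obtains \<phi> where "iso C \<phi>" "Dom C \<phi> = s" "Cod C \<phi> = s'" "\<And>i. i \<in> I ==> \<phi> \<cdot>[C] \<iota> i = \<iota>' i"
proof -
  note d = is_coproductD[OF c] and d' = is_coproductD[OF c']
  obtain a where a: "a \<in> Arr C" "Dom C a = s" "Cod C a = s'" "\<And>i. i \<in> I ==> a \<cdot>[C] \<iota> i = \<iota>' i"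
    using d' by (rule_tac coproduct_lift[OF c d'(1), of \<iota>']) simp_all
  obtain b where b: "b \<in> Arr C" "Dom C b = s'" "Cod C b = s" "\<And>i. i \<in> I ==> b \<cdot>[C] \<iota>' i = \<iota> i"
    using d by (rule_tac coproduct_lift[OF c' d(1), of \<iota>]) simp_all
  have "b \<cdot>[C] a = Ident C s"
    using a b d C by (rule_tac coproduct_eqI[OF c C]) simp_all
  moreover have "a \<cdot>[C] b = Ident C s'"
    using a b d' C by (rule_tac coproduct_eqI[OF c' C]) simp_all
  ultimately have "iso C a" using a b by (intro isoI[where g = b]) simp_all
  then show ?thesis using that a by blast
qed

lemma coproduct_Sigma:
  assumes c: "is_coproduct C I S s \<iota>" and C: "category C"
    and k: "\<And>i. i \<in> I ==> is_coproduct C (J i) (X i) (S i) (\<kappa> i)"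
  shows "is_coproduct C (Sigma I J) (\<lambda>(i, j). X i j) s (\<lambda>(i, j). \<iota> i \<cdot>[C] \<kappa> i j)"
proof -
  note d = is_coproductD[OF c] and e = is_coproductD[OF k]
  show ?thesis
  proof (rule is_coproductI)
    fix t u assume t: "t \<in> Obj C" and u: "\<And>p. p \<in> Sigma I J ==> u p \<in> Arr C"
      "\<And>p. p \<in> Sigma I J ==> Dom C (u p) = (case p of (i, j) \<Rightarrow> X i j)" "\<And>p. p \<in> Sigma I J ==> Cod C (u p) = t"
    have "\<exists>w. w \<in> Arr C \<and> Dom C w = S i \<and> Cod C w = t \<and> (\<forall>j\<in>J i. w \<cdot>[C] \<kappa> i j = u (i, j))" if i: "i \<in> I" for i
      using u[of "(i, _)"] i by (rule_tac coproduct_lift[OF k[OF i] t, of "\<lambda>j. u (i, j)"]) auto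
    then obtain w where w: "\<And>i. i \<in> I ==> w i \<in> Arr C \<and> Dom C (w i) = S i \<and> Cod C (w i) = t \<and> (\<forall>j\<in>J i. w i \<cdot>[C] \<kappa> i j = u (i, j))"
      by metis
    obtain v where v: "v \<in> Arr C" "Dom C v = s" "Cod C v = t" "\<And>i. i \<in> I ==> v \<cdot>[C] \<iota> i = w i"
      using w by (rule_tac coproduct_lift[OF c t, of w]) auto
    have "v \<cdot>[C] (\<iota> i \<cdot>[C] \<kappa> i j) = u (i, j)" if ij: "i \<in> I" "j \<in> J i" for i j
      using v(1-3) d(2-4)[OF ij(1)] e(2-4)[OF ij] w[OF ij(1)] ij(2) by (simp add: extend[OF v(4)[OF ij(1)] C])
    then show "\<exists>w\<in>Arr C. Dom C w = s \<and> Cod C w = t \<and> (\<forall>p\<in>Sigma I J. w \<cdot>[C] (case p of (i, j) \<Rightarrow> \<iota> i \<cdot>[C] \<kappa> i j) = u p)"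
      using v by auto
  next
    fix a b assume ab: "a \<in> Arr C" "b \<in> Arr C" "Dom C a = s" "Dom C b = s" "Cod C b = Cod C a"
      and eq: "\<And>p. p \<in> Sigma I J ==> a \<cdot>[C] (case p of (i, j) \<Rightarrow> \<iota> i \<cdot>[C] \<kappa> i j) = b \<cdot>[C] (case p of (i, j) \<Rightarrow> \<iota> i \<cdot>[C] \<kappa> i j)"
    have "a \<cdot>[C] \<iota> i = b \<cdot>[C] \<iota> i" if i: "i \<in> I" for i
    proof (rule coproduct_eqI[OF k[OF i] C])
      fix j assume j: "j \<in> J i"
      have "a \<cdot>[C] (\<iota> i \<cdot>[C] \<kappa> i j) = b \<cdot>[C] (\<iota> i \<cdot>[C] \<kappa> i j)" using eq[of "(i, j)"] i j by simp
      then show "(a \<cdot>[C] \<iota> i) \<cdot>[C] \<kappa> i j = (b \<cdot>[C] \<iota> i) \<cdot>[C] \<kappa> i j"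
        using ab d(2-4)[OF i] e(2-4)[OF i j] C by simp
    qed (use ab d(2-4)[OF i] C in simp_all)
    then show "a = b" using ab by (rule_tac coproduct_eqI[OF c C]) auto
  qed (use d e C in auto)
qed

lemma is_initial_iff: "is_initial C s \<longleftrightarrow> is_coproduct C {} X s \<iota>"
  unfolding is_initial_def is_coproduct_def by simp

lemma initial_ex1: "is_initial C z ==> t \<in> Obj C ==> \<exists>!f. f \<in> hom C z t"
  unfolding is_initial_def by blast

lemma initial_eqI:
  assumes z: "is_initial C (Dom C f)" and C: "category C" and f: "f \<in> Arr C" "g \<in> Arr C" "Dom C g = Dom C f" "Cod C g = Cod C f"
  shows "f = g"
proof -
  have "\<exists>!h. h \<in> hom C (Dom C f) (Cod C f)" using initial_ex1[OF z, of "Cod C f"] f(1) C by simp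
  moreover have "f \<in> hom C (Dom C f) (Cod C f)" "g \<in> hom C (Dom C f) (Cod C f)" using f by simp_all
  ultimately show ?thesis by blast
qed

lemma coproduct_drop_initial:
  assumes c: "is_coproduct C I X s \<iota>" and C: "category C" and J: "J \<subseteq> I"
    and z: "\<And>i. i \<in> I ==> i \<notin> J ==> is_initial C (X i)"
  shows "is_coproduct C J X s \<iota>"
proof -
  note d = is_coproductD[OF c]
  show ?thesis
  proof (rule is_coproductI)
    fix t u assume t: "t \<in> Obj C" and u: "\<And>p. p \<in> J ==> u p \<in> Arr C"
      "\<And>p. p \<in> J ==> Dom C (u p) = X p" "\<And>p. p \<in> J ==> Cod C (u p) = t"
    have "\<exists>v. v \<in> Arr C \<and> Dom C v = X i \<and> Cod C v = t \<and> (i \<in> J \<longrightarrow> v = u i)" if i: "i \<in> I" for i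
    proof (cases "i \<in> J")
      case True then show ?thesis using u by blast
    next
      case False
      then show ?thesis using initial_ex1[OF z[OF i False] t] by auto
    qed
    then obtain v where v: "\<And>i. i \<in> I ==> v i \<in> Arr C \<and> Dom C (v i) = X i \<and> Cod C (v i) = t \<and> (i \<in> J \<longrightarrow> v i = u i)" by metis
    obtain w where w: "w \<in> Arr C" "Dom C w = s" "Cod C w = t" "\<And>i. i \<in> I ==> w \<cdot>[C] \<iota> i = v i"
      using v by (rule_tac coproduct_lift[OF c t, of v]) auto
    then show "\<exists>w\<in>Arr C. Dom C w = s \<and> Cod C w = t \<and> (\<forall>k\<in>J. w \<cdot>[C] \<iota> k = u k)"
      using v J by (intro bexI[of _ w]) auto
  next
    fix a b assume ab: "a \<in> Arr C" "b \<in> Arr C" "Dom C a = s" "Dom C b = s" "Cod C b = Cod C a"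
      and eq: "\<And>i. i \<in> J ==> a \<cdot>[C] \<iota> i = b \<cdot>[C] \<iota> i"
    have "a \<cdot>[C] \<iota> i = b \<cdot>[C] \<iota> i" if i: "i \<in> I" for i
    proof (cases "i \<in> J")
      case True then show ?thesis by (rule eq)
    next
      case False
      have t: "a \<cdot>[C] \<iota> i \<in> Arr C" "b \<cdot>[C] \<iota> i \<in> Arr C" "Dom C (a \<cdot>[C] \<iota> i) = X i" "Dom C (b \<cdot>[C] \<iota> i) = X i"
        "Cod C (b \<cdot>[C] \<iota> i) = Cod C (a \<cdot>[C] \<iota> i)" using ab d(2-4)[OF i] C by simp_all
      show ?thesis by (rule initial_eqI[OF _ C t(1,2)]) (use z[OF i False] t(3-5) in simp_all)
    qed
    then show "a = b" using ab by (rule_tac coproduct_eqI[OF c C]) auto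
  qed (use d J in auto)
qed

section \<open>Extensivity\<close>

locale lext = univ small for small :: "'u set \<Rightarrow> bool" +
  fixes V :: "('o, 'm) cat"
  assumes L: "infinitary_lextensive small V"
begin

lemma V [simp]: "category V" and fl: "has_finite_limits V"
  using L unfolding infinitary_lextensive_def by blast+

sublocale cartesian V
  by unfold_locales (use finite_limits_pullbacks[OF V fl] terminal_exists[OF fl] in auto)

notation comp_C (infixr "\<cdot>" 70)

text \<open>The axioms of \<open>infinitary_lextensive\<close> speak only of index sets in
  \<open>'u\<close>; an injective code moves a coproduct over another index set to such a set and
  back.\<close>

lemma coproduct_via_small:
  fixes I :: "'i set" and e :: "'i \<Rightarrow> 'u"
  assumes e: "inj_on e I"
  shows "is_coproduct V I X s \<iota> \<longleftrightarrow> is_coproduct V (e ` I) (\<lambda>k. X (inv_into I e k)) s (\<lambda>k. \<iota> (inv_into I e k))"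
proof
  assume "is_coproduct V I X s \<iota>"
  from coproduct_reindex[OF this V bij_betw_inv_into[OF inj_on_imp_bij_betw[OF e]]]
  show "is_coproduct V (e ` I) (\<lambda>k. X (inv_into I e k)) s (\<lambda>k. \<iota> (inv_into I e k))" .
next
  assume "is_coproduct V (e ` I) (\<lambda>k. X (inv_into I e k)) s (\<lambda>k. \<iota> (inv_into I e k))"
  from coproduct_reindex[OF this V inj_on_imp_bij_betw[OF e]]
  show "is_coproduct V I X s \<iota>"
    using e by (subst coproduct_cong[of I X _ \<iota>]) auto
qed

lemma coproduct_exists:
  assumes "smallish small I" "\<And>i. i \<in> I ==> X i \<in> Obj V"
  obtains s \<iota> where "is_coproduct V I X s \<iota>"
proof -
  obtain e :: "_ \<Rightarrow> 'u" where e: "inj_on e I" "small (e ` I)" using assms(1) unfolding smallish_def by blast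
  have "\<forall>k\<in>e ` I. X (inv_into I e k) \<in> Obj V" using assms(2) by (auto simp: inv_into_into)
  then obtain s \<iota>' where c: "is_coproduct V (e ` I) (\<lambda>k. X (inv_into I e k)) s \<iota>'"
  proof -
    have "\<forall>(I :: 'u set) X. small I \<and> (\<forall>i\<in>I. X i \<in> Obj V) \<longrightarrow> (\<exists>s \<iota>. is_coproduct V I X s \<iota>)"
      using L unfolding infinitary_lextensive_def by blast
    from this[rule_format, of "e ` I" "\<lambda>k. X (inv_into I e k)"] show thesis
      using that e(2) \<open>\<forall>k\<in>e ` I. X (inv_into I e k) \<in> Obj V\<close> by blast
  qed
  from coproduct_reindex[OF c V inj_on_imp_bij_betw[OF e(1)]]
  have "is_coproduct V I X s (\<lambda>k. \<iota>' (e k))"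
    using e(1) by (subst coproduct_cong[of I X "\<lambda>k. X (inv_into I e (e k))"]) auto
  then show ?thesis using that by blast
qed

lemma coproduct_monic:
  assumes "smallish small I" and c: "is_coproduct V I X s \<iota>" and i: "i \<in> I"
  shows "monic V (\<iota> i)"
proof -
  obtain e :: "_ \<Rightarrow> 'u" where e: "inj_on e I" "small (e ` I)" using assms(1) unfolding smallish_def by blast
  have "monic V (\<iota> (inv_into I e (e i)))"
    using L e(2) c[unfolded coproduct_via_small[OF e(1)]] i unfolding infinitary_lextensive_def by blast
  then show ?thesis using e(1) i by simp
qed

lemma coproduct_stable:
  assumes "smallish small I" and c: "is_coproduct V I X s \<iota>" and f: "arr f" "cod f = s"
    and pb: "\<And>i. i \<in> I ==> is_pullback V f (\<iota> i) (p i) (q i)"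
  shows "is_coproduct V I (\<lambda>i. dom (p i)) (dom f) p"
proof -
  obtain e :: "_ \<Rightarrow> 'u" where e: "inj_on e I" "small (e ` I)" using assms(1) unfolding smallish_def by blast
  have st: "\<forall>(I :: 'u set) X s \<iota>. small I \<and> is_coproduct V I X s \<iota> \<longrightarrow>
      (\<forall>f\<in>Arr V. \<forall>p q. cod f = s \<and> (\<forall>i\<in>I. is_pullback V f (\<iota> i) (p i) (q i)) \<longrightarrow>
           is_coproduct V I (\<lambda>i. dom (p i)) (dom f) p)"
    using L unfolding infinitary_lextensive_def by blast
  have "\<forall>k\<in>e ` I. is_pullback V f (\<iota> (inv_into I e k)) (p (inv_into I e k)) (q (inv_into I e k))"
    using pb e(1) by simp
  then have "is_coproduct V (e ` I) (\<lambda>k. dom (p (inv_into I e k))) (dom f) (\<lambda>k. p (inv_into I e k))"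
    using st[rule_format, OF conjI[OF e(2) c[unfolded coproduct_via_small[OF e(1)]]] f(1),
        of "\<lambda>k. p (inv_into I e k)" "\<lambda>k. q (inv_into I e k)"] f(2) by blast
  then show ?thesis unfolding coproduct_via_small[OF e(1), of "\<lambda>i. dom (p i)"] .
qed

text \<open>An initial object is a coproduct over the empty set, and stability under pullback along
  f makes the domain of f such a coproduct as well.\<close>

lemma strict_initial:
  assumes z: "is_initial V (cod f)" and f: "arr f"
  shows "is_initial V (dom f)"
proof -
  have "smallish small ({} :: 'u set)" by (rule smallish_small[OF small_empty])
  moreover have "is_coproduct V ({} :: 'u set) (\<lambda>_. undefined) (cod f) (\<lambda>_. undefined)"
    using z by (simp only: is_initial_iff[symmetric])
  ultimately have "is_coproduct V ({} :: 'u set) (\<lambda>i. dom f) (dom f) (\<lambda>_. f)"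
    by (rule coproduct_stable[OF _ _ f refl]) simp
  then show ?thesis by (simp only: is_initial_iff[symmetric])
qed

text \<open>The arrows a and b induce one into the pullback of the two injections. That pullback is
  initial by disjointness, and initial objects are strict.\<close>

lemma coproduct_disjoint:
  assumes "smallish small I" and c: "is_coproduct V I X s \<iota>" and ij: "i \<in> I" "j \<in> I" "i \<noteq> j"
    and a: "arr a" "cod a = X i" and b: "arr b" "cod b = X j" "dom b = dom a"
    and eq: "\<iota> i \<cdot> a = \<iota> j \<cdot> b"
  shows "is_initial V (dom a)"
proof -
  note d = is_coproductD[OF c]
  obtain e :: "_ \<Rightarrow> 'u" where e: "inj_on e I" "small (e ` I)" using assms(1) unfolding smallish_def by blast
  have dj: "\<forall>(I :: 'u set) X s \<iota>. small I \<and> is_coproduct V I X s \<iota> \<longrightarrow>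
      (\<forall>i\<in>I. \<forall>j\<in>I. \<forall>p q. i \<noteq> j \<and> is_pullback V (\<iota> i) (\<iota> j) p q \<longrightarrow> is_initial V (dom p))"
    using L unfolding infinitary_lextensive_def by blast
  have pb: "is_pullback V (\<iota> i) (\<iota> j) (pb_fst V (\<iota> i) (\<iota> j)) (pb_snd V (\<iota> i) (\<iota> j))"
    using d ij by (intro chosen_pullback) simp_all
  have "e i \<noteq> e j" using e(1) ij by (auto dest: inj_onD)
  then have z: "is_initial V (dom (pb_fst V (\<iota> i) (\<iota> j)))"
    using dj[rule_format, OF conjI[OF e(2) c[unfolded coproduct_via_small[OF e(1)]]], of "e i" "e j"] pb ij e(1) by simp
  obtain w where "arr w" "dom w = dom a" "cod w = dom (pb_fst V (\<iota> i) (\<iota> j))"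
    using pullback_lift[OF pb a(1) b(1,3)] a b d ij eq by metis
  then show ?thesis using strict_initial[of w] z by simp
qed

text \<open>Stability turns the fibres of f over the summands into a decomposition of its
  domain.\<close>

lemma cover:
  assumes I: "smallish small I" and c: "is_coproduct V I X s \<iota>" and f: "arr f" "cod f = s"
  obtains T p q where "is_coproduct V I T (dom f) p" "\<And>i. i \<in> I ==> is_pullback V f (\<iota> i) (p i) (q i)"
    "\<And>i. i \<in> I ==> dom (p i) = T i"
proof -
  note d = is_coproductD[OF c]
  have pb: "is_pullback V f (\<iota> i) (pb_fst V f (\<iota> i)) (pb_snd V f (\<iota> i))" if "i \<in> I" for i
    using f d that by (intro chosen_pullback) simp_all
  show ?thesis using that[OF coproduct_stable[OF I c f pb] pb] by simp
qed

text \<open>The domain is decomposed along f, and each piece again along g. The last clause says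
  that the piece (i, j) is the largest part on which f lands in summand i and g in summand
  j.\<close>

lemma cover2:
  assumes I: "smallish small I" and c: "is_coproduct V I X s \<iota>" and f: "arr f" "cod f = s"
    and J: "smallish small J" and c': "is_coproduct V J X' s' \<iota>'" and g: "arr g" "cod g = s'" "dom g = dom f"
  obtains T r a b where "is_coproduct V (I \<times> J) T (dom f) r"
    "\<And>i j. i \<in> I ==> j \<in> J ==> arr (a (i, j)) \<and> dom (a (i, j)) = T (i, j) \<and> cod (a (i, j)) = X i \<and> f \<cdot> r (i, j) = \<iota> i \<cdot> a (i, j)"
    "\<And>i j. i \<in> I ==> j \<in> J ==> arr (b (i, j)) \<and> dom (b (i, j)) = T (i, j) \<and> cod (b (i, j)) = X' j \<and> g \<cdot> r (i, j) = \<iota>' j \<cdot> b (i, j)"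
    "\<And>i j t x y. i \<in> I ==> j \<in> J ==> arr t ==> arr x ==> arr y ==> cod t = dom f ==>
       dom x = dom t ==> dom y = dom t ==> cod x = X i ==> cod y = X' j ==>
       f \<cdot> t = \<iota> i \<cdot> x ==> g \<cdot> t = \<iota>' j \<cdot> y ==>
       \<exists>h\<in>Arr V. dom h = dom t \<and> cod h = T (i, j) \<and> r (i, j) \<cdot> h = t"
proof -
  note d = is_coproductD[OF c] and d' = is_coproductD[OF c']
  obtain T1 p1 q1 where 1: "is_coproduct V I T1 (dom f) p1" "\<And>i. i \<in> I ==> is_pullback V f (\<iota> i) (p1 i) (q1 i)"
    "\<And>i. i \<in> I ==> dom (p1 i) = T1 i" by (rule cover[OF I c f]) (rule that)
  note s1 = pullback_simps[OF 1(2)]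
  have "\<exists>T2 p2 q2. is_coproduct V J T2 (T1 i) p2 \<and> (\<forall>j\<in>J. is_pullback V (g \<cdot> p1 i) (\<iota>' j) (p2 j) (q2 j)) \<and>
    (\<forall>j\<in>J. dom (p2 j) = T2 j)" if i: "i \<in> I" for i
  proof -
    have gp: "arr (g \<cdot> p1 i)" "cod (g \<cdot> p1 i) = s'" "dom (g \<cdot> p1 i) = T1 i"
      using g s1[OF i] 1(3)[OF i] by simp_all
    show ?thesis by (rule cover[OF J c' gp(1,2)]) (use gp(3) in auto)
  qed
  then obtain T2 p2 q2 where 2: "\<And>i. i \<in> I ==> is_coproduct V J (T2 i) (T1 i) (p2 i)"
    "\<And>i j. i \<in> I ==> j \<in> J ==> is_pullback V (g \<cdot> p1 i) (\<iota>' j) (p2 i j) (q2 i j)"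
    "\<And>i j. i \<in> I ==> j \<in> J ==> dom (p2 i j) = T2 i j" by metis
  note s2 = pullback_simps[OF 2(2)]
  have s1': "arr (p1 i)" "cod (p1 i) = dom f" "arr (q1 i)" "dom (q1 i) = T1 i" "cod (q1 i) = X i"
    if "i \<in> I" for i using s1[OF that] 1(3)[OF that] d(3)[OF that] by simp_all
  have s2': "arr (p2 i j)" "cod (p2 i j) = T1 i" "arr (q2 i j)" "dom (q2 i j) = T2 i j" "cod (q2 i j) = X' j"
    if "i \<in> I" "j \<in> J" for i j using s2[OF that] 2(3)[OF that] d'(3)[OF that(2)] s1'[OF that(1)] 1(3)[OF that(1)] g by simp_all
  show ?thesis
  proof (rule that[of "\<lambda>(i, j). T2 i j" "\<lambda>(i, j). p1 i \<cdot> p2 i j" "\<lambda>(i, j). q1 i \<cdot> p2 i j" "\<lambda>(i, j). q2 i j"])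
    show "is_coproduct V (I \<times> J) (\<lambda>(i, j). T2 i j) (dom f) (\<lambda>(i, j). p1 i \<cdot> p2 i j)"
      by (rule coproduct_Sigma[OF 1(1) V 2(1)])
  next
    fix i j assume ij: "i \<in> I" "j \<in> J"
    show "arr ((case (i, j) of (i, j) \<Rightarrow> q1 i \<cdot> p2 i j)) \<and>
      dom (case (i, j) of (i, j) \<Rightarrow> q1 i \<cdot> p2 i j) = (case (i, j) of (i, j) \<Rightarrow> T2 i j) \<and>
      cod (case (i, j) of (i, j) \<Rightarrow> q1 i \<cdot> p2 i j) = X i \<and>
      f \<cdot> (case (i, j) of (i, j) \<Rightarrow> p1 i \<cdot> p2 i j) = \<iota> i \<cdot> (case (i, j) of (i, j) \<Rightarrow> q1 i \<cdot> p2 i j)"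
      using s1'[OF ij(1)] s2'[OF ij] 1(3)[OF ij(1)] 2(3)[OF ij] f d(2-4)[OF ij(1)]
      by (simp add: extend[OF s1(9)[OF ij(1)] V])
    show "arr ((case (i, j) of (i, j) \<Rightarrow> q2 i j)) \<and>
      dom (case (i, j) of (i, j) \<Rightarrow> q2 i j) = (case (i, j) of (i, j) \<Rightarrow> T2 i j) \<and>
      cod (case (i, j) of (i, j) \<Rightarrow> q2 i j) = X' j \<and>
      g \<cdot> (case (i, j) of (i, j) \<Rightarrow> p1 i \<cdot> p2 i j) = \<iota>' j \<cdot> (case (i, j) of (i, j) \<Rightarrow> q2 i j)"
      using s1'[OF ij(1)] s2'[OF ij] 1(3)[OF ij(1)] 2(3)[OF ij] f g s2(9)[OF ij] by simp
    fix t x y assume t: "arr t" and x: "arr x" and y: "arr y" and t': "cod t = dom f"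
      "dom x = dom t" "dom y = dom t" "cod x = X i" "cod y = X' j"
      and ft: "f \<cdot> t = \<iota> i \<cdot> x" and gt: "g \<cdot> t = \<iota>' j \<cdot> y"
    obtain w where w: "arr w" "dom w = dom t" "cod w = T1 i" "p1 i \<cdot> w = t"
      using ft t x t' d(2-4)[OF ij(1)] 1(3)[OF ij(1)] by (rule_tac pullback_lift[OF 1(2)[OF ij(1)], of t x]) simp_all
    have "(g \<cdot> p1 i) \<cdot> w = \<iota>' j \<cdot> y" using gt w g s1'[OF ij(1)] 1(3)[OF ij(1)] by simp
    then obtain h where h: "arr h" "dom h = dom t" "cod h = T2 i j" "p2 i j \<cdot> h = w"
      using w y t' g s1'[OF ij(1)] 1(3)[OF ij(1)] d'(2-4)[OF ij(2)] 2(3)[OF ij]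
      by (rule_tac pullback_lift[OF 2(2)[OF ij], of w y]) simp_all
    show "\<exists>h\<in>Arr V. dom h = dom t \<and> cod h = (case (i, j) of (i, j) \<Rightarrow> T2 i j) \<and>
       (case (i, j) of (i, j) \<Rightarrow> p1 i \<cdot> p2 i j) \<cdot> h = t"
      using h w s1'[OF ij(1)] s2'[OF ij] 1(3)[OF ij(1)] 2(3)[OF ij] by (intro bexI[of _ h]) simp_all
  qed
qed

text \<open>The pieces over the summands are jointly epic. Agreement is asked for on every arrow
  that f sends into a summand, so that users need not name the pieces.\<close>

lemma locally_eqI:
  assumes I: "smallish small I" and c: "is_coproduct V I X s \<iota>" and f: "arr f" "cod f = s"
    and a: "arr a" "dom a = dom f" and b: "arr b" "dom b = dom f" "cod b = cod a"
    and eq: "\<And>i r x. i \<in> I ==> arr r ==> arr x ==> cod r = dom f ==> dom x = dom r ==> cod x = X i ==>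
      f \<cdot> r = \<iota> i \<cdot> x ==> a \<cdot> r = b \<cdot> r"
  shows "a = b"
proof -
  obtain T p q where c': "is_coproduct V I T (dom f) p" and pb: "\<And>i. i \<in> I ==> is_pullback V f (\<iota> i) (p i) (q i)"
    by (rule cover[OF I c f]) (rule that)
  have "a \<cdot> p i = b \<cdot> p i" if i: "i \<in> I" for i
    using pullback_simps[OF pb[OF i]] is_coproductD(3)[OF c i] by (intro eq[OF i, of "p i" "q i"]) auto
  then show ?thesis using a b by (rule_tac coproduct_eqI[OF c' V]) auto
qed

end

section \<open>Discrete objects\<close>

context lext
begin

lemma csum_coproduct:
  assumes "smallish small I" "\<And>i. i \<in> I ==> X i \<in> Obj V"
  shows "is_coproduct V I X (csum V I X) (csum_in V I X)"
proof -
  obtain s \<iota> where "is_coproduct V I X s \<iota>" using coproduct_exists[OF assms] .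
  then have "\<exists>x. case x of (s, \<iota>) \<Rightarrow> is_coproduct V I X s \<iota>" by blast
  then have "case SOME x. case x of (s, \<iota>) \<Rightarrow> is_coproduct V I X s \<iota> of (s, \<iota>) \<Rightarrow> is_coproduct V I X s \<iota>"
    by (rule someI_ex)
  then show ?thesis unfolding csum_def csum_in_def by (simp add: case_prod_unfold)
qed

lemma cotuple_simps:
  assumes "smallish small I" "\<And>i. i \<in> I ==> X i \<in> Obj V" "t \<in> Obj V"
    "\<And>i. i \<in> I ==> arr (u i)" "\<And>i. i \<in> I ==> dom (u i) = X i" "\<And>i. i \<in> I ==> cod (u i) = t"
  shows "arr (cotuple V I X t u)" "dom (cotuple V I X t u) = csum V I X" "cod (cotuple V I X t u) = t"
    "i \<in> I ==> cotuple V I X t u \<cdot> csum_in V I X i = u i"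
proof -
  have "\<exists>!w. w \<in> hom V (csum V I X) t \<and> (\<forall>i\<in>I. w \<cdot> csum_in V I X i = u i)"
    by (rule coproduct_ex1[OF csum_coproduct[OF assms(1,2)] assms(3)]) (use assms(4-6) in simp_all)
  from theI'[OF this] show "arr (cotuple V I X t u)" "dom (cotuple V I X t u) = csum V I X" "cod (cotuple V I X t u) = t"
    "i \<in> I ==> cotuple V I X t u \<cdot> csum_in V I X i = u i"
    unfolding cotuple_def by simp_all
qed

lemma J_coproduct:
  assumes "small A"
  shows "is_coproduct V A (\<lambda>_. one) (J_obj V A) (J_in V A)"
  unfolding J_obj_def J_in_def by (rule csum_coproduct[OF smallish_small[OF assms]]) simp

lemma J_arr_simps:
  assumes "small A" "small B" "\<And>a. a \<in> A ==> f a \<in> B"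
  shows "arr (J_arr V A f B)" "dom (J_arr V A f B) = J_obj V A" "cod (J_arr V A f B) = J_obj V B"
    "a \<in> A ==> J_arr V A f B \<cdot> J_in V A a = J_in V B (f a)"
proof -
  note d = is_coproductD[OF J_coproduct[OF assms(2)]]
  show "arr (J_arr V A f B)" "dom (J_arr V A f B) = J_obj V A" "cod (J_arr V A f B) = J_obj V B"
    "a \<in> A ==> J_arr V A f B \<cdot> J_in V A a = J_in V B (f a)"
    using cotuple_simps[OF smallish_small[OF assms(1)], of "\<lambda>_. one" "J_obj V B" "\<lambda>a. J_in V B (f a)"] d assms(3)
    unfolding J_arr_def J_obj_def[of V A] J_in_def[of V A] by simp_all
qed

lemma coproduct_singleton: "is_coproduct V {c} (\<lambda>_. one) one (\<lambda>_. Ident V one)"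
proof (rule is_coproductI)
  fix t u assume "t \<in> Obj V" and u: "\<And>i. i \<in> {c} ==> arr (u i)" "\<And>i. i \<in> {c} ==> dom (u i) = one"
    "\<And>i. i \<in> {c} ==> cod (u i) = t"
  show "\<exists>w\<in>Arr V. dom w = one \<and> cod w = t \<and> (\<forall>i\<in>{c}. w \<cdot> Ident V one = u i)"
    using u[of c] by (intro bexI[of _ "u c"]) simp_all
next
  fix a b assume "arr a" "arr b" "dom a = one" "dom b = one"
    and "\<And>i. i \<in> {c} ==> a \<cdot> Ident V one = b \<cdot> Ident V one"
  then show "a = b" by simp
qed simp_all

definition discrete :: "'o \<Rightarrow> bool" where
  "discrete S \<longleftrightarrow> (\<exists>A \<phi>. small A \<and> is_coproduct V A (\<lambda>_. one) S \<phi>)"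

lemma discrete_one: "discrete one"
  unfolding discrete_def using small_singleton coproduct_singleton
  by (intro exI[of _ "{undefined}"] exI[of _ "\<lambda>_. Ident V one"] conjI)

lemma discrete_iso:
  assumes "iso V \<phi>" "discrete (dom \<phi>)"
  shows "discrete (cod \<phi>)"
  using assms(2) coproduct_iso_target[OF _ V assms(1) refl] unfolding discrete_def by blast

lemma discrete_smallish:
  assumes "smallish small I" and c: "is_coproduct V I (\<lambda>_. one) S \<phi>"
  shows "discrete S"
proof -
  obtain e :: "_ \<Rightarrow> 'u" where e: "inj_on e I" "small (e ` I)" using assms(1) unfolding smallish_def by blast
  show ?thesis unfolding discrete_def using e(2) c[unfolded coproduct_via_small[OF e(1)]] by blast
qed

lemma coproduct_discrete:
  assumes I: "small I" and c: "is_coproduct V I X s \<iota>" and d: "\<And>i. i \<in> I ==> discrete (X i)"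
  shows "discrete s"
proof -
  obtain A \<phi> where A: "\<And>i. i \<in> I ==> small (A i) \<and> is_coproduct V (A i) (\<lambda>_. one) (X i) (\<phi> i)"
    using d unfolding discrete_def by metis
  have "is_coproduct V (Sigma I A) (\<lambda>(i, j). one) s (\<lambda>(i, j). \<iota> i \<cdot> \<phi> i j)"
    using A by (intro coproduct_Sigma[OF c V]) blast
  then have "is_coproduct V (Sigma I A) (\<lambda>_. one) s (\<lambda>(i, j). \<iota> i \<cdot> \<phi> i j)" by (simp add: case_prod_unfold)
  \<comment> \<open>All the chosen index sets lie in one small set, their union, and this keeps the
    disjoint union small.\<close>
  moreover have "smallish small (Sigma I A)"
    using A by (intro smallish_Sigma[OF smallish_small[OF I], of "\<Union>i\<in>I. A i"] small_Union[OF I]) auto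
  ultimately show ?thesis by (intro discrete_smallish)
qed

end

locale lextJ = lext small V for small :: "'u set \<Rightarrow> bool" and V :: "('o, 'm) cat" +
  assumes JF: "fully_faithful (set_cat small) V (J_funct V)"
begin

lemma J_full:
  assumes A: "small A" "small B" and r: "arr r" "dom r = J_obj V A" "cod r = J_obj V B"
  obtains f where "f \<in> A \<rightarrow>\<^sub>E B" "r = J_arr V A f B"
proof -
  have "A \<in> Obj (set_cat small)" "B \<in> Obj (set_cat small)" using A by (simp_all add: set_cat_def)
  from fully_faithfulD(1)[OF JF this, of r] obtain h where
    h: "h \<in> Arr (set_cat small)" "Dom (set_cat small) h = A" "Cod (set_cat small) h = B" "FArr (J_funct V) h = r"
    using r by (auto simp: J_funct_def)
  obtain A' f B' where "h = (A', f, B')" by (cases h)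
  then show ?thesis using h that[of f] by (simp add: set_cat_def J_funct_def)
qed

lemma J_faithful:
  assumes A: "small A" "small B" and f: "f \<in> A \<rightarrow>\<^sub>E B" "g \<in> A \<rightarrow>\<^sub>E B" "J_arr V A f B = J_arr V A g B"
  shows "f = g"
proof -
  have AB: "A \<in> Obj (set_cat small)" "B \<in> Obj (set_cat small)" using A by (simp_all add: set_cat_def)
  have "(A, f, B) = (A, g, B)"
    by (rule fully_faithfulD(2)[OF JF AB]) (use A f in \<open>simp_all add: set_cat_def J_funct_def\<close>)
  then show ?thesis by simp
qed

text \<open>The terminal object is J of a singleton, so by fullness a point of
  \<open>J_obj V A\<close> is J of a function on a singleton, which picks an element of A.\<close>

lemma J_point:
  assumes A: "small A" and r: "arr r" "dom r = one" "cod r = J_obj V A"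
  obtains a where "a \<in> A" "r = J_in V A a"
proof -
  fix c :: 'u
  note Jc = J_coproduct[OF small_singleton[of c]]
  obtain \<phi> where \<phi>: "iso V \<phi>" "dom \<phi> = J_obj V {c}" "cod \<phi> = one" "\<And>i. i \<in> {c} ==> \<phi> \<cdot> J_in V {c} i = Ident V one"
    using coproduct_compare[OF Jc coproduct_singleton V] by metis
  obtain f where f: "f \<in> {c} \<rightarrow>\<^sub>E A" "r \<cdot> \<phi> = J_arr V {c} f A"
    using \<phi> r by (rule_tac J_full[OF small_singleton[of c] A, of "r \<cdot> \<phi>"]) auto
  have "J_in V A (f c) = (r \<cdot> \<phi>) \<cdot> J_in V {c} c"
  proof -
    have "f c \<in> A" using f(1) by auto
    then show ?thesis unfolding f(2) using J_arr_simps(4)[OF small_singleton[of c] A, of f c] by simp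
  qed
  also have "\<dots> = r" using r \<phi> is_coproductD[OF Jc] by simp
  finally show ?thesis using that[of "f c"] f(1) by auto
qed

text \<open>Two elements of A are two functions on a singleton, and J is faithful on these.\<close>

lemma J_in_inject:
  assumes A: "small A" and ab: "a \<in> A" "b \<in> A" "J_in V A a = J_in V A b"
  shows "a = b"
proof -
  fix c :: 'u
  note Jc = J_coproduct[OF small_singleton[of c]]
  let ?f = "\<lambda>x\<in>{c}. a" and ?g = "\<lambda>x\<in>{c}. b"
  note f = J_arr_simps[OF small_singleton[of c] A, of ?f] and g = J_arr_simps[OF small_singleton[of c] A, of ?g]
  have "J_arr V {c} ?f A = J_arr V {c} ?g A"
    using f g ab by (rule_tac coproduct_eqI[OF Jc V]) simp_all
  then have "?f = ?g" using ab by (intro J_faithful[OF small_singleton[of c] A]) auto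
  then have "?f c = ?g c" by (rule fun_cong)
  then show ?thesis by simp
qed

lemma point:
  assumes A: "small A" and c: "is_coproduct V A (\<lambda>_. one) S \<phi>" and r: "arr r" "dom r = one" "cod r = S"
  obtains a where "a \<in> A" "r = \<phi> a"
proof -
  note d = is_coproductD[OF c]
  obtain \<psi> where \<psi>: "iso V \<psi>" "dom \<psi> = S" "cod \<psi> = J_obj V A" "\<And>i. i \<in> A ==> \<psi> \<cdot> \<phi> i = J_in V A i"
    using coproduct_compare[OF c J_coproduct[OF A] V] by metis
  obtain a where a: "a \<in> A" "\<psi> \<cdot> r = J_in V A a"
    using r \<psi> by (rule_tac J_point[OF A, of "\<psi> \<cdot> r"]) auto
  have "r = \<phi> a" using a \<psi> r d by (rule_tac iso_cancel_left[OF V \<psi>(1)]) simp_all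
  then show ?thesis using a(1) that by blast
qed

lemma point_inject:
  assumes A: "small A" and c: "is_coproduct V A (\<lambda>_. one) S \<phi>" and ab: "a \<in> A" "b \<in> A" "\<phi> a = \<phi> b"
  shows "a = b"
proof -
  obtain \<psi> where \<psi>: "iso V \<psi>" "dom \<psi> = S" "cod \<psi> = J_obj V A" "\<And>i. i \<in> A ==> \<psi> \<cdot> \<phi> i = J_in V A i"
    using coproduct_compare[OF c J_coproduct[OF A] V] by metis
  show ?thesis using \<psi>(4)[OF ab(1)] \<psi>(4)[OF ab(2)] ab by (intro J_in_inject[OF A ab(1,2)]) simp
qed

lemma discrete_initial:
  assumes "is_initial V S"
  shows "discrete S"
proof -
  have "is_coproduct V {} (\<lambda>_. one) S (\<lambda>_. undefined)" using assms by (simp only: is_initial_iff[symmetric])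
  then show ?thesis unfolding discrete_def using small_empty by blast
qed

text \<open>If c = d, both projections are the unique arrow to the terminal object, and the diagonal
  inverts them. If c and d differ, disjointness makes the pullback initial, that is, discrete
  without points.\<close>

lemma discrete_pullback_point:
  assumes A: "small A" and \<phi>: "is_coproduct V A (\<lambda>_. one) S \<phi>" and c: "c \<in> A" "d \<in> A"
    and pb: "is_pullback V (\<phi> c) (\<phi> d) p q"
  shows "discrete (dom p)"
proof (cases "c = d")
  case True
  note s = pullback_simps[OF pb] and \<phi>' = is_coproductD(2-4)[OF \<phi> c(1)] is_coproductD(2-4)[OF \<phi> c(2)]
  obtain w where w: "arr w" "dom w = one" "cod w = dom p" "p \<cdot> w = Ident V one"
    using \<phi>' True by (rule_tac pullback_lift[OF pb, of "Ident V one" "Ident V one"]) simp_all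
  have q: "q = p" using s \<phi>' by (intro to_one_eq) simp_all
  have "w \<cdot> p = Ident V (dom p)"
    using w s \<phi>' q by (rule_tac pullback_eqI[OF pb V]) (simp_all add: extend[OF w(4) V])
  then have "iso V w" using w s \<phi>' by (intro isoI[where g = p]) simp_all
  then show ?thesis using discrete_iso[of w] discrete_one w by simp
next
  case False
  note s = pullback_simps[OF pb] and \<phi>' = is_coproductD(2-4)[OF \<phi> c(1)] is_coproductD(2-4)[OF \<phi> c(2)]
  show ?thesis
    using coproduct_disjoint[OF smallish_small[OF A] \<phi> c False _ _ _ _ _ s(9)] s \<phi>' by (intro discrete_initial) simp
qed

lemma discrete_pullback_cover:
  assumes pb: "is_pullback V f g p q" and A: "small A" and \<kappa>: "is_coproduct V A X (dom f) \<kappa>"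
    and d: "\<And>i r s. i \<in> A ==> is_pullback V (f \<cdot> \<kappa> i) g r s ==> discrete (dom r)"
  shows "discrete (dom p)"
proof -
  note s = pullback_simps[OF pb]
  obtain T u t where T: "is_coproduct V A T (dom p) u" and ut: "\<And>i. i \<in> A ==> is_pullback V p (\<kappa> i) (u i) (t i)"
    and uT: "\<And>i. i \<in> A ==> dom (u i) = T i"
    using s by (rule_tac cover[OF smallish_small[OF A] \<kappa>, of p]) auto
  show ?thesis
  proof (rule coproduct_discrete[OF A T])
    fix i assume i: "i \<in> A"
    show "discrete (T i)"
      using d[OF i pullback_paste[OF V pb pullback_sym[OF ut[OF i]]]] pullback_simps(6)[OF ut[OF i]] uT[OF i] by simp
  qed
qed

text \<open>Decomposing both domains into points reduces the claim to two points of the codomain.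
  Fullness of J enters because these points have to be injections of the codomain.\<close>

lemma discrete_pullback:
  assumes pb: "is_pullback V f g p q" and S: "discrete (dom f)" "discrete (dom g)" "discrete (cod f)"
  shows "discrete (dom p)"
proof -
  note s = pullback_simps[OF pb]
  obtain A \<phi> where A: "small A" and \<phi>: "is_coproduct V A (\<lambda>_. one) (dom f) \<phi>" using S(1) unfolding discrete_def by blast
  obtain B \<psi> where B: "small B" and \<psi>: "is_coproduct V B (\<lambda>_. one) (dom g) \<psi>" using S(2) unfolding discrete_def by blast
  obtain D \<rho> where D: "small D" and \<rho>: "is_coproduct V D (\<lambda>_. one) (cod f) \<rho>" using S(3) unfolding discrete_def by blast
  show ?thesis
  proof (rule discrete_pullback_cover[OF pb A \<phi>])
    fix a r r' assume a: "a \<in> A" and pa: "is_pullback V (f \<cdot> \<phi> a) g r r'"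
    have "discrete (dom r')"
    proof (rule discrete_pullback_cover[OF pullback_sym[OF pa] B \<psi>])
      fix b t t' assume b: "b \<in> B" and pb': "is_pullback V (g \<cdot> \<psi> b) (f \<cdot> \<phi> a) t t'"
      obtain c where c: "c \<in> D" "f \<cdot> \<phi> a = \<rho> c"
        using is_coproductD(2-4)[OF \<phi> a] s by (rule_tac point[OF D \<rho>, of "f \<cdot> \<phi> a"]) simp_all
      obtain d where d: "d \<in> D" "g \<cdot> \<psi> b = \<rho> d"
        using is_coproductD(2-4)[OF \<psi> b] s by (rule_tac point[OF D \<rho>, of "g \<cdot> \<psi> b"]) simp_all
      show "discrete (dom t)" by (rule discrete_pullback_point[OF D \<rho> d(1) c(1) pb'[unfolded c(2) d(2)]])
    qed
    then show "discrete (dom r)" using pullback_simps(6)[OF pa] by simp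
  qed
qed

text \<open>Only the existence of a lift for each single point is required: the fibres of z are
  treated one at a time, and extensivity reassembles them.\<close>

lemma discrete_descent:
  assumes pb: "is_pullback V q z a b" and S: "discrete (dom q)" and P: "discrete (dom a)"
    and B: "small B" and \<rho>: "is_coproduct V B (\<lambda>_. one) (cod q) \<rho>"
    and surj: "\<And>b. b \<in> B ==> \<exists>e\<in>Arr V. dom e = one \<and> cod e = dom q \<and> q \<cdot> e = \<rho> b"
  shows "discrete (dom z)"
proof -
  note s = pullback_simps[OF pb]
  obtain T p t where T: "is_coproduct V B T (dom z) p" and pt: "\<And>i. i \<in> B ==> is_pullback V z (\<rho> i) (p i) (t i)"
    and Tp: "\<And>i. i \<in> B ==> dom (p i) = T i"
    using s by (rule_tac cover[OF smallish_small[OF B] \<rho>, of z]) auto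
  show ?thesis
  proof (rule coproduct_discrete[OF B T])
    fix i assume i: "i \<in> B"
    obtain e where e: "arr e" "dom e = one" "cod e = dom q" "q \<cdot> e = \<rho> i" using surj[OF i] by blast
    have pb2: "is_pullback V e a (pb_fst V e a) (pb_snd V e a)" using e s by (intro chosen_pullback) simp_all
    have "discrete (dom (pb_fst V e a))"
      using discrete_pullback[OF pb2] e discrete_one P S s by simp
    \<comment> \<open>Since e lifts the point \<rho> i, pasting identifies this pullback with the
      fibre of z over that point.\<close>
    moreover have "is_pullback V (\<rho> i) z (pb_fst V e a) (b \<cdot> pb_snd V e a)"
      using pullback_paste[OF V pb pb2] e(4) by simp
    then obtain \<phi> where "iso V \<phi>" "dom \<phi> = dom (pb_fst V e a)" "cod \<phi> = dom (t i)"
      using pullback_compare[OF V pullback_sym[OF pt[OF i]]] by metis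
    moreover have "dom (t i) = T i" using pullback_simps[OF pt[OF i]] Tp[OF i] by simp
    ultimately show "discrete (T i)" using discrete_iso by metis
  qed
qed

end

section \<open>Internal categories in terms of generalized elements\<close>

definition composable :: "('o, 'm) cat \<Rightarrow> ('o, 'm) icat \<Rightarrow> 'm \<Rightarrow> 'm \<Rightarrow> bool" where
  "composable C X a b \<longleftrightarrow> a \<in> Arr C \<and> b \<in> Arr C \<and> Dom C b = Dom C a \<and> Cod C a = imor X \<and>
     Cod C b = imor X \<and> src X \<cdot>[C] a = tgt X \<cdot>[C] b"

text \<open>Multiplication on generalized elements of a common stage; it avoids iterated pullbacks
  of composable triples.\<close>

definition imul :: "('o, 'm) cat \<Rightarrow> ('o, 'm) icat \<Rightarrow> 'm \<Rightarrow> 'm \<Rightarrow> 'm" where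
  "imul C X a b = mult X \<cdot>[C] pb_pair C (src X) (tgt X) a b"

text \<open>The part of an internal category needed to calculate with \<open>imul\<close>. Of
  \<open>mult\<close> only the type is recorded, since its laws are often what is being
  established.\<close>

definition icat_graph :: "('o, 'm) cat \<Rightarrow> ('o, 'm) icat \<Rightarrow> bool" where
  "icat_graph C X \<longleftrightarrow> iobj X \<in> Obj C \<and> imor X \<in> Obj C \<and>
     src X \<in> hom C (imor X) (iobj X) \<and> tgt X \<in> hom C (imor X) (iobj X) \<and>
     unt X \<in> hom C (iobj X) (imor X) \<and> mult X \<in> hom C (pb_obj C (src X) (tgt X)) (imor X) \<and>
     src X \<cdot>[C] unt X = Ident C (iobj X) \<and> tgt X \<cdot>[C] unt X = Ident C (iobj X)"

lemma icat_graphD: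
  assumes "icat_graph C X"
  shows "iobj X \<in> Obj C" "imor X \<in> Obj C" "src X \<in> Arr C" "Dom C (src X) = imor X" "Cod C (src X) = iobj X"
    "tgt X \<in> Arr C" "Dom C (tgt X) = imor X" "Cod C (tgt X) = iobj X"
    "unt X \<in> Arr C" "Dom C (unt X) = iobj X" "Cod C (unt X) = imor X"
    "mult X \<in> Arr C" "Dom C (mult X) = pb_obj C (src X) (tgt X)" "Cod C (mult X) = imor X"
    "src X \<cdot>[C] unt X = Ident C (iobj X)" "tgt X \<cdot>[C] unt X = Ident C (iobj X)"
  using assms unfolding icat_graph_def by auto

lemma icat_graphI:
  assumes "is_icat C X" shows "icat_graph C X"
  using assms unfolding is_icat_def icat_graph_def Let_def by blast

lemma composableD:
  assumes "composable C X a b"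
  shows "a \<in> Arr C" "b \<in> Arr C" "Dom C b = Dom C a" "Cod C a = imor X" "Cod C b = imor X"
    "src X \<cdot>[C] a = tgt X \<cdot>[C] b"
  using assms unfolding composable_def by auto

context pb_category
begin

abbreviation "ICat \<equiv> int_cat C"

lemma imul_typing:
  assumes X: "icat_graph C X" and ab: "composable C X a b"
  shows "arr (imul C X a b)" "dom (imul C X a b) = dom a" "cod (imul C X a b) = imor X"
  using icat_graphD[OF X] composableD[OF ab] by (simp_all add: imul_def)

lemma composable_comp:
  assumes X: "icat_graph C X" and ab: "composable C X a b" and r: "arr r" "cod r = dom a"
  shows "composable C X (a \<cdot> r) (b \<cdot> r)"
proof -
  note d = icat_graphD[OF X] and c = composableD[OF ab]
  have "src X \<cdot> (a \<cdot> r) = tgt X \<cdot> (b \<cdot> r)"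
    using d c(1-5) r by (simp add: extend[OF c(6) C])
  then show ?thesis using c(1-5) r by (simp add: composable_def)
qed

text \<open>Naturality in the stage, which lets a law for generic elements be specialised to all
  elements.\<close>

lemma imul_comp:
  assumes X: "icat_graph C X" and ab: "composable C X a b" and r: "arr r" "cod r = dom a"
  shows "imul C X a b \<cdot> r = imul C X (a \<cdot> r) (b \<cdot> r)"
proof -
  note d = icat_graphD[OF X] and c = composableD[OF ab]
  have "imul C X a b \<cdot> r = mult X \<cdot> (pb_pair C (src X) (tgt X) a b \<cdot> r)"
    using d c r by (simp add: imul_def)
  also have "\<dots> = imul C X (a \<cdot> r) (b \<cdot> r)"
    using d c r by (subst pb_pair_comp[OF C P]) (simp_all add: imul_def)
  finally show ?thesis .
qed

lemma composable_proj:
  assumes X: "icat_graph C X"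
  shows "composable C X (pb_fst C (src X) (tgt X)) (pb_snd C (src X) (tgt X))"
  using icat_graphD[OF X] by (simp add: composable_def pb_commute)

lemma mult_imul:
  assumes X: "icat_graph C X"
  shows "mult X = imul C X (pb_fst C (src X) (tgt X)) (pb_snd C (src X) (tgt X))"
proof -
  note d = icat_graphD[OF X]
  have "pb_pair C (src X) (tgt X) (pb_fst C (src X) (tgt X)) (pb_snd C (src X) (tgt X)) = Ident C (pb_obj C (src X) (tgt X))"
    using d pb_commute[OF P, of "src X" "tgt X"] by (rule_tac pb_eqI[OF C P, of "src X" "tgt X"]) simp_all
  then show ?thesis using d by (simp add: imul_def)
qed

text \<open>The equations of \<open>is_icat\<close> are the instances of these laws at the generic
  composable pair and triple, given by the pullback projections.\<close>

lemma icatI: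
  assumes X: "icat_graph C X"
    and st: "\<And>a b. composable C X a b ==> src X \<cdot> imul C X a b = src X \<cdot> b"
       "\<And>a b. composable C X a b ==> tgt X \<cdot> imul C X a b = tgt X \<cdot> a"
    and unit: "imul C X (Ident C (imor X)) (unt X \<cdot> src X) = Ident C (imor X)"
      "imul C X (unt X \<cdot> tgt X) (Ident C (imor X)) = Ident C (imor X)"
    and assoc: "\<And>a b c. composable C X a b ==> composable C X b c ==>
      imul C X (imul C X a b) c = imul C X a (imul C X b c)"
  shows "is_icat C X"
proof -
  note d = icat_graphD[OF X]
  let ?s = "src X" and ?t = "tgt X"
  let ?p = "pb_fst C ?s ?t" and ?q = "pb_snd C ?s ?t"
  let ?p' = "pb_fst C (?s \<cdot> ?q) ?t" and ?q' = "pb_snd C (?s \<cdot> ?q) ?t"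
  note pq = composable_proj[OF X]
  have p': "arr ?p'" "cod ?p' = pb_obj C ?s ?t" "arr ?q'" "cod ?q' = imor X" "dom ?q' = dom ?p'" using d by simp_all
  have 1: "composable C X (?p \<cdot> ?p') (?q \<cdot> ?p')"
    using d p' by (intro composable_comp[OF X pq]) simp_all
  have "?s \<cdot> (?q \<cdot> ?p') = ?t \<cdot> ?q'"
    using pb_commute[OF P, of "?s \<cdot> ?q" ?t] d by simp
  then have 2: "composable C X (?q \<cdot> ?p') ?q'" using d p' by (simp add: composable_def)
  have s: "?s \<cdot> mult X = ?s \<cdot> ?q" "?t \<cdot> mult X = ?t \<cdot> ?p"
    unfolding mult_imul[OF X] using st[OF pq] by simp_all
  show ?thesis
    unfolding is_icat_def Let_def
    using d unit assoc[OF 1 2] s by (simp add: imul_def)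
qed

lemma icatD:
  assumes X: "is_icat C X"
  shows "composable C X a b ==> src X \<cdot> imul C X a b = src X \<cdot> b"
    and "composable C X a b ==> tgt X \<cdot> imul C X a b = tgt X \<cdot> a"
    and "arr a ==> cod a = imor X ==> imul C X a (unt X \<cdot> (src X \<cdot> a)) = a"
    and "arr a ==> cod a = imor X ==> imul C X (unt X \<cdot> (tgt X \<cdot> a)) a = a"
    and "composable C X a b ==> composable C X b c ==>
      imul C X (imul C X a b) c = imul C X a (imul C X b c)"
proof -
  note G = icat_graphI[OF X]
  note d = icat_graphD[OF G]
  let ?s = "src X" and ?t = "tgt X"
  let ?p = "pb_fst C ?s ?t" and ?q = "pb_snd C ?s ?t"
  let ?p' = "pb_fst C (?s \<cdot> ?q) ?t" and ?q' = "pb_snd C (?s \<cdot> ?q) ?t"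
  note pq = composable_proj[OF G]
  have s: "?s \<cdot> mult X = ?s \<cdot> ?q" and t: "?t \<cdot> mult X = ?t \<cdot> ?p"
    and u1: "imul C X (Ident C (imor X)) (unt X \<cdot> ?s) = Ident C (imor X)"
    and u2: "imul C X (unt X \<cdot> ?t) (Ident C (imor X)) = Ident C (imor X)"
    and as: "imul C X (imul C X (?p \<cdot> ?p') (?q \<cdot> ?p')) ?q' = imul C X (?p \<cdot> ?p') (imul C X (?q \<cdot> ?p') ?q')"
    using X unfolding is_icat_def Let_def imul_def by blast+
  {
    assume ab: "composable C X a b"
    note c = composableD[OF ab]
    show "src X \<cdot> imul C X a b = src X \<cdot> b"
      using d c by (simp add: imul_def extend[OF s C])
    show "tgt X \<cdot> imul C X a b = tgt X \<cdot> a"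
      using d c by (simp add: imul_def extend[OF t C])
  }
  {
    assume a: "arr a" "cod a = imor X"
    have "composable C X (Ident C (imor X)) (unt X \<cdot> ?s)" "composable C X (unt X \<cdot> ?t) (Ident C (imor X))"
      using d by (simp_all add: composable_def extend[OF d(15) C] extend[OF d(16) C])
    from imul_comp[OF G this(1) a(1)] imul_comp[OF G this(2) a(1)]
    show "imul C X a (unt X \<cdot> (src X \<cdot> a)) = a" "imul C X (unt X \<cdot> (tgt X \<cdot> a)) a = a"
      using a d u1 u2 by simp_all
  }
  {
    assume ab: "composable C X a b" and bc: "composable C X b c"
    note c = composableD[OF ab] and c' = composableD[OF bc]
    have p': "arr ?p'" "cod ?p' = pb_obj C ?s ?t" "arr ?q'" "cod ?q' = imor X" "dom ?q' = dom ?p'"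
      "dom ?p' = pb_obj C (?s \<cdot> ?q) ?t" using d by simp_all
    have 1: "composable C X (?p \<cdot> ?p') (?q \<cdot> ?p')"
      using d p' by (intro composable_comp[OF G pq]) simp_all
    have "?s \<cdot> (?q \<cdot> ?p') = ?t \<cdot> ?q'"
      using pb_commute[OF P, of "?s \<cdot> ?q" ?t] d by simp
    then have 2: "composable C X (?q \<cdot> ?p') ?q'" using d p' by (simp add: composable_def)
    \<comment> \<open>The arrow classifying the triple (a, b, c) in the object of composable
      triples; along it the generic associativity law becomes the desired one.\<close>
    define w where "w = pb_pair C (?s \<cdot> ?q) ?t (pb_pair C ?s ?t a b) c"
    have w: "arr w" "dom w = dom a" "cod w = dom ?p'" "?p' \<cdot> w = pb_pair C ?s ?t a b" "?q' \<cdot> w = c"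
      using d c c' by (simp_all add: w_def)
    have abc: "(?p \<cdot> ?p') \<cdot> w = a" "(?q \<cdot> ?p') \<cdot> w = b"
      using d c w p' by simp_all
    have i1: "imul C X (?p \<cdot> ?p') (?q \<cdot> ?p') \<cdot> w = imul C X a b"
      using imul_comp[OF G 1 w(1)] w(3) p' d unfolding abc by simp
    have i2: "imul C X (?q \<cdot> ?p') ?q' \<cdot> w = imul C X b c"
      using imul_comp[OF G 2 w(1)] w(3) p' d unfolding abc w(5) by simp
    have 3: "composable C X (imul C X (?p \<cdot> ?p') (?q \<cdot> ?p')) ?q'"
      unfolding composable_def using imul_typing[OF G 1] composableD[OF 2] p' d
      composableD[OF 1] by (simp add: imul_def[of C X "?p \<cdot> ?p'"] extend[OF s C])
    have 4: "composable C X (?p \<cdot> ?p') (imul C X (?q \<cdot> ?p') ?q')"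
      unfolding composable_def using imul_typing[OF G 2] composableD[OF 1] p' d
      composableD[OF 2] by (simp add: imul_def[of C X "?q \<cdot> ?p'"] extend[OF t C])
    have "imul C X (imul C X a b) c = imul C X (imul C X (?p \<cdot> ?p') (?q \<cdot> ?p')) ?q' \<cdot> w"
      using imul_comp[OF G 3 w(1)] w imul_typing[OF G 1] p' d unfolding i1 w(5) by simp
    also have "\<dots> = imul C X (?p \<cdot> ?p') (imul C X (?q \<cdot> ?p') ?q') \<cdot> w" unfolding as ..
    also have "\<dots> = imul C X a (imul C X b c)"
      using imul_comp[OF G 4 w(1)] w p' d unfolding i2 abc by simp
    finally show "imul C X (imul C X a b) c = imul C X a (imul C X b c)" .
  }
qed

section \<open>Internal functors and the category of internal categories\<close>

lemma ifunD:
  assumes F: "is_ifun C F"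
  shows "is_icat C (ifdom F)" "is_icat C (ifcod F)" "arr (if_obj F)" "dom (if_obj F) = iobj (ifdom F)"
    "cod (if_obj F) = iobj (ifcod F)" "arr (if_mor F)" "dom (if_mor F) = imor (ifdom F)"
    "cod (if_mor F) = imor (ifcod F)"
    "src (ifcod F) \<cdot> if_mor F = if_obj F \<cdot> src (ifdom F)"
    "tgt (ifcod F) \<cdot> if_mor F = if_obj F \<cdot> tgt (ifdom F)"
    "if_mor F \<cdot> unt (ifdom F) = unt (ifcod F) \<cdot> if_obj F"
    "if_mor F \<cdot> mult (ifdom F) = imul C (ifcod F)
       (if_mor F \<cdot> pb_fst C (src (ifdom F)) (tgt (ifdom F))) (if_mor F \<cdot> pb_snd C (src (ifdom F)) (tgt (ifdom F)))"
  using F unfolding is_ifun_def Let_def imul_def by auto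

lemma ifun_composable:
  assumes F: "is_ifun C F" and ab: "composable C (ifdom F) a b"
  shows "composable C (ifcod F) (if_mor F \<cdot> a) (if_mor F \<cdot> b)"
proof -
  note f = ifunD[OF F] and c = composableD[OF ab]
  note d = icat_graphD[OF icat_graphI[OF f(1)]] and e = icat_graphD[OF icat_graphI[OF f(2)]]
  have "src (ifcod F) \<cdot> (if_mor F \<cdot> a) = tgt (ifcod F) \<cdot> (if_mor F \<cdot> b)"
    using f(3-8) c d e by (simp add: extend[OF f(9) C] extend[OF f(10) C])
  then show ?thesis using f(3-8) c by (simp add: composable_def)
qed

lemma ifun_imul:
  assumes F: "is_ifun C F" and ab: "composable C (ifdom F) a b"
  shows "if_mor F \<cdot> imul C (ifdom F) a b = imul C (ifcod F) (if_mor F \<cdot> a) (if_mor F \<cdot> b)"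
proof -
  note f = ifunD[OF F] and c = composableD[OF ab]
  note G = icat_graphI[OF f(1)] and H = icat_graphI[OF f(2)]
  note d = icat_graphD[OF G] and e = icat_graphD[OF H]
  let ?w = "pb_pair C (src (ifdom F)) (tgt (ifdom F)) a b"
  have w: "arr ?w" "dom ?w = dom a" "cod ?w = pb_obj C (src (ifdom F)) (tgt (ifdom F))"
    "pb_fst C (src (ifdom F)) (tgt (ifdom F)) \<cdot> ?w = a" "pb_snd C (src (ifdom F)) (tgt (ifdom F)) \<cdot> ?w = b"
    using d c by simp_all
  note cc = ifun_composable[OF F composable_proj[OF G]]
  have "if_mor F \<cdot> imul C (ifdom F) a b = (if_mor F \<cdot> mult (ifdom F)) \<cdot> ?w"
    using f(6-8) d w(1-3) by (simp add: imul_def)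
  also have "\<dots> = imul C (ifcod F) (if_mor F \<cdot> a) (if_mor F \<cdot> b)"
    unfolding f(12) using imul_comp[OF H cc w(1)] w f(6-8) d by simp
  finally show ?thesis .
qed

lemma ifunI:
  assumes XY: "is_icat C X" "is_icat C Y"
    and f0: "arr f0" "dom f0 = iobj X" "cod f0 = iobj Y"
    and f1: "arr f1" "dom f1 = imor X" "cod f1 = imor Y"
    and st: "src Y \<cdot> f1 = f0 \<cdot> src X" "tgt Y \<cdot> f1 = f0 \<cdot> tgt X" "f1 \<cdot> unt X = unt Y \<cdot> f0"
    and mul: "\<And>a b. composable C X a b ==> f1 \<cdot> imul C X a b = imul C Y (f1 \<cdot> a) (f1 \<cdot> b)"
  shows "is_ifun C \<lparr>ifdom = X, ifcod = Y, if_obj = f0, if_mor = f1\<rparr>"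
  unfolding is_ifun_def Let_def
  using XY f0 f1 st mul[OF composable_proj[OF icat_graphI[OF XY(1)]]]
  by (simp add: mult_imul[OF icat_graphI[OF XY(1)], symmetric]) (simp add: imul_def)

lemma int_cat_simps [simp]:
  "X \<in> Obj ICat \<longleftrightarrow> is_icat C X" "F \<in> Arr ICat \<longleftrightarrow> is_ifun C F"
  "Dom ICat = ifdom" "Cod ICat = ifcod"
  "Ident ICat X = \<lparr>ifdom = X, ifcod = X, if_obj = Ident C (iobj X), if_mor = Ident C (imor X)\<rparr>"
  "G \<cdot>[ICat] F = \<lparr>ifdom = ifdom F, ifcod = ifcod G, if_obj = if_obj G \<cdot> if_obj F, if_mor = if_mor G \<cdot> if_mor F\<rparr>"
  by (simp_all add: int_cat_def)

lemma ifun_ident: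
  assumes X: "is_icat C X"
  shows "is_ifun C \<lparr>ifdom = X, ifcod = X, if_obj = Ident C (iobj X), if_mor = Ident C (imor X)\<rparr>"
proof (rule ifunI[OF X X])
  note G = icat_graphI[OF X]
  note d = icat_graphD[OF G]
  fix a b assume ab: "composable C X a b"
  show "Ident C (imor X) \<cdot> imul C X a b = imul C X (Ident C (imor X) \<cdot> a) (Ident C (imor X) \<cdot> b)"
    using imul_typing[OF G ab] composableD[OF ab] by simp
qed (use icat_graphD[OF icat_graphI[OF X]] in simp_all)

lemma ifun_comp:
  assumes F: "is_ifun C F" and G: "is_ifun C G" and FG: "ifcod F = ifdom G"
  shows "is_ifun C \<lparr>ifdom = ifdom F, ifcod = ifcod G, if_obj = if_obj G \<cdot> if_obj F, if_mor = if_mor G \<cdot> if_mor F\<rparr>"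
proof -
  note f = ifunD[OF F] and g = ifunD[OF G]
  note X = icat_graphI[OF f(1)] and Y = icat_graphI[OF g(1)] and Z = icat_graphI[OF g(2)]
  note d = icat_graphD[OF X] icat_graphD[OF Y] icat_graphD[OF Z]
  show ?thesis
  proof (rule ifunI[OF f(1) g(2)])
    show "src (ifcod G) \<cdot> (if_mor G \<cdot> if_mor F) = (if_obj G \<cdot> if_obj F) \<cdot> src (ifdom F)"
      using f(3-9) g(3-8) d FG by (simp add: extend[OF g(9) C])
    show "tgt (ifcod G) \<cdot> (if_mor G \<cdot> if_mor F) = (if_obj G \<cdot> if_obj F) \<cdot> tgt (ifdom F)"
      using f(3-8,10) g(3-8) d FG by (simp add: extend[OF g(10) C])
    show "(if_mor G \<cdot> if_mor F) \<cdot> unt (ifdom F) = unt (ifcod G) \<cdot> (if_obj G \<cdot> if_obj F)"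
      using f(3-8,11) g(3-8) d FG extend[OF g(11) C, of "if_obj F"] by simp
    fix a b assume ab: "composable C (ifdom F) a b"
    note ab' = ifun_composable[OF F ab, unfolded FG]
    show "(if_mor G \<cdot> if_mor F) \<cdot> imul C (ifdom F) a b =
      imul C (ifcod G) ((if_mor G \<cdot> if_mor F) \<cdot> a) ((if_mor G \<cdot> if_mor F) \<cdot> b)"
      using f(6-8) g(6-8) FG composableD[OF ab] imul_typing[OF X ab] ifun_imul[OF F ab] ifun_imul[OF G ab'] by simp
  qed (use f(3-8) g(3-8) FG in simp_all)
qed

lemma category_int_cat: "category ICat"
  unfolding category_def
proof (intro conjI ballI impI)
  fix F assume F: "F \<in> Arr ICat"
  note f = ifunD[OF F[simplified]]
  show "Dom ICat F \<in> Obj ICat" "Cod ICat F \<in> Obj ICat" using f by simp_all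
  show "F \<cdot>[ICat] Ident ICat (Dom ICat F) = F" "Ident ICat (Cod ICat F) \<cdot>[ICat] F = F"
    using f(3-8) by simp_all
next
  fix X assume "X \<in> Obj ICat"
  then show "Ident ICat X \<in> hom ICat X X" using ifun_ident by simp
next
  fix F G assume "F \<in> Arr ICat" "G \<in> Arr ICat" "Cod ICat F = Dom ICat G"
  then show "G \<cdot>[ICat] F \<in> hom ICat (Dom ICat F) (Cod ICat G)" using ifun_comp by simp
next
  fix F G H assume a: "F \<in> Arr ICat" "G \<in> Arr ICat" "H \<in> Arr ICat"
    "Cod ICat F = Dom ICat G \<and> Cod ICat G = Dom ICat H"
  note f = ifunD[OF a(1)[simplified]] and g = ifunD[OF a(2)[simplified]] and h = ifunD[OF a(3)[simplified]]
  show "(H \<cdot>[ICat] G) \<cdot>[ICat] F = H \<cdot>[ICat] (G \<cdot>[ICat] F)"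
    using f(3-8) g(3-8) h(3-8) a(4) by simp
qed

end

section \<open>Pullbacks of internal categories\<close>

text \<open>Limits of internal categories are computed levelwise; the structure maps are induced by
  those of the two factors.\<close>

definition icat_pb :: "('o, 'm) cat \<Rightarrow> ('o, 'm) ifun \<Rightarrow> ('o, 'm) ifun \<Rightarrow> ('o, 'm) icat" where
  "icat_pb C F G =
     (let X = ifdom F; Y = ifdom G; f0 = if_obj F; g0 = if_obj G; f1 = if_mor F; g1 = if_mor G;
          p0 = pb_fst C f0 g0; q0 = pb_snd C f0 g0; p1 = pb_fst C f1 g1; q1 = pb_snd C f1 g1;
          s = pb_pair C f0 g0 (src X \<cdot>[C] p1) (src Y \<cdot>[C] q1);
          t = pb_pair C f0 g0 (tgt X \<cdot>[C] p1) (tgt Y \<cdot>[C] q1);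
          a = pb_fst C s t; b = pb_snd C s t in
      \<lparr>iobj = pb_obj C f0 g0, imor = pb_obj C f1 g1, src = s, tgt = t,
       unt = pb_pair C f1 g1 (unt X \<cdot>[C] p0) (unt Y \<cdot>[C] q0),
       mult = pb_pair C f1 g1 (imul C X (p1 \<cdot>[C] a) (p1 \<cdot>[C] b)) (imul C Y (q1 \<cdot>[C] a) (q1 \<cdot>[C] b))\<rparr>)"

locale ifun_cospan = pb_category C for C :: "('o, 'm) cat" +
  fixes F G :: "('o, 'm) ifun"
  assumes F: "is_ifun C F" and G: "is_ifun C G" and FG: "ifcod F = ifcod G"
begin

abbreviation "X \<equiv> ifdom F"
abbreviation "Y \<equiv> ifdom G"
abbreviation "Z \<equiv> ifcod G"
abbreviation "W \<equiv> icat_pb C F G"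
abbreviation "f0 \<equiv> if_obj F"
abbreviation "f1 \<equiv> if_mor F"
abbreviation "g0 \<equiv> if_obj G"
abbreviation "g1 \<equiv> if_mor G"
abbreviation "p0 \<equiv> pb_fst C f0 g0"
abbreviation "q0 \<equiv> pb_snd C f0 g0"
abbreviation "p1 \<equiv> pb_fst C f1 g1"
abbreviation "q1 \<equiv> pb_snd C f1 g1"

lemmas fD = ifunD[OF F, unfolded FG] and gD = ifunD[OF G]
lemmas Xg = icat_graphI[OF fD(1)] and Yg = icat_graphI[OF gD(1)] and Zg = icat_graphI[OF gD(2)]
lemmas Xd [simp] = icat_graphD(1-14)[OF Xg] and Yd [simp] = icat_graphD(1-14)[OF Yg] and Zd [simp] = icat_graphD(1-14)[OF Zg]
lemmas ft [simp] = fD(3-8) and gt [simp] = gD(3-8)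

lemma c0: "f0 \<cdot> p0 = g0 \<cdot> q0" and c1: "f1 \<cdot> p1 = g1 \<cdot> q1"
  using pb_commute[OF P, of f0 g0] pb_commute[OF P, of f1 g1] by simp_all

lemma s_lift: "f0 \<cdot> (src X \<cdot> p1) = g0 \<cdot> (src Y \<cdot> q1)"
  by (simp add: extend[OF fD(9)[symmetric] C] extend[OF gD(9)[symmetric] C] c1)

lemma t_lift: "f0 \<cdot> (tgt X \<cdot> p1) = g0 \<cdot> (tgt Y \<cdot> q1)"
  by (simp add: extend[OF fD(10)[symmetric] C] extend[OF gD(10)[symmetric] C] c1)

lemma e_lift: "f1 \<cdot> (unt X \<cdot> p0) = g1 \<cdot> (unt Y \<cdot> q0)"
  by (simp add: extend[OF fD(11) C] extend[OF gD(11) C] c0)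

lemma W_simps [simp]: "iobj W = pb_obj C f0 g0" "imor W = pb_obj C f1 g1"
  by (simp_all add: icat_pb_def Let_def)

lemma W_src [simp]: "arr (src W)" "dom (src W) = pb_obj C f1 g1" "cod (src W) = pb_obj C f0 g0"
  and W_tgt [simp]: "arr (tgt W)" "dom (tgt W) = pb_obj C f1 g1" "cod (tgt W) = pb_obj C f0 g0"
  and W_unt [simp]: "arr (unt W)" "dom (unt W) = pb_obj C f0 g0" "cod (unt W) = pb_obj C f1 g1"
  and ps: "p0 \<cdot> src W = src X \<cdot> p1" and qs: "q0 \<cdot> src W = src Y \<cdot> q1"
  and pt: "p0 \<cdot> tgt W = tgt X \<cdot> p1" and qt: "q0 \<cdot> tgt W = tgt Y \<cdot> q1"
  and pe: "p1 \<cdot> unt W = unt X \<cdot> p0" and qe: "q1 \<cdot> unt W = unt Y \<cdot> q0"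
  using s_lift t_lift e_lift by (simp_all add: icat_pb_def Let_def)

lemma composable_pq:
  assumes ab: "composable C W a b"
  shows "composable C X (p1 \<cdot> a) (p1 \<cdot> b)" "composable C Y (q1 \<cdot> a) (q1 \<cdot> b)"
proof -
  note c = composableD[OF ab, simplified]
  have "src X \<cdot> (p1 \<cdot> a) = tgt X \<cdot> (p1 \<cdot> b)"
    using c by (simp add: extend[OF ps[symmetric] C] extend[OF pt[symmetric] C])
  then show "composable C X (p1 \<cdot> a) (p1 \<cdot> b)" using c(1-5) by (simp add: composable_def)
  have "src Y \<cdot> (q1 \<cdot> a) = tgt Y \<cdot> (q1 \<cdot> b)"
    using c by (simp add: extend[OF qs[symmetric] C] extend[OF qt[symmetric] C])
  then show "composable C Y (q1 \<cdot> a) (q1 \<cdot> b)" using c(1-5) by (simp add: composable_def)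
qed

lemma mult_lift:
  assumes ab: "composable C W a b"
  shows "f1 \<cdot> imul C X (p1 \<cdot> a) (p1 \<cdot> b) = g1 \<cdot> imul C Y (q1 \<cdot> a) (q1 \<cdot> b)"
proof -
  note c = composableD[OF ab, simplified]
  show ?thesis
    unfolding ifun_imul[OF F composable_pq(1)[OF ab]] ifun_imul[OF G composable_pq(2)[OF ab]]
    using c(1-5) FG by (simp add: extend[OF c1 C])
qed

lemma W_st: "composable C W (pb_fst C (src W) (tgt W)) (pb_snd C (src W) (tgt W))"
  by (simp add: composable_def pb_commute)

lemma W_mult: "mult W = pb_pair C f1 g1
    (imul C X (p1 \<cdot> pb_fst C (src W) (tgt W)) (p1 \<cdot> pb_snd C (src W) (tgt W)))
    (imul C Y (q1 \<cdot> pb_fst C (src W) (tgt W)) (q1 \<cdot> pb_snd C (src W) (tgt W)))"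
  by (simp add: icat_pb_def Let_def)

lemma W_mult_simps [simp]:
  "arr (mult W)" "dom (mult W) = pb_obj C (src W) (tgt W)" "cod (mult W) = pb_obj C f1 g1"
  and pm: "p1 \<cdot> mult W = imul C X (p1 \<cdot> pb_fst C (src W) (tgt W)) (p1 \<cdot> pb_snd C (src W) (tgt W))"
  and qm: "q1 \<cdot> mult W = imul C Y (q1 \<cdot> pb_fst C (src W) (tgt W)) (q1 \<cdot> pb_snd C (src W) (tgt W))"
  unfolding W_mult
  using imul_typing[OF Xg composable_pq(1)[OF W_st]] imul_typing[OF Yg composable_pq(2)[OF W_st]] mult_lift[OF W_st]
  by simp_all

lemma W_eqI:
  assumes "arr a" "arr b" "dom a = dom b" "cod a = imor W" "cod b = imor W"
    "p1 \<cdot> a = p1 \<cdot> b" "q1 \<cdot> a = q1 \<cdot> b"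
  shows "a = b"
  using assms by (rule_tac pb_eqI[OF C P, of f1 g1]) simp_all

lemma W0_eqI:
  assumes "arr a" "arr b" "dom a = dom b" "cod a = iobj W" "cod b = iobj W"
    "p0 \<cdot> a = p0 \<cdot> b" "q0 \<cdot> a = q0 \<cdot> b"
  shows "a = b"
  using assms by (rule_tac pb_eqI[OF C P, of f0 g0]) simp_all

lemma W_graph: "icat_graph C W"
proof -
  have "src W \<cdot> unt W = Ident C (iobj W)"
    by (rule W0_eqI) (simp_all add: extend[OF ps C] extend[OF qs C] pe qe
      extend[OF icat_graphD(15)[OF Xg] C] extend[OF icat_graphD(15)[OF Yg] C])
  moreover have "tgt W \<cdot> unt W = Ident C (iobj W)"
    by (rule W0_eqI) (simp_all add: extend[OF pt C] extend[OF qt C] pe qe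
      extend[OF icat_graphD(16)[OF Xg] C] extend[OF icat_graphD(16)[OF Yg] C])
  ultimately show ?thesis by (simp add: icat_graph_def)
qed

lemma p_imul:
  assumes ab: "composable C W a b"
  shows "p1 \<cdot> imul C W a b = imul C X (p1 \<cdot> a) (p1 \<cdot> b)"
    and "q1 \<cdot> imul C W a b = imul C Y (q1 \<cdot> a) (q1 \<cdot> b)"
proof -
  note c = composableD[OF ab, simplified]
  let ?w = "pb_pair C (src W) (tgt W) a b"
  have w: "arr ?w" "cod ?w = pb_obj C (src W) (tgt W)" using c by simp_all
  have "p1 \<cdot> imul C W a b = imul C X (p1 \<cdot> pb_fst C (src W) (tgt W)) (p1 \<cdot> pb_snd C (src W) (tgt W)) \<cdot> ?w"
    unfolding imul_def[of C W] using w c by (intro extend[OF pm C]) simp_all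
  also have "\<dots> = imul C X (p1 \<cdot> a) (p1 \<cdot> b)"
    using w c by (subst imul_comp[OF Xg composable_pq(1)[OF W_st]]) simp_all
  finally show "p1 \<cdot> imul C W a b = imul C X (p1 \<cdot> a) (p1 \<cdot> b)" .
  have "q1 \<cdot> imul C W a b = imul C Y (q1 \<cdot> pb_fst C (src W) (tgt W)) (q1 \<cdot> pb_snd C (src W) (tgt W)) \<cdot> ?w"
    unfolding imul_def[of C W] using w c by (intro extend[OF qm C]) simp_all
  also have "\<dots> = imul C Y (q1 \<cdot> a) (q1 \<cdot> b)"
    using w c by (subst imul_comp[OF Yg composable_pq(2)[OF W_st]]) simp_all
  finally show "q1 \<cdot> imul C W a b = imul C Y (q1 \<cdot> a) (q1 \<cdot> b)" .
qed

text \<open>An arrow into W is determined by its components in the two factors, and by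
  \<open>p_imul\<close> multiplication is componentwise, so each law follows from the laws of X and
  Y.\<close>

lemma W_icat: "is_icat C W"
proof (rule icatI[OF W_graph])
  note X = icatD[OF fD(1)] and Y = icatD[OF gD(1)]
  note ty = imul_typing[OF W_graph, simplified]
  {
    fix a b assume ab: "composable C W a b"
    note c = composableD[OF ab, simplified] and ti = ty[OF ab]
    note pq = p_imul[OF ab] and cp = composable_pq[OF ab]
    show "src W \<cdot> imul C W a b = src W \<cdot> b"
      by (rule W0_eqI) (use c ti in \<open>simp_all add: extend[OF ps C] extend[OF qs C] pq X(1)[OF cp(1)] Y(1)[OF cp(2)]\<close>)
    show "tgt W \<cdot> imul C W a b = tgt W \<cdot> a"
      by (rule W0_eqI) (use c ti in \<open>simp_all add: extend[OF pt C] extend[OF qt C] pq X(2)[OF cp(1)] Y(2)[OF cp(2)]\<close>)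
  }
  note st [simp] = icat_graphD(15,16)[OF W_graph]
  have 1: "composable C W (Ident C (imor W)) (unt W \<cdot> src W)"
    and 2: "composable C W (unt W \<cdot> tgt W) (Ident C (imor W))"
    by (simp_all add: composable_def extend[OF st(1) C] extend[OF st(2) C])
  show "imul C W (Ident C (imor W)) (unt W \<cdot> src W) = Ident C (imor W)"
    by (rule W_eqI) (use ty[OF 1] in \<open>simp_all add: p_imul[OF 1, simplified] extend[OF pe C] extend[OF qe C] ps qs X(3) Y(3)\<close>)
  show "imul C W (unt W \<cdot> tgt W) (Ident C (imor W)) = Ident C (imor W)"
    by (rule W_eqI) (use ty[OF 2] in \<open>simp_all add: p_imul[OF 2, simplified] extend[OF pe C] extend[OF qe C] pt qt X(4) Y(4)\<close>)
  fix a b c assume ab: "composable C W a b" and bc: "composable C W b c"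
  note cab = composableD[OF ab, simplified] and cbc = composableD[OF bc, simplified]
  have s: "src W \<cdot> imul C W a b = src W \<cdot> b"
    by (rule W0_eqI) (use cab ty[OF ab] in \<open>simp_all add: extend[OF ps C] extend[OF qs C] p_imul[OF ab] X(1)[OF composable_pq(1)[OF ab]] Y(1)[OF composable_pq(2)[OF ab]]\<close>)
  have t: "tgt W \<cdot> imul C W b c = tgt W \<cdot> b"
    by (rule W0_eqI) (use cbc ty[OF bc] in \<open>simp_all add: extend[OF pt C] extend[OF qt C] p_imul[OF bc] X(2)[OF composable_pq(1)[OF bc]] Y(2)[OF composable_pq(2)[OF bc]]\<close>)
  have 3: "composable C W (imul C W a b) c" using cab cbc ty[OF ab] s by (simp add: composable_def)
  have 4: "composable C W a (imul C W b c)" using cab cbc ty[OF bc] t by (simp add: composable_def)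
  show "imul C W (imul C W a b) c = imul C W a (imul C W b c)"
  proof (rule W_eqI)
    show "p1 \<cdot> imul C W (imul C W a b) c = p1 \<cdot> imul C W a (imul C W b c)"
      unfolding p_imul[OF 3] p_imul[OF 4] p_imul[OF ab] p_imul[OF bc]
      by (rule X(5)[OF composable_pq(1)[OF ab] composable_pq(1)[OF bc]])
    show "q1 \<cdot> imul C W (imul C W a b) c = q1 \<cdot> imul C W a (imul C W b c)"
      unfolding p_imul[OF 3] p_imul[OF 4] p_imul[OF ab] p_imul[OF bc]
      by (rule Y(5)[OF composable_pq(2)[OF ab] composable_pq(2)[OF bc]])
  qed (use ty[OF 3] ty[OF 4] ty[OF ab] cab in simp_all)
qed

definition "pF = \<lparr>ifdom = W, ifcod = X, if_obj = p0, if_mor = p1\<rparr>"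
definition "pG = \<lparr>ifdom = W, ifcod = Y, if_obj = q0, if_mor = q1\<rparr>"

lemma pF_ifun: "is_ifun C pF"
  unfolding pF_def
  by (rule ifunI[OF W_icat fD(1)]) (simp_all add: ps pt pe p_imul)

lemma pG_ifun: "is_ifun C pG"
  unfolding pG_def
  by (rule ifunI[OF W_icat gD(1)]) (simp_all add: qs qt qe p_imul)

text \<open>The mediating functor consists of the mediating arrows on objects and on morphisms;
  functoriality is again checked on components.\<close>

lemma int_cat_pullback: "is_pullback ICat F G pF pG"
proof (rule is_pullbackI)
  show "F \<in> Arr ICat" "G \<in> Arr ICat" "pF \<in> Arr ICat" "pG \<in> Arr ICat"
    using F G pF_ifun pG_ifun by simp_all
  show "Cod ICat F = Cod ICat G" "Dom ICat pF = Dom ICat pG"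
    "Cod ICat pF = Dom ICat F" "Cod ICat pG = Dom ICat G"
    using FG by (simp_all add: pF_def pG_def)
  show "F \<cdot>[ICat] pF = G \<cdot>[ICat] pG" using FG c0 c1 by (simp add: pF_def pG_def)
next
  fix U K assume a: "U \<in> Arr ICat" "K \<in> Arr ICat" "Dom ICat U = Dom ICat K"
    "Cod ICat U = Dom ICat F" "Cod ICat K = Dom ICat G"
    "F \<cdot>[ICat] U = G \<cdot>[ICat] K"
  have U: "is_ifun C U" and K: "is_ifun C K" and d: "ifdom K = ifdom U" "ifcod U = X" "ifcod K = Y"
    and e0: "f0 \<cdot> if_obj U = g0 \<cdot> if_obj K" and e1: "f1 \<cdot> if_mor U = g1 \<cdot> if_mor K"
    using a by simp_all
  note u = ifunD[OF U, unfolded d] and k = ifunD[OF K, unfolded d]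
  note T = icat_graphI[OF u(1)]
  note Td = icat_graphD(1-14)[OF T]
  define w0 w1 where "w0 = pb_pair C f0 g0 (if_obj U) (if_obj K)" and "w1 = pb_pair C f1 g1 (if_mor U) (if_mor K)"
  have w0: "arr w0" "dom w0 = iobj (ifdom U)" "cod w0 = iobj W" "p0 \<cdot> w0 = if_obj U" "q0 \<cdot> w0 = if_obj K"
    using u(3-5) k(3-5) e0 by (simp_all add: w0_def)
  have w1: "arr w1" "dom w1 = imor (ifdom U)" "cod w1 = imor W" "p1 \<cdot> w1 = if_mor U" "q1 \<cdot> w1 = if_mor K"
    using u(6-8) k(6-8) e1 by (simp_all add: w1_def)
  have "is_ifun C \<lparr>ifdom = ifdom U, ifcod = W, if_obj = w0, if_mor = w1\<rparr>"
  proof (rule ifunI[OF u(1) W_icat])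
    show "src W \<cdot> w1 = w0 \<cdot> src (ifdom U)"
      by (rule W0_eqI) (use w0(1-3) w1 Td u(9) k(9) in \<open>simp_all add: extend[OF ps C] extend[OF qs C] extend[OF w0(4) C] extend[OF w0(5) C]\<close>)
    show "tgt W \<cdot> w1 = w0 \<cdot> tgt (ifdom U)"
      by (rule W0_eqI) (use w0(1-3) w1 Td u(10) k(10) in \<open>simp_all add: extend[OF pt C] extend[OF qt C] extend[OF w0(4) C] extend[OF w0(5) C]\<close>)
    show "w1 \<cdot> unt (ifdom U) = unt W \<cdot> w0"
      by (rule W_eqI) (use w0 w1(1-3) Td u(11) k(11) in \<open>simp_all add: extend[OF pe C] extend[OF qe C] extend[OF w1(4) C] extend[OF w1(5) C]\<close>)
    fix a b assume ab: "composable C (ifdom U) a b"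
    note c = composableD[OF ab] and ti = imul_typing[OF T ab]
    have "src W \<cdot> (w1 \<cdot> a) = tgt W \<cdot> (w1 \<cdot> b)"
    proof (rule W0_eqI)
      have cu: "composable C X (if_mor U \<cdot> a) (if_mor U \<cdot> b)" using ifun_composable[OF U ab] d by simp
      have ck: "composable C Y (if_mor K \<cdot> a) (if_mor K \<cdot> b)" using ifun_composable[OF K, of a b] ab d by simp
      show "p0 \<cdot> (src W \<cdot> (w1 \<cdot> a)) = p0 \<cdot> (tgt W \<cdot> (w1 \<cdot> b))"
        using w1(1-3) c composableD(6)[OF cu]
        by (simp add: extend[OF ps C] extend[OF pt C] extend[OF w1(4) C])
      show "q0 \<cdot> (src W \<cdot> (w1 \<cdot> a)) = q0 \<cdot> (tgt W \<cdot> (w1 \<cdot> b))"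
        using w1(1-3) c composableD(6)[OF ck]
        by (simp add: extend[OF qs C] extend[OF qt C] extend[OF w1(5) C])
    qed (use w1(1-3) c in simp_all)
    then have cw: "composable C W (w1 \<cdot> a) (w1 \<cdot> b)" using w1(1-3) c by (simp add: composable_def)
    show "w1 \<cdot> imul C (ifdom U) a b = imul C W (w1 \<cdot> a) (w1 \<cdot> b)"
    proof (rule W_eqI)
      show "p1 \<cdot> (w1 \<cdot> imul C (ifdom U) a b) = p1 \<cdot> imul C W (w1 \<cdot> a) (w1 \<cdot> b)"
        using w1(1-3) c ti ifun_imul[OF U ab] d by (simp add: p_imul[OF cw] extend[OF w1(4) C])
      show "q1 \<cdot> (w1 \<cdot> imul C (ifdom U) a b) = q1 \<cdot> imul C W (w1 \<cdot> a) (w1 \<cdot> b)"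
        using w1(1-3) c ti ifun_imul[OF K, of a b] ab d by (simp add: p_imul[OF cw] extend[OF w1(5) C])
    qed (use w1(1-3) c ti imul_typing[OF W_graph cw] in simp_all)
  qed (use w0 w1 in simp_all)
  then show "\<exists>w\<in>Arr ICat. Dom ICat w = Dom ICat U \<and> Cod ICat w = Dom ICat pF \<and>
      pF \<cdot>[ICat] w = U \<and> pG \<cdot>[ICat] w = K"
    using w0 w1 d by (intro bexI[of _ "\<lparr>ifdom = ifdom U, ifcod = W, if_obj = w0, if_mor = w1\<rparr>"]) (simp_all add: pF_def pG_def)
next
  fix A B assume a: "A \<in> Arr ICat" "B \<in> Arr ICat" "Dom ICat A = Dom ICat B"
    "Cod ICat A = Dom ICat pF" "Cod ICat B = Dom ICat pF"
    "pF \<cdot>[ICat] A = pF \<cdot>[ICat] B" "pG \<cdot>[ICat] A = pG \<cdot>[ICat] B"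
  have A: "is_ifun C A" and B: "is_ifun C B" and d: "ifdom A = ifdom B" "ifcod A = W" "ifcod B = W"
    and e: "p0 \<cdot> if_obj A = p0 \<cdot> if_obj B" "p1 \<cdot> if_mor A = p1 \<cdot> if_mor B"
      "q0 \<cdot> if_obj A = q0 \<cdot> if_obj B" "q1 \<cdot> if_mor A = q1 \<cdot> if_mor B"
    using a by (simp_all add: pF_def pG_def)
  have "if_obj A = if_obj B" by (rule W0_eqI) (use ifunD(3-5)[OF A] ifunD(3-5)[OF B] d e in simp_all)
  moreover have "if_mor A = if_mor B" by (rule W_eqI) (use ifunD(6-8)[OF A] ifunD(6-8)[OF B] d e in simp_all)
  ultimately show "A = B" using d by (intro ifun.equality) simp_all
qed

end

context pb_category
begin

lemma int_cat_has_pullbacks: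
  shows "has_pullbacks ICat"
  unfolding has_pullbacks_def
proof (intro ballI impI)
  fix F G assume a: "F \<in> Arr ICat" "G \<in> Arr ICat" "Cod ICat F = Cod ICat G"
  interpret ifun_cospan C F G using a by unfold_locales simp_all
  show "\<exists>p q. is_pullback ICat F G p q" using int_cat_pullback by blast
qed

lemma int_cat_iso_obj:
  assumes i: "iso ICat \<phi>"
  shows "iso C (if_obj \<phi>)"
proof -
  obtain \<psi> where \<psi>: "\<psi> \<in> Arr ICat" "Dom ICat \<psi> = Cod ICat \<phi>" "Cod ICat \<psi> = Dom ICat \<phi>"
    "\<psi> \<cdot>[ICat] \<phi> = Ident ICat (Dom ICat \<phi>)" "\<phi> \<cdot>[ICat] \<psi> = Ident ICat (Cod ICat \<phi>)"
    using isoD[OF category_int_cat i] by blast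
  have "is_ifun C \<phi>" "is_ifun C \<psi>" using iso_arr[OF i] \<psi>(1) by simp_all
  note d = ifunD(3-5)[OF this(1)] ifunD(3-5)[OF this(2)]
  show ?thesis
    using d \<psi>(2-5) by (intro isoI[where g = "if_obj \<psi>"]) simp_all
qed

text \<open>The levelwise pullback has this property by construction, and every other pullback is
  isomorphic to it.\<close>

lemma int_cat_pullback_obj:
  assumes pb: "is_pullback ICat F G A B"
  shows "is_pullback C (if_obj F) (if_obj G) (if_obj A) (if_obj B)"
proof -
  note d = pullback_simps[OF pb]
  interpret ifun_cospan C F G using d by unfold_locales simp_all
  obtain i where i: "iso ICat i" "Dom ICat i = Dom ICat A" "Cod ICat i = Dom ICat pF"
    "pF \<cdot>[ICat] i = A" "pG \<cdot>[ICat] i = B"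
    using pullback_compare[OF category_int_cat int_cat_pullback pb] .
  have i0: "iso C (if_obj i)" by (rule int_cat_iso_obj[OF i(1)])
  have "is_ifun C i" using iso_arr[OF i(1)] by simp
  then have "cod (if_obj i) = dom p0" using ifunD(5)[ of i] i(3) by (simp add: pF_def)
  from pullback_iso_left[OF C chosen_pullback[OF P] i0 this]
  have "is_pullback C f0 g0 (p0 \<cdot> if_obj i) (q0 \<cdot> if_obj i)" by simp
  moreover have "if_obj A = p0 \<cdot> if_obj i" "if_obj B = q0 \<cdot> if_obj i"
    unfolding i(4,5)[symmetric] by (simp_all add: pF_def pG_def)
  ultimately show ?thesis by simp
qed

lemma int_cat_isoI:
  assumes F: "is_ifun C F" and G: "is_ifun C G"
    and d: "ifdom G = ifcod F" "ifcod G = ifdom F"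
    and e: "if_obj G \<cdot> if_obj F = Ident C (iobj (ifdom F))" "if_obj F \<cdot> if_obj G = Ident C (iobj (ifcod F))"
      "if_mor G \<cdot> if_mor F = Ident C (imor (ifdom F))" "if_mor F \<cdot> if_mor G = Ident C (imor (ifcod F))"
  shows "iso ICat F"
  by (rule isoI[where g = G]) (use F G d e in simp_all)

end

section \<open>Enriched categories in terms of generalized elements\<close>

definition vmul :: "('o, 'm) cat \<Rightarrow> ('u, 'o, 'm) vcat \<Rightarrow> 'u \<Rightarrow> 'u \<Rightarrow> 'u \<Rightarrow> 'm \<Rightarrow> 'm \<Rightarrow> 'm" where
  "vmul C M x y z a b = vcomp M (x, y, z) \<cdot>[C] prod_pair C a b"

definition vcat_graph :: "('u set \<Rightarrow> bool) \<Rightarrow> ('o, 'm) cat \<Rightarrow> ('u, 'o, 'm) vcat \<Rightarrow> bool" where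
  "vcat_graph small C M \<longleftrightarrow> small (vobj M) \<and>
     (\<forall>x\<in>vobj M. \<forall>y\<in>vobj M. vhom M (x, y) \<in> Obj C) \<and>
     (\<forall>x\<in>vobj M. \<forall>y\<in>vobj M. \<forall>z\<in>vobj M.
        vcomp M (x, y, z) \<in> hom C (prod_obj C (vhom M (y, z)) (vhom M (x, y))) (vhom M (x, z))) \<and>
     (\<forall>x\<in>vobj M. vid M x \<in> hom C (term_obj C) (vhom M (x, x)))"

lemma vcat_graphD:
  assumes "vcat_graph small C M"
  shows "small (vobj M)" "x \<in> vobj M ==> y \<in> vobj M ==> vhom M (x, y) \<in> Obj C"
    and "x \<in> vobj M ==> y \<in> vobj M ==> z \<in> vobj M ==> vcomp M (x, y, z) \<in> Arr C"
    and "x \<in> vobj M ==> y \<in> vobj M ==> z \<in> vobj M ==>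
      Dom C (vcomp M (x, y, z)) = prod_obj C (vhom M (y, z)) (vhom M (x, y))"
    and "x \<in> vobj M ==> y \<in> vobj M ==> z \<in> vobj M ==> Cod C (vcomp M (x, y, z)) = vhom M (x, z)"
    and "x \<in> vobj M ==> vid M x \<in> Arr C" "x \<in> vobj M ==> Dom C (vid M x) = term_obj C"
    and "x \<in> vobj M ==> Cod C (vid M x) = vhom M (x, x)"
  using assms unfolding vcat_graph_def by auto

lemma vcat_graphI: "is_vcat small C M ==> vcat_graph small C M"
  unfolding is_vcat_def vcat_graph_def Let_def by blast

context cartesian
begin

lemma vmul_typing:
  assumes M: "vcat_graph small C M" and x: "x \<in> vobj M" "y \<in> vobj M" "z \<in> vobj M"
    and ab: "arr a" "arr b" "dom b = dom a" "cod a = vhom M (y, z)" "cod b = vhom M (x, y)"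
  shows "arr (vmul C M x y z a b)" "dom (vmul C M x y z a b) = dom a" "cod (vmul C M x y z a b) = vhom M (x, z)"
  using vcat_graphD(2-5)[OF M] x ab by (simp_all add: vmul_def)

lemma vmul_comp:
  assumes M: "vcat_graph small C M" and x: "x \<in> vobj M" "y \<in> vobj M" "z \<in> vobj M"
    and ab: "arr a" "arr b" "dom b = dom a" "cod a = vhom M (y, z)" "cod b = vhom M (x, y)"
    and r: "arr r" "cod r = dom a"
  shows "vmul C M x y z a b \<cdot> r = vmul C M x y z (a \<cdot> r) (b \<cdot> r)"
  using vcat_graphD(2-5)[OF M] x ab r by (simp add: vmul_def prod_pair_comp)

lemma vcomp_vmul:
  assumes M: "vcat_graph small C M" and x: "x \<in> vobj M" "y \<in> vobj M" "z \<in> vobj M"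
  shows "vcomp M (x, y, z) = vmul C M x y z (prod_fst C (vhom M (y, z)) (vhom M (x, y))) (prod_snd C (vhom M (y, z)) (vhom M (x, y)))"
proof -
  note d = vcat_graphD[OF M]
  have "prod_pair C (prod_fst C (vhom M (y, z)) (vhom M (x, y))) (prod_snd C (vhom M (y, z)) (vhom M (x, y))) =
      Ident C (prod_obj C (vhom M (y, z)) (vhom M (x, y)))"
    using d x by (rule_tac prod_eqI[of _ _ "vhom M (y, z)" "vhom M (x, y)"]) simp_all
  then show ?thesis using d x by (simp add: vmul_def)
qed

text \<open>The diagrams in \<open>is_vcat\<close> are the instances of these laws at product
  projections, the generic elements of the hom-objects. In the unit laws the projection to
  \<open>one\<close> is the unique arrow to it.\<close>

lemma vcatI:
  assumes M: "vcat_graph small C M"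
    and ext: "vhom M \<in> extensional (vobj M \<times> vobj M)" "vcomp M \<in> extensional (vobj M \<times> vobj M \<times> vobj M)"
      "vid M \<in> extensional (vobj M)"
    and unit: "\<And>x y a. x \<in> vobj M ==> y \<in> vobj M ==> arr a ==> cod a = vhom M (x, y) ==>
        vmul C M x x y a (vid M x \<cdot> bang C (dom a)) = a"
      "\<And>x y a. x \<in> vobj M ==> y \<in> vobj M ==> arr a ==> cod a = vhom M (x, y) ==>
        vmul C M x y y (vid M y \<cdot> bang C (dom a)) a = a"
    and assoc: "\<And>w x y z a b c. w \<in> vobj M ==> x \<in> vobj M ==> y \<in> vobj M ==> z \<in> vobj M ==>
       arr a ==> arr b ==> arr c ==> dom b = dom a ==> dom c = dom a ==>
       cod a = vhom M (y, z) ==> cod b = vhom M (x, y) ==> cod c = vhom M (w, x) ==>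
       vmul C M w x z (vmul C M x y z a b) c = vmul C M w y z a (vmul C M w x y b c)"
  shows "is_vcat small C M"
proof -
  note d = vcat_graphD[OF M]
  have u1: "vcomp M (x, x, y) \<cdot> prod_arr C (Ident C (vhom M (x, y))) (vid M x) = prod_fst C (vhom M (x, y)) one"
    if x: "x \<in> vobj M" "y \<in> vobj M" for x y
  proof -
    have b: "bang C (prod_obj C (vhom M (x, y)) one) = prod_snd C (vhom M (x, y)) one"
      using d x by (intro to_one_eq) simp_all
    show ?thesis using unit(1)[OF x, of "prod_fst C (vhom M (x, y)) one"] d x by (simp add: vmul_def prod_arr_def b)
  qed
  have u2: "vcomp M (x, y, y) \<cdot> prod_arr C (vid M y) (Ident C (vhom M (x, y))) = prod_snd C one (vhom M (x, y))"
    if x: "x \<in> vobj M" "y \<in> vobj M" for x y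
  proof -
    have b: "bang C (prod_obj C one (vhom M (x, y))) = prod_fst C one (vhom M (x, y))"
      using d x by (intro to_one_eq) simp_all
    show ?thesis using unit(2)[OF x, of "prod_snd C one (vhom M (x, y))"] d x by (simp add: vmul_def prod_arr_def b)
  qed
  have as: "vcomp M (w, x, z) \<cdot> prod_arr C (vcomp M (x, y, z)) (Ident C (vhom M (w, x))) =
         (vcomp M (w, y, z) \<cdot> prod_arr C (Ident C (vhom M (y, z))) (vcomp M (w, x, y))) \<cdot>
            prod_assoc C (vhom M (y, z)) (vhom M (x, y)) (vhom M (w, x))"
    if x: "w \<in> vobj M" "x \<in> vobj M" "y \<in> vobj M" "z \<in> vobj M" for w x y z
  proof -
    let ?A = "vhom M (y, z)" and ?B = "vhom M (x, y)" and ?D = "vhom M (w, x)"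
    have o: "?A \<in> Obj C" "?B \<in> Obj C" "?D \<in> Obj C" using d x by simp_all
    let ?p = "prod_fst C (prod_obj C ?A ?B) ?D"
    \<comment> \<open>The projections of the iterated product, forming the generic composable
      triple.\<close>
    define a b c where "a = prod_fst C ?A ?B \<cdot> ?p" and "b = prod_snd C ?A ?B \<cdot> ?p"
      and "c = prod_snd C (prod_obj C ?A ?B) ?D"
    have t: "arr a" "arr b" "arr c" "dom b = dom a" "dom c = dom a" "cod a = ?A" "cod b = ?B" "cod c = ?D"
      "dom a = prod_obj C (prod_obj C ?A ?B) ?D"
      using o by (simp_all add: a_def b_def c_def)
    have pab: "prod_pair C a b = ?p" unfolding a_def b_def using o by (intro prod_pair_eta) simp_all
    have pa: "prod_assoc C ?A ?B ?D = prod_pair C a (prod_pair C b c)"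
      by (simp add: prod_assoc_def Let_def a_def b_def c_def)
    have "vcomp M (w, x, z) \<cdot> prod_arr C (vcomp M (x, y, z)) (Ident C ?D) = vmul C M w x z (vmul C M x y z a b) c"
      using d x o t by (simp add: vmul_def prod_arr_def pab c_def[symmetric])
    also have "\<dots> = vmul C M w y z a (vmul C M w x y b c)" using assoc[OF x t(1-8)] .
    also have "\<dots> = (vcomp M (w, y, z) \<cdot> prod_arr C (Ident C ?A) (vcomp M (w, x, y))) \<cdot> prod_assoc C ?A ?B ?D"
      using d x o t by (simp add: pa vmul_def prod_arr_pair)
    finally show ?thesis .
  qed
  show ?thesis
    unfolding is_vcat_def Let_def using M[unfolded vcat_graph_def] ext u1 u2 as by blast
qed

text \<open>Precomposing a diagram of \<open>is_vcat\<close> with the pairing of the given elements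
  turns it into the law for these elements.\<close>

lemma vcatD:
  assumes vc: "is_vcat small C M"
  shows "x \<in> vobj M ==> y \<in> vobj M ==> arr a ==> cod a = vhom M (x, y) ==>
        vmul C M x x y a (vid M x \<cdot> bang C (dom a)) = a"
    and "x \<in> vobj M ==> y \<in> vobj M ==> arr a ==> cod a = vhom M (x, y) ==>
        vmul C M x y y (vid M y \<cdot> bang C (dom a)) a = a"
    and "w \<in> vobj M ==> x \<in> vobj M ==> y \<in> vobj M ==> z \<in> vobj M ==>
       arr a ==> arr b ==> arr c ==> dom b = dom a ==> dom c = dom a ==>
       cod a = vhom M (y, z) ==> cod b = vhom M (x, y) ==> cod c = vhom M (w, x) ==>
       vmul C M w x z (vmul C M x y z a b) c = vmul C M w y z a (vmul C M w x y b c)"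
proof -
  note M = vcat_graphI[OF vc]
  note d = vcat_graphD[OF M]
  {
    assume x: "x \<in> vobj M" "y \<in> vobj M" and a: "arr a" "cod a = vhom M (x, y)"
    have ao: "dom a \<in> Obj C" using a by simp
    have u: "vcomp M (x, x, y) \<cdot> prod_arr C (Ident C (vhom M (x, y))) (vid M x) = prod_fst C (vhom M (x, y)) one"
      "vcomp M (x, y, y) \<cdot> prod_arr C (vid M y) (Ident C (vhom M (x, y))) = prod_snd C one (vhom M (x, y))"
      using vc x unfolding is_vcat_def Let_def by blast+
    have "vmul C M x x y a (vid M x \<cdot> bang C (dom a)) =
      (vcomp M (x, x, y) \<cdot> prod_arr C (Ident C (vhom M (x, y))) (vid M x)) \<cdot> prod_pair C a (bang C (dom a))"
      using d x a ao by (simp add: vmul_def prod_arr_pair)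
    then show "vmul C M x x y a (vid M x \<cdot> bang C (dom a)) = a" unfolding u using a ao by simp
    have "vmul C M x y y (vid M y \<cdot> bang C (dom a)) a =
      (vcomp M (x, y, y) \<cdot> prod_arr C (vid M y) (Ident C (vhom M (x, y)))) \<cdot> prod_pair C (bang C (dom a)) a"
      using d x a ao by (simp add: vmul_def prod_arr_pair)
    then show "vmul C M x y y (vid M y \<cdot> bang C (dom a)) a = a" unfolding u using a ao by simp
  }
  assume x: "w \<in> vobj M" "x \<in> vobj M" "y \<in> vobj M" "z \<in> vobj M" and
    t: "arr a" "arr b" "arr c" "dom b = dom a" "dom c = dom a"
       "cod a = vhom M (y, z)" "cod b = vhom M (x, y)" "cod c = vhom M (w, x)"
  let ?A = "vhom M (y, z)" and ?B = "vhom M (x, y)" and ?D = "vhom M (w, x)"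
  let ?l = "vcomp M (w, x, z) \<cdot> prod_arr C (vcomp M (x, y, z)) (Ident C ?D)"
  let ?r = "(vcomp M (w, y, z) \<cdot> prod_arr C (Ident C ?A) (vcomp M (w, x, y))) \<cdot> prod_assoc C ?A ?B ?D"
  have as: "?l = ?r" using vc x unfolding is_vcat_def Let_def by blast
  let ?w = "prod_pair C (prod_pair C a b) c"
  have "vmul C M w x z (vmul C M x y z a b) c = ?l \<cdot> ?w"
    using d x t by (simp add: vmul_def prod_arr_pair)
  also have "\<dots> = ?r \<cdot> ?w" unfolding as ..
  also have "\<dots> = vmul C M w y z a (vmul C M w x y b c)"
    using d x t by (simp add: vmul_def prod_arr_pair prod_assoc_pair)
  finally show "vmul C M w x z (vmul C M x y z a b) c = vmul C M w y z a (vmul C M w x y b c)" .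
qed

section \<open>V-functors and the category of V-categories\<close>

lemma vfunD:
  assumes F: "is_vfun small C F"
  shows "is_vcat small C (vfdom F)" "is_vcat small C (vfcod F)" "vf_obj F \<in> vobj (vfdom F) \<rightarrow>\<^sub>E vobj (vfcod F)"
    "vf_hom F \<in> extensional (vobj (vfdom F) \<times> vobj (vfdom F))"
    and "x \<in> vobj (vfdom F) ==> vf_obj F x \<in> vobj (vfcod F)"
    and "x \<in> vobj (vfdom F) ==> y \<in> vobj (vfdom F) ==> arr (vf_hom F (x, y))"
    and "x \<in> vobj (vfdom F) ==> y \<in> vobj (vfdom F) ==> dom (vf_hom F (x, y)) = vhom (vfdom F) (x, y)"
    and "x \<in> vobj (vfdom F) ==> y \<in> vobj (vfdom F) ==> cod (vf_hom F (x, y)) = vhom (vfcod F) (vf_obj F x, vf_obj F y)"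
    and "x \<in> vobj (vfdom F) ==> vf_hom F (x, x) \<cdot> vid (vfdom F) x = vid (vfcod F) (vf_obj F x)"
    and "x \<in> vobj (vfdom F) ==> y \<in> vobj (vfdom F) ==> z \<in> vobj (vfdom F) ==>
      arr a ==> arr b ==> dom b = dom a ==> cod a = vhom (vfdom F) (y, z) ==> cod b = vhom (vfdom F) (x, y) ==>
      vf_hom F (x, z) \<cdot> vmul C (vfdom F) x y z a b =
      vmul C (vfcod F) (vf_obj F x) (vf_obj F y) (vf_obj F z) (vf_hom F (y, z) \<cdot> a) (vf_hom F (x, y) \<cdot> b)"
proof -
  let ?M = "vfdom F" and ?N = "vfcod F" and ?f = "vf_obj F" and ?k = "vf_hom F"
  show vM: "is_vcat small C ?M" and vN: "is_vcat small C ?N" and f: "?f \<in> vobj ?M \<rightarrow>\<^sub>E vobj ?N"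
    and "?k \<in> extensional (vobj ?M \<times> vobj ?M)"
    using F unfolding is_vfun_def Let_def by blast+
  show fx: "?f x \<in> vobj ?N" if "x \<in> vobj ?M" for x using f that by blast
  have kk: "?k (x, y) \<in> hom C (vhom ?M (x, y)) (vhom ?N (?f x, ?f y))" if "x \<in> vobj ?M" "y \<in> vobj ?M" for x y
    using F that unfolding is_vfun_def Let_def by blast
  then show k: "arr (?k (x, y))" "dom (?k (x, y)) = vhom ?M (x, y)" "cod (?k (x, y)) = vhom ?N (?f x, ?f y)"
    if "x \<in> vobj ?M" "y \<in> vobj ?M" for x y using that by simp_all
  show "?k (x, x) \<cdot> vid ?M x = vid ?N (?f x)" if "x \<in> vobj ?M" for x
    using F that unfolding is_vfun_def Let_def by blast
  assume x: "x \<in> vobj ?M" "y \<in> vobj ?M" "z \<in> vobj ?M" and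
    t: "arr a" "arr b" "dom b = dom a" "cod a = vhom ?M (y, z)" "cod b = vhom ?M (x, y)"
  have e: "?k (x, z) \<cdot> vcomp ?M (x, y, z) = vcomp ?N (?f x, ?f y, ?f z) \<cdot> prod_arr C (?k (y, z)) (?k (x, y))"
    using F x unfolding is_vfun_def Let_def by blast
  note d = vcat_graphD[OF vcat_graphI[OF vM]] and d' = vcat_graphD[OF vcat_graphI[OF vN]]
  show "?k (x, z) \<cdot> vmul C ?M x y z a b = vmul C ?N (?f x) (?f y) (?f z) (?k (y, z) \<cdot> a) (?k (x, y) \<cdot> b)"
    using x t k[OF x(1,3)] k[OF x(1,2)] k[OF x(2,3)] fx d d'
    by (simp add: vmul_def extend[OF e C] prod_arr_pair)
qed

lemma vfunI:
  assumes MN: "is_vcat small C (vfdom F)" "is_vcat small C (vfcod F)"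
    and f: "vf_obj F \<in> vobj (vfdom F) \<rightarrow>\<^sub>E vobj (vfcod F)" and ext: "vf_hom F \<in> extensional (vobj (vfdom F) \<times> vobj (vfdom F))"
    and k: "\<And>x y. x \<in> vobj (vfdom F) ==> y \<in> vobj (vfdom F) ==> arr (vf_hom F (x, y))"
      "\<And>x y. x \<in> vobj (vfdom F) ==> y \<in> vobj (vfdom F) ==> dom (vf_hom F (x, y)) = vhom (vfdom F) (x, y)"
      "\<And>x y. x \<in> vobj (vfdom F) ==> y \<in> vobj (vfdom F) ==> cod (vf_hom F (x, y)) = vhom (vfcod F) (vf_obj F x, vf_obj F y)"
    and unit: "\<And>x. x \<in> vobj (vfdom F) ==> vf_hom F (x, x) \<cdot> vid (vfdom F) x = vid (vfcod F) (vf_obj F x)"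
    and mul: "\<And>x y z a b. x \<in> vobj (vfdom F) ==> y \<in> vobj (vfdom F) ==> z \<in> vobj (vfdom F) ==>
      arr a ==> arr b ==> dom b = dom a ==> cod a = vhom (vfdom F) (y, z) ==> cod b = vhom (vfdom F) (x, y) ==>
      vf_hom F (x, z) \<cdot> vmul C (vfdom F) x y z a b =
      vmul C (vfcod F) (vf_obj F x) (vf_obj F y) (vf_obj F z) (vf_hom F (y, z) \<cdot> a) (vf_hom F (x, y) \<cdot> b)"
  shows "is_vfun small C F"
proof -
  let ?M = "vfdom F" and ?N = "vfcod F" and ?f = "vf_obj F" and ?k = "vf_hom F"
  note M = vcat_graphI[OF MN(1)] and N = vcat_graphI[OF MN(2)]
  have "?k (x, z) \<cdot> vcomp ?M (x, y, z) = vcomp ?N (?f x, ?f y, ?f z) \<cdot> prod_arr C (?k (y, z)) (?k (x, y))"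
    if x: "x \<in> vobj ?M" "y \<in> vobj ?M" "z \<in> vobj ?M" for x y z
    unfolding vcomp_vmul[OF M x] prod_arr_def
    using mul[OF x, of "prod_fst C (vhom ?M (y, z)) (vhom ?M (x, y))" "prod_snd C (vhom ?M (y, z)) (vhom ?M (x, y))"]
      vcat_graphD(2)[OF M] x k by (simp add: vmul_def)
  then show ?thesis unfolding is_vfun_def Let_def using MN f ext k unit by simp
qed

lemma V_cat_simps [simp]:
  "M \<in> Obj (V_cat small C) \<longleftrightarrow> is_vcat small C M" "F \<in> Arr (V_cat small C) \<longleftrightarrow> is_vfun small C F"
  "Dom (V_cat small C) = vfdom" "Cod (V_cat small C) = vfcod"
  "Ident (V_cat small C) M = \<lparr>vfdom = M, vfcod = M, vf_obj = (\<lambda>x\<in>vobj M. x),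
                   vf_hom = (\<lambda>xy\<in>vobj M \<times> vobj M. Ident C (vhom M xy))\<rparr>"
  "G \<cdot>[V_cat small C] F = \<lparr>vfdom = vfdom F, vfcod = vfcod G,
       vf_obj = compose (vobj (vfdom F)) (vf_obj G) (vf_obj F),
       vf_hom = (\<lambda>(x, y)\<in>vobj (vfdom F) \<times> vobj (vfdom F).
                   vf_hom G (vf_obj F x, vf_obj F y) \<cdot> vf_hom F (x, y))\<rparr>"
  by (simp_all add: V_cat_def)

lemma vfun_eqI:
  assumes F: "is_vfun small C F" and G: "is_vfun small C G" and d: "vfdom F = vfdom G" "vfcod F = vfcod G"
    and e: "\<And>x. x \<in> vobj (vfdom F) ==> vf_obj F x = vf_obj G x"
      "\<And>x y. x \<in> vobj (vfdom F) ==> y \<in> vobj (vfdom F) ==> vf_hom F (x, y) = vf_hom G (x, y)"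
  shows "F = G"
proof -
  have "vf_obj F = vf_obj G"
    using vfunD(3)[OF F] vfunD(3)[OF G] d e(1) by (auto intro!: extensionalityI[of _ "vobj (vfdom F)"] simp: PiE_def)
  moreover have "vf_hom F = vf_hom G"
    using vfunD(4)[OF F] vfunD(4)[OF G] d e(2) by (auto intro!: extensionalityI[of _ "vobj (vfdom F) \<times> vobj (vfdom F)"])
  ultimately show ?thesis using d by (intro vfun.equality) simp_all
qed

lemma vfun_ident:
  assumes M: "is_vcat small C M"
  shows "is_vfun small C (Ident (V_cat small C) M)"
proof (rule vfunI)
  note g = vcat_graphI[OF M]
  note d = vcat_graphD(2-8)[OF g]
  let ?F = "Ident (V_cat small C) M"
  show "vf_hom ?F (x, z) \<cdot> vmul C (vfdom ?F) x y z a b =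
      vmul C (vfcod ?F) (vf_obj ?F x) (vf_obj ?F y) (vf_obj ?F z) (vf_hom ?F (y, z) \<cdot> a) (vf_hom ?F (x, y) \<cdot> b)"
    if "x \<in> vobj (vfdom ?F)" "y \<in> vobj (vfdom ?F)" "z \<in> vobj (vfdom ?F)"
      "arr a" "arr b" "dom b = dom a" "cod a = vhom (vfdom ?F) (y, z)" "cod b = vhom (vfdom ?F) (x, y)" for x y z a b
    using that vmul_typing[OF g, of x y z a b] by simp
qed (use M vcat_graphD(2-8)[OF vcat_graphI[OF M]] in \<open>simp_all add: extensional_def\<close>)

lemma vfun_comp:
  assumes F: "is_vfun small C F" and G: "is_vfun small C G" and FG: "vfcod F = vfdom G"
  shows "is_vfun small C (G \<cdot>[V_cat small C] F)"
proof -
  note f = vfunD[OF F, unfolded FG] and g = vfunD[OF G]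
  let ?H = "G \<cdot>[V_cat small C] F"
  note M = vcat_graphI[OF f(1)] and N = vcat_graphI[OF g(1)]
  note d = vcat_graphD(2-8)[OF M]
  have ho: "vf_obj ?H x = vf_obj G (vf_obj F x)" if "x \<in> vobj (vfdom F)" for x using that by (simp add: compose_def)
  have hh: "vf_hom ?H (x, y) = vf_hom G (vf_obj F x, vf_obj F y) \<cdot> vf_hom F (x, y)" if "x \<in> vobj (vfdom F)" "y \<in> vobj (vfdom F)" for x y
    using that by simp
  have hd: "vfdom ?H = vfdom F" "vfcod ?H = vfcod G" by simp_all
  show ?thesis
  proof (rule vfunI, unfold hd)
    show "vf_obj ?H \<in> vobj (vfdom F) \<rightarrow>\<^sub>E vobj (vfcod G)" using f(5) g(5) by (auto simp: compose_def)
    show "vf_hom ?H \<in> extensional (vobj (vfdom F) \<times> vobj (vfdom F))" by simp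
    fix x assume x: "x \<in> vobj (vfdom F)"
    show "vf_hom ?H (x, x) \<cdot> vid (vfdom F) x = vid (vfcod G) (vf_obj ?H x)"
      unfolding ho[OF x] hh[OF x x]
      using x f(5-8)[OF x] f(6-8)[OF x x] f(9)[OF x] g(6-9)[OF f(5)[OF x]] d g(6-8)[OF f(5)[OF x] f(5)[OF x]] by simp
  next
    fix x y z a b assume x: "x \<in> vobj (vfdom F)" "y \<in> vobj (vfdom F)" "z \<in> vobj (vfdom F)"
      and t: "arr a" "arr b" "dom b = dom a" "cod a = vhom (vfdom F) (y, z)" "cod b = vhom (vfdom F) (x, y)"
    note fx = f(5)[OF x(1)] f(5)[OF x(2)] f(5)[OF x(3)]
    note k = f(6-8)[OF x(1,2)] f(6-8)[OF x(2,3)] f(6-8)[OF x(1,3)]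
    note l = g(6-8)[OF fx(1,2)] g(6-8)[OF fx(2,3)] g(6-8)[OF fx(1,3)]
    have "vf_hom ?H (x, z) \<cdot> vmul C (vfdom F) x y z a b =
      vf_hom G (vf_obj F x, vf_obj F z) \<cdot> (vf_hom F (x, z) \<cdot> vmul C (vfdom F) x y z a b)"
      unfolding hh[OF x(1,3)] using k l vmul_typing[OF M x t] by simp
    also have "\<dots> = vmul C (vfcod G) (vf_obj G (vf_obj F x)) (vf_obj G (vf_obj F y)) (vf_obj G (vf_obj F z))
       (vf_hom G (vf_obj F y, vf_obj F z) \<cdot> (vf_hom F (y, z) \<cdot> a)) (vf_hom G (vf_obj F x, vf_obj F y) \<cdot> (vf_hom F (x, y) \<cdot> b))"
      unfolding f(10)[OF x t] by (rule g(10)[OF fx]) (use k t in simp_all)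
    also have "\<dots> = vmul C (vfcod G) (vf_obj ?H x) (vf_obj ?H y) (vf_obj ?H z) (vf_hom ?H (y, z) \<cdot> a) (vf_hom ?H (x, y) \<cdot> b)"
      unfolding hh[OF x(1,2)] hh[OF x(2,3)] ho[OF x(1)] ho[OF x(2)] ho[OF x(3)] using k l t by simp
    finally show "vf_hom ?H (x, z) \<cdot> vmul C (vfdom F) x y z a b =
      vmul C (vfcod G) (vf_obj ?H x) (vf_obj ?H y) (vf_obj ?H z) (vf_hom ?H (y, z) \<cdot> a) (vf_hom ?H (x, y) \<cdot> b)" .
  qed (use f(1,5-8) g(2,5-8) in \<open>simp_all add: compose_def\<close>)
qed

lemma category_V_cat: "category (V_cat small C)"
  unfolding category_def
proof (intro conjI ballI impI)
  fix F assume F: "F \<in> Arr (V_cat small C)"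
  note f = vfunD[OF F[simplified]]
  show "Dom (V_cat small C) F \<in> Obj (V_cat small C)" "Cod (V_cat small C) F \<in> Obj (V_cat small C)" using f(1,2) by simp_all
  note i = vfun_ident[OF f(1)] vfun_ident[OF f(2)]
  have c: "is_vfun small C (F \<cdot>[V_cat small C] Ident (V_cat small C) (vfdom F))"
    "is_vfun small C (Ident (V_cat small C) (vfcod F) \<cdot>[V_cat small C] F)"
    by (rule vfun_comp[OF i(1) F[simplified]], simp) (rule vfun_comp[OF F[simplified] i(2)], simp)
  show "F \<cdot>[V_cat small C] Ident (V_cat small C) (Dom (V_cat small C) F) = F"
    by (rule vfun_eqI) (use c F f(5-8) in \<open>simp_all add: compose_def\<close>)
  show "Ident (V_cat small C) (Cod (V_cat small C) F) \<cdot>[V_cat small C] F = F"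
    by (rule vfun_eqI) (use c F f(5-8) in \<open>simp_all add: compose_def\<close>)
next
  fix X assume "X \<in> Obj (V_cat small C)"
  then have "is_vfun small C (Ident (V_cat small C) X)" using vfun_ident by simp
  then show "Ident (V_cat small C) X \<in> hom (V_cat small C) X X" by simp
next
  fix F G assume "F \<in> Arr (V_cat small C)" "G \<in> Arr (V_cat small C)" "Cod (V_cat small C) F = Dom (V_cat small C) G"
  then have "is_vfun small C (G \<cdot>[V_cat small C] F)" using vfun_comp by simp
  then show "G \<cdot>[V_cat small C] F \<in> hom (V_cat small C) (Dom (V_cat small C) F) (Cod (V_cat small C) G)" by simp
next
  fix F G H assume a: "F \<in> Arr (V_cat small C)" "G \<in> Arr (V_cat small C)" "H \<in> Arr (V_cat small C)"
    "Cod (V_cat small C) F = Dom (V_cat small C) G \<and> Cod (V_cat small C) G = Dom (V_cat small C) H"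
  have a': "is_vfun small C F" "is_vfun small C G" "is_vfun small C H" "vfcod F = vfdom G" "vfcod G = vfdom H" using a by simp_all
  note f = vfunD[OF a'(1)] and g = vfunD[OF a'(2)] and h = vfunD[OF a'(3)]
  have 1: "is_vfun small C (G \<cdot>[V_cat small C] F)" "is_vfun small C (H \<cdot>[V_cat small C] G)" 
    using vfun_comp[OF a'(1,2,4)] vfun_comp[OF a'(2,3,5)] .
  have 2: "is_vfun small C (H \<cdot>[V_cat small C] (G \<cdot>[V_cat small C] F))" "is_vfun small C ((H \<cdot>[V_cat small C] G) \<cdot>[V_cat small C] F)"
    using vfun_comp[OF 1(1) a'(3)] vfun_comp[OF a'(1) 1(2)] a' by simp_all
  show "(H \<cdot>[V_cat small C] G) \<cdot>[V_cat small C] F = H \<cdot>[V_cat small C] (G \<cdot>[V_cat small C] F)"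
    by (rule vfun_eqI[OF 2(2,1)]) (use f(5-8) g(5-8) h(5-8) a' in \<open>simp_all add: compose_def\<close>)
qed

end

section \<open>Presentations of internal categories by enriched categories\<close>

context lextJ
begin

abbreviation "VCat \<equiv> V_cat small V"

text \<open>\<open>M\<close> presents \<open>Z\<close> if \<open>Z\<close> is the internal category associated with \<open>M\<close>, up to the choice of
  coproducts.\<close>

definition graph_pres :: "('u, 'o, 'm) vcat \<Rightarrow> ('o, 'm) icat \<Rightarrow> ('u \<Rightarrow> 'm) \<Rightarrow> ('u \<times> 'u \<Rightarrow> 'm) \<Rightarrow> bool" where
  "graph_pres M Z \<phi> \<kappa> \<longleftrightarrow> vcat_graph small V M \<and> icat_graph V Z \<and>
     is_coproduct V (vobj M) (\<lambda>_. one) (iobj Z) \<phi> \<and> is_coproduct V (vobj M \<times> vobj M) (vhom M) (imor Z) \<kappa> \<and>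
     (\<forall>x\<in>vobj M. \<forall>y\<in>vobj M. src Z \<cdot> \<kappa> (x, y) = \<phi> x \<cdot> bang V (vhom M (x, y)) \<and>
        tgt Z \<cdot> \<kappa> (x, y) = \<phi> y \<cdot> bang V (vhom M (x, y)))"

definition presents :: "('u, 'o, 'm) vcat \<Rightarrow> ('o, 'm) icat \<Rightarrow> ('u \<Rightarrow> 'm) \<Rightarrow> ('u \<times> 'u \<Rightarrow> 'm) \<Rightarrow> bool" where
  "presents M Z \<phi> \<kappa> \<longleftrightarrow> graph_pres M Z \<phi> \<kappa> \<and>
     (\<forall>x\<in>vobj M. unt Z \<cdot> \<phi> x = \<kappa> (x, x) \<cdot> vid M x) \<and>
     (\<forall>x\<in>vobj M. \<forall>y\<in>vobj M. \<forall>z\<in>vobj M. \<forall>a\<in>Arr V. \<forall>b\<in>Arr V.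
        dom b = dom a \<and> cod a = vhom M (y, z) \<and> cod b = vhom M (x, y) \<longrightarrow>
        imul V Z (\<kappa> (y, z) \<cdot> a) (\<kappa> (x, y) \<cdot> b) = \<kappa> (x, z) \<cdot> vmul V M x y z a b)"

lemma graph_presD:
  assumes "graph_pres M Z \<phi> \<kappa>"
  shows "vcat_graph small V M" "icat_graph V Z"
    "is_coproduct V (vobj M) (\<lambda>_. one) (iobj Z) \<phi>" "is_coproduct V (vobj M \<times> vobj M) (vhom M) (imor Z) \<kappa>"
    and "small (vobj M)" "smallish small (vobj M)" "smallish small (vobj M \<times> vobj M)"
    and "x \<in> vobj M ==> y \<in> vobj M ==> src Z \<cdot> \<kappa> (x, y) = \<phi> x \<cdot> bang V (vhom M (x, y))"
    and "x \<in> vobj M ==> y \<in> vobj M ==> tgt Z \<cdot> \<kappa> (x, y) = \<phi> y \<cdot> bang V (vhom M (x, y))"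
proof -
  show 1: "vcat_graph small V M" and "icat_graph V Z"
    "is_coproduct V (vobj M) (\<lambda>_. one) (iobj Z) \<phi>" "is_coproduct V (vobj M \<times> vobj M) (vhom M) (imor Z) \<kappa>"
    "x \<in> vobj M ==> y \<in> vobj M ==> src Z \<cdot> \<kappa> (x, y) = \<phi> x \<cdot> bang V (vhom M (x, y))"
    "x \<in> vobj M ==> y \<in> vobj M ==> tgt Z \<cdot> \<kappa> (x, y) = \<phi> y \<cdot> bang V (vhom M (x, y))"
    using assms unfolding graph_pres_def by blast+
  show s: "small (vobj M)" using vcat_graphD(1)[OF 1] .
  then show "smallish small (vobj M)" by (rule smallish_small)
  then show "smallish small (vobj M \<times> vobj M)" by (intro smallish_Times)
qed

lemma graph_pres_typing:
  assumes "graph_pres M Z \<phi> \<kappa>"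
  shows "x \<in> vobj M ==> arr (\<phi> x)" "x \<in> vobj M ==> dom (\<phi> x) = one" "x \<in> vobj M ==> cod (\<phi> x) = iobj Z"
    "x \<in> vobj M ==> y \<in> vobj M ==> arr (\<kappa> (x, y))" "x \<in> vobj M ==> y \<in> vobj M ==> dom (\<kappa> (x, y)) = vhom M (x, y)"
    "x \<in> vobj M ==> y \<in> vobj M ==> cod (\<kappa> (x, y)) = imor Z"
    "x \<in> vobj M ==> y \<in> vobj M ==> vhom M (x, y) \<in> Obj V"
  using is_coproductD(2-4)[OF graph_presD(3)[OF assms]] is_coproductD(2-4)[OF graph_presD(4)[OF assms], of "(x, y)"]
    vcat_graphD(2)[OF graph_presD(1)[OF assms]] by simp_all

lemma graph_pres_st:
  assumes g: "graph_pres M Z \<phi> \<kappa>" and x: "x \<in> vobj M" "y \<in> vobj M" and a: "arr a" "cod a = vhom M (x, y)"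
  shows "src Z \<cdot> (\<kappa> (x, y) \<cdot> a) = \<phi> x \<cdot> bang V (dom a)"
    and "tgt Z \<cdot> (\<kappa> (x, y) \<cdot> a) = \<phi> y \<cdot> bang V (dom a)"
  using graph_pres_typing[OF g] icat_graphD[OF graph_presD(2)[OF g]] x a
  by (simp_all add: extend[OF graph_presD(8)[OF g x] V] extend[OF graph_presD(9)[OF g x] V])

lemma graph_pres_monic:
  assumes g: "graph_pres M Z \<phi> \<kappa>" and x: "x \<in> vobj M" "y \<in> vobj M"
    and ab: "arr a" "arr b" "dom b = dom a" "cod a = vhom M (x, y)" "cod b = vhom M (x, y)"
    and eq: "\<kappa> (x, y) \<cdot> a = \<kappa> (x, y) \<cdot> b"
  shows "a = b"
  by (rule monicD[OF coproduct_monic[OF graph_presD(7)[OF g] graph_presD(4)[OF g], of "(x, y)"]])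
    (use ab eq x graph_pres_typing[OF g] in simp_all)

section \<open>Decomposition into matching pieces\<close>

lemma point_disjoint:
  assumes g: "graph_pres M Z \<phi> \<kappa>" and x: "x \<in> vobj M" "y \<in> vobj M" "x \<noteq> y" and T: "T \<in> Obj V"
    and eq: "\<phi> x \<cdot> bang V T = \<phi> y \<cdot> bang V T"
  shows "is_initial V T"
  using coproduct_disjoint[OF graph_presD(6)[OF g] graph_presD(3)[OF g] x _ _ _ _ _ eq] T by simp

text \<open>The source of one element and the target of the other are the same arrow, through \<phi>
  y and through \<phi> w, and distinct points are disjoint.\<close>

lemma composable_cases:
  assumes g: "graph_pres M Z \<phi> \<kappa>" and x: "x \<in> vobj M" "w \<in> vobj M" "y \<in> vobj M" "z \<in> vobj M"
    and ab: "arr a" "arr b" "dom b = dom a" "cod a = vhom M (y, z)" "cod b = vhom M (x, w)"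
    and eq: "src Z \<cdot> (\<kappa> (y, z) \<cdot> a) = tgt Z \<cdot> (\<kappa> (x, w) \<cdot> b)"
  shows "y = w \<or> is_initial V (dom a)"
proof -
  have "\<phi> y \<cdot> bang V (dom a) = \<phi> w \<cdot> bang V (dom a)"
    using eq graph_pres_st[OF g x(3,4) ab(1,4)] graph_pres_st[OF g x(1,2) ab(2,5)] ab(3) by simp
  moreover have "dom a \<in> Obj V" using ab(1) by simp
  ultimately show ?thesis using point_disjoint[OF g x(3,2)] by blast
qed

text \<open>The stage is decomposed along a and along b. A piece whose middle objects differ is
  initial, and every equation holds there, so only the matching pieces remain.\<close>

lemma composable_eqI:
  assumes g: "graph_pres M Z \<phi> \<kappa>" and ab: "composable V Z a b"
    and u: "arr u" "dom u = dom a" and v: "arr v" "dom v = dom a" "cod v = cod u"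
    and eq: "\<And>x y z R a' b'. x \<in> vobj M ==> y \<in> vobj M ==> z \<in> vobj M ==> arr R ==> cod R = dom a ==>
      arr a' ==> arr b' ==> dom a' = dom R ==> dom b' = dom R ==>
      cod a' = vhom M (y, z) ==> cod b' = vhom M (x, y) ==>
      a \<cdot> R = \<kappa> (y, z) \<cdot> a' ==> b \<cdot> R = \<kappa> (x, y) \<cdot> b' ==> u \<cdot> R = v \<cdot> R"
  shows "u = v"
proof -
  note c = composableD[OF ab] and ty = graph_pres_typing[OF g]
  show ?thesis
  proof (rule locally_eqI[OF graph_presD(7)[OF g] graph_presD(4)[OF g] c(1,4) u v])
    fix k r x assume k: "k \<in> vobj M \<times> vobj M" and r: "arr r" "arr x" "cod r = dom a" "dom x = dom r" "cod x = vhom M k"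
      and ar: "a \<cdot> r = \<kappa> k \<cdot> x"
    obtain y z where yz: "k = (y, z)" "y \<in> vobj M" "z \<in> vobj M" using k by blast
    show "u \<cdot> r = v \<cdot> r"
    proof (rule locally_eqI[OF graph_presD(7)[OF g] graph_presD(4)[OF g], of "b \<cdot> r"])
      fix k' r' x' assume k': "k' \<in> vobj M \<times> vobj M" and r': "arr r'" "arr x'" "cod r' = dom (b \<cdot> r)"
        "dom x' = dom r'" "cod x' = vhom M k'" and br: "(b \<cdot> r) \<cdot> r' = \<kappa> k' \<cdot> x'"
      obtain x0 w where xw: "k' = (x0, w)" "x0 \<in> vobj M" "w \<in> vobj M" using k' by blast
      have r'c: "cod r' = dom r" using r' r c by simp
      define R where "R = r \<cdot> r'"
      have R: "arr R" "dom R = dom r'" "cod R = dom a" using r r' r'c by (simp_all add: R_def)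
      define x2 where "x2 = x \<cdot> r'"
      have x2: "arr x2" "dom x2 = dom R" "cod x2 = vhom M (y, z)" using r r' r'c yz R by (simp_all add: x2_def)
      have aR: "a \<cdot> R = \<kappa> (y, z) \<cdot> x2"
        using r r'(1,2,4,5) r'c c yz ty(4-6)[OF yz(2,3)] by (simp add: R_def x2_def extend[OF ar V])
      have bR: "b \<cdot> R = \<kappa> (x0, w) \<cdot> x'" using br r r' r'c c xw by (simp add: R_def)
      have "composable V Z (a \<cdot> R) (b \<cdot> R)" by (rule composable_comp[OF graph_presD(2)[OF g] ab R(1,3)])
      from composableD(6)[OF this, unfolded aR bR]
      have "y = w \<or> is_initial V (dom x2)"
        using composable_cases[OF g xw(2,3) yz(2,3) x2(1) r'(2)] x2 r' R xw by simp
      then have "u \<cdot> R = v \<cdot> R"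
      proof
        assume "y = w"
        then show ?thesis using eq[OF xw(2) yz(2,3) R(1,3) x2(1) r'(2) x2(2) _ x2(3) _ aR] bR r' R xw by simp
      next
        assume "is_initial V (dom x2)"
        then show ?thesis using u v R x2 by (rule_tac initial_eqI[OF _ V]) simp_all
      qed
      then show "(u \<cdot> r) \<cdot> r' = (v \<cdot> r) \<cdot> r'" using u v r r' r'c by (simp add: R_def)
    qed (use c r u v in simp_all)
  qed
qed

lemma presentsD:
  assumes "presents M Z \<phi> \<kappa>"
  shows "graph_pres M Z \<phi> \<kappa>" "x \<in> vobj M ==> unt Z \<cdot> \<phi> x = \<kappa> (x, x) \<cdot> vid M x"
    and "x \<in> vobj M ==> y \<in> vobj M ==> z \<in> vobj M ==> arr a ==> arr b ==>
        dom b = dom a ==> cod a = vhom M (y, z) ==> cod b = vhom M (x, y) ==>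
        imul V Z (\<kappa> (y, z) \<cdot> a) (\<kappa> (x, y) \<cdot> b) = \<kappa> (x, z) \<cdot> vmul V M x y z a b"
  using assms unfolding presents_def by blast+

text \<open>On matching pieces multiplication is the composition of M, so each law reduces to the
  corresponding law of a V-category. Associativity needs a further decomposition along the third
  element.\<close>

lemma presents_icat:
  assumes pr: "presents M Z \<phi> \<kappa>" and M: "is_vcat small V M"
  shows "is_icat V Z"
proof (rule icatI)
  note g = presentsD(1)[OF pr] and un = presentsD(2)[OF pr] and mu = presentsD(3)[OF pr]
  note Mg = graph_presD(1)[OF g] and Zg = graph_presD(2)[OF g]
  note ty = graph_pres_typing[OF g] and st = graph_pres_st[OF g]
  note d = icat_graphD[OF Zg]
  show "icat_graph V Z" by (rule Zg)
  have stc: "src Z \<cdot> imul V Z a b = src Z \<cdot> b" "tgt Z \<cdot> imul V Z a b = tgt Z \<cdot> a"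
    if ab: "composable V Z a b" for a b
  proof -
    note c = composableD[OF ab] and ti = imul_typing[OF Zg ab]
    have "src Z \<cdot> (imul V Z a b \<cdot> R) = src Z \<cdot> (b \<cdot> R) \<and> tgt Z \<cdot> (imul V Z a b \<cdot> R) = tgt Z \<cdot> (a \<cdot> R)"
      if x: "x \<in> vobj M" "y \<in> vobj M" "z \<in> vobj M" and R: "arr R" "cod R = dom a" and
      t: "arr a'" "arr b'" "dom a' = dom R" "dom b' = dom R"
      "cod a' = vhom M (y, z)" "cod b' = vhom M (x, y)"
      and e: "a \<cdot> R = \<kappa> (y, z) \<cdot> a'" "b \<cdot> R = \<kappa> (x, y) \<cdot> b'" for x y z R a' b'
    proof -
      have t': "dom b' = dom a'" using t by simp
      have i: "imul V Z a b \<cdot> R = \<kappa> (x, z) \<cdot> vmul V M x y z a' b'"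
        unfolding imul_comp[OF Zg ab R] e by (rule mu[OF x t(1,2) t' t(5,6)])
      note tv = vmul_typing[OF Mg x t(1,2) t' t(5,6)]
      show ?thesis unfolding i e using st[OF x(1,3) tv(1,3)] st[OF x(2,3) t(1,5)] st[OF x(1,2) t(2,6)] tv t by simp
    qed
    note s = this
    show "src Z \<cdot> imul V Z a b = src Z \<cdot> b"
      by (rule composable_eqI[OF g ab]) (use s c ti d in \<open>simp_all\<close>)
    show "tgt Z \<cdot> imul V Z a b = tgt Z \<cdot> a"
      by (rule composable_eqI[OF g ab]) (use s c ti d in \<open>simp_all\<close>)
  qed
  then show "\<And>a b. composable V Z a b ==> src Z \<cdot> imul V Z a b = src Z \<cdot> b"
    "\<And>a b. composable V Z a b ==> tgt Z \<cdot> imul V Z a b = tgt Z \<cdot> a" by blast+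
  have un': "unt Z \<cdot> (\<phi> x \<cdot> bang V T) = \<kappa> (x, x) \<cdot> (vid M x \<cdot> bang V T)" if "x \<in> vobj M" "T \<in> Obj V" for x T
    using that ty d vcat_graphD(6-8)[OF Mg] by (simp add: extend[OF un V])
  have 1: "composable V Z (Ident V (imor Z)) (unt Z \<cdot> src Z)"
    and 2: "composable V Z (unt Z \<cdot> tgt Z) (Ident V (imor Z))"
    using d by (simp_all add: composable_def extend[OF d(15) V] extend[OF d(16) V])
  show "imul V Z (Ident V (imor Z)) (unt Z \<cdot> src Z) = Ident V (imor Z)"
  proof (rule coproduct_eqI[OF graph_presD(4)[OF g] V])
    fix k assume "k \<in> vobj M \<times> vobj M"
    then obtain x y where k: "k = (x, y)" and x: "x \<in> vobj M" "y \<in> vobj M" by blast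
    have "src Z \<cdot> \<kappa> (x, y) = \<phi> x \<cdot> bang V (vhom M (x, y))" by (rule graph_presD(8)[OF g x])
    then have e: "unt Z \<cdot> (src Z \<cdot> \<kappa> (x, y)) = \<kappa> (x, x) \<cdot> (vid M x \<cdot> bang V (vhom M (x, y)))"
      using un'[OF x(1) ty(7)[OF x]] by simp
    have "imul V Z (Ident V (imor Z)) (unt Z \<cdot> src Z) \<cdot> \<kappa> k =
      imul V Z (\<kappa> (x, y) \<cdot> Ident V (vhom M (x, y))) (\<kappa> (x, x) \<cdot> (vid M x \<cdot> bang V (vhom M (x, y))))"
      unfolding k using imul_comp[OF Zg 1, of "\<kappa> (x, y)"] ty(4-7)[OF x] d e by simp
    also have "\<dots> = \<kappa> (x, y) \<cdot> vmul V M x x y (Ident V (vhom M (x, y))) (vid M x \<cdot> bang V (vhom M (x, y)))"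
      by (rule mu[OF x(1,1,2)]) (use ty(7)[OF x] vcat_graphD(6-8)[OF Mg x(1)] in simp_all)
    also have "\<dots> = \<kappa> k" using vcatD(1)[OF M x, of "Ident V (vhom M (x, y))"] ty(4-7)[OF x] k by simp
    also have "\<dots> = Ident V (imor Z) \<cdot> \<kappa> k" using ty(4-7)[OF x] k by simp
    finally show "imul V Z (Ident V (imor Z)) (unt Z \<cdot> src Z) \<cdot> \<kappa> k = Ident V (imor Z) \<cdot> \<kappa> k" .
  qed (use imul_typing[OF Zg 1] d in simp_all)
  show "imul V Z (unt Z \<cdot> tgt Z) (Ident V (imor Z)) = Ident V (imor Z)"
  proof (rule coproduct_eqI[OF graph_presD(4)[OF g] V])
    fix k assume "k \<in> vobj M \<times> vobj M"
    then obtain x y where k: "k = (x, y)" and x: "x \<in> vobj M" "y \<in> vobj M" by blast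
    have "tgt Z \<cdot> \<kappa> (x, y) = \<phi> y \<cdot> bang V (vhom M (x, y))" by (rule graph_presD(9)[OF g x])
    then have e: "unt Z \<cdot> (tgt Z \<cdot> \<kappa> (x, y)) = \<kappa> (y, y) \<cdot> (vid M y \<cdot> bang V (vhom M (x, y)))"
      using un'[OF x(2) ty(7)[OF x]] by simp
    have "imul V Z (unt Z \<cdot> tgt Z) (Ident V (imor Z)) \<cdot> \<kappa> k =
      imul V Z (\<kappa> (y, y) \<cdot> (vid M y \<cdot> bang V (vhom M (x, y)))) (\<kappa> (x, y) \<cdot> Ident V (vhom M (x, y)))"
      unfolding k using imul_comp[OF Zg 2, of "\<kappa> (x, y)"] ty(4-7)[OF x] d e by simp
    also have "\<dots> = \<kappa> (x, y) \<cdot> vmul V M x y y (vid M y \<cdot> bang V (vhom M (x, y))) (Ident V (vhom M (x, y)))"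
      by (rule mu[OF x(1,2,2)]) (use ty(7)[OF x] vcat_graphD(6-8)[OF Mg x(2)] in simp_all)
    also have "\<dots> = \<kappa> k" using vcatD(2)[OF M x, of "Ident V (vhom M (x, y))"] ty(4-7)[OF x] k by simp
    also have "\<dots> = Ident V (imor Z) \<cdot> \<kappa> k" using ty(4-7)[OF x] k by simp
    finally show "imul V Z (unt Z \<cdot> tgt Z) (Ident V (imor Z)) \<cdot> \<kappa> k = Ident V (imor Z) \<cdot> \<kappa> k" .
  qed (use imul_typing[OF Zg 2] d in simp_all)
  fix a b c assume ab: "composable V Z a b" and bc: "composable V Z b c"
  note cab = composableD[OF ab] and cbc = composableD[OF bc]
  note tab = imul_typing[OF Zg ab] and tbc = imul_typing[OF Zg bc]
  have 3: "composable V Z (imul V Z a b) c" using stc[OF ab] tab cab cbc by (simp add: composable_def)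
  have 4: "composable V Z a (imul V Z b c)" using stc[OF bc] tbc cab cbc by (simp add: composable_def)
  note t3 = imul_typing[OF Zg 3] and t4 = imul_typing[OF Zg 4]
  show "imul V Z (imul V Z a b) c = imul V Z a (imul V Z b c)"
  proof (rule composable_eqI[OF g bc])
    fix w x y R b' c' assume x: "w \<in> vobj M" "x \<in> vobj M" "y \<in> vobj M" and R: "arr R" "cod R = dom b" and
      t: "arr b'" "arr c'" "dom b' = dom R" "dom c' = dom R"
      "cod b' = vhom M (x, y)" "cod c' = vhom M (w, x)"
      and e: "b \<cdot> R = \<kappa> (x, y) \<cdot> b'" "c \<cdot> R = \<kappa> (w, x) \<cdot> c'"
    have Ra: "cod R = dom a" using R cab by simp
    show "imul V Z (imul V Z a b) c \<cdot> R = imul V Z a (imul V Z b c) \<cdot> R"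
    proof (rule locally_eqI[OF graph_presD(7)[OF g] graph_presD(4)[OF g], of "a \<cdot> R"])
      fix k r a' assume k: "k \<in> vobj M \<times> vobj M" and r: "arr r" "arr a'" "cod r = dom (a \<cdot> R)"
        "dom a' = dom r" "cod a' = vhom M k" and ar: "(a \<cdot> R) \<cdot> r = \<kappa> k \<cdot> a'"
      obtain y' z where k': "k = (y', z)" "y' \<in> vobj M" "z \<in> vobj M" using k by blast
      have rR: "cod r = dom R" using r R Ra cab by simp
      \<comment> \<open>The common refinement of the pieces for b and c with those for a.\<close>
      define S b2 c2 where "S = R \<cdot> r" and "b2 = b' \<cdot> r" and "c2 = c' \<cdot> r"
      have S: "arr S" "dom S = dom r" "cod S = dom a" "cod S = dom b" using r rR R Ra by (simp_all add: S_def)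
      have b2: "arr b2" "dom b2 = dom a'" "cod b2 = vhom M (x, y)" and c2: "arr c2" "dom c2 = dom b2" "cod c2 = vhom M (w, x)"
        using t r rR by (simp_all add: b2_def c2_def)
      have c2': "dom c2 = dom a'" using c2 b2 by simp
      have a': "cod a' = vhom M (y', z)" using r k' by simp
      have eS: "a \<cdot> S = \<kappa> (y', z) \<cdot> a'" "b \<cdot> S = \<kappa> (x, y) \<cdot> b2" "c \<cdot> S = \<kappa> (w, x) \<cdot> c2"
        using ar r rR R Ra cab cbc t ty(4-6)[OF x(2,3)] ty(4-6)[OF x(1,2)] k'
        by (simp_all add: S_def b2_def c2_def extend[OF e(1) V] extend[OF e(2) V])
      have "src Z \<cdot> (\<kappa> (y', z) \<cdot> a') = tgt Z \<cdot> (\<kappa> (x, y) \<cdot> b2)"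
        using composableD(6)[OF composable_comp[OF Zg ab S(1,3)]] unfolding eS .
      from composable_cases[OF g x(2,3) k'(2,3) r(2) b2(1,2) a' b2(3) this]
      have "imul V Z (imul V Z a b) c \<cdot> S = imul V Z a (imul V Z b c) \<cdot> S"
      proof
        assume y: "y' = y"
        note v1 = vmul_typing[OF Mg x(2,3) k'(3) r(2) b2(1,2) a'[unfolded y] b2(3)]
        note v2 = vmul_typing[OF Mg x(1-3) b2(1) c2(1,2) b2(3) c2(3)]
        have "imul V Z (imul V Z a b) c \<cdot> S = imul V Z (imul V Z (a \<cdot> S) (b \<cdot> S)) (c \<cdot> S)"
          using imul_comp[OF Zg 3 S(1)] imul_comp[OF Zg ab S(1,3)] tab S by simp
        also have "\<dots> = imul V Z (\<kappa> (x, z) \<cdot> vmul V M x y z a' b2) (\<kappa> (w, x) \<cdot> c2)"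
          unfolding eS using mu[OF x(2,3) k'(3) r(2) b2(1,2) a'[unfolded y] b2(3)] y by simp
        also have "\<dots> = \<kappa> (w, z) \<cdot> vmul V M w x z (vmul V M x y z a' b2) c2"
          by (rule mu[OF x(1,2) k'(3) v1(1) c2(1)]) (use v1 c2 c2' in simp_all)
        also have "\<dots> = \<kappa> (w, z) \<cdot> vmul V M w y z a' (vmul V M w x y b2 c2)"
          using vcatD(3)[OF M x k'(3) r(2) b2(1) c2(1) b2(2) c2' a'[unfolded y] b2(3) c2(3)] by simp
        also have "\<dots> = imul V Z (\<kappa> (y, z) \<cdot> a') (\<kappa> (w, y) \<cdot> vmul V M w x y b2 c2)"
          by (rule mu[OF x(1,3) k'(3) r(2) v2(1), symmetric]) (use v2 b2 a' y in simp_all)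
        also have "\<dots> = imul V Z (a \<cdot> S) (imul V Z (b \<cdot> S) (c \<cdot> S))"
          unfolding eS using mu[OF x(1-3) b2(1) c2(1,2) b2(3) c2(3)] y by simp
        also have "\<dots> = imul V Z a (imul V Z b c) \<cdot> S"
          using imul_comp[OF Zg 4 S(1)] imul_comp[OF Zg bc S(1,4)] S by simp
        finally show ?thesis .
      next
        assume "is_initial V (dom a')"
        then show ?thesis using r S t3 t4 tab cab by (rule_tac initial_eqI[OF _ V]) simp_all
      qed
      then show "(imul V Z (imul V Z a b) c \<cdot> R) \<cdot> r = (imul V Z a (imul V Z b c) \<cdot> R) \<cdot> r"
        using t3 t4 tab R Ra r rR by (simp add: S_def)
    qed (use cab R Ra t3 t4 tab in simp_all)
  qed (use cab cbc t3 t4 tab in simp_all)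
qed

text \<open>Decompose the domain of t along the summands of the morphisms: a piece other than (x, y)
  has a wrong source or target and is therefore initial, so t is determined by what happens in the
  summand (x, y).\<close>

lemma presents_factor:
  assumes g: "graph_pres M Z \<phi> \<kappa>" and x: "x \<in> vobj M" "y \<in> vobj M" and t: "arr t" "cod t = imor Z"
    and st: "src Z \<cdot> t = \<phi> x \<cdot> bang V (dom t)" "tgt Z \<cdot> t = \<phi> y \<cdot> bang V (dom t)"
  obtains h where "arr h" "dom h = dom t" "cod h = vhom M (x, y)" "\<kappa> (x, y) \<cdot> h = t"
proof -
  note ty = graph_pres_typing[OF g] and d = icat_graphD[OF graph_presD(2)[OF g]]
  obtain T p q where c: "is_coproduct V (vobj M \<times> vobj M) T (dom t) p"
    and pb: "\<And>i. i \<in> vobj M \<times> vobj M ==> is_pullback V t (\<kappa> i) (p i) (q i)" and Tp: "\<And>i. i \<in> vobj M \<times> vobj M ==> dom (p i) = T i"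
    by (rule cover[OF graph_presD(7)[OF g] graph_presD(4)[OF g] t]) (rule that)
  have init: "is_initial V (T k)" if k: "k \<in> vobj M \<times> vobj M" "k \<noteq> (x, y)" for k
  proof -
    obtain x' y' where k': "k = (x', y')" "x' \<in> vobj M" "y' \<in> vobj M" using k by blast
    note s = pullback_simps[OF pb[OF k(1)]]
    have qk: "arr (q k)" "cod (q k) = vhom M (x', y')" "dom (q k) = T k" "arr (p k)" "cod (p k) = dom t" "dom (p k) = T k"
      using s Tp[OF k(1)] ty(5)[OF k'(2,3)] k' by simp_all
    have To: "T k \<in> Obj V" using qk category_simps(1)[OF V qk(1)] by simp
    have "src Z \<cdot> (t \<cdot> p k) = \<phi> x \<cdot> bang V (T k)" "tgt Z \<cdot> (t \<cdot> p k) = \<phi> y \<cdot> bang V (T k)"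
      using t d qk ty(1-3)[OF x(1)] ty(1-3)[OF x(2)] by (simp_all add: extend[OF st(1) V] extend[OF st(2) V])
    moreover have "src Z \<cdot> (t \<cdot> p k) = \<phi> x' \<cdot> bang V (T k)" "tgt Z \<cdot> (t \<cdot> p k) = \<phi> y' \<cdot> bang V (T k)"
      using graph_pres_st[OF g k'(2,3) qk(1,2)] k'(1) qk(3) s(9) by simp_all
    ultimately have "\<phi> x' \<cdot> bang V (T k) = \<phi> x \<cdot> bang V (T k)" "\<phi> y' \<cdot> bang V (T k) = \<phi> y \<cdot> bang V (T k)" by simp_all
    then show ?thesis
      using point_disjoint[OF g k'(2) x(1) _ To] point_disjoint[OF g k'(3) x(2) _ To] k k'(1) by blast
  qed
  have "\<exists>u. arr u \<and> dom u = T k \<and> cod u = vhom M (x, y) \<and> \<kappa> (x, y) \<cdot> u = t \<cdot> p k" if k: "k \<in> vobj M \<times> vobj M" for k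
  proof (cases "k = (x, y)")
    case True
    show ?thesis using pullback_simps[OF pb[OF k]] Tp[OF k] ty(5)[OF x] True by (intro exI[of _ "q k"]) simp
  next
    case False
    note z = init[OF k False] and s = pullback_simps[OF pb[OF k]]
    obtain u where u: "arr u" "dom u = T k" "cod u = vhom M (x, y)"
      using initial_ex1[OF z ty(7)[OF x]] by auto
    have "\<kappa> (x, y) \<cdot> u = t \<cdot> p k"
      using u z s Tp[OF k] ty(4-6)[OF x] t by (rule_tac initial_eqI[OF _ V]) simp_all
    then show ?thesis using u by blast
  qed
  then obtain u where u: "\<And>k. k \<in> vobj M \<times> vobj M ==> arr (u k) \<and> dom (u k) = T k \<and> cod (u k) = vhom M (x, y) \<and> \<kappa> (x, y) \<cdot> u k = t \<cdot> p k"
    by metis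
  obtain h where h: "arr h" "dom h = dom t" "cod h = vhom M (x, y)" "\<And>k. k \<in> vobj M \<times> vobj M ==> h \<cdot> p k = u k"
    by (rule coproduct_lift[OF c ty(7)[OF x], of u]) (use u in auto)
  have "\<kappa> (x, y) \<cdot> h = t"
    using h(1-3) ty(4-6)[OF x] t
  proof (rule_tac coproduct_eqI[OF c V])
    fix k assume k: "k \<in> vobj M \<times> vobj M"
    show "(\<kappa> (x, y) \<cdot> h) \<cdot> p k = t \<cdot> p k"
      using h u[OF k] ty(4-6)[OF x] is_coproductD(2-4)[OF c k] k by simp
  qed simp_all
  then show ?thesis using that h by blast
qed

text \<open>Composable pairs decompose into pieces indexed by two pairs of objects. A matching piece
  carries the composition of M; any other piece is initial, and the unique arrow out of it is
  taken.\<close>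

lemma graph_pres_mult_ex:
  assumes g: "graph_pres M Z \<phi> \<kappa>"
  obtains m where "arr m" "dom m = pb_obj V (src Z) (tgt Z)" "cod m = imor Z"
    "\<And>x y z a b. x \<in> vobj M ==> y \<in> vobj M ==> z \<in> vobj M ==> arr a ==> arr b ==>
       dom b = dom a ==> cod a = vhom M (y, z) ==> cod b = vhom M (x, y) ==>
       m \<cdot> pb_pair V (src Z) (tgt Z) (\<kappa> (y, z) \<cdot> a) (\<kappa> (x, y) \<cdot> b) = \<kappa> (x, z) \<cdot> vmul V M x y z a b"
proof -
  note ty = graph_pres_typing[OF g] and Mg = graph_presD(1)[OF g]
  note d = icat_graphD[OF graph_presD(2)[OF g]] and sm = graph_presD(7)[OF g] and ck = graph_presD(4)[OF g]
  let ?A = "vobj M" and ?f = "pb_fst V (src Z) (tgt Z)" and ?g = "pb_snd V (src Z) (tgt Z)"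
  have f: "arr ?f" "cod ?f = imor Z" "arr ?g" "cod ?g = imor Z" "dom ?g = dom ?f"
    "dom ?f = pb_obj V (src Z) (tgt Z)" using d by simp_all
  obtain T r a b where T: "is_coproduct V ((?A \<times> ?A) \<times> (?A \<times> ?A)) T (dom ?f) r"
    and a: "\<And>i j. i \<in> ?A \<times> ?A ==> j \<in> ?A \<times> ?A ==>
      arr (a (i, j)) \<and> dom (a (i, j)) = T (i, j) \<and> cod (a (i, j)) = vhom M i \<and> ?f \<cdot> r (i, j) = \<kappa> i \<cdot> a (i, j)"
    and b: "\<And>i j. i \<in> ?A \<times> ?A ==> j \<in> ?A \<times> ?A ==>
      arr (b (i, j)) \<and> dom (b (i, j)) = T (i, j) \<and> cod (b (i, j)) = vhom M j \<and> ?g \<cdot> r (i, j) = \<kappa> j \<cdot> b (i, j)"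
    and fac: "\<And>i j t x y. i \<in> ?A \<times> ?A ==> j \<in> ?A \<times> ?A ==> arr t ==> arr x ==> arr y ==>
       cod t = dom ?f ==> dom x = dom t ==> dom y = dom t ==> cod x = vhom M i ==> cod y = vhom M j ==>
       ?f \<cdot> t = \<kappa> i \<cdot> x ==> ?g \<cdot> t = \<kappa> j \<cdot> y ==> \<exists>h\<in>Arr V. dom h = dom t \<and> cod h = T (i, j) \<and> r (i, j) \<cdot> h = t"
    by (rule cover2[OF sm ck f(1,2) sm ck f(3-5)]) (rule that)
  note dT = is_coproductD(2-4)[OF T]
  have ex: "\<exists>v. arr v \<and> dom v = T ((y, z), (x, w)) \<and> cod v = imor Z \<and>
      (y = w \<longrightarrow> v = \<kappa> (x, z) \<cdot> vmul V M x y z (a ((y, z), (x, w))) (b ((y, z), (x, w))))"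
    if x: "x \<in> ?A" "w \<in> ?A" "y \<in> ?A" "z \<in> ?A" for x w y z
  proof -
    let ?k = "((y, z), (x, w))"
    have ak: "arr (a ?k)" "dom (a ?k) = T ?k" "cod (a ?k) = vhom M (y, z)" "?f \<cdot> r ?k = \<kappa> (y, z) \<cdot> a ?k"
      and bk: "arr (b ?k)" "dom (b ?k) = dom (a ?k)" "cod (b ?k) = vhom M (x, w)" "?g \<cdot> r ?k = \<kappa> (x, w) \<cdot> b ?k"
      using a[of "(y, z)" "(x, w)"] b[of "(y, z)" "(x, w)"] x by simp_all
    have rk: "arr (r ?k)" "cod (r ?k) = dom ?f" using dT[of ?k] x by simp_all
    show ?thesis
    proof (cases "y = w")
      case True
      have "cod (b ?k) = vhom M (x, y)" using bk(3) True by simp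
      note tv = vmul_typing[OF Mg x(1,3,4) ak(1) bk(1,2) ak(3) this]
      show ?thesis using True tv ty(4-6)[OF x(1,4)] ak by (intro exI[of _ "\<kappa> (x, z) \<cdot> vmul V M x y z (a ?k) (b ?k)"]) simp
    next
      case False
      have "src Z \<cdot> (?f \<cdot> r ?k) = tgt Z \<cdot> (?g \<cdot> r ?k)"
        using f rk d pb_commute[OF P, of "src Z" "tgt Z"] by (simp add: extend[OF _ V, of "src Z" ?f "tgt Z \<cdot> ?g"])
      from composable_cases[OF g x ak(1) bk(1,2) ak(3) bk(3) this[unfolded ak(4) bk(4)]]
      have "is_initial V (T ?k)" using False ak by simp
      from ex1_implies_ex[OF initial_ex1[OF this d(2)]] show ?thesis using False by auto
    qed
  qed
  have "\<exists>v. arr v \<and> dom v = T k \<and> cod v = imor Z \<and> (\<forall>x y z. k = ((y, z), (x, y)) \<longrightarrow>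
      v = \<kappa> (x, z) \<cdot> vmul V M x y z (a k) (b k))"
    if k: "k \<in> (?A \<times> ?A) \<times> (?A \<times> ?A)" for k
  proof -
    obtain y z x w where k': "k = ((y, z), (x, w))" "x \<in> ?A" "w \<in> ?A" "y \<in> ?A" "z \<in> ?A" using k by blast
    show ?thesis using ex[OF k'(2-5)] unfolding k'(1) by auto
  qed
  then obtain v where v: "\<And>k. k \<in> (?A \<times> ?A) \<times> (?A \<times> ?A) ==> arr (v k) \<and> dom (v k) = T k \<and> cod (v k) = imor Z \<and>
      (\<forall>x y z. k = ((y, z), (x, y)) \<longrightarrow> v k = \<kappa> (x, z) \<cdot> vmul V M x y z (a k) (b k))" by metis
  obtain m where m: "arr m" "dom m = dom ?f" "cod m = imor Z"
    "\<And>k. k \<in> (?A \<times> ?A) \<times> (?A \<times> ?A) ==> m \<cdot> r k = v k"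
    by (rule coproduct_lift[OF T d(2), of v]) (use v in auto)
  show ?thesis
  proof (rule that[OF m(1) _ m(3)])
    fix x y z a' b' assume x: "x \<in> ?A" "y \<in> ?A" "z \<in> ?A" and
      t: "arr a'" "arr b'" "dom b' = dom a'" "cod a' = vhom M (y, z)" "cod b' = vhom M (x, y)"
    let ?k = "((y, z), (x, y))" and ?t = "pb_pair V (src Z) (tgt Z) (\<kappa> (y, z) \<cdot> a') (\<kappa> (x, y) \<cdot> b')"
    note ts = ty(4-6)[OF x(2,3)] ty(4-6)[OF x(1,2)]
    have "src Z \<cdot> (\<kappa> (y, z) \<cdot> a') = tgt Z \<cdot> (\<kappa> (x, y) \<cdot> b')"
      using graph_pres_st[OF g x(2,3) t(1,4)] graph_pres_st[OF g x(1,2) t(2,5)] t by simp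
    then have ps: "arr ?t" "dom ?t = dom a'" "cod ?t = dom ?f" "?f \<cdot> ?t = \<kappa> (y, z) \<cdot> a'" "?g \<cdot> ?t = \<kappa> (x, y) \<cdot> b'"
      using t ts d by simp_all
    have k: "?k \<in> (?A \<times> ?A) \<times> (?A \<times> ?A)" "(y, z) \<in> ?A \<times> ?A" "(x, y) \<in> ?A \<times> ?A" using x by simp_all
    \<comment> \<open>A pair of elements in matching summands factors through the corresponding
      piece by the last clause of \<open>cover2\<close>; as the injections are monic, h carries the
      generic elements of the piece to the given ones.\<close>
    obtain h where h: "arr h" "dom h = dom ?t" "cod h = T ?k" "r ?k \<cdot> h = ?t"
      using fac[OF k(2,3) ps(1) t(1,2) ps(3)] ps t by auto
    have ak: "arr (a ?k)" "dom (a ?k) = T ?k" "cod (a ?k) = vhom M (y, z)" "?f \<cdot> r ?k = \<kappa> (y, z) \<cdot> a ?k"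
      and bk: "arr (b ?k)" "dom (b ?k) = dom (a ?k)" "cod (b ?k) = vhom M (x, y)" "?g \<cdot> r ?k = \<kappa> (x, y) \<cdot> b ?k"
      using a[OF k(2,3)] b[OF k(2,3)] by simp_all
    note rk = dT[OF k(1)]
    have "\<kappa> (y, z) \<cdot> (a ?k \<cdot> h) = \<kappa> (y, z) \<cdot> a'" "\<kappa> (x, y) \<cdot> (b ?k \<cdot> h) = \<kappa> (x, y) \<cdot> b'"
      using ps(4,5) ak(1-3) bk(1-3) h(1-3) rk f ts unfolding h(4)[symmetric]
      by (simp_all add: extend[OF ak(4) V] extend[OF bk(4) V])
    then have ah: "a ?k \<cdot> h = a'" and bh: "b ?k \<cdot> h = b'"
      using ak bk h t ps by (rule_tac graph_pres_monic[OF g x(2,3)], simp_all)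
        (rule_tac graph_pres_monic[OF g x(1,2)], simp_all)
    note tv = vmul_typing[OF Mg x ak(1) bk(1,2) ak(3) bk(3)]
    have mr: "m \<cdot> r ?k = \<kappa> (x, z) \<cdot> vmul V M x y z (a ?k) (b ?k)" using m(4)[OF k(1)] v[OF k(1)] by simp
    have "m \<cdot> ?t = (\<kappa> (x, z) \<cdot> vmul V M x y z (a ?k) (b ?k)) \<cdot> h"
      unfolding mr[symmetric] using m(1-3) h rk by simp
    also have "\<dots> = \<kappa> (x, z) \<cdot> vmul V M x y z a' b'"
      using vmul_comp[OF Mg x ak(1) bk(1,2) ak(3) bk(3) h(1)] tv ty(4-6)[OF x(1,3)] h ak ah bh by simp
    finally show "m \<cdot> ?t = \<kappa> (x, z) \<cdot> vmul V M x y z a' b'" .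
  qed (use m f in simp)
qed

text \<open>The hypothesis concerns the generic pair of elements, and every other pair arises from
  it by composing with \<open>prod_pair\<close>.\<close>

lemma graph_pres_mult_extend:
  assumes g: "graph_pres M Z \<phi> \<kappa>" and m: "arr m" "dom m = pb_obj V (src Z) (tgt Z)"
    and x: "x \<in> vobj M" "y \<in> vobj M" "z \<in> vobj M"
    and e: "m \<cdot> pb_pair V (src Z) (tgt Z) (\<kappa> (y, z) \<cdot> prod_fst V (vhom M (y, z)) (vhom M (x, y)))
         (\<kappa> (x, y) \<cdot> prod_snd V (vhom M (y, z)) (vhom M (x, y))) = \<kappa> (x, z) \<cdot> vcomp M (x, y, z)"
    and t: "arr a" "arr b" "dom b = dom a" "cod a = vhom M (y, z)" "cod b = vhom M (x, y)"
  shows "m \<cdot> pb_pair V (src Z) (tgt Z) (\<kappa> (y, z) \<cdot> a) (\<kappa> (x, y) \<cdot> b) = \<kappa> (x, z) \<cdot> vmul V M x y z a b"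
proof -
  let ?a = "prod_fst V (vhom M (y, z)) (vhom M (x, y))" and ?b = "prod_snd V (vhom M (y, z)) (vhom M (x, y))"
  note ty = graph_pres_typing[OF g] and d = icat_graphD[OF graph_presD(2)[OF g]]
  note ts = ty(4-7)[OF x(2,3)] ty(4-7)[OF x(1,2)] ty(4-7)[OF x(1,3)]
  have pt: "arr ?a" "arr ?b" "dom ?b = dom ?a" "cod ?a = vhom M (y, z)" "cod ?b = vhom M (x, y)"
    "dom ?a = prod_obj V (vhom M (y, z)) (vhom M (x, y))" using ts by simp_all
  have st: "src Z \<cdot> (\<kappa> (y, z) \<cdot> ?a) = tgt Z \<cdot> (\<kappa> (x, y) \<cdot> ?b)"
    using graph_pres_st[OF g x(2,3) pt(1,4)] graph_pres_st[OF g x(1,2) pt(2,5)] pt by simp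
  have "pb_pair V (src Z) (tgt Z) (\<kappa> (y, z) \<cdot> a) (\<kappa> (x, y) \<cdot> b) =
     pb_pair V (src Z) (tgt Z) (\<kappa> (y, z) \<cdot> ?a) (\<kappa> (x, y) \<cdot> ?b) \<cdot> prod_pair V a b"
    using ts t pt st d by (subst pb_pair_comp[OF V P]) simp_all
  then show ?thesis
    using m ts t pt st d vcat_graphD(3-5)[OF graph_presD(1)[OF g] x] by (simp add: extend[OF e V] vmul_def)
qed

text \<open>The projections of the object of composable pairs form the generic composable pair, and
  on its matching pieces the two arrows agree.\<close>

lemma graph_pres_mult_unique:
  assumes g: "graph_pres M Z \<phi> \<kappa>" and m: "arr m" "dom m = pb_obj V (src Z) (tgt Z)"
    and n: "arr n" "dom n = pb_obj V (src Z) (tgt Z)" "cod n = cod m"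
    and e: "\<And>x y z a b. x \<in> vobj M ==> y \<in> vobj M ==> z \<in> vobj M ==> arr a ==> arr b ==>
       dom b = dom a ==> cod a = vhom M (y, z) ==> cod b = vhom M (x, y) ==>
       m \<cdot> pb_pair V (src Z) (tgt Z) (\<kappa> (y, z) \<cdot> a) (\<kappa> (x, y) \<cdot> b) =
       n \<cdot> pb_pair V (src Z) (tgt Z) (\<kappa> (y, z) \<cdot> a) (\<kappa> (x, y) \<cdot> b)"
  shows "m = n"
proof -
  note ty = graph_pres_typing[OF g] and d = icat_graphD[OF graph_presD(2)[OF g]]
  show ?thesis
  proof (rule composable_eqI[OF g composable_proj[OF graph_presD(2)[OF g]]])
    fix x y z R a b assume x: "x \<in> vobj M" "y \<in> vobj M" "z \<in> vobj M" and
      R: "arr R" "cod R = dom (pb_fst V (src Z) (tgt Z))" and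
      t: "arr a" "arr b" "dom a = dom R" "dom b = dom R" "cod a = vhom M (y, z)" "cod b = vhom M (x, y)"
      and ab: "pb_fst V (src Z) (tgt Z) \<cdot> R = \<kappa> (y, z) \<cdot> a" "pb_snd V (src Z) (tgt Z) \<cdot> R = \<kappa> (x, y) \<cdot> b"
    have st: "src Z \<cdot> (\<kappa> (y, z) \<cdot> a) = tgt Z \<cdot> (\<kappa> (x, y) \<cdot> b)"
      using graph_pres_st[OF g x(2,3) t(1,5)] graph_pres_st[OF g x(1,2) t(2,6)] t by simp
    have "pb_pair V (src Z) (tgt Z) (\<kappa> (y, z) \<cdot> a) (\<kappa> (x, y) \<cdot> b) = R"
      using ty(4-6)[OF x(2,3)] ty(4-6)[OF x(1,2)] t R ab d st by (rule_tac pb_eqI[OF V P, of "src Z" "tgt Z"]) simp_all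
    then show "m \<cdot> R = n \<cdot> R" using e[OF x t(1,2)] t by simp
  qed (use m n d in simp_all)
qed

lemma Phi_obj_presents:
  assumes M: "is_vcat small V M"
  shows "presents M (Phi_obj V M) (J_in V (vobj M)) (csum_in V (vobj M \<times> vobj M) (vhom M))"
proof -
  let ?A = "vobj M" and ?H = "vhom M" and ?Z = "Phi_obj V M" and ?\<phi> = "J_in V (vobj M)" and ?\<kappa> = "csum_in V (vobj M \<times> vobj M) (vhom M)"
  note Mg = vcat_graphI[OF M]
  note vd = vcat_graphD[OF Mg]
  note A = vd(1)
  have AA: "smallish small (?A \<times> ?A)" using smallish_small[OF A] by (intro smallish_Times)
  have H: "?H k \<in> Obj V" if "k \<in> ?A \<times> ?A" for k using that vd(2) by auto
  have ck: "is_coproduct V (?A \<times> ?A) ?H (csum V (?A \<times> ?A) ?H) ?\<kappa>" by (rule csum_coproduct[OF AA H])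
  note cJ = J_coproduct[OF A]
  note dk = is_coproductD[OF ck] and dJ = is_coproductD[OF cJ]
  let ?s = "src ?Z" and ?t = "tgt ?Z"
  define u where "u = (\<lambda>(x, y). ?\<phi> x \<cdot> bang V (?H (x, y)))"
  define v where "v = (\<lambda>(x, y). ?\<phi> y \<cdot> bang V (?H (x, y)))"
  have sdef: "?s = cotuple V (?A \<times> ?A) ?H (J_obj V ?A) u" "?t = cotuple V (?A \<times> ?A) ?H (J_obj V ?A) v"
    by (simp_all add: Phi_obj_def Let_def u_def v_def)
  have s: "arr ?s" "dom ?s = csum V (?A \<times> ?A) ?H" "cod ?s = J_obj V ?A"
      "k \<in> ?A \<times> ?A ==> ?s \<cdot> ?\<kappa> k = u k" for k
    unfolding sdef using dJ H by (intro cotuple_simps[OF AA]; auto simp: u_def)+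
  have t: "arr ?t" "dom ?t = csum V (?A \<times> ?A) ?H" "cod ?t = J_obj V ?A"
      "k \<in> ?A \<times> ?A ==> ?t \<cdot> ?\<kappa> k = v k" for k
    unfolding sdef using dJ H by (intro cotuple_simps[OF AA]; auto simp: v_def)+
  have io: "iobj ?Z = J_obj V ?A" "imor ?Z = csum V (?A \<times> ?A) ?H" by (simp_all add: Phi_obj_def Let_def)
  have udef: "unt ?Z = cotuple V ?A (\<lambda>_. one) (csum V (?A \<times> ?A) ?H) (\<lambda>x. ?\<kappa> (x, x) \<cdot> vid M x)"
    by (simp add: Phi_obj_def Let_def)
  have e: "arr (unt ?Z)" "dom (unt ?Z) = J_obj V ?A" "cod (unt ?Z) = csum V (?A \<times> ?A) ?H"
      "x \<in> ?A ==> unt ?Z \<cdot> ?\<phi> x = ?\<kappa> (x, x) \<cdot> vid M x" for x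
    unfolding udef J_obj_def J_in_def
    using dk vd(6-8) by (intro cotuple_simps[OF smallish_small[OF A]]; simp)+
  have se: "?s \<cdot> unt ?Z = Ident V (J_obj V ?A)"
    using s(1-3) e(1-3) dJ vd(2,6-8) dk s(4)
    by (rule_tac coproduct_eqI[OF cJ V]) (simp_all add: e(4) u_def extend[OF s(4) V])
  have te: "?t \<cdot> unt ?Z = Ident V (J_obj V ?A)"
    using t(1-3) e(1-3) dJ vd(2,6-8) dk t(4)
    by (rule_tac coproduct_eqI[OF cJ V]) (simp_all add: e(4) v_def extend[OF t(4) V])
  \<comment> \<open>the notion of a graph does not constrain \<open>mult\<close>, so any arrow of its type serves until it is constructed\<close>
  let ?Y = "?Z\<lparr>mult := pb_fst V ?s ?t\<rparr>"
  have g0: "graph_pres M ?Y ?\<phi> ?\<kappa>"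
    unfolding graph_pres_def icat_graph_def
    using Mg ck cJ dk(1) dJ(1) s t e(1-3) se te io by (simp add: u_def v_def)
  obtain m where m: "arr m" "dom m = pb_obj V ?s ?t" "cod m = csum V (?A \<times> ?A) ?H"
    "\<And>x y z a b. x \<in> vobj M ==> y \<in> vobj M ==> z \<in> vobj M ==> arr a ==> arr b ==>
       dom b = dom a ==> cod a = vhom M (y, z) ==> cod b = vhom M (x, y) ==>
       m \<cdot> pb_pair V ?s ?t (?\<kappa> (y, z) \<cdot> a) (?\<kappa> (x, y) \<cdot> b) = ?\<kappa> (x, z) \<cdot> vmul V M x y z a b"
    using graph_pres_mult_ex[OF g0] io by auto
  \<comment> \<open>The description in \<open>Phi_obj\<close> constrains the multiplication only at
    generic pairs. It extends to all pairs of elements in matching summands, hence has at most one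
    solution, and m is one.\<close>
  have "mult ?Z = m"
  proof -
    have d: "mult ?Z = (THE m. m \<in> hom V (pb_obj V ?s ?t) (csum V (?A \<times> ?A) ?H) \<and>
         (\<forall>x\<in>?A. \<forall>y\<in>?A. \<forall>z\<in>?A.
            m \<cdot> pb_pair V ?s ?t (?\<kappa> (y, z) \<cdot> prod_fst V (?H (y, z)) (?H (x, y)))
                                 (?\<kappa> (x, y) \<cdot> prod_snd V (?H (y, z)) (?H (x, y))) =
            ?\<kappa> (x, z) \<cdot> vcomp M (x, y, z)))"
      by (simp only: Phi_obj_def Let_def icat.simps)
    show ?thesis unfolding d
    proof (rule the_equality)
      show "m \<in> hom V (pb_obj V ?s ?t) (csum V (?A \<times> ?A) ?H) \<and>
         (\<forall>x\<in>?A. \<forall>y\<in>?A. \<forall>z\<in>?A.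
            m \<cdot> pb_pair V ?s ?t (?\<kappa> (y, z) \<cdot> prod_fst V (?H (y, z)) (?H (x, y)))
                                 (?\<kappa> (x, y) \<cdot> prod_snd V (?H (y, z)) (?H (x, y))) =
            ?\<kappa> (x, z) \<cdot> vcomp M (x, y, z))"
        using m vd(2) by (simp add: vcomp_vmul[OF Mg])
    next
      fix n assume n: "n \<in> hom V (pb_obj V ?s ?t) (csum V (?A \<times> ?A) ?H) \<and>
         (\<forall>x\<in>?A. \<forall>y\<in>?A. \<forall>z\<in>?A.
            n \<cdot> pb_pair V ?s ?t (?\<kappa> (y, z) \<cdot> prod_fst V (?H (y, z)) (?H (x, y)))
                                 (?\<kappa> (x, y) \<cdot> prod_snd V (?H (y, z)) (?H (x, y))) =
            ?\<kappa> (x, z) \<cdot> vcomp M (x, y, z))"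
      then have n': "arr n" "dom n = pb_obj V (src ?Y) (tgt ?Y)" "cod n = csum V (?A \<times> ?A) ?H" by simp_all
      show "n = m"
        by (rule graph_pres_mult_unique[OF g0 n'(1,2) m(1)])
          (use m n' n graph_pres_mult_extend[OF g0 n'(1,2)] in simp_all)
    qed
  qed
  then have mm: "mult ?Z = m" .
  have g: "graph_pres M ?Z ?\<phi> ?\<kappa>"
    using g0 m(1-3) mm unfolding graph_pres_def icat_graph_def by (simp add: io)
  show ?thesis unfolding presents_def imul_def mm using g e(4) m(4) by simp
qed

text \<open>Formulated for arbitrary presentations, so that the same facts serve for
  \<open>Phi_arr\<close> and for the isomorphism between a presented category and its copy in the
  image.\<close>

definition induces :: "('u, 'o, 'm) vfun \<Rightarrow> ('o, 'm) ifun \<Rightarrow> ('u \<Rightarrow> 'm) \<Rightarrow> ('u \<times> 'u \<Rightarrow> 'm) \<Rightarrow>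
    ('u \<Rightarrow> 'm) \<Rightarrow> ('u \<times> 'u \<Rightarrow> 'm) \<Rightarrow> bool" where
  "induces F G \<phi> \<kappa> \<phi>' \<kappa>' \<longleftrightarrow>
     (\<forall>x\<in>vobj (vfdom F). if_obj G \<cdot> \<phi> x = \<phi>' (vf_obj F x)) \<and>
     (\<forall>x\<in>vobj (vfdom F). \<forall>y\<in>vobj (vfdom F). if_mor G \<cdot> \<kappa> (x, y) = \<kappa>' (vf_obj F x, vf_obj F y) \<cdot> vf_hom F (x, y))"

lemma inducesD:
  assumes "induces F G \<phi> \<kappa> \<phi>' \<kappa>'"
  shows "x \<in> vobj (vfdom F) ==> if_obj G \<cdot> \<phi> x = \<phi>' (vf_obj F x)"
    "x \<in> vobj (vfdom F) ==> y \<in> vobj (vfdom F) ==> if_mor G \<cdot> \<kappa> (x, y) = \<kappa>' (vf_obj F x, vf_obj F y) \<cdot> vf_hom F (x, y)"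
  using assms unfolding induces_def by blast+

text \<open>Equations on objects and morphisms are checked on the summands of the presentation,
  compatibility with multiplication on matching pieces, where it is functoriality of F.\<close>

lemma induces_ifun:
  assumes F: "is_vfun small V F" and pr: "presents (vfdom F) Z \<phi> \<kappa>" and pr': "presents (vfcod F) Z' \<phi>' \<kappa>'"
    and f0: "arr f0" "dom f0 = iobj Z" "cod f0 = iobj Z'"
    and f1: "arr f1" "dom f1 = imor Z" "cod f1 = imor Z'"
    and ind: "induces F \<lparr>ifdom = Z, ifcod = Z', if_obj = f0, if_mor = f1\<rparr> \<phi> \<kappa> \<phi>' \<kappa>'"
  shows "is_ifun V \<lparr>ifdom = Z, ifcod = Z', if_obj = f0, if_mor = f1\<rparr>"
proof -
  let ?M = "vfdom F" and ?N = "vfcod F" and ?f = "vf_obj F" and ?k = "vf_hom F"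
  note F' = vfunD[OF F] and i0 = inducesD(1)[OF ind, simplified] and i1 = inducesD(2)[OF ind, simplified]
  note g = presentsD(1)[OF pr] and g' = presentsD(1)[OF pr']
  note Z = presents_icat[OF pr F'(1)] and Z' = presents_icat[OF pr' F'(2)]
  note Zg = graph_presD(2)[OF g] and Zg' = graph_presD(2)[OF g']
  note d = icat_graphD[OF Zg] and d' = icat_graphD[OF Zg']
  note ty = graph_pres_typing[OF g] and ty' = graph_pres_typing[OF g']
  note c0 = graph_presD(3)[OF g] and c1 = graph_presD(4)[OF g]
  have k: "?f x \<in> vobj ?N" "?f y \<in> vobj ?N" "arr (?k (x, y))" "dom (?k (x, y)) = vhom ?M (x, y)"
    "cod (?k (x, y)) = vhom ?N (?f x, ?f y)" if "x \<in> vobj ?M" "y \<in> vobj ?M" for x y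
    using F'(5-8) that by simp_all
  have st: "src Z' \<cdot> f1 = f0 \<cdot> src Z \<and> tgt Z' \<cdot> f1 = f0 \<cdot> tgt Z"
  proof -
    have "src Z' \<cdot> (f1 \<cdot> \<kappa> (x, y)) = f0 \<cdot> (src Z \<cdot> \<kappa> (x, y)) \<and> tgt Z' \<cdot> (f1 \<cdot> \<kappa> (x, y)) = f0 \<cdot> (tgt Z \<cdot> \<kappa> (x, y))"
      if x: "x \<in> vobj ?M" "y \<in> vobj ?M" for x y
      using graph_pres_st[OF g' k(1,2)[OF x] k(3,5)[OF x]] graph_presD(8,9)[OF g x] k[OF x] ty(1-3)[OF x(1)] ty(1-3)[OF x(2)] ty(7)[OF x] f0
      by (simp add: i1[OF x] extend[OF i0[OF x(1)] V] extend[OF i0[OF x(2)] V])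
    note e = this
    have "src Z' \<cdot> f1 = f0 \<cdot> src Z"
      by (rule coproduct_eqI[OF c1 V]) (use e d d' f0 f1 ty in \<open>auto\<close>)
    moreover have "tgt Z' \<cdot> f1 = f0 \<cdot> tgt Z"
      by (rule coproduct_eqI[OF c1 V]) (use e d d' f0 f1 ty in \<open>auto\<close>)
    ultimately show ?thesis by simp
  qed
  have un: "f1 \<cdot> unt Z = unt Z' \<cdot> f0"
  proof (rule coproduct_eqI[OF c0 V])
    fix x assume x: "x \<in> vobj ?M"
    note u = presentsD(2)[OF pr x] and u' = presentsD(2)[OF pr' k(1)[OF x x]]
    have "f1 \<cdot> (unt Z \<cdot> \<phi> x) = unt Z' \<cdot> (f0 \<cdot> \<phi> x)"
      unfolding u i0[OF x] u' using F'(9)[OF x] k[OF x x] ty(4-6)[OF x x] ty'(4-6)[OF k(1,1)[OF x x]] f1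
        vcat_graphD(6-8)[OF graph_presD(1)[OF g] x]
      by (simp add: extend[OF i1[OF x x] V])
    then show "(f1 \<cdot> unt Z) \<cdot> \<phi> x = (unt Z' \<cdot> f0) \<cdot> \<phi> x" using ty(1-3)[OF x] f0 f1 d d' by simp
  qed (use d d' f0 f1 in simp_all)
  show ?thesis
  proof (rule ifunI[OF Z Z' f0 f1 conjunct1[OF st] conjunct2[OF st] un])
    fix a b assume ab: "composable V Z a b"
    note c = composableD[OF ab] and ti = imul_typing[OF Zg ab]
    have "src Z' \<cdot> (f1 \<cdot> a) = tgt Z' \<cdot> (f1 \<cdot> b)"
      using st c f0 f1 d d' by (simp add: extend[OF conjunct1[OF st] V] extend[OF conjunct2[OF st] V])
    then have ab': "composable V Z' (f1 \<cdot> a) (f1 \<cdot> b)" using c f1 by (simp add: composable_def)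
    note ti' = imul_typing[OF Zg' ab']
    show "f1 \<cdot> imul V Z a b = imul V Z' (f1 \<cdot> a) (f1 \<cdot> b)"
    proof (rule composable_eqI[OF g ab])
      fix x y z R a' b' assume x: "x \<in> vobj ?M" "y \<in> vobj ?M" "z \<in> vobj ?M" and R: "arr R" "cod R = dom a" and
        t: "arr a'" "arr b'" "dom a' = dom R" "dom b' = dom R" "cod a' = vhom ?M (y, z)" "cod b' = vhom ?M (x, y)"
        and e: "a \<cdot> R = \<kappa> (y, z) \<cdot> a'" "b \<cdot> R = \<kappa> (x, y) \<cdot> b'"
      have t': "dom b' = dom a'" using t by simp
      note kx = k[OF x(1,2)] and ky = k[OF x(2,3)] and kz = k[OF x(1,3)]
      note tv = vmul_typing[OF graph_presD(1)[OF g] x t(1,2) t' t(5,6)]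
      have "(f1 \<cdot> imul V Z a b) \<cdot> R = f1 \<cdot> imul V Z (a \<cdot> R) (b \<cdot> R)"
        using imul_comp[OF Zg ab R] ti f1 R by simp
      also have "\<dots> = f1 \<cdot> (\<kappa> (x, z) \<cdot> vmul V ?M x y z a' b')"
        unfolding e presentsD(3)[OF pr x t(1,2) t' t(5,6)] ..
      also have "\<dots> = \<kappa>' (?f x, ?f z) \<cdot> (?k (x, z) \<cdot> vmul V ?M x y z a' b')"
        using tv ty(4-6)[OF x(1,3)] f1 kz ty'(4-6)[OF kz(1,2)] by (simp add: extend[OF i1[OF x(1,3)] V])
      also have "\<dots> = \<kappa>' (?f x, ?f z) \<cdot> vmul V ?N (?f x) (?f y) (?f z) (?k (y, z) \<cdot> a') (?k (x, y) \<cdot> b')"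
        using F'(10)[OF x t(1,2) t' t(5,6)] by simp
      also have "\<dots> = imul V Z' (\<kappa>' (?f y, ?f z) \<cdot> (?k (y, z) \<cdot> a')) (\<kappa>' (?f x, ?f y) \<cdot> (?k (x, y) \<cdot> b'))"
        using kx ky kz t t' by (intro presentsD(3)[OF pr', symmetric]) simp_all
      also have "\<dots> = imul V Z' (f1 \<cdot> (a \<cdot> R)) (f1 \<cdot> (b \<cdot> R))"
        unfolding e using t kx ky f1 ty(4-6)[OF x(2,3)] ty(4-6)[OF x(1,2)] ty'(4-6)[OF kx(1,2)] ty'(4-6)[OF ky(1,2)]
        by (simp add: extend[OF i1[OF x(2,3)] V] extend[OF i1[OF x(1,2)] V])
      also have "\<dots> = imul V Z' (f1 \<cdot> a) (f1 \<cdot> b) \<cdot> R"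
        using imul_comp[OF Zg' ab' R(1)] R c f1 by simp
      finally show "(f1 \<cdot> imul V Z a b) \<cdot> R = imul V Z' (f1 \<cdot> a) (f1 \<cdot> b) \<cdot> R" .
    qed (use ti ti' f1 c in simp_all)
  qed
qed

text \<open>Distinct objects give distinct points and the injections of hom-objects are monic, so G
  determines both parts of the V-functor.\<close>

lemma induces_inject:
  assumes F: "is_vfun small V F" "is_vfun small V F'" and e: "vfdom F = vfdom F'" "vfcod F = vfcod F'"
    and g: "graph_pres (vfcod F) Z' \<phi>' \<kappa>'" and ind: "induces F G \<phi> \<kappa> \<phi>' \<kappa>'" "induces F' G \<phi> \<kappa> \<phi>' \<kappa>'"
  shows "F = F'"
proof -
  note f = vfunD[OF F(1)] and f' = vfunD[OF F(2), folded e]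
  have o: "vf_obj F x = vf_obj F' x" if x: "x \<in> vobj (vfdom F)" for x
    using point_inject[OF graph_presD(5,3)[OF g] f(5)[OF x] f'(5)[OF x]]
      inducesD(1)[OF ind(1)] inducesD(1)[OF ind(2)] x e by simp
  show ?thesis
  proof (rule vfun_eqI[OF F e o])
    fix x y assume x: "x \<in> vobj (vfdom F)" "y \<in> vobj (vfdom F)"
    show "vf_hom F (x, y) = vf_hom F' (x, y)"
      by (rule graph_pres_monic[OF g f(5)[OF x(1)] f(5)[OF x(2)]])
        (use f(6-8)[OF x] f'(6-8)[OF x] o[OF x(1)] o[OF x(2)] inducesD(2)[OF ind(1) x] inducesD(2)[OF ind(2)] x e in simp_all)
  qed
qed

text \<open>A point of Z goes to a point of Z', which is an injection by fullness of J and so names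
  an object of N. The restriction of G to a hom-object then has prescribed source and target, hence
  factors through one summand.\<close>

lemma induces_ex:
  assumes M: "is_vcat small V M" "is_vcat small V N" and pr: "presents M Z \<phi> \<kappa>" and pr': "presents N Z' \<phi>' \<kappa>'"
    and G: "is_ifun V G" "ifdom G = Z" "ifcod G = Z'"
  obtains F where "is_vfun small V F" "vfdom F = M" "vfcod F = N" "induces F G \<phi> \<kappa> \<phi>' \<kappa>'"
proof -
  note G' = ifunD[OF G(1), unfolded G(2,3)]
  note g = presentsD(1)[OF pr] and g' = presentsD(1)[OF pr']
  note Zg = graph_presD(2)[OF g] and Zg' = graph_presD(2)[OF g'] and Mg = graph_presD(1)[OF g]
  note d = icat_graphD[OF Zg] and d' = icat_graphD[OF Zg']
  note ty = graph_pres_typing[OF g] and ty' = graph_pres_typing[OF g']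
  have "\<exists>a. a \<in> vobj N \<and> if_obj G \<cdot> \<phi> x = \<phi>' a" if x: "x \<in> vobj M" for x
    using point[OF graph_presD(5,3)[OF g'], of "if_obj G \<cdot> \<phi> x"] ty(1-3)[OF x] G'(3-5) by auto
  then obtain f where f: "\<And>x. x \<in> vobj M ==> f x \<in> vobj N" "\<And>x. x \<in> vobj M ==> if_obj G \<cdot> \<phi> x = \<phi>' (f x)" by metis
  have "\<exists>h. arr h \<and> dom h = vhom M (x, y) \<and> cod h = vhom N (f x, f y) \<and> if_mor G \<cdot> \<kappa> (x, y) = \<kappa>' (f x, f y) \<cdot> h"
    if x: "x \<in> vobj M" "y \<in> vobj M" for x y
  proof -
    let ?t = "if_mor G \<cdot> \<kappa> (x, y)"
    have t: "arr ?t" "cod ?t = imor Z'" "dom ?t = vhom M (x, y)" using ty(4-6)[OF x] G'(6-8) by simp_all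
    have s: "src Z' \<cdot> ?t = \<phi>' (f x) \<cdot> bang V (dom ?t)" "tgt Z' \<cdot> ?t = \<phi>' (f y) \<cdot> bang V (dom ?t)"
      using ty(4-7)[OF x] ty(1-3)[OF x(1)] ty(1-3)[OF x(2)] G'(3-8) t d d' graph_presD(8,9)[OF g x]
      by (simp_all add: extend[OF G'(9) V] extend[OF G'(10) V] extend[OF f(2)[OF x(1)] V] extend[OF f(2)[OF x(2)] V])
    show ?thesis using presents_factor[OF g' f(1)[OF x(1)] f(1)[OF x(2)] t(1,2) s] t(3) by metis
  qed
  then obtain h where h: "\<And>x y. x \<in> vobj M ==> y \<in> vobj M ==> arr (h x y) \<and> dom (h x y) = vhom M (x, y) \<and>
     cod (h x y) = vhom N (f x, f y) \<and> if_mor G \<cdot> \<kappa> (x, y) = \<kappa>' (f x, f y) \<cdot> h x y" by metis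
  define F where "F = \<lparr>vfdom = M, vfcod = N, vf_obj = restrict f (vobj M), vf_hom = (\<lambda>(x, y)\<in>vobj M \<times> vobj M. h x y)\<rparr>"
  have F': "vfdom F = M" "vfcod F = N" "x \<in> vobj M ==> vf_obj F x = f x"
    "x \<in> vobj M ==> y \<in> vobj M ==> vf_hom F (x, y) = h x y" for x y
    by (simp_all add: F_def)
  have ind: "induces F G \<phi> \<kappa> \<phi>' \<kappa>'" unfolding induces_def using F' f(2) h by simp
  have "is_vfun small V F"
  proof (rule vfunI, unfold F'(1,2))
    fix x assume x: "x \<in> vobj M"
    note hx = h[OF x x] and v = vcat_graphD(6-8)[OF Mg x] and v' = vcat_graphD(6-8)[OF graph_presD(1)[OF g'] f(1)[OF x]]
    have "\<kappa>' (f x, f x) \<cdot> (h x x \<cdot> vid M x) = if_mor G \<cdot> (unt Z \<cdot> \<phi> x)"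
      using hx v ty(4-6)[OF x x] ty'(4-6)[OF f(1,1)[OF x]] G'(6-8) presentsD(2)[OF pr x]
      by (simp add: extend[of V "if_mor G" "\<kappa> (x, x)" "\<kappa>' (f x, f x) \<cdot> h x x"])
    also have "\<dots> = \<kappa>' (f x, f x) \<cdot> vid N (f x)"
      using presentsD(2)[OF pr' f(1)[OF x]] f(2)[OF x] ty(1-3)[OF x] G'(3-8) d d'
      by (simp add: extend[OF G'(11) V])
    finally have "h x x \<cdot> vid M x = vid N (f x)"
      using hx v v' by (rule_tac graph_pres_monic[OF g' f(1,1)[OF x]]) simp_all
    then show "vf_hom F (x, x) \<cdot> vid M x = vid N (vf_obj F x)" using F' x by simp
  next
    fix x y z a b assume x: "x \<in> vobj M" "y \<in> vobj M" "z \<in> vobj M" and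
      t: "arr a" "arr b" "dom b = dom a" "cod a = vhom M (y, z)" "cod b = vhom M (x, y)"
    note fx = f(1)[OF x(1)] f(1)[OF x(2)] f(1)[OF x(3)]
    note hx = h[OF x(1,2)] and hy = h[OF x(2,3)] and hz = h[OF x(1,3)]
    note tv = vmul_typing[OF Mg x t]
    have u: "arr (h y z \<cdot> a)" "arr (h x y \<cdot> b)" "dom (h x y \<cdot> b) = dom (h y z \<cdot> a)"
      "cod (h y z \<cdot> a) = vhom N (f y, f z)" "cod (h x y \<cdot> b) = vhom N (f x, f y)" "dom (h y z \<cdot> a) = dom a"
      using hx hy t by simp_all
    note tv' = vmul_typing[OF graph_presD(1)[OF g'] fx u(1-5)]
    have ab: "composable V (ifdom G) (\<kappa> (y, z) \<cdot> a) (\<kappa> (x, y) \<cdot> b)"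
      using graph_pres_st[OF g x(2,3) t(1,4)] graph_pres_st[OF g x(1,2) t(2,5)] t ty(4-6)[OF x(1,2)] ty(4-6)[OF x(2,3)] G(2)
      by (simp add: composable_def)
    have e: "if_mor G \<cdot> (\<kappa> (y, z) \<cdot> a) = \<kappa>' (f y, f z) \<cdot> (h y z \<cdot> a)" "if_mor G \<cdot> (\<kappa> (x, y) \<cdot> b) = \<kappa>' (f x, f y) \<cdot> (h x y \<cdot> b)"
      using hx hy t ty(4-6)[OF x(1,2)] ty(4-6)[OF x(2,3)] ty'(4-6)[OF fx(1,2)] ty'(4-6)[OF fx(2,3)] G'(6-8)
      by (simp_all add: extend[of V "if_mor G" "\<kappa> (y, z)" "\<kappa>' (f y, f z) \<cdot> h y z"]
          extend[of V "if_mor G" "\<kappa> (x, y)" "\<kappa>' (f x, f y) \<cdot> h x y"])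
    have "\<kappa>' (f x, f z) \<cdot> (h x z \<cdot> vmul V M x y z a b) = if_mor G \<cdot> (\<kappa> (x, z) \<cdot> vmul V M x y z a b)"
      using hz tv ty(4-6)[OF x(1,3)] ty'(4-6)[OF fx(1,3)] G'(6-8)
      by (simp add: extend[of V "if_mor G" "\<kappa> (x, z)" "\<kappa>' (f x, f z) \<cdot> h x z"])
    also have "\<dots> = imul V Z' (\<kappa>' (f y, f z) \<cdot> (h y z \<cdot> a)) (\<kappa>' (f x, f y) \<cdot> (h x y \<cdot> b))"
      using presentsD(3)[OF pr x t] ifun_imul[OF G(1) ab] G(2,3) e by simp
    also have "\<dots> = \<kappa>' (f x, f z) \<cdot> vmul V N (f x) (f y) (f z) (h y z \<cdot> a) (h x y \<cdot> b)"
      by (rule presentsD(3)[OF pr' fx u(1-5)])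
    finally have "h x z \<cdot> vmul V M x y z a b = vmul V N (f x) (f y) (f z) (h y z \<cdot> a) (h x y \<cdot> b)"
      using hz tv tv' u by (rule_tac graph_pres_monic[OF g' fx(1,3)]) simp_all
    then show "vf_hom F (x, z) \<cdot> vmul V M x y z a b = vmul V N (vf_obj F x) (vf_obj F y) (vf_obj F z) (vf_hom F (y, z) \<cdot> a) (vf_hom F (x, y) \<cdot> b)"
      using F' x by simp
  qed (use M F' f(1) h in \<open>simp_all add: F_def\<close>)
  then show ?thesis using F' ind by (intro that)
qed

text \<open>The hom-object (x, y) is the part of the morphisms with source \<phi> x and target
  \<phi> y, as cut out by \<open>cover2\<close>. Units and composites lift to these parts because
  their sources and targets are right, and the laws are inherited since the injections are
  monic.\<close>

lemma discrete_presented: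
  assumes Z: "is_icat V Z" and dZ: "discrete (iobj Z)"
  obtains M \<phi> \<kappa> where "is_vcat small V M" "presents M Z \<phi> \<kappa>"
proof -
  obtain A \<phi> where A: "small A" and \<phi>: "is_coproduct V A (\<lambda>_. one) (iobj Z) \<phi>" using dZ unfolding discrete_def by blast
  note Zg = icat_graphI[OF Z] and Zd = icatD[OF Z]
  note d = icat_graphD[OF Zg] and ty0 = is_coproductD(2-4)[OF \<phi>] and sA = smallish_small[OF A]
  obtain T \<kappa> a b where c: "is_coproduct V (A \<times> A) T (dom (src Z)) \<kappa>"
    and a: "\<And>x y. x \<in> A ==> y \<in> A ==> arr (a (x, y)) \<and> dom (a (x, y)) = T (x, y) \<and> cod (a (x, y)) = one \<and> src Z \<cdot> \<kappa> (x, y) = \<phi> x \<cdot> a (x, y)"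
    and b: "\<And>x y. x \<in> A ==> y \<in> A ==> arr (b (x, y)) \<and> dom (b (x, y)) = T (x, y) \<and> cod (b (x, y)) = one \<and> tgt Z \<cdot> \<kappa> (x, y) = \<phi> y \<cdot> b (x, y)"
    and fac: "\<And>x y t u v. x \<in> A ==> y \<in> A ==> arr t ==> arr u ==> arr v ==> cod t = dom (src Z) ==>
       dom u = dom t ==> dom v = dom t ==> cod u = one ==> cod v = one ==> src Z \<cdot> t = \<phi> x \<cdot> u ==>
       tgt Z \<cdot> t = \<phi> y \<cdot> v ==> \<exists>h\<in>Arr V. dom h = dom t \<and> cod h = T (x, y) \<and> \<kappa> (x, y) \<cdot> h = t"
    by (rule cover2[OF sA \<phi> d(3,5) sA \<phi> d(6,8)]) (use d in simp, rule that)
  \<comment> \<open>Restricted because \<open>is_vcat\<close> asks for extensional families.\<close>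
  define H where "H = restrict T (A \<times> A)"
  have H: "H (x, y) = T (x, y)" if "x \<in> A" "y \<in> A" for x y using that by (simp add: H_def)
  have \<kappa>: "is_coproduct V (A \<times> A) H (imor Z) \<kappa>"
    using c d(4) coproduct_cong[of "A \<times> A" H T \<kappa> \<kappa>] by (simp add: H_def)
  have ty: "arr (\<kappa> (x, y))" "dom (\<kappa> (x, y)) = H (x, y)" "cod (\<kappa> (x, y)) = imor Z" "H (x, y) \<in> Obj V"
    if "x \<in> A" "y \<in> A" for x y
    using is_coproductD(2-4)[OF \<kappa>, of "(x, y)"] that category_simps(1)[OF V, of "\<kappa> (x, y)"] by auto
  have st: "src Z \<cdot> \<kappa> (x, y) = \<phi> x \<cdot> bang V (H (x, y))" "tgt Z \<cdot> \<kappa> (x, y) = \<phi> y \<cdot> bang V (H (x, y))"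
    if x: "x \<in> A" "y \<in> A" for x y
  proof -
    have "a (x, y) = bang V (H (x, y))" "b (x, y) = bang V (H (x, y))"
      using a[OF x] b[OF x] ty(4)[OF x] H[OF x] by (auto intro: to_one_eq)
    then show "src Z \<cdot> \<kappa> (x, y) = \<phi> x \<cdot> bang V (H (x, y))" "tgt Z \<cdot> \<kappa> (x, y) = \<phi> y \<cdot> bang V (H (x, y))"
      using a[OF x] b[OF x] by simp_all
  qed
  have st2: "src Z \<cdot> (\<kappa> (x, y) \<cdot> r) = \<phi> x \<cdot> bang V (dom r)" "tgt Z \<cdot> (\<kappa> (x, y) \<cdot> r) = \<phi> y \<cdot> bang V (dom r)"
    if x: "x \<in> A" "y \<in> A" and r: "arr r" "cod r = H (x, y)" for x y r
    using ty[OF x] ty0[OF x(1)] ty0[OF x(2)] d r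
    by (simp_all add: extend[OF st(1)[OF x] V] extend[OF st(2)[OF x] V])
  have lift: "\<exists>h. arr h \<and> dom h = dom t \<and> cod h = H (x, y) \<and> \<kappa> (x, y) \<cdot> h = t"
    if "x \<in> A" "y \<in> A" "arr t" "cod t = imor Z" "src Z \<cdot> t = \<phi> x \<cdot> bang V (dom t)" "tgt Z \<cdot> t = \<phi> y \<cdot> bang V (dom t)" for x y t
    using fac[of x y t "bang V (dom t)" "bang V (dom t)"] that d H by auto
  have mono: "u = v" if x: "x \<in> A" "y \<in> A" and "arr u" "arr v" "dom u = dom v" "cod u = H (x, y)" "cod v = H (x, y)"
    "\<kappa> (x, y) \<cdot> u = \<kappa> (x, y) \<cdot> v" for x y u v
    by (rule monicD[OF coproduct_monic[OF smallish_Times[OF sA sA] \<kappa>, of "(x, y)"]]) (use that ty[OF x] in simp_all)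
  have cmp: "composable V Z (\<kappa> (y, z) \<cdot> u) (\<kappa> (x, y) \<cdot> v)"
    if x: "x \<in> A" "y \<in> A" "z \<in> A" and "arr u" "arr v" "dom v = dom u" "cod u = H (y, z)" "cod v = H (x, y)" for x y z u v
    using that ty[OF x(1,2)] ty[OF x(2,3)] st2[OF x(1,2)] st2[OF x(2,3)] by (simp add: composable_def)
  let ?p = "\<lambda>x y z. prod_fst V (H (y, z)) (H (x, y))" and ?q = "\<lambda>x y z. prod_snd V (H (y, z)) (H (x, y))"
  have "\<exists>h. arr h \<and> dom h = prod_obj V (H (y, z)) (H (x, y)) \<and> cod h = H (x, z) \<and>
      \<kappa> (x, z) \<cdot> h = imul V Z (\<kappa> (y, z) \<cdot> ?p x y z) (\<kappa> (x, y) \<cdot> ?q x y z)" if x: "x \<in> A" "y \<in> A" "z \<in> A" for x y z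
  proof -
    have ab: "composable V Z (\<kappa> (y, z) \<cdot> ?p x y z) (\<kappa> (x, y) \<cdot> ?q x y z)" using ty x by (intro cmp[OF x]) simp_all
    note ti = imul_typing[OF Zg ab]
    show ?thesis
      using lift[OF x(1,3) ti(1,3)] ti(2) Zd(1,2)[OF ab] st2[OF x(2,3)] st2[OF x(1,2)] ty[OF x(1,2)] ty[OF x(2,3)] by simp
  qed
  then obtain h where h: "\<And>x y z. x \<in> A ==> y \<in> A ==> z \<in> A ==> arr (h x y z) \<and> dom (h x y z) = prod_obj V (H (y, z)) (H (x, y)) \<and>
      cod (h x y z) = H (x, z) \<and> \<kappa> (x, z) \<cdot> h x y z = imul V Z (\<kappa> (y, z) \<cdot> ?p x y z) (\<kappa> (x, y) \<cdot> ?q x y z)" by metis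
  have "\<exists>h. arr h \<and> dom h = one \<and> cod h = H (x, x) \<and> \<kappa> (x, x) \<cdot> h = unt Z \<cdot> \<phi> x" if x: "x \<in> A" for x
    using lift[OF x x, of "unt Z \<cdot> \<phi> x"] ty0[OF x] d by (simp add: extend[OF d(15) V] extend[OF d(16) V])
  then obtain e where e: "\<And>x. x \<in> A ==> arr (e x) \<and> dom (e x) = one \<and> cod (e x) = H (x, x) \<and> \<kappa> (x, x) \<cdot> e x = unt Z \<cdot> \<phi> x" by metis
  define M where "M = \<lparr>vobj = A, vhom = H, vcomp = (\<lambda>(x, y, z)\<in>A \<times> A \<times> A. h x y z), vid = restrict e A\<rparr>"
  have Ms: "vobj M = A" "vhom M = H" "x \<in> A ==> y \<in> A ==> z \<in> A ==> vcomp M (x, y, z) = h x y z" "x \<in> A ==> vid M x = e x" for x y z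
    by (simp_all add: M_def)
  have Mg: "vcat_graph small V M" unfolding vcat_graph_def using A ty h e Ms by simp
  have g: "graph_pres M Z \<phi> \<kappa>" unfolding graph_pres_def Ms using Mg Zg \<phi> \<kappa> st by simp
  have mu: "imul V Z (\<kappa> (y, z) \<cdot> u) (\<kappa> (x, y) \<cdot> v) = \<kappa> (x, z) \<cdot> vmul V M x y z u v"
    if x: "x \<in> A" "y \<in> A" "z \<in> A" and t: "arr u" "arr v" "dom v = dom u" "cod u = H (y, z)" "cod v = H (x, y)" for x y z u v
  proof -
    have ab: "composable V Z (\<kappa> (y, z) \<cdot> ?p x y z) (\<kappa> (x, y) \<cdot> ?q x y z)" using ty x by (intro cmp[OF x]) simp_all
    have "arr (h x y z) \<and> dom (h x y z) = prod_obj V (H (y, z)) (H (x, y)) \<and> cod (h x y z) = H (x, z)"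
      using h[OF x] by blast
    then have "\<kappa> (x, z) \<cdot> vmul V M x y z u v = (\<kappa> (x, z) \<cdot> h x y z) \<cdot> prod_pair V u v"
      using t ty[OF x(1,3)] x by (simp add: vmul_def Ms)
    also have "\<dots> = imul V Z (\<kappa> (y, z) \<cdot> ?p x y z) (\<kappa> (x, y) \<cdot> ?q x y z) \<cdot> prod_pair V u v" using h[OF x] by simp
    also have "\<dots> = imul V Z (\<kappa> (y, z) \<cdot> u) (\<kappa> (x, y) \<cdot> v)"
      using ty[OF x(1,2)] ty[OF x(2,3)] t by (subst imul_comp[OF Zg ab]) simp_all
    finally show ?thesis by simp
  qed
  have pr: "presents M Z \<phi> \<kappa>" unfolding presents_def Ms(1,2) using g e mu Ms by simp
  have un: "arr (e x \<cdot> bang V T) \<and> dom (e x \<cdot> bang V T) = T \<and> cod (e x \<cdot> bang V T) = H (x, x) \<and>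
     \<kappa> (x, x) \<cdot> (e x \<cdot> bang V T) = unt Z \<cdot> (\<phi> x \<cdot> bang V T)" if "x \<in> A" "T \<in> Obj V" for x T
    using e[OF that(1)] that ty0[OF that(1)] ty[OF that(1,1)] d by (simp add: extend[of V "\<kappa> (x, x)" "e x" "unt Z \<cdot> \<phi> x"])
  have "is_vcat small V M"
  proof (rule vcatI[OF Mg])
    fix x y u assume x: "x \<in> vobj M" "y \<in> vobj M" and u: "arr u" "cod u = vhom M (x, y)"
    have x': "x \<in> A" "y \<in> A" and u': "cod u = H (x, y)" "dom u \<in> Obj V" using x u Ms by simp_all
    note e1 = un[OF x'(1) u'(2)] and e2 = un[OF x'(2) u'(2)]
    have ku: "arr (\<kappa> (x, y) \<cdot> u)" "cod (\<kappa> (x, y) \<cdot> u) = imor Z" using ty[OF x'] u(1) u' by simp_all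
    have tv: "arr (vmul V M x x y u (e x \<cdot> bang V (dom u)))" "dom (vmul V M x x y u (e x \<cdot> bang V (dom u))) = dom u"
      "cod (vmul V M x x y u (e x \<cdot> bang V (dom u))) = H (x, y)"
      using vmul_typing[OF Mg x(1,1,2) u(1), of "e x \<cdot> bang V (dom u)"] e1 u Ms by simp_all
    have "\<kappa> (x, y) \<cdot> vmul V M x x y u (e x \<cdot> bang V (dom u)) = imul V Z (\<kappa> (x, y) \<cdot> u) (\<kappa> (x, x) \<cdot> (e x \<cdot> bang V (dom u)))"
      by (rule mu[OF x'(1,1,2) u(1), symmetric]) (use e1 u u' in simp_all)
    also have "\<dots> = \<kappa> (x, y) \<cdot> u"
      using Zd(3)[OF ku] st2[OF x' u(1) u'(1)] e1 by simp
    finally show "vmul V M x x y u (vid M x \<cdot> bang V (dom u)) = u"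
      unfolding Ms(4)[OF x'(1)] using tv u u' by (rule_tac mono[OF x']) simp_all
    have tv: "arr (vmul V M x y y (e y \<cdot> bang V (dom u)) u)" "dom (vmul V M x y y (e y \<cdot> bang V (dom u)) u) = dom u"
      "cod (vmul V M x y y (e y \<cdot> bang V (dom u)) u) = H (x, y)"
      using vmul_typing[OF Mg x(1,2,2) _ u(1), of "e y \<cdot> bang V (dom u)"] e2 u Ms by simp_all
    have "\<kappa> (x, y) \<cdot> vmul V M x y y (e y \<cdot> bang V (dom u)) u = imul V Z (\<kappa> (y, y) \<cdot> (e y \<cdot> bang V (dom u))) (\<kappa> (x, y) \<cdot> u)"
      by (rule mu[OF x'(1,2,2) _ u(1), symmetric]) (use e2 u u' in simp_all)
    also have "\<dots> = \<kappa> (x, y) \<cdot> u"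
      using Zd(4)[OF ku] st2[OF x' u(1) u'(1)] e2 by simp
    finally show "vmul V M x y y (vid M y \<cdot> bang V (dom u)) u = u"
      unfolding Ms(4)[OF x'(2)] using tv u u' by (rule_tac mono[OF x']) simp_all
  next
    fix w x y z u v t assume x: "w \<in> vobj M" "x \<in> vobj M" "y \<in> vobj M" "z \<in> vobj M" and
      t: "arr u" "arr v" "arr t" "dom v = dom u" "dom t = dom u"
       "cod u = vhom M (y, z)" "cod v = vhom M (x, y)" "cod t = vhom M (w, x)"
    have x': "w \<in> A" "x \<in> A" "y \<in> A" "z \<in> A" and t': "cod u = H (y, z)" "cod v = H (x, y)" "cod t = H (w, x)" "dom t = dom v"
      using x t Ms by simp_all
    note v1 = vmul_typing[OF Mg x(2-4) t(1,2,4,6,7)] and v2 = vmul_typing[OF Mg x(1-3) t(2,3) t'(4) t(7,8)]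
    note c1 = cmp[OF x'(2-4) t(1,2,4) t'(1,2)] and c2 = cmp[OF x'(1-3) t(2,3) t'(4,2,3)]
    have v1': "dom t = dom (vmul V M x y z u v)" and v2': "dom (vmul V M w x y v t) = dom u" using v1 v2 t by simp_all
    note w1 = vmul_typing[OF Mg x(1,2,4) v1(1) t(3) v1' v1(3) t(8)] and w2 = vmul_typing[OF Mg x(1,3,4) t(1) v2(1) v2' t(6) v2(3)]
    have "\<kappa> (w, z) \<cdot> vmul V M w x z (vmul V M x y z u v) t = imul V Z (imul V Z (\<kappa> (y, z) \<cdot> u) (\<kappa> (x, y) \<cdot> v)) (\<kappa> (w, x) \<cdot> t)"
      unfolding mu[OF x'(2-4) t(1,2,4) t'(1,2)]
      by (rule mu[OF x'(1,2,4) v1(1) t(3) v1' _ t'(3), symmetric]) (use v1 Ms in simp)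
    also have "\<dots> = imul V Z (\<kappa> (y, z) \<cdot> u) (imul V Z (\<kappa> (x, y) \<cdot> v) (\<kappa> (w, x) \<cdot> t))" by (rule Zd(5)[OF c1 c2])
    also have "\<dots> = \<kappa> (w, z) \<cdot> vmul V M w y z u (vmul V M w x y v t)"
      unfolding mu[OF x'(1-3) t(2,3) t'(4,2,3)]
      by (rule mu[OF x'(1,3,4) t(1) v2(1) v2' t'(1)]) (use v2 Ms in simp)
    finally show "vmul V M w x z (vmul V M x y z u v) t = vmul V M w y z u (vmul V M w x y v t)"
      using w1 w2 v1 Ms by (rule_tac mono[OF x'(1,4)]) simp_all
  qed (simp_all add: M_def H_def)
  then show ?thesis using pr by (rule that)
qed

section \<open>Phi as a functor and its essential image\<close>

abbreviation "\<phi>J M \<equiv> J_in V (vobj M)"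
abbreviation "\<kappa>J M \<equiv> csum_in V (vobj M \<times> vobj M) (vhom M)"

lemma Phi_simps [simp]:
  "FObj (Phi V) M = Phi_obj V M" "FArr (Phi V) F = Phi_arr V F"
  "ifdom (Phi_arr V F) = Phi_obj V (vfdom F)" "ifcod (Phi_arr V F) = Phi_obj V (vfcod F)"
  "if_obj (Phi_arr V F) = J_arr V (vobj (vfdom F)) (vf_obj F) (vobj (vfcod F))"
  "iobj (Phi_obj V M) = J_obj V (vobj M)" "imor (Phi_obj V M) = csum V (vobj M \<times> vobj M) (vhom M)"
  by (simp_all add: Phi_def Phi_arr_def Phi_obj_def Let_def)

text \<open>On each summand the cotuples in \<open>Phi_arr\<close> restrict to the data of F, which
  is what \<open>induces\<close> records.\<close>

lemma Phi_arr_induced: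
  assumes F: "is_vfun small V F"
  shows "is_ifun V (Phi_arr V F)" "induces F (Phi_arr V F) (\<phi>J (vfdom F)) (\<kappa>J (vfdom F)) (\<phi>J (vfcod F)) (\<kappa>J (vfcod F))"
proof -
  let ?M = "vfdom F" and ?N = "vfcod F"
  note f = vfunD[OF F]
  note pr = Phi_obj_presents[OF f(1)] and pr' = Phi_obj_presents[OF f(2)]
  note g = presentsD(1)[OF pr] and g' = presentsD(1)[OF pr']
  note ty' = graph_pres_typing[OF g'] and ty = graph_pres_typing[OF g]
  note j = J_arr_simps[of "vobj ?M" "vobj ?N" "vf_obj F", OF graph_presD(5)[OF g] graph_presD(5)[OF g'] f(5)]
  let ?u = "\<lambda>(x, y). \<kappa>J ?N (vf_obj F x, vf_obj F y) \<cdot> vf_hom F (x, y)"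
  have mor: "if_mor (Phi_arr V F) = cotuple V (vobj ?M \<times> vobj ?M) (vhom ?M) (csum V (vobj ?N \<times> vobj ?N) (vhom ?N)) ?u"
    by (simp add: Phi_arr_def Let_def)
  have u: "arr (?u k)" "dom (?u k) = vhom ?M k" "cod (?u k) = csum V (vobj ?N \<times> vobj ?N) (vhom ?N)" "vhom ?M k \<in> Obj V"
    if "k \<in> vobj ?M \<times> vobj ?M" for k using that f(5-8) ty'(4-6) ty(7) by auto
  have c: "csum V (vobj ?N \<times> vobj ?N) (vhom ?N) \<in> Obj V" using is_coproductD(1)[OF graph_presD(4)[OF g']] by simp
  have m: "arr (if_mor (Phi_arr V F))" "dom (if_mor (Phi_arr V F)) = csum V (vobj ?M \<times> vobj ?M) (vhom ?M)"
    "cod (if_mor (Phi_arr V F)) = csum V (vobj ?N \<times> vobj ?N) (vhom ?N)"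
    "k \<in> vobj ?M \<times> vobj ?M ==> if_mor (Phi_arr V F) \<cdot> \<kappa>J ?M k = ?u k" for k
    unfolding mor by (rule cotuple_simps[OF graph_presD(7)[OF g] u(4) c u(1-3)]; assumption)+
  show i: "induces F (Phi_arr V F) (\<phi>J ?M) (\<kappa>J ?M) (\<phi>J ?N) (\<kappa>J ?N)"
    unfolding induces_def using j(4) m(4) by simp
  have e: "Phi_arr V F = \<lparr>ifdom = Phi_obj V ?M, ifcod = Phi_obj V ?N, if_obj = if_obj (Phi_arr V F), if_mor = if_mor (Phi_arr V F)\<rparr>"
    by (simp add: Phi_arr_def Let_def)
  show "is_ifun V (Phi_arr V F)"
    by (subst e, rule induces_ifun[OF F pr pr']) (use j m i[unfolded induces_def] in \<open>simp_all add: induces_def\<close>)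
qed

lemma ifun_eqI:
  assumes g: "graph_pres M Z \<phi> \<kappa>" and G: "is_ifun V G" "ifdom G = Z" and H: "is_ifun V H" "ifdom H = Z" "ifcod H = ifcod G"
    and e0: "\<And>x. x \<in> vobj M ==> if_obj G \<cdot> \<phi> x = if_obj H \<cdot> \<phi> x"
    and e1: "\<And>x y. x \<in> vobj M ==> y \<in> vobj M ==> if_mor G \<cdot> \<kappa> (x, y) = if_mor H \<cdot> \<kappa> (x, y)"
  shows "G = H"
proof -
  note G' = ifunD[OF G(1)] and H' = ifunD[OF H(1)]
  have "if_obj G = if_obj H"
    by (rule coproduct_eqI[OF graph_presD(3)[OF g] V]) (use G' H' G H e0 in simp_all)
  moreover have "if_mor G = if_mor H"
    by (rule coproduct_eqI[OF graph_presD(4)[OF g] V]) (use G' H' G H e1 in auto)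
  ultimately show ?thesis using G H by simp
qed

text \<open>An internal functor out of a presented category is determined by its restrictions to the
  summands, where identities and composites are those of V-functors.\<close>

lemma Phi_functor: "is_functor VCat ICat (Phi V)"
  unfolding is_functor_def
proof (intro conjI ballI impI)
  fix M assume "M \<in> Obj VCat"
  then have M: "is_vcat small V M" by simp
  note pr = Phi_obj_presents[OF M]
  note g = presentsD(1)[OF pr] and Z = presents_icat[OF pr M]
  show "FObj (Phi V) M \<in> Obj ICat" using Z by simp
  note i = vfun_ident[OF M]
  note ii = inducesD[OF Phi_arr_induced(2)[OF i], simplified]
  note ty = graph_pres_typing[OF g]
  show "FArr (Phi V) (Ident VCat M) = Ident ICat (FObj (Phi V) M)"
    by (rule ifun_eqI[OF g]) (use Phi_arr_induced(1)[OF i] ifun_ident[OF Z] ii ty in simp_all)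
next
  fix F assume "F \<in> Arr VCat"
  then show "FArr (Phi V) F \<in> hom ICat (FObj (Phi V) (Dom VCat F)) (FObj (Phi V) (Cod VCat F))"
    using Phi_arr_induced(1) by simp
next
  fix F G assume a: "F \<in> Arr VCat" "G \<in> Arr VCat" "Cod VCat F = Dom VCat G"
  then have F: "is_vfun small V F" and G: "is_vfun small V G" and FG: "vfcod F = vfdom G" by simp_all
  note H = vfun_comp[OF F G FG]
  note f = vfunD[OF F, unfolded FG] and g' = vfunD[OF G]
  note pr = Phi_obj_presents[OF f(1)] Phi_obj_presents[OF g'(1)] Phi_obj_presents[OF g'(2)]
  note gp = presentsD(1)[OF pr(1)] presentsD(1)[OF pr(2)] presentsD(1)[OF pr(3)]
  note ty = graph_pres_typing[OF gp(1)] and ty' = graph_pres_typing[OF gp(2)] and ty'' = graph_pres_typing[OF gp(3)]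
  note iF = inducesD[OF Phi_arr_induced(2)[OF F], unfolded FG] and iG = inducesD[OF Phi_arr_induced(2)[OF G]]
    and iH = inducesD[OF Phi_arr_induced(2)[OF H], simplified]
  note F' = ifunD[OF Phi_arr_induced(1)[OF F]] and G' = ifunD[OF Phi_arr_induced(1)[OF G]]
  have cc: "is_ifun V (Phi_arr V G \<cdot>[ICat] Phi_arr V F)"
    using ifun_comp[OF Phi_arr_induced(1)[OF F] Phi_arr_induced(1)[OF G]] FG by simp
  have "Phi_arr V (G \<cdot>[VCat] F) = Phi_arr V G \<cdot>[ICat] Phi_arr V F"
  proof (rule ifun_eqI[OF gp(1) Phi_arr_induced(1)[OF H] _ cc])
    fix x assume x: "x \<in> vobj (vfdom F)"
    show "if_obj (Phi_arr V (G \<cdot>[VCat] F)) \<cdot> \<phi>J (vfdom F) x = if_obj (Phi_arr V G \<cdot>[ICat] Phi_arr V F) \<cdot> \<phi>J (vfdom F) x"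
      using iH(1)[OF x] iF(1)[OF x] iG(1)[OF f(5)[OF x]] x F'(3-8) G'(3-8) ty(1-3)[OF x] FG by (simp add: compose_def)
    fix y assume y: "y \<in> vobj (vfdom F)"
    show "if_mor (Phi_arr V (G \<cdot>[VCat] F)) \<cdot> \<kappa>J (vfdom F) (x, y) = if_mor (Phi_arr V G \<cdot>[ICat] Phi_arr V F) \<cdot> \<kappa>J (vfdom F) (x, y)"
      using iH(2)[OF x y] iF(2)[OF x y] x y F'(3-8) G'(3-8) ty(4-6)[OF x y] FG f(6-8)[OF x y] g'(6-8)[OF f(5)[OF x] f(5)[OF y]]
        ty'(4-6)[OF f(5)[OF x] f(5)[OF y]] ty''(4-6)[OF g'(5)[OF f(5)[OF x]] g'(5)[OF f(5)[OF y]]]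
      by (simp add: compose_def extend[OF iG(2)[OF f(5)[OF x] f(5)[OF y]] V])
  qed (use FG in simp_all)
  then show "FArr (Phi V) (G \<cdot>[VCat] F) = FArr (Phi V) G \<cdot>[ICat] FArr (Phi V) F" by (simp del: V_cat_simps)
qed

text \<open>\<open>induces_inject\<close> and \<open>induces_ex\<close>, applied to the
  presentations of the two internal categories by M and N.\<close>

lemma Phi_fully_faithful: "fully_faithful VCat ICat (Phi V)"
  unfolding fully_faithful_def
proof (intro ballI)
  fix M N assume "M \<in> Obj VCat" "N \<in> Obj VCat"
  then have MN: "is_vcat small V M" "is_vcat small V N" by simp_all
  note pr = Phi_obj_presents[OF MN(1)] and pr' = Phi_obj_presents[OF MN(2)]
  note g = presentsD(1)[OF pr] and g' = presentsD(1)[OF pr']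
  show "bij_betw (FArr (Phi V)) (hom VCat M N) (hom ICat (FObj (Phi V) M) (FObj (Phi V) N))"
    unfolding bij_betw_def
  proof
    show "inj_on (FArr (Phi V)) (hom VCat M N)"
    proof (rule inj_onI)
      fix F F' assume "F \<in> hom VCat M N" "F' \<in> hom VCat M N" "FArr (Phi V) F = FArr (Phi V) F'"
      then have F: "is_vfun small V F" "is_vfun small V F'" "vfdom F = M" "vfdom F' = M" "vfcod F = N" "vfcod F' = N"
        "Phi_arr V F' = Phi_arr V F" by simp_all
      show "F = F'"
        by (rule induces_inject[OF F(1,2), of "Phi_obj V N" "\<phi>J N" "\<kappa>J N" "Phi_arr V F" "\<phi>J M" "\<kappa>J M"])
          (use F g' Phi_arr_induced(2)[OF F(1)] Phi_arr_induced(2)[OF F(2)] in simp_all)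
    qed
    show "FArr (Phi V) ` hom VCat M N = hom ICat (FObj (Phi V) M) (FObj (Phi V) N)"
    proof (intro subset_antisym subsetI)
      fix G assume "G \<in> FArr (Phi V) ` hom VCat M N"
      then obtain F where F: "is_vfun small V F" "vfdom F = M" "vfcod F = N" "G = Phi_arr V F" by auto
      then show "G \<in> hom ICat (FObj (Phi V) M) (FObj (Phi V) N)" using Phi_arr_induced(1)[OF F(1)] by simp
    next
      fix G assume "G \<in> hom ICat (FObj (Phi V) M) (FObj (Phi V) N)"
      then have G: "is_ifun V G" "ifdom G = Phi_obj V M" "ifcod G = Phi_obj V N" by simp_all
      obtain F where F: "is_vfun small V F" "vfdom F = M" "vfcod F = N" "induces F G (\<phi>J M) (\<kappa>J M) (\<phi>J N) (\<kappa>J N)"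
        using induces_ex[OF MN pr pr' G] .
      note i = Phi_arr_induced[OF F(1), unfolded F(2,3)]
      have "Phi_arr V F = G"
        by (rule ifun_eqI[OF g i(1)]) (use G F inducesD[OF i(2)] inducesD[OF F(4)] in simp_all)
      then show "G \<in> FArr (Phi V) ` hom VCat M N" using F by (intro image_eqI[of _ _ F]) simp_all
    qed
  qed
qed

lemma ff_functor_Phi: "ff_functor VCat ICat (Phi V)"
  using category_V_cat category_int_cat Phi_functor Phi_fully_faithful int_cat_has_pullbacks
  by (intro ff_functor.intro)

text \<open>Two internal categories presented by the same M differ only in the choice of coproducts.
  The comparison of coproducts and its inverse are both induced by the identity of M, hence are
  functors.\<close>

lemma Phi_image_iff:
  "ff_functor.in_image VCat ICat (Phi V) Z \<longleftrightarrow> is_icat V Z \<and> discrete (iobj Z)"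
  unfolding ff_functor.in_image_def[OF ff_functor_Phi]
proof (intro iffI; elim conjE bexE exE)
  fix M \<psi> assume "M \<in> Obj VCat" and \<psi>: "iso ICat \<psi>" "Dom ICat \<psi> = FObj (Phi V) M" "Cod ICat \<psi> = Z"
  then have M: "is_vcat small V M" by simp
  have "is_ifun V \<psi>" using iso_arr[OF \<psi>(1)] by simp
  note f = ifunD[OF this]
  have i: "iso V (if_obj \<psi>)" by (rule int_cat_iso_obj[OF \<psi>(1)])
  have "discrete (J_obj V (vobj M))" unfolding discrete_def
    using vcat_graphD(1)[OF vcat_graphI[OF M]] J_coproduct by blast
  then show "is_icat V Z \<and> discrete (iobj Z)"
    using discrete_iso[OF i] f(2-5) \<psi>(2,3) by simp
next
  assume "is_icat V Z" "discrete (iobj Z)"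
  then obtain M \<phi> \<kappa> where M: "is_vcat small V M" and pr: "presents M Z \<phi> \<kappa>" by (rule discrete_presented)
  note pr' = Phi_obj_presents[OF M]
  note g = presentsD(1)[OF pr] and g' = presentsD(1)[OF pr']
  note ty = graph_pres_typing[OF g] and ty' = graph_pres_typing[OF g']
  let ?W = "Phi_obj V M" and ?I = "Ident VCat M"
  obtain f0 where f0: "iso V f0" "dom f0 = iobj ?W" "cod f0 = iobj Z" "\<And>x. x \<in> vobj M ==> f0 \<cdot> \<phi>J M x = \<phi> x"
    by (rule coproduct_compare[OF graph_presD(3)[OF g'] graph_presD(3)[OF g] V]) (rule that)
  obtain f1 where f1: "iso V f1" "dom f1 = imor ?W" "cod f1 = imor Z" "\<And>k. k \<in> vobj M \<times> vobj M ==> f1 \<cdot> \<kappa>J M k = \<kappa> k"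
    by (rule coproduct_compare[OF graph_presD(4)[OF g'] graph_presD(4)[OF g] V]) (rule that)
  obtain h0 where h0: "arr h0" "dom h0 = cod f0" "cod h0 = dom f0" "h0 \<cdot> f0 = Ident V (dom f0)" "f0 \<cdot> h0 = Ident V (cod f0)"
    using isoD[OF V f0(1)] by blast
  obtain h1 where h1: "arr h1" "dom h1 = cod f1" "cod h1 = dom f1" "h1 \<cdot> f1 = Ident V (dom f1)" "f1 \<cdot> h1 = Ident V (cod f1)"
    using isoD[OF V f1(1)] by blast
  note a0 = iso_arr[OF f0(1)] and a1 = iso_arr[OF f1(1)]
  let ?G = "\<lparr>ifdom = ?W, ifcod = Z, if_obj = f0, if_mor = f1\<rparr>" and ?H = "\<lparr>ifdom = Z, ifcod = ?W, if_obj = h0, if_mor = h1\<rparr>"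
  have I: "is_vfun small V ?I" "vfdom ?I = M" "vfcod ?I = M" using vfun_ident[OF M] by simp_all
  have "is_ifun V ?G"
    by (rule induces_ifun[OF I(1), unfolded I(2,3), OF pr' pr]) (use a0 a1 f0 f1 ty in \<open>simp_all add: induces_def\<close>)
  moreover have "h0 \<cdot> \<phi> x = \<phi>J M x" if x: "x \<in> vobj M" for x
    unfolding f0(4)[OF x, symmetric] using h0 a0 ty'(1-3)[OF x] f0(2) by (simp add: extend[OF h0(4) V])
  moreover have "h1 \<cdot> \<kappa> (x, y) = \<kappa>J M (x, y)" if x: "x \<in> vobj M" "y \<in> vobj M" for x y
    using f1(4)[of "(x, y)", symmetric] x h1 a1 ty'(4-6)[OF x] f1(2) by (simp add: extend[OF h1(4) V])
  moreover have "is_ifun V ?H"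
    by (rule induces_ifun[OF I(1), unfolded I(2,3), OF pr pr'])
      (use calculation(2,3) h0 h1 f0 f1 ty' in \<open>simp_all add: induces_def\<close>)
  ultimately have "iso ICat ?G"
    by (rule_tac int_cat_isoI[ of ?G ?H]) (use h0 h1 f0(2,3) f1(2,3) in simp_all)
  then show "\<exists>M\<in>Obj VCat. \<exists>\<psi>. iso ICat \<psi> \<and> Dom ICat \<psi> = FObj (Phi V) M \<and> Cod ICat \<psi> = Z"
    using M by (intro bexI[of _ M] exI[of _ ?G]) simp_all
qed

section \<open>Full subcategories and surjectivity on objects\<close>

definition full_sub :: "('u, 'o, 'm) vcat \<Rightarrow> 'u set \<Rightarrow> ('u, 'o, 'm) vcat" where
  "full_sub N B = \<lparr>vobj = B, vhom = restrict (vhom N) (B \<times> B),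
     vcomp = restrict (vcomp N) (B \<times> B \<times> B), vid = restrict (vid N) B\<rparr>"

definition full_sub_incl :: "('u, 'o, 'm) vcat \<Rightarrow> 'u set \<Rightarrow> ('u, 'o, 'm) vfun" where
  "full_sub_incl N B = \<lparr>vfdom = full_sub N B, vfcod = N, vf_obj = (\<lambda>x\<in>B. x),
     vf_hom = (\<lambda>k\<in>B \<times> B. Ident V (vhom N k))\<rparr>"

lemma full_sub_simps [simp]:
  "vobj (full_sub N B) = B" "x \<in> B ==> y \<in> B ==> vhom (full_sub N B) (x, y) = vhom N (x, y)"
  "x \<in> B ==> y \<in> B ==> z \<in> B ==> vmul V (full_sub N B) x y z a b = vmul V N x y z a b"
  "x \<in> B ==> vid (full_sub N B) x = vid N x"
  "vfdom (full_sub_incl N B) = full_sub N B" "vfcod (full_sub_incl N B) = N"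
  "x \<in> B ==> vf_obj (full_sub_incl N B) x = x"
  "x \<in> B ==> y \<in> B ==> vf_hom (full_sub_incl N B) (x, y) = Ident V (vhom N (x, y))"
  by (simp_all add: full_sub_def full_sub_incl_def vmul_def)

lemma vcat_full_sub:
  assumes N: "is_vcat small V N" and B: "B \<subseteq> vobj N"
  shows "is_vcat small V (full_sub N B)"
proof -
  note Ng = vcat_graphI[OF N]
  note d = vcat_graphD[OF Ng] and v = vcatD[OF N]
  have b: "x \<in> vobj N" if "x \<in> B" for x using that B by blast
  have g: "vcat_graph small V (full_sub N B)"
    unfolding vcat_graph_def using small_subset[OF d(1) B] d(2-8) b by (simp add: full_sub_def)
  show ?thesis
    by (rule vcatI[OF g]) (use v b vmul_typing[OF Ng] in \<open>simp_all add: full_sub_def[of N B, THEN arg_cong[of _ _ vhom]]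
      full_sub_def[of N B, THEN arg_cong[of _ _ vcomp]] full_sub_def[of N B, THEN arg_cong[of _ _ vid]]\<close>)
qed

lemma vfun_full_sub_incl:
  assumes N: "is_vcat small V N" and B: "B \<subseteq> vobj N"
  shows "is_vfun small V (full_sub_incl N B)"
proof (rule vfunI)
  note Ng = vcat_graphI[OF N]
  note d = vcat_graphD[OF Ng]
  have b: "x \<in> vobj N" if "x \<in> B" for x using that B by blast
  let ?F = "full_sub_incl N B"
  show "vf_obj ?F \<in> vobj (vfdom ?F) \<rightarrow>\<^sub>E vobj (vfcod ?F)" "vf_hom ?F \<in> extensional (vobj (vfdom ?F) \<times> vobj (vfdom ?F))"
    using B by (auto simp: full_sub_incl_def full_sub_def)
  show "is_vcat small V (vfdom ?F)" "is_vcat small V (vfcod ?F)" using vcat_full_sub[OF N B] N by simp_all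
  fix x y assume x: "x \<in> vobj (vfdom ?F)" "y \<in> vobj (vfdom ?F)"
  show "arr (vf_hom ?F (x, y))" "dom (vf_hom ?F (x, y)) = vhom (vfdom ?F) (x, y)"
    "cod (vf_hom ?F (x, y)) = vhom (vfcod ?F) (vf_obj ?F x, vf_obj ?F y)"
    using x b d by simp_all
  show "vf_hom ?F (x, x) \<cdot> vid (vfdom ?F) x = vid (vfcod ?F) (vf_obj ?F x)"
    using x b d(6-8) by simp
  fix z a c assume "z \<in> vobj (vfdom ?F)" "arr a" "arr c" "dom c = dom a"
    "cod a = vhom (vfdom ?F) (y, z)" "cod c = vhom (vfdom ?F) (x, y)"
  then show "vf_hom ?F (x, z) \<cdot> vmul V (vfdom ?F) x y z a c =
      vmul V (vfcod ?F) (vf_obj ?F x) (vf_obj ?F y) (vf_obj ?F z) (vf_hom ?F (y, z) \<cdot> a) (vf_hom ?F (x, y) \<cdot> c)"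
    using x b vmul_typing[OF Ng, of x y z a c] by simp
qed

text \<open>The inclusion is injective on objects and the identity on hom-objects.\<close>

lemma monic_full_sub_incl:
  assumes N: "is_vcat small V N" and B: "B \<subseteq> vobj N"
  shows "monic VCat (full_sub_incl N B)"
  unfolding monic_def
proof (intro conjI ballI impI; (elim conjE)?)
  let ?I = "full_sub_incl N B"
  have I: "is_vfun small V ?I" by (rule vfun_full_sub_incl[OF N B])
  then show "?I \<in> Arr VCat" by simp
  fix F G assume "F \<in> Arr VCat" "G \<in> Arr VCat" "Dom VCat F = Dom VCat G"
    "Cod VCat F = Dom VCat ?I" "Cod VCat G = Dom VCat ?I"
    and eq: "?I \<cdot>[VCat] F = ?I \<cdot>[VCat] G"
  then have F: "is_vfun small V F" "vfcod F = full_sub N B" and G: "is_vfun small V G" "vfcod G = full_sub N B" and FG: "vfdom F = vfdom G"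
    by (simp_all del: V_cat_simps(6) add: full_sub_incl_def)
  note f = vfunD[OF F(1), unfolded F(2) FG] and g = vfunD[OF G(1), unfolded G(2)]
  have o: "vf_obj F x = vf_obj G x" if x: "x \<in> vobj (vfdom G)" for x
    using arg_cong[OF eq, of "\<lambda>H. vf_obj H x"] x FG f(5)[OF x] g(5)[OF x] by (simp add: compose_def)
  show "F = G"
  proof (rule vfun_eqI[OF F(1) G(1) FG])
    fix x y assume "x \<in> vobj (vfdom F)" "y \<in> vobj (vfdom F)"
    then have x: "x \<in> vobj (vfdom G)" "y \<in> vobj (vfdom G)" using FG by simp_all
    then show "vf_hom F (x, y) = vf_hom G (x, y)"
      using arg_cong[OF eq, of "\<lambda>H. vf_hom H (x, y)"] FG f(5)[OF x(1)] g(5)[OF x(1)] f(5)[OF x(2)] g(5)[OF x(2)]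
        f(6-8)[OF x] g(6-8)[OF x] o[OF x(1)] o[OF x(2)] by simp
  qed (use F G FG o in simp_all)
qed

text \<open>An extremal V-functor factors through the inclusion of its full image.\<close>

lemma extremal_surjective:
  assumes p: "is_vfun small V p" and ex: "extremal VCat p" and b: "b \<in> vobj (vfcod p)"
  obtains a where "a \<in> vobj (vfdom p)" "vf_obj p a = b"
proof -
  note f = vfunD[OF p]
  let ?M = "vfdom p" and ?N = "vfcod p"
  define B where "B = vf_obj p ` vobj ?M"
  have B: "B \<subseteq> vobj ?N" using f(5) by (auto simp: B_def)
  have fB: "vf_obj p x \<in> B" if "x \<in> vobj ?M" for x using that by (simp add: B_def)
  let ?S = "full_sub ?N B" and ?I = "full_sub_incl ?N B"
  define p' where "p' = \<lparr>vfdom = ?M, vfcod = ?S, vf_obj = vf_obj p, vf_hom = vf_hom p\<rparr>"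
  have ps: "vfdom p' = ?M" "vfcod p' = ?S" "vf_obj p' = vf_obj p" "vf_hom p' = vf_hom p" by (simp_all add: p'_def)
  have p': "is_vfun small V p'"
  proof (rule vfunI, unfold ps)
    show "vf_obj p \<in> vobj ?M \<rightarrow>\<^sub>E vobj ?S" using f(3) fB by (auto simp: PiE_def)
  qed (use f(1,4-10) fB vcat_full_sub[OF f(2) B] in simp_all)
  have I: "is_vfun small V ?I" by (rule vfun_full_sub_incl[OF f(2) B])
  have Ip: "is_vfun small V (?I \<cdot>[VCat] p')" by (rule vfun_comp[OF p' I]) (simp add: ps)
  have e: "?I \<cdot>[VCat] p' = p"
    by (rule vfun_eqI[OF Ip p]) (use ps fB f(6-8) in \<open>simp_all add: compose_def\<close>)
  have "\<exists>k\<in>Arr VCat. Dom VCat k = Cod VCat ?I \<and> Cod VCat k = Dom VCat ?I \<and>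
      ?I \<cdot>[VCat] k = Ident VCat (Cod VCat ?I)"
    by (rule ex[unfolded extremal_def, rule_format, OF conjI[OF monic_full_sub_incl[OF f(2) B] conjI[OF _ conjI[OF _ e]]]])
      (use p' ps in simp_all)
  then obtain k where k: "is_vfun small V k" "vfdom k = ?N" "vfcod k = ?S"
    "?I \<cdot>[VCat] k = Ident VCat ?N"
    unfolding Bex_def V_cat_simps(2-4) full_sub_simps(5,6) by blast
  have kb: "vf_obj k b \<in> B" using vfunD(5)[OF k(1)] k(2,3) b by simp
  \<comment> \<open>The composite of k with the inclusion is the identity and the inclusion fixes
    objects, so b itself lies in the image of p.\<close>
  have "vf_obj k b = b"
    using arg_cong[OF k(4), of "\<lambda>H. vf_obj H b"] b k(2) kb by (simp add: compose_def)
  then show ?thesis using kb that unfolding B_def by auto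
qed

text \<open>The object of objects of a pullback is the pullback of the objects of objects, and
  discrete objects are closed under pullback.\<close>

lemma ff_functor_pb_Phi: "ff_functor_pb VCat ICat (Phi V)"
proof (intro ff_functor_pb.intro[OF ff_functor_Phi] ff_functor_pb_axioms.intro)
  fix f g p q assume a: "f \<in> Arr VCat" "g \<in> Arr VCat" "Cod VCat f = Cod VCat g"
    and pb: "is_pullback ICat (FArr (Phi V) f) (FArr (Phi V) g) p q"
  have f: "is_vfun small V f" "is_vfun small V g" using a by simp_all
  note pb0 = int_cat_pullback_obj[OF pb]
  have p: "is_ifun V p" using pullback_simps(3)[OF pb] by simp
  note d = ifunD[OF Phi_arr_induced(1)[OF f(1)]] and d' = ifunD[OF Phi_arr_induced(1)[OF f(2)]]
  have J: "discrete (J_obj V (vobj M))" if "is_vcat small V M" for M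
    using vcat_graphD(1)[OF vcat_graphI[OF that]] J_coproduct unfolding discrete_def by blast
  have "discrete (dom (if_obj p))"
    by (rule discrete_pullback[OF pb0]) (use d(3-5) d'(3-5) J vfunD(1,2)[OF f(1)] vfunD(1,2)[OF f(2)] in simp_all)
  then show "ff_functor.in_image VCat ICat (Phi V) (Dom ICat p)"
    unfolding Phi_image_iff using ifunD[OF p] by simp
qed

end

theorem theorem9p10:
  fixes small :: "'u set \<Rightarrow> bool"
    and V :: "('o, 'm) cat"
    and p :: "('u, 'o, 'm) vfun"
  assumes "universe small"
    and "infinitary_lextensive small V"
    and "\<forall>f\<in>Arr V. \<exists>e m. regular_epi V e \<and> monic V m \<and> Cod V e = Dom V m \<and> f = m \<cdot>\<^bsub>V\<^esub> e"
    and "fully_faithful (set_cat small) V (J_funct V)"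
    and "p \<in> Arr (V_cat small V)"
    and "effective_descent (int_cat V) (FArr (Phi V) p)"
  shows "effective_descent (V_cat small V) p"
proof -
  interpret lextJ small V using assms(1,2,4) by unfold_locales
  interpret ff_functor_pb "VCat" "ICat" "Phi V" by (rule ff_functor_pb_Phi)
  have p: "is_vfun small V p" using assms(5) by simp
  note f = vfunD[OF p]
  have sm: "small (vobj (vfdom p))" "small (vobj (vfcod p))" using vcat_graphD(1)[OF vcat_graphI] f(1,2) by blast+
  show ?thesis
  \<comment> \<open>What remains is to descend discreteness of the object of objects along p, with
    extremality of p available.\<close>
  proof (rule reflects_effective_descent[OF assms(5,6)])
    fix F a b assume ex: "extremal VCat p" and pb: "is_pullback ICat (FArr (Phi V) p) F a b"
      and a: "in_image (Dom ICat a)"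
    have F: "is_ifun V F" "is_ifun V a" using pullback_simps(2,3)[OF pb] by simp_all
    have pb0: "is_pullback V (J_arr V (vobj (vfdom p)) (vf_obj p) (vobj (vfcod p))) (if_obj F) (if_obj a) (if_obj b)"
      using int_cat_pullback_obj[OF pb] by simp
    note j = J_arr_simps[of "vobj (vfdom p)" "vobj (vfcod p)" "vf_obj p", OF sm f(5)]
    have "discrete (Dom V (if_obj F))"
    proof (rule discrete_descent[OF pb0 _ _ sm(2)])
      show "discrete (Dom V (J_arr V (vobj (vfdom p)) (vf_obj p) (vobj (vfcod p))))"
        using J_coproduct[OF sm(1)] sm(1) j(2) unfolding discrete_def by auto
      show "discrete (Dom V (if_obj a))"
        using a ifunD(4)[OF F(2)] unfolding Phi_image_iff by simp
      show "is_coproduct V (vobj (vfcod p)) (\<lambda>_. one) (Cod V (J_arr V (vobj (vfdom p)) (vf_obj p) (vobj (vfcod p)))) (J_in V (vobj (vfcod p)))"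
        using J_coproduct[OF sm(2)] j(3) by simp
      fix c assume "c \<in> vobj (vfcod p)"
      \<comment> \<open>Surjectivity on objects lifts the point c of the base: the lift is the
        injection at a preimage of c.\<close>
      then obtain e where e: "e \<in> vobj (vfdom p)" "vf_obj p e = c" by (rule extremal_surjective[OF p ex])
      then show "\<exists>e\<in>Arr V. Dom V e = one \<and> Cod V e = Dom V (J_arr V (vobj (vfdom p)) (vf_obj p) (vobj (vfcod p))) \<and>
          J_arr V (vobj (vfdom p)) (vf_obj p) (vobj (vfcod p)) \<cdot> e = J_in V (vobj (vfcod p)) c"
        using j is_coproductD(2-4)[OF J_coproduct[OF sm(1)]] by (intro bexI[of _ "J_in V (vobj (vfdom p)) e"]) simp_all
    qed
    then show "in_image (Dom ICat F)" unfolding Phi_image_iff using ifunD[OF F(1)] by simp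
  qed
qed

end
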